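(* Suppose that $S$ restricts to a $C_0$-semigroup $S_H$ on $H$, and let $\kappa(t):=\sup_{s\in[0,t]}\|S_H(s)\|_{\mathscr{L}(H)}$. Then for all $1<p<\infty$ the operators $D_HP(t)$, $t>0$ (initially defined on $\mathscr{F}C_{\rm b}^{1,0}(E)$), extend uniquely to bounded operators from $L^p(E,\mu_\infty)$ to $L^p(E,\mu_\infty;H)$, and there exists a constant $C\ge0$ such that for any $t>0$, $$\sqrt{t}\,\|D_HP(t)\|_{\mathscr{L}(L^p(E,\mu_\infty),L^p(E,\mu_\infty;H))}\le C\,\kappa(t).$$
   Context: Setting. $E$ is a real Banach space, $A$ is the generator of a $C_0$-semigroup $S=(S(t))_{t\ge0}$ on $E$, and $H$ is a real Hilbert space continuously embedded in $E$ with inclusion map $i:H\hookrightarrow E$. The semigroup $S$ restricts to a $C_0$-semigroup on $H$ if there is a $C_0$-semigroup $S_H$ on $H$ with $S(t)\circ i=i\circ S_H(t)$ for all $t\ge0$. Standing assumption: the operator $I_\infty:L^2(0,\infty;H)\to E$, $I_\infty g:=\int_0^\infty S(t)i g(t)\,dt$, is $\gamma$-radonifying; equivalently, $I_\infty I_\infty^*$ is the covariance operator of a centred Gaussian Radon measure $\mu_\infty$ on $E$. Then for each $t\ge0$ the operator $I_t:L^2(0,t;H)\to E$, $I_tg:=\int_0^tS(s)ig(s)\,ds$, is also $\gamma$-radonifying, and $I_tI_t^*$ is the covariance operator of a centred Gaussian Radon measure $\mu_t$ on $E$. With $W_H$ an $H$-cylindrical Brownian motion, $\mu_t$ is the distribution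 of $\int_0^tS(t-s)i\,dW_H(s)$, and $U^x(t)=S(t)x+\int_0^tS(t-s)i\,dW_H(s)$ is the solution of $dU(t)=AU(t)\,dt+dW_H(t)$, $U(0)=x$. The measure $\mu_\infty$ is invariant for this equation. The Ornstein-Uhlenbeck semigroup $P=(P(t))_{t\ge0}$ is defined for bounded continuous $f:E\to\mathbb{R}$ by $P(t)f(x)=\mathbb{E}f(U^x(t))=\int_Ef(S(t)x+y)\,d\mu_t(y)$; it extends uniquely to a $C_0$-contraction semigroup, again denoted $P$, on $L^p(E,\mu_\infty)$ for $1\le p<\infty$. For integers $k,l\ge0$, $\mathscr{F}C_{\rm b}^{k,l}(E)$ is the space of all $f\in C_{\rm b}(E)$ of the form $f(x)=\varphi(\langle x,x_1^*\rangle,\dots,\langle x,x_N^*\rangle)$ with $N\ge1$, $\varphi\in C_{\rm b}^k(\mathbb{R}^N)$ ($k$ times continuously differentiable, bounded with bounded derivatives up to order $k$) and $x_1^*,\dots,x_N^*\in\mathsf{D}(A^{*l})$ (all of $E^*$ if $l=0$). For such $f$ with $k\ge1$, $$D_Hf(x)=\sum_{n=1}^N\frac{\partial\varphi}{\partial x_n}(\langle x,x_1^*\rangle,\dots,\langle x,x_N^*\rangle)\,i^*x_n^*\in H,$$ where $H$ is identified with its dual. For $f\in\mathscr{F}C_{\rm b}^{1,0}(E)$ one has $P(t)f\in\mathscr{F}C_{\rm b}^{1,0}(E)$, so $D_HP(t)f$ is well defined. When $S$ restricts to a $C_0$-semigroup on $H$, $D_H$ is closable as a densely defined operator from $L^p(E,\mu_\infty)$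 to $L^p(E,\mu_\infty;H)$ for $1\le p<\infty$ (known); its closure is again denoted $D_H$. *)

theory Defs
  imports "HOL-Probability.Probability"
begin

section \<open>Semigroups\<close>

text \<open>Values of \<open>S\<close> at negative times play no role.\<close>

definition C0_semigroup :: "(real \<Rightarrow> ('a::real_normed_vector \<Rightarrow>\<^sub>L 'a)) \<Rightarrow> bool" where
  "C0_semigroup S \<longleftrightarrow>
     S 0 = id_blinfun \<and>
     (\<forall>s\<ge>0. \<forall>t\<ge>0. S (s + t) = S s o\<^sub>L S t) \<and>
     (\<forall>x. ((\<lambda>t. S t x) \<longlongrightarrow> x) (at_right 0))"

section \<open>Lebesgue-Bochner spaces\<close>

text \<open>
  The target space may be non-separable, so strong measurability is Borel measurability
  together with separability of the range; these are the pointwise limits of simple functions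
  (every almost everywhere class of Bochner measurable functions contains one).
\<close>

definition strongly_measurable :: "'a measure \<Rightarrow> ('a \<Rightarrow> 'b::real_normed_vector) \<Rightarrow> bool" where
  "strongly_measurable M f \<longleftrightarrow>
     f \<in> borel_measurable M \<and> (\<exists>D. countable D \<and> f ` space M \<subseteq> closure D)"

text \<open>
  Elements of $L^p(M; B)$ are represented by functions; equality in $L^p$ is equality almost
  everywhere, and operators on $L^p$ act on representatives. Compatibility of such an operator
  with almost everywhere equality follows from linearity and boundedness.
\<close>

definition Lp :: "real \<Rightarrow> 'a measure \<Rightarrow> ('a \<Rightarrow> 'b::real_normed_vector) set" where
  "Lp p M = {f. strongly_measurable M f \<and> integrable M (\<lambda>x. norm (f x) powr p)}"

definition Lp_norm :: "real \<Rightarrow> 'a measure \<Rightarrow> ('a \<Rightarrow> 'b::real_normed_vector) \<Rightarrow> real" where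
  "Lp_norm p M f = (\<integral>x. norm (f x) powr p \<partial>M) powr (1 / p)"

definition bounded_linear_Lp_Lp ::
  "real \<Rightarrow> 'a measure \<Rightarrow> (('a \<Rightarrow> 'b::real_normed_vector) \<Rightarrow> ('a \<Rightarrow> 'c::real_normed_vector)) \<Rightarrow> bool"
where
  "bounded_linear_Lp_Lp p M T \<longleftrightarrow>
     (\<forall>f\<in>Lp p M. T f \<in> Lp p M) \<and>
     (\<forall>f\<in>Lp p M. \<forall>g\<in>Lp p M. AE x in M. T (\<lambda>y. f y + g y) x = T f x + T g x) \<and>
     (\<forall>c. \<forall>f\<in>Lp p M. AE x in M. T (\<lambda>y. c *\<^sub>R f y) x = c *\<^sub>R T f x) \<and>
     (\<exists>K. \<forall>f\<in>Lp p M. Lp_norm p M (T f) \<le> K * Lp_norm p M f)"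

definition Lp_onorm ::
  "real \<Rightarrow> 'a measure \<Rightarrow> (('a \<Rightarrow> 'b::real_normed_vector) \<Rightarrow> ('a \<Rightarrow> 'c::real_normed_vector)) \<Rightarrow> real"
where
  "Lp_onorm p M T = Sup {Lp_norm p M (T f) | f. f \<in> Lp p M \<and> Lp_norm p M f \<le> 1}"

definition bounded_linear_L2 ::
  "'a measure \<Rightarrow> (('a \<Rightarrow> 'b::real_normed_vector) \<Rightarrow> 'c::real_normed_vector) \<Rightarrow> bool" where
  "bounded_linear_L2 M T \<longleftrightarrow>
     (\<forall>f\<in>Lp 2 M. \<forall>g\<in>Lp 2 M. T (\<lambda>y. f y + g y) = T f + T g) \<and>
     (\<forall>c. \<forall>f\<in>Lp 2 M. T (\<lambda>y. c *\<^sub>R f y) = c *\<^sub>R T f) \<and>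
     (\<exists>K. \<forall>f\<in>Lp 2 M. norm (T f) \<le> K * Lp_norm 2 M f)"

section \<open>Gaussian Radon measures and radonifying operators\<close>

text \<open>Degenerate Gaussian distributions (Dirac measure at the origin) are allowed.\<close>

definition centred_gaussian_real :: "real measure \<Rightarrow> bool" where
  "centred_gaussian_real \<nu> \<longleftrightarrow>
     \<nu> = return borel 0 \<or> (\<exists>\<sigma>>0. \<nu> = density lborel (\<lambda>x. ennreal (normal_density 0 \<sigma> x)))"

definition centred_gaussian_radon :: "'e::real_normed_vector measure \<Rightarrow> bool" where
  "centred_gaussian_radon \<mu> \<longleftrightarrow>
     sets \<mu> = sets borel \<and> prob_space \<mu> \<and>
     (\<forall>B\<in>sets borel. emeasure \<mu> B = (SUP K\<in>{K. K \<subseteq> B \<and> compact K}. emeasure \<mu> K)) \<and>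
     (\<forall>x' :: 'e \<Rightarrow>\<^sub>L real. centred_gaussian_real (distr \<mu> borel (blinfun_apply x')))"

definition has_covariance ::
  "'e::real_normed_vector measure \<Rightarrow> (('e \<Rightarrow>\<^sub>L real) \<Rightarrow> 'e) \<Rightarrow> bool" where
  "has_covariance \<mu> Q \<longleftrightarrow>
     (\<forall>x' y' :: 'e \<Rightarrow>\<^sub>L real. y' (Q x') = (\<integral>x. x' x * y' x \<partial>\<mu>))"

text \<open>\<open>g\<close> represents $T^* x'$ in $L^2(M; H)$.\<close>

definition is_L2_adjoint ::
  "'a measure \<Rightarrow> (('a \<Rightarrow> 'h::real_inner) \<Rightarrow> 'e::real_normed_vector) \<Rightarrow>
    ('e \<Rightarrow>\<^sub>L real) \<Rightarrow> ('a \<Rightarrow> 'h) \<Rightarrow> bool" where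
  "is_L2_adjoint M T x' g \<longleftrightarrow>
     g \<in> Lp 2 M \<and> (\<forall>f\<in>Lp 2 M. x' (T f) = (\<integral>s. f s \<bullet> g s \<partial>M))"

text \<open>
  $T T^*$ as an operator from $E^*$ to $E$. For bounded \<open>T\<close> on a complete space the representative
  exists, and the value does not depend on its choice.
\<close>

definition L2_TTstar ::
  "'a measure \<Rightarrow> (('a \<Rightarrow> 'h::real_inner) \<Rightarrow> 'e::real_normed_vector) \<Rightarrow> ('e \<Rightarrow>\<^sub>L real) \<Rightarrow> 'e" where
  "L2_TTstar M T x' = T (SOME g. is_L2_adjoint M T x' g)"

definition gamma_radonifying ::
  "'a measure \<Rightarrow> (('a \<Rightarrow> 'h::real_inner) \<Rightarrow> 'e::real_normed_vector) \<Rightarrow> bool" where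
  "gamma_radonifying M T \<longleftrightarrow>
     bounded_linear_L2 M T \<and>
     (\<exists>\<mu>. centred_gaussian_radon \<mu> \<and> has_covariance \<mu> (L2_TTstar M T))"

text \<open>A centred Gaussian Radon measure is determined by its covariance operator.\<close>

definition gaussian_measure :: "(('e::real_normed_vector \<Rightarrow>\<^sub>L real) \<Rightarrow> 'e) \<Rightarrow> 'e measure" where
  "gaussian_measure Q = (THE \<mu>. centred_gaussian_radon \<mu> \<and> has_covariance \<mu> Q)"

section \<open>The Ornstein-Uhlenbeck semigroup\<close>

text \<open>
  \<open>conv_op S i J\<close> is $I_t$ for $J = (0,t)$ and $I_\infty$ for $J = (0,\infty)$. The library's Bochner
  integral requires a separable target; the Henstock-Kurzweil integral does not, it extends the
  Bochner integral on bounded intervals, and over $(0,\infty)$ it is the norm limit of the integrals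
  over $(0,T)$.
\<close>

definition conv_op ::
  "(real \<Rightarrow> ('e::real_normed_vector \<Rightarrow>\<^sub>L 'e)) \<Rightarrow> ('h::real_normed_vector \<Rightarrow>\<^sub>L 'e) \<Rightarrow>
    real set \<Rightarrow> (real \<Rightarrow> 'h) \<Rightarrow> 'e" where
  "conv_op S i J g = integral J (\<lambda>s. S s (i (g s)))"

definition OU_measure ::
  "(real \<Rightarrow> ('e::real_normed_vector \<Rightarrow>\<^sub>L 'e)) \<Rightarrow> ('h::real_inner \<Rightarrow>\<^sub>L 'e) \<Rightarrow> real set \<Rightarrow> 'e measure"
where
  "OU_measure S i J = gaussian_measure (L2_TTstar (restrict_space lborel J) (conv_op S i J))"

abbreviation mu_t where "mu_t S i t \<equiv> OU_measure S i {0<..<t}"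

abbreviation mu_infty where "mu_infty S i \<equiv> OU_measure S i {0<..}"

definition OU ::
  "(real \<Rightarrow> ('e::real_normed_vector \<Rightarrow>\<^sub>L 'e)) \<Rightarrow> ('h::real_inner \<Rightarrow>\<^sub>L 'e) \<Rightarrow> real \<Rightarrow>
    ('e \<Rightarrow> real) \<Rightarrow> 'e \<Rightarrow> real" where
  "OU S i t f x = (\<integral>y. f (S t x + y) \<partial>mu_t S i t)"

section \<open>Cylindrical functions and the gradient in the direction of H\<close>

definition partial_deriv :: "nat \<Rightarrow> ((nat \<Rightarrow> real) \<Rightarrow> real) \<Rightarrow> (nat \<Rightarrow> real) \<Rightarrow> real" where
  "partial_deriv n \<phi> u = deriv (\<lambda>s. \<phi> (u(n := s))) (u n)"

text \<open>
  $C_b^1(\mathbb{R}^N)$, where a function on $\mathbb{R}^N$ is encoded as a function of sequences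
  that depends on the first \<open>N\<close> entries only. For such functions, continuity in the product
  topology is continuity on $\mathbb{R}^N$.
\<close>

definition Cb1 :: "nat \<Rightarrow> ((nat \<Rightarrow> real) \<Rightarrow> real) \<Rightarrow> bool" where
  "Cb1 N \<phi> \<longleftrightarrow>
     (\<forall>u v. (\<forall>j<N. u j = v j) \<longrightarrow> \<phi> u = \<phi> v) \<and>
     continuous_on UNIV \<phi> \<and> bounded (range \<phi>) \<and>
     (\<forall>n<N. (\<forall>u. (\<lambda>s. \<phi> (u(n := s))) field_differentiable at (u n)) \<and>
            continuous_on UNIV (partial_deriv n \<phi>) \<and> bounded (range (partial_deriv n \<phi>)))"

definition cyl_rep ::
  "('e::real_normed_vector \<Rightarrow> real) \<Rightarrow> nat \<Rightarrow> ((nat \<Rightarrow> real) \<Rightarrow> real) \<Rightarrow> (nat \<Rightarrow> ('e \<Rightarrow>\<^sub>L real)) \<Rightarrow> bool"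
where
  "cyl_rep f N \<phi> x' \<longleftrightarrow> 1 \<le> N \<and> Cb1 N \<phi> \<and> (\<forall>x. f x = \<phi> (\<lambda>n. x' n x))"

text \<open>The space $\mathscr{F}C_b^{1,0}(E)$.\<close>

definition FCb1 :: "('e::real_normed_vector \<Rightarrow> real) set" where
  "FCb1 = {f. \<exists>N \<phi> x'. cyl_rep f N \<phi> x'}"

text \<open>$i^* x'$ as an element of \<open>H\<close>, identified with its dual by the Riesz theorem.\<close>

definition H_adjoint ::
  "('h::real_inner \<Rightarrow>\<^sub>L 'e::real_normed_vector) \<Rightarrow> ('e \<Rightarrow>\<^sub>L real) \<Rightarrow> 'h" where
  "H_adjoint i x' = (THE h. \<forall>k. k \<bullet> h = x' (i k))"

text \<open>
  The gradient does not depend on the representation of \<open>f\<close>, since its inner product with \<open>h\<close>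
  is the derivative of \<open>f\<close> in the direction \<open>i h\<close>.
\<close>

definition DH ::
  "('h::real_inner \<Rightarrow>\<^sub>L 'e::real_normed_vector) \<Rightarrow> ('e \<Rightarrow> real) \<Rightarrow> 'e \<Rightarrow> 'h" where
  "DH i f = (THE D. \<exists>N \<phi> x'. cyl_rep f N \<phi> x' \<and>
     D = (\<lambda>x. \<Sum>n<N. partial_deriv n \<phi> (\<lambda>j. x' j x) *\<^sub>R H_adjoint i (x' n)))"

text \<open>\<open>T\<close> is a bounded extension of $D_H P(t)$ from cylindrical functions to $L^p(E,\mu_\infty)$.\<close>

definition bounded_extension_DH_OU ::
  "(real \<Rightarrow> ('e::real_normed_vector \<Rightarrow>\<^sub>L 'e)) \<Rightarrow> ('h::real_inner \<Rightarrow>\<^sub>L 'e) \<Rightarrow> real \<Rightarrow> real \<Rightarrow>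
    (('e \<Rightarrow> real) \<Rightarrow> 'e \<Rightarrow> 'h) \<Rightarrow> bool" where
  "bounded_extension_DH_OU S i p t T \<longleftrightarrow>
     bounded_linear_Lp_Lp p (mu_infty S i) T \<and>
     (\<forall>f\<in>FCb1. AE x in mu_infty S i. T f x = DH i (OU S i t f) x)"

end

theory Submission
  imports Defs
begin

text \<open>
  Fix \<open>t > 0\<close>. For \<open>h \<in> H\<close> and \<open>s \<in> (0,t)\<close> one has $S(t) i h = S(s) i\, S_H(t-s) h$. Averaging over \<open>s\<close>
  shows that $S(t) i h = I_t g$ with $g(s) = S_H(t-s) h / t$, so $S(t) i h$ lies in the
  Cameron--Martin space of $\mu_t$ with norm at most $\kappa(t) \|h\| / \sqrt t$. Integration by parts
  against the Gaussian measure $\mu_t$ in the direction $S(t) i h$, followed by Young's inequality,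
  gives the pointwise bound
  $\|D_H P(t) f\|^p \le (C \kappa(t) / \sqrt t)^p\, P(t) |f|^p$ on cylindrical functions. Integrating
  it against the invariant measure $\mu_\infty$ yields the estimate in $L^p(\mu_\infty)$, and the
  extension exists and is unique because cylindrical functions are dense.
\<close>

section \<open>Functional analysis and semigroups\<close>

text \<open>Neither E nor H is assumed separable, and this shapes most of the work. A Radon measure
  is carried by a \<sigma>-compact set, on which countably many functionals form an injective map
  \<open>J\<close> into the sequence space. Existence, uniqueness, invariance and density are
  reduced along such maps to laws of real sequences, which characteristic functions determine. Sums
  of random vectors are likewise formed in the sequence space, since addition need not be measurable
  for the product of the Borel \<sigma>-algebras of a non-separable space. The measures
  \<open>mu_t\<close> and \<open>mu_infty\<close> are definite descriptions, so uniqueness must be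
  proved, and for \<open>mu_t\<close> existence too; it is inherited from \<open>mu_infty\<close>,
  whose covariance is the larger one. The final constant depends on p only: the factor 1 +
  \<open>gauss_abs_moment r\<close> with 1/p + 1/r = 1 comes from Young's inequality, and the factor
  2 from using (a + b)^p \<le> 2^p (a^p + b^p) in place of Minkowski's inequality when the estimate
  passes from cylindrical functions to their limits.\<close>

lemma real_inner_closest_point:
  fixes M :: "'h::{real_inner,complete_space} set"
  assumes "subspace M" "closed M"
  obtains m where "m \<in> M" "\<And>k. k \<in> M \<Longrightarrow> inner k (x - m) = 0"
proof -
  define d where "d = (INF m\<in>M. norm (x - m)^2)"
  have ne: "M \<noteq> {}" using subspace_0[OF assms(1)] by auto
  have bdd: "bdd_below ((\<lambda>m. norm (x - m)^2) ` M)" by (rule bdd_belowI2[of _ 0]) simp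
  have dle: "d \<le> norm (x - m)^2" if "m \<in> M" for m
    unfolding d_def by (rule cINF_lower[OF bdd that])
  have "\<exists>m\<in>M. norm (x - m)^2 < d + 1 / real (Suc n)" for n
  proof (rule ccontr)
    assume "\<not> ?thesis"
    then have "d + 1 / real (Suc n) \<le> d" unfolding d_def
      by (intro cINF_greatest ne) (auto simp: not_less d_def)
    then show False by (simp add: field_simps)
  qed
  then obtain m where m: "\<And>n. m n \<in> M" "\<And>n. norm (x - m n)^2 < d + 1 / real (Suc n)"
    by metis
  \<comment> \<open>The midpoint of \<open>m a\<close> and \<open>m b\<close> lies in
    \<open>M\<close>, so the parallelogram identity bounds their distance by the two excesses over
    \<open>d\<close>.\<close>
  have par: "norm (m a - m b)^2 \<le> 2 / real (Suc a) + 2 / real (Suc b)" for a b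
  proof -
    have "(1/2) *\<^sub>R (m a + m b) \<in> M"
      using assms(1) m(1) by (intro subspace_scale subspace_add) auto
    from dle[OF this] have "d \<le> norm (x - (1/2) *\<^sub>R (m a + m b))^2" .
    moreover have "4 * norm (x - (1/2) *\<^sub>R (m a + m b))^2 + norm (m a - m b)^2
        = 2 * norm (x - m a)^2 + 2 * norm (x - m b)^2"
      by (simp add: power2_norm_eq_inner inner_diff_left inner_diff_right inner_add_left
          inner_add_right inner_commute algebra_simps)
    ultimately have "norm (m a - m b)^2 \<le> 2 * norm (x - m a)^2 + 2 * norm (x - m b)^2 - 4 * d"
      by simp
    then show ?thesis using m(2)[of a] m(2)[of b] by simp
  qed
  have "Cauchy m"
  proof (rule metric_CauchyI)
    fix e :: real assume e: "0 < e"
    obtain N where N: "4 / e^2 < real N" using reals_Archimedean2 by blast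
    show "\<exists>M. \<forall>a\<ge>M. \<forall>b\<ge>M. dist (m a) (m b) < e"
    proof (intro exI allI impI)
      fix a b assume ab: "N \<le> a" "N \<le> b"
      have N0: "0 < real N" using N e by (smt (verit) zero_less_power divide_pos_pos)
      have "1 / real (Suc a) \<le> 1 / real N" "1 / real (Suc b) \<le> 1 / real N"
        using ab N0 by (auto intro!: divide_left_mono)
      then have "norm (m a - m b)^2 \<le> 4 / real N" using par[of a b] by simp
      also have "\<dots> < e^2" using N N0 e by (simp add: field_simps)
      finally show "dist (m a) (m b) < e"
        using e power2_less_imp_less[of "norm (m a - m b)" e] by (simp add: dist_norm)
    qed
  qed
  then obtain l where l: "m \<longlonglongrightarrow> l" using Cauchy_convergent convergent_def by blast
  have lM: "l \<in> M" using assms(2) m(1) l by (metis closed_sequentially)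
  have "(\<lambda>n. norm (x - m n)^2) \<longlonglongrightarrow> norm (x - l)^2" by (intro tendsto_intros l)
  moreover have "(\<lambda>n. d + 1 / real (Suc n)) \<longlonglongrightarrow> d + 0"
    by (intro tendsto_intros LIMSEQ_Suc[OF lim_1_over_n])
  ultimately have ld: "norm (x - l)^2 \<le> d"
    using m(2) by (intro LIMSEQ_le[of _ _ _ d]) (auto intro!: exI less_imp_le)
  have "inner k (x - l) = 0" if k: "k \<in> M" for k
  proof (cases "k = 0")
    case False
    \<comment> \<open>This \<open>c\<close> minimises the quadratic c -> |x - l - c k|^2; optimality
      of \<open>l\<close> then leaves no room for a nonzero inner product.\<close>
    define c where "c = inner k (x - l) / inner k k"
    have "l + c *\<^sub>R k \<in> M" using assms(1) lM k by (intro subspace_add subspace_scale)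
    then have "norm (x - l)^2 \<le> norm (x - (l + c *\<^sub>R k))^2" using dle ld order_trans by blast
    also have "\<dots> = norm (x - l)^2 - 2 * c * inner k (x - l) + c^2 * inner k k"
      unfolding power2_norm_eq_inner
      by (simp add: inner_diff_left inner_diff_right inner_add_left inner_add_right
          inner_commute algebra_simps power2_eq_square)
    also have "\<dots> = norm (x - l)^2 - (inner k (x - l))^2 / inner k k"
      using False by (simp add: c_def power2_eq_square field_simps)
    finally have "(inner k (x - l))^2 / inner k k \<le> 0" by simp
    moreover have "0 < inner k k" using False by simp
    ultimately show ?thesis by (simp add: divide_le_0_iff)
  qed simp
  with lM show ?thesis using that by blast
qed

text \<open>The kernel of a nonzero \<open>f\<close> has codimension one, so a vector
  \<open>z\<close> orthogonal to it determines \<open>f\<close> up to the factor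
  \<open>f z / inner z z\<close>. Uniqueness is what lets the \<open>THE\<close> in
  \<open>H_adjoint\<close> denote.\<close>

lemma riesz_representation:
  fixes f :: "'h::{real_inner,complete_space} \<Rightarrow>\<^sub>L real"
  shows "\<exists>!h. \<forall>k. inner k h = f k"
proof -
  have "\<exists>h. \<forall>k. inner k h = f k"
  proof (cases "\<forall>x. f x = 0")
    case True
    then show ?thesis by (intro exI[of _ 0]) simp
  next
    case False
    then obtain x where x: "f x \<noteq> 0" by blast
    have "subspace {x. f x = 0}"
      by (auto simp: subspace_def blinfun.add_right blinfun.scaleR_right)
    moreover have "closed {x. f x = 0}"
      by (intro closed_Collect_eq continuous_intros)
    ultimately obtain m where "m \<in> {x. f x = 0}" "\<And>k. k \<in> {x. f x = 0} \<Longrightarrow> inner k (x - m) = 0"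
      using real_inner_closest_point[of "{x. f x = 0}" x] by metis
    then have m: "f m = 0" "\<And>k. f k = 0 \<Longrightarrow> inner k (x - m) = 0" by auto
    define z where "z = x - m"
    have fz: "f z = f x" by (simp add: z_def blinfun.diff_right m)
    with x have z0: "inner z z \<noteq> 0" by auto
    have "inner k ((f z / inner z z) *\<^sub>R z) = f k" for k
    proof -
      have "f (k - (f k / f z) *\<^sub>R z) = 0"
        using fz x by (simp add: blinfun.diff_right blinfun.scaleR_right)
      then have "inner (k - (f k / f z) *\<^sub>R z) z = 0" using m(2) by (simp add: z_def)
      then have "inner k z = f k / f z * inner z z" by (simp add: inner_diff_left)
      then show ?thesis using z0 fz x by simp
    qed
    then show ?thesis by blast
  qed
  moreover have "h = h'" if "\<forall>k. inner k h = f k" "\<forall>k. inner k h' = f k" for h h'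
  proof -
    have "inner (h - h') (h - h') = 0" using that by (simp add: inner_diff_right)
    then show ?thesis by simp
  qed
  ultimately show ?thesis by blast
qed

lemma inner_H_adjoint:
  fixes i :: "'h::{real_inner,complete_space} \<Rightarrow>\<^sub>L 'e::real_normed_vector"
  shows "inner k (H_adjoint i x') = x' (i k)"
proof -
  have "\<exists>!h. \<forall>k. inner k h = x' (i k)"
    using riesz_representation[of "x' o\<^sub>L i"] by simp
  from theI'[OF this] show ?thesis unfolding H_adjoint_def by blast
qed

lemma eq_if_inner_eq:
  fixes a b :: "'h::real_inner"
  assumes "\<And>k. inner k a = inner k b"
  shows "a = b"
proof -
  have "inner (a - b) (a - b) = 0" using assms[of "a - b"] by (simp add: inner_diff_right)
  then show ?thesis by simp
qed

text \<open>Sokal's proof of the uniform boundedness principle, avoiding Baire's theorem.\<close>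

lemma norm_blinfun_half_ball:
  fixes T :: "'a::real_normed_vector \<Rightarrow>\<^sub>L 'b::real_normed_vector"
  assumes r: "0 < r" and c: "c < norm T"
  obtains y where "norm (y - x) \<le> r" "c * r \<le> norm (T y)"
proof (cases "0 < c")
  case False
  then have "c * r \<le> 0" using r by (simp add: mult_nonpos_nonneg)
  then show ?thesis using that[of x] r by (simp add: order_trans[OF _ norm_ge_zero])
next
  case True
  have "\<exists>z. c * norm z < norm (T z)"
  proof (rule ccontr)
    assume "\<not> ?thesis"
    then have "norm T \<le> c" using True by (intro norm_blinfun_bound) (auto simp: not_less)
    with c show False by simp
  qed
  then obtain z where z: "c * norm z < norm (T z)" by blast
  then have z0: "z \<noteq> 0" by auto
  define w where "w = (r / norm z) *\<^sub>R z"
  have nw: "norm w = r" using z0 r by (simp add: w_def)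
  have "norm (T w) = r / norm z * norm (T z)" using r by (simp add: w_def blinfun.scaleR_right)
  also have "\<dots> \<ge> r / norm z * (c * norm z)" using z r by (intro mult_left_mono) auto
  finally have Tw: "c * r \<le> norm (T w)" using z0 by (simp add: mult.commute)
  \<comment> \<open>The two candidates x + w and x - w differ by 2 w, so their images cannot both be
    shorter than \<open>T w\<close>.\<close>
  have "2 *\<^sub>R T w = T (x + w) - T (x - w)"
    by (simp add: blinfun.add_right blinfun.diff_right scaleR_2)
  then have "2 * norm (T w) \<le> norm (T (x + w)) + norm (T (x - w))"
    by (metis norm_scaleR abs_numeral norm_triangle_ineq4)
  then have "c * r \<le> norm (T (x + w)) \<or> c * r \<le> norm (T (x - w))" using Tw by linarith
  then show ?thesis using that[of "x + w"] that[of "x - w"] nw by (auto simp: algebra_simps)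
qed

lemma uniform_boundedness:
  fixes T :: "nat \<Rightarrow> 'a::{real_normed_vector,complete_space} \<Rightarrow>\<^sub>L 'b::real_normed_vector"
  assumes pt: "\<And>x. bdd_above (range (\<lambda>n. norm (T n x)))"
  shows "bdd_above (range (\<lambda>n. norm (T n)))"
proof (rule ccontr)
  assume nb: "\<not> ?thesis"
  have "\<exists>n. C < norm (T n)" for C
    using nb unfolding bdd_above_def by (auto simp: not_le)
  \<comment> \<open>Norms beyond 4^k k beat the step sizes (1/3)^k below: the values at the limit
    point grow at least like (4/3)^k k / 6.\<close>
  then have "\<forall>k::nat. \<exists>n. 4 ^ k * real k < norm (T n)" by blast
  then obtain n where n: "\<And>k::nat. 4 ^ k * real k < norm (T (n k))" by metis
  have "\<exists>y. norm (y - x) \<le> (1/3)^k \<and> (2/3) * (1/3)^k * norm (T (n k)) \<le> norm (T (n k) y)" for k x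
  proof (cases "norm (T (n k)) = 0")
    case False
    then show ?thesis
      using norm_blinfun_half_ball[of "(1/3)^k" "(2/3) * norm (T (n k))" "T (n k)" x]
      by (auto simp: mult_ac)
  qed (auto intro: exI[of _ x])
  then have "\<forall>k x. \<exists>y. norm (y - x) \<le> (1/3)^k \<and> (2/3) * (1/3)^k * norm (T (n k)) \<le> norm (T (n k) y)"
    by blast
  then obtain g where g: "\<And>k x. norm (g k x - x) \<le> (1/3)^k"
    "\<And>k x. (2/3) * (1/3)^k * norm (T (n k)) \<le> norm (T (n k) (g k x))" by metis
  define x where "x = rec_nat 0 g"
  have xS: "x (Suc k) = g k (x k)" for k by (simp add: x_def)
  have step: "norm (x (Suc k) - x k) \<le> (1/3)^k" for k using g(1) xS by simp
  \<comment> \<open>The remaining steps sum to at most half of (1/3)^k, less than the 2/3 secured in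
    step \<open>k\<close>. The difference 2/3 - 1/2 = 1/6 survives at the limit and appears in
    \<open>big\<close>.\<close>
  have tail: "norm (x (j + Suc k) - x (Suc k)) \<le> (1/3)^k / 2" for j k
  proof -
    have "norm (x (j + Suc k) - x (Suc k)) \<le> (1/3)^k / 2 * (1 - (1/3)^j)"
    proof (induction j)
      case (Suc j)
      have "norm (x (Suc j + Suc k) - x (Suc k))
          \<le> norm (x (Suc (j + Suc k)) - x (j + Suc k)) + norm (x (j + Suc k) - x (Suc k))"
        using norm_triangle_ineq[of "x (Suc (j + Suc k)) - x (j + Suc k)" "x (j + Suc k) - x (Suc k)"]
        by simp
      also have "\<dots> \<le> (1/3)^(j + Suc k) + (1/3)^k / 2 * (1 - (1/3)^j)"
        by (intro add_mono step Suc.IH)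
      also have "\<dots> = (1/3)^k / 2 * (1 - (1/3)^(Suc j))" by (simp add: power_add field_simps)
      finally show ?case .
    qed simp
    also have "\<dots> \<le> (1/3)^k / 2 * 1" by (intro mult_left_mono) auto
    finally show ?thesis by simp
  qed
  have "Cauchy x"
  proof (rule metric_CauchyI)
    fix e :: real assume "0 < e"
    then obtain k where k: "(1/3::real)^k < e" using real_arch_pow_inv[of e "1/3"] by auto
    have near: "dist (x m) (x (Suc k)) \<le> (1/3)^k / 2" if "Suc k \<le> m" for m
      using tail[of "m - Suc k" k] that by (simp add: dist_norm)
    have "dist (x m) (x n) < e" if "Suc k \<le> m" "Suc k \<le> n" for m n
      using near[OF that(1)] near[OF that(2)] k dist_triangle2[of "x m" "x n" "x (Suc k)"] by linarith
    then show "\<exists>M. \<forall>m\<ge>M. \<forall>n\<ge>M. dist (x m) (x n) < e" by blast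
  qed
  then obtain l where l: "x \<longlonglongrightarrow> l" using Cauchy_convergent convergent_def by blast
  have lx: "norm (l - x (Suc k)) \<le> (1/3)^k / 2" for k
  proof (rule LIMSEQ_le_const2)
    show "(\<lambda>j. norm (x (j + Suc k) - x (Suc k))) \<longlonglongrightarrow> norm (l - x (Suc k))"
      by (intro tendsto_intros LIMSEQ_ignore_initial_segment l)
  qed (use tail in auto)
  obtain B where B: "\<And>m. norm (T m l) \<le> B"
    using pt[of l] by (auto simp: bdd_above_def)
  have big: "(4/3)^k * real k / 6 \<le> B" for k
  proof -
    have "norm (T (n k) (x (Suc k))) \<le> norm (T (n k) l) + norm (T (n k) (l - x (Suc k)))"
      using norm_triangle_ineq4[of "T (n k) l" "T (n k) (l - x (Suc k))"] by (simp add: blinfun.diff_right)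
    also have "norm (T (n k) (l - x (Suc k))) \<le> norm (T (n k)) * ((1/3)^k / 2)"
      by (rule order_trans[OF norm_blinfun mult_left_mono[OF lx]]) auto
    finally have "norm (T (n k) (x (Suc k))) \<le> norm (T (n k) l) + norm (T (n k)) * ((1 / 3) ^ k / 2)"
      by simp
    then have "(2/3) * (1/3)^k * norm (T (n k)) - norm (T (n k)) * ((1/3)^k / 2) \<le> B"
      using g(2)[of k "x k"] B[of "n k"] unfolding xS by linarith
    then have "(1/3)^k / 6 * norm (T (n k)) \<le> B" by (simp add: field_simps)
    moreover have "(1/3)^k / 6 * (4 ^ k * real k) \<le> (1/3)^k / 6 * norm (T (n k))"
      by (intro mult_left_mono less_imp_le n) auto
    ultimately show ?thesis by (simp add: power_divide field_simps)
  qed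
  obtain k where k: "6 * B < real k" using reals_Archimedean2 by blast
  have "1 * real k \<le> (4/3)^k * real k" by (intro mult_right_mono) auto
  with big[of k] k show False by simp
qed

text \<open>Strong continuity makes every orbit bounded along times tending to 0, so unbounded norms
  near 0 would contradict uniform boundedness. The semigroup law then carries a bound on a short
  interval to all of [0, t].\<close>

lemma C0_semigroup_local_bound:
  fixes S :: "real \<Rightarrow> ('a::{real_normed_vector,complete_space} \<Rightarrow>\<^sub>L 'a)"
  assumes S: "C0_semigroup S"
  shows "bdd_above ((\<lambda>s. norm (S s)) ` {0..t})"
proof -
  have S0: "S 0 = id_blinfun" and Sadd: "\<And>s t. 0 \<le> s \<Longrightarrow> 0 \<le> t \<Longrightarrow> S (s + t) = S s o\<^sub>L S t"
    and Slim: "\<And>x. ((\<lambda>t. S t x) \<longlongrightarrow> x) (at_right 0)"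
    using S by (auto simp: C0_semigroup_def)
  have "\<exists>d>0. \<exists>C. \<forall>s. 0 < s \<and> s < d \<longrightarrow> norm (S s) \<le> C"
  proof (rule ccontr)
    assume "\<not> ?thesis"
    then have "\<forall>d>0. \<forall>C. \<exists>s. 0 < s \<and> s < d \<and> C < norm (S s)" by (auto simp: not_le)
    then have "\<exists>s. 0 < s \<and> s < 1 / real (Suc n) \<and> real n < norm (S s)" for n
      by (metis of_nat_0_less_iff zero_less_Suc zero_less_divide_1_iff)
    then obtain s where s: "\<And>n. 0 < s n" "\<And>n. s n < 1 / real (Suc n)" "\<And>n. real n < norm (S (s n))"
      by metis
    have "s \<longlonglongrightarrow> 0"
    proof (rule tendsto_sandwich[of "\<lambda>_. 0"])
      show "\<forall>\<^sub>F n in sequentially. 0 \<le> s n" using s(1) by (simp add: less_imp_le)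
      show "\<forall>\<^sub>F n in sequentially. s n \<le> 1 / real (Suc n)" using s(2) by (simp add: less_imp_le)
      show "(\<lambda>n. 1 / real (Suc n)) \<longlonglongrightarrow> 0" by (rule LIMSEQ_Suc[OF lim_1_over_n])
    qed (rule tendsto_const)
    then have fs: "filterlim s (at_right 0) sequentially"
      using s(1) by (intro filterlim_at_withinI) (auto intro!: always_eventually)
    have "bdd_above (range (\<lambda>n. norm (S (s n) x)))" for x
    proof -
      have "(\<lambda>n. S (s n) x) \<longlonglongrightarrow> x" by (rule filterlim_compose[OF Slim fs])
      then have "bounded (range (\<lambda>n. S (s n) x))" by (rule convergent_imp_bounded)
      then show ?thesis by (simp add: bounded_iff bdd_above_def)
    qed
    then have "bdd_above (range (\<lambda>n. norm (S (s n))))" by (rule uniform_boundedness)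
    then obtain B where "\<And>n. norm (S (s n)) \<le> B" by (auto simp: bdd_above_def)
    moreover obtain n where "B < real n" using reals_Archimedean2 by blast
    ultimately show False using s(3)[of n] by (smt (verit))
  qed
  then obtain d C where d: "0 < d" and C: "\<And>s. 0 < s \<Longrightarrow> s < d \<Longrightarrow> norm (S s) \<le> C" by blast
  \<comment> \<open>Halving \<open>d\<close> puts the closed interval [0, e] inside the region of
    the bound; \<open>B\<close> is at least 1 so that its powers increase and the identity at time 0
    is covered.\<close>
  define e where "e = d / 2"
  define B where "B = max 1 C"
  have e: "0 < e" using d by (simp add: e_def)
  have B1: "1 \<le> B" by (simp add: B_def)
  have Be: "norm (S s) \<le> B" if "0 \<le> s" "s \<le> e" for s
    using that C[of s] d S0 norm_blinfun_id_le[where 'a='a] by (cases "s = 0") (auto simp: B_def e_def)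
  have iter: "norm (S s) \<le> B ^ Suc n" if "0 \<le> s" "s \<le> real (Suc n) * e" for s n
    using that
  proof (induction n arbitrary: s)
    case 0 then show ?case using Be by simp
  next
    case (Suc n)
    show ?case
    proof (cases "s \<le> e")
      case True
      have "B ^ 1 \<le> B ^ Suc (Suc n)" by (intro power_increasing B1) auto
      then show ?thesis using Be[OF Suc.prems(1) True] by simp
    next
      case False
      have "S s = S e o\<^sub>L S (s - e)" using Sadd[of e "s - e"] e False by simp
      then have "norm (S s) \<le> norm (S e) * norm (S (s - e))" by (simp add: norm_blinfun_compose)
      also have "\<dots> \<le> B * B ^ Suc n"
        using Suc.prems False e Be[of e] B1
        by (intro mult_mono Suc.IH) (auto simp: algebra_simps)
      finally show ?thesis by simp
    qed
  qed
  obtain n where n: "t / e < real n" using reals_Archimedean2 by blast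
  then have "t < real n * e" using e by (simp add: field_simps)
  also have "\<dots> \<le> real (Suc n) * e" using e by simp
  finally have tn: "t \<le> real (Suc n) * e" by simp
  show ?thesis
    by (rule bdd_aboveI2[of _ _ "B ^ Suc n"]) (meson atLeastAtMost_iff iter order_trans tn)
qed

text \<open>Only right continuity at 0 is given. Writing the increment as S(a) applied to S(b - a) x
  - x, with a \<le> b, gives continuity from both sides once S(a) is bounded near the point.\<close>

lemma C0_semigroup_continuous_on:
  fixes S :: "real \<Rightarrow> ('a::{real_normed_vector,complete_space} \<Rightarrow>\<^sub>L 'a)"
  assumes S: "C0_semigroup S"
  shows "continuous_on {0..} (\<lambda>s. S s x)"
proof -
  have S0: "S 0 = id_blinfun" and Sadd: "\<And>s t. 0 \<le> s \<Longrightarrow> 0 \<le> t \<Longrightarrow> S (s + t) = S s o\<^sub>L S t"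
    and Slim: "\<And>x. ((\<lambda>t. S t x) \<longlongrightarrow> x) (at_right 0)"
    using S by (auto simp: C0_semigroup_def)
  show ?thesis
    unfolding continuous_on_iff
  proof (intro ballI allI impI)
    fix s e :: real assume s: "s \<in> {0..}" and e: "0 < e"
    obtain B where B: "\<And>r. 0 \<le> r \<Longrightarrow> r \<le> s + 1 \<Longrightarrow> norm (S r) \<le> B"
      using C0_semigroup_local_bound[OF S, of "s + 1"] unfolding bdd_above_def by force
    have B0: "0 \<le> B" using order_trans[OF norm_ge_zero B[of 0]] s by simp
    have "eventually (\<lambda>r. dist (S r x) x < e / (B + 1)) (at_right 0)"
      using Slim[of x] e B0 by (intro tendstoD) auto
    then obtain d where d: "0 < d" "\<And>r. 0 < r \<Longrightarrow> r < d \<Longrightarrow> norm (S r x - x) < e / (B + 1)"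
      by (auto simp: eventually_at_right_field dist_norm)
    have key: "norm (S b x - S a x) < e" if ab: "0 \<le> a" "a \<le> b" "b \<le> s + 1" "b - a < d" for a b
    proof (cases "a = b")
      case False
      have "S b x - S a x = S a (S (b - a) x - x)"
        using Sadd[of a "b - a"] ab by (simp add: blinfun.diff_right)
      then have "norm (S b x - S a x) \<le> norm (S a) * norm (S (b - a) x - x)"
        by (simp add: norm_blinfun)
      also have "\<dots> \<le> B * norm (S (b - a) x - x)"
        using ab by (intro mult_right_mono B) auto
      also have "\<dots> \<le> B * (e / (B + 1))"
        using d(2)[of "b - a"] ab False B0 by (intro mult_left_mono) auto
      also have "\<dots> < e" using e B0 by (simp add: field_simps)
      finally show ?thesis .
    qed (use e in simp)
    show "\<exists>d>0. \<forall>r\<in>{0..}. dist r s < d \<longrightarrow> dist (S r x) (S s x) < e"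
    proof (intro exI[of _ "min 1 d"] conjI ballI impI)
      fix r assume r: "r \<in> {0..}" "dist r s < min 1 d"
      show "dist (S r x) (S s x) < e"
        using r s key[of r s] key[of s r]
        by (cases "r \<le> s") (auto simp: dist_norm dist_real_def norm_minus_commute)
    qed (use d in auto)
  qed
qed


text \<open>Zorn's lemma on graphs, that is on subspaces of the product of E with the line in which
  r \<le> norm y. Being closed under negation, such a subspace satisfies the two-sided bound as
  well, and over y = 0 this makes it single-valued.\<close>

lemma hahn_banach_norming:
  fixes x :: "'e::real_normed_vector"
  obtains f :: "'e \<Rightarrow>\<^sub>L real" where "norm f \<le> 1" "f x = norm x"
proof -
  define A where "A = {G :: ('e \<times> real) set. subspace G \<and> (x, norm x) \<in> G \<and> (\<forall>(y, r)\<in>G. r \<le> norm y)}"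
  have "range (\<lambda>c. c *\<^sub>R (x, norm x)) \<in> A"
  proof -
    have "subspace (range (\<lambda>c. c *\<^sub>R (x, norm x)))"
      using span_singleton[of "(x, norm x)"] subspace_span by metis
    then show ?thesis unfolding A_def
      by (auto intro: image_eqI[of _ _ 1] simp: mult_right_mono)
  qed
  then have "A \<noteq> {}" by blast
  moreover have "\<Union>C \<in> A" if C: "C \<noteq> {}" "subset.chain A C" for C
  proof -
    have CA: "C \<subseteq> A" and lin: "\<And>X Y. X \<in> C \<Longrightarrow> Y \<in> C \<Longrightarrow> X \<subseteq> Y \<or> Y \<subseteq> X"
      using C(2) by (auto simp: subset_chain_def)
    have sub: "subspace X" if "X \<in> C" for X using that CA by (auto simp: A_def)
    have "subspace (\<Union>C)"
      unfolding subspace_def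
    proof (intro conjI allI ballI)
      show "0 \<in> \<Union>C" using C(1) sub subspace_0 by blast
      fix u v assume "u \<in> \<Union>C" "v \<in> \<Union>C"
      then obtain X Y where XY: "X \<in> C" "u \<in> X" "Y \<in> C" "v \<in> Y" by blast
      with lin[of X Y] have "(u \<in> Y \<and> v \<in> Y) \<or> (u \<in> X \<and> v \<in> X)" by blast
      with XY sub subspace_add show "u + v \<in> \<Union>C" by blast
    next
      fix c u assume "u \<in> \<Union>C"
      then show "c *\<^sub>R u \<in> \<Union>C" using sub subspace_scale by blast
    qed
    moreover have "(x, norm x) \<in> \<Union>C" using C(1) CA by (auto simp: A_def)
    moreover have "\<forall>(y, r)\<in>\<Union>C. r \<le> norm y" using CA by (auto simp: A_def)
    ultimately show ?thesis by (simp add: A_def)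
  qed
  ultimately obtain G where G: "G \<in> A" and maxG: "\<And>X. X \<in> A \<Longrightarrow> G \<subseteq> X \<Longrightarrow> X = G"
    using subset_Zorn_nonempty[of A] by metis
  have sG: "subspace G" and xG: "(x, norm x) \<in> G" and leG: "\<And>y r. (y, r) \<in> G \<Longrightarrow> r \<le> norm y"
    using G by (auto simp: A_def)
  have dom: "\<exists>r. (z, r) \<in> G" for z
  proof -
    \<comment> \<open>The value of the extension at \<open>z\<close>. By \<open>cross\<close> the
      lower bounds imposed by points of \<open>G\<close> stay below all upper bounds, so their
      supremum meets both.\<close>
    define r where "r = (SUP (y, s)\<in>G. s - norm (y - z))"
    have cross: "s - norm (y - z) \<le> norm (y' + z) - s'" if "(y, s) \<in> G" "(y', s') \<in> G" for y s y' s'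
    proof -
      have "(y + y', s + s') \<in> G" using subspace_add[OF sG that] by simp
      then have "s + s' \<le> norm (y + y')" by (rule leG)
      also have "\<dots> \<le> norm (y - z) + norm (y' + z)"
        using norm_triangle_ineq[of "y - z" "y' + z"] by simp
      finally show ?thesis by simp
    qed
    have G0: "(0, 0) \<in> G" using subspace_0[OF sG] by (simp add: zero_prod_def)
    have bdd: "bdd_above ((\<lambda>(y, s). s - norm (y - z)) ` G)"
      using cross[OF _ G0] by (intro bdd_aboveI2[of _ _ "norm z"]) auto
    have r1: "s - norm (y - z) \<le> r" if "(y, s) \<in> G" for y s
      unfolding r_def using cSUP_upper[OF that bdd] by simp
    have r2: "r \<le> norm (y + z) - s" if "(y, s) \<in> G" for y s
      unfolding r_def using G0 cross that by (intro cSUP_least) auto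
    define G' where "G' = {(y + c *\<^sub>R z, s + c * r) | y s c. (y, s) \<in> G}"
    have "subspace G'"
      unfolding subspace_def
    proof (intro conjI allI ballI)
      have "(0 + 0 *\<^sub>R z, 0 + 0 * r) \<in> G'" using G0 unfolding G'_def by blast
      then show "0 \<in> G'" by (simp add: zero_prod_def)
      fix u v assume "u \<in> G'" "v \<in> G'"
      then obtain y s c y' s' c' where uv: "u = (y + c *\<^sub>R z, s + c * r)" "(y, s) \<in> G"
        "v = (y' + c' *\<^sub>R z, s' + c' * r)" "(y', s') \<in> G" unfolding G'_def by blast
      have "(y + y', s + s') \<in> G" using subspace_add[OF sG uv(2,4)] by simp
      then show "u + v \<in> G'" unfolding G'_def uv
        by (intro CollectI exI[of _ "y + y'"] exI[of _ "s + s'"] exI[of _ "c + c'"])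
           (simp add: algebra_simps)
    next
      fix c u assume "u \<in> G'"
      then obtain y s d where u: "u = (y + d *\<^sub>R z, s + d * r)" "(y, s) \<in> G" unfolding G'_def by blast
      have "(c *\<^sub>R y, c * s) \<in> G" using subspace_scale[OF sG u(2), of c] by simp
      then show "c *\<^sub>R u \<in> G'" unfolding G'_def u
        by (intro CollectI exI[of _ "c *\<^sub>R y"] exI[of _ "c * s"] exI[of _ "c * d"])
           (simp add: algebra_simps)
    qed
    moreover have GG': "G \<subseteq> G'"
    proof clarify
      fix y s assume "(y, s) \<in> G"
      then have "(y + 0 *\<^sub>R z, s + 0 * r) \<in> G'" unfolding G'_def by blast
      then show "(y, s) \<in> G'" by simp
    qed
    moreover have "s + c * r \<le> norm (y + c *\<^sub>R z)" if ys: "(y, s) \<in> G" for y s c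
    proof (cases "c = 0")
      case True then show ?thesis using leG[OF ys] by simp
    next
      case False
      \<comment> \<open>Dividing by \<open>a\<close> reduces to the coefficients 1 and -1 of
        \<open>z\<close>, where the two bounds on \<open>r\<close> apply directly.\<close>
      define a where "a = \<bar>c\<bar>"
      have a: "0 < a" using False by (simp add: a_def)
      have m: "((1 / a) *\<^sub>R y, s / a) \<in> G" using subspace_scale[OF sG ys, of "1 / a"] by simp
      have eq: "norm (y + c *\<^sub>R z) = a * norm ((1 / a) *\<^sub>R y + (c / a) *\<^sub>R z)"
      proof -
        have "y + c *\<^sub>R z = a *\<^sub>R ((1 / a) *\<^sub>R y + (c / a) *\<^sub>R z)" using a by (simp add: scaleR_add_right)
        then show ?thesis using a by (metis abs_of_pos norm_scaleR)
      qed
      have "s / a + (c / a) * r \<le> norm ((1 / a) *\<^sub>R y + (c / a) *\<^sub>R z)"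
      proof (cases "0 < c")
        case True
        then have "c / a = 1" by (simp add: a_def)
        then show ?thesis using r2[OF m] by simp
      next
        case c: False
        then have "c / a = - 1" using False by (simp add: a_def)
        then show ?thesis using r1[OF m] by simp
      qed
      then have "a * (s / a + (c / a) * r) \<le> norm (y + c *\<^sub>R z)"
        unfolding eq using a by (intro mult_left_mono) auto
      then show ?thesis using a by (simp add: distrib_left)
    qed
    ultimately have "G' \<in> A" using xG unfolding A_def G'_def by blast
    then have "G' = G" using GG' by (rule maxG)
    moreover have "(0 + 1 *\<^sub>R z, 0 + 1 * r) \<in> G'" using G0 unfolding G'_def by blast
    ultimately show ?thesis by auto
  qed
  have uniq: "r = s" if "(z, r) \<in> G" "(z, s) \<in> G" for z r s
    using leG[of 0 "r - s"] leG[of 0 "s - r"] subspace_diff[OF sG that] subspace_diff[OF sG that(2,1)]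
    by simp
  define f where "f z = (THE r. (z, r) \<in> G)" for z
  have fG: "(z, f z) \<in> G" for z
    unfolding f_def using dom[of z] uniq by (metis theI)
  have fI: "(z, r) \<in> G \<Longrightarrow> f z = r" for z r using fG uniq by blast
  have fle: "\<bar>f z\<bar> \<le> norm z" for z
    using leG[OF fG[of z]] leG[of "- z" "- f z"] subspace_neg[OF sG fG[of z]] by simp
  have "bounded_linear f"
  proof (rule bounded_linear_intro[where K = 1])
    show "f (u + v) = f u + f v" for u v
      using subspace_add[OF sG fG[of u] fG[of v]] by (intro fI) simp
    show "f (c *\<^sub>R u) = c *\<^sub>R f u" for c u
      using subspace_scale[OF sG fG[of u], of c] by (intro fI) simp
  qed (use fle in simp)
  then have app: "blinfun_apply (Blinfun f) = f" by (rule bounded_linear_Blinfun_apply)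
  show ?thesis
  proof (rule that)
    show "norm (Blinfun f) \<le> 1" by (rule norm_blinfun_bound) (use fle app in auto)
    show "Blinfun f x = norm x" unfolding app by (rule fI[OF xG])
  qed
qed

text \<open>Evaluation on a countable dense set maps the dual unit ball into the sequence space,
  every subset of which is separable. The norm bound gives equicontinuity, which carries convergence
  from \<open>D\<close> to its closure.\<close>

lemma countable_pointwise_dense_functionals:
  fixes Z :: "'e::real_normed_vector set"
  assumes D: "countable D" "Z \<subseteq> closure D"
  shows "\<exists>\<xi> :: nat \<Rightarrow> 'e \<Rightarrow>\<^sub>L real. (\<forall>n. norm (\<xi> n) \<le> 1) \<and>
    (\<forall>x' :: 'e \<Rightarrow>\<^sub>L real. norm x' \<le> 1 \<longrightarrow>
      (\<exists>r :: nat \<Rightarrow> nat. \<forall>z\<in>Z. (\<lambda>j. blinfun_apply (\<xi> (r j)) z) \<longlonglongrightarrow> blinfun_apply x' z))"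
proof -
  \<comment> \<open>Inserting 0 keeps the enumerated set nonempty, as \<open>from_nat_into\<close>
    needs.\<close>
  define d where "d = from_nat_into (insert 0 D)"
  have rd: "range d = insert 0 D" unfolding d_def using D(1) by (intro range_from_nat_into) auto
  define ev where "ev x' = (\<lambda>k. blinfun_apply x' (d k))" for x' :: "'e \<Rightarrow>\<^sub>L real"
  define V where "V = ev ` {x'. norm x' \<le> 1}"
  obtain C where C: "countable C" "C \<subseteq> V" "V \<subseteq> closure C" using separable[of V] by blast
  have "ev 0 \<in> V" unfolding V_def by auto
  then have "C \<noteq> {}" using C(3) by auto
  then have rC: "range (from_nat_into C) = C" using C(1) by (intro range_from_nat_into) 
  have "\<exists>x'. norm x' \<le> 1 \<and> ev x' = from_nat_into C n" for n
    using rC C(2) unfolding V_def by (metis (no_types, lifting) imageE mem_Collect_eq rangeI subset_eq)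
  then obtain \<xi> where \<xi>: "\<And>n. norm (\<xi> n) \<le> 1" "\<And>n. ev (\<xi> n) = from_nat_into C n" by metis
  show ?thesis
  proof (intro exI[of _ \<xi>] conjI allI impI)
    show "norm (\<xi> n) \<le> 1" for n by (rule \<xi>)
    fix x' :: "'e \<Rightarrow>\<^sub>L real" assume x': "norm x' \<le> 1"
    then have "ev x' \<in> closure C" using C(3) unfolding V_def by auto
    then obtain c where c: "\<And>j. c j \<in> C" "c \<longlonglongrightarrow> ev x'" by (auto simp: closure_sequential)
    have "\<forall>j. \<exists>n. c j = from_nat_into C n" using c(1) rC by (metis imageE)
    then obtain r where "\<And>j. c j = from_nat_into C (r j)" by metis
    then have r: "c j = ev (\<xi> (r j))" for j by (simp add: \<xi>(2))
    have lim: "(\<lambda>j. \<xi> (r j) (d k)) \<longlonglongrightarrow> x' (d k)" for k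
    proof -
      have "continuous_on UNIV (\<lambda>u::nat \<Rightarrow> real. u k)" by (rule continuous_on_product_coordinates)
      then have "isCont (\<lambda>u::nat \<Rightarrow> real. u k) (ev x')"
        by (rule bspec[OF iffD1[OF continuous_on_eq_continuous_at[OF open_UNIV]] UNIV_I])
      then have "(\<lambda>j. (\<lambda>u. u k) (c j)) \<longlonglongrightarrow> (\<lambda>u. u k) (ev x')"
        by (rule isCont_tendsto_compose[OF _ c(2)])
      then show ?thesis unfolding r unfolding ev_def .
    qed
    have "(\<lambda>j. \<xi> (r j) z) \<longlonglongrightarrow> x' z" if z: "z \<in> Z" for z
    proof (rule metric_LIMSEQ_I)
      fix e :: real assume e: "0 < e"
      have "z \<in> closure D" using z D(2) by blast
      moreover have "0 < e / 3" using e by simp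
      ultimately obtain y where y: "y \<in> D" "dist y z < e / 3" unfolding closure_approachable by blast
      obtain k where k: "y = d k" using y(1) rd by (metis imageE insertI2)
      obtain N where N: "\<And>j. N \<le> j \<Longrightarrow> dist (\<xi> (r j) y) (x' y) < e / 3"
        using metric_LIMSEQ_D[OF lim[of k] \<open>0 < e / 3\<close>] k by blast
      have close: "dist (f z) (f y) < e / 3" if "norm f \<le> 1" for f :: "'e \<Rightarrow>\<^sub>L real"
      proof -
        have "norm (f (z - y)) \<le> norm f * norm (z - y)" by (rule norm_blinfun)
        also have "\<dots> \<le> 1 * norm (z - y)" using that by (intro mult_right_mono) auto
        finally show ?thesis using y(2) by (simp add: dist_norm blinfun.diff_right norm_minus_commute)
      qed
      show "\<exists>N. \<forall>j\<ge>N. dist (\<xi> (r j) z) (x' z) < e"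
      proof (intro exI[of _ N] allI impI)
        fix j assume "N \<le> j"
        then show "dist (\<xi> (r j) z) (x' z) < e"
          using N[of j] close[OF \<xi>(1)[of "r j"]] close[OF x'] unfolding dist_real_def by linarith
      qed
    qed
    then show "\<exists>r. \<forall>z\<in>Z. (\<lambda>j. \<xi> (r j) z) \<longlonglongrightarrow> x' z" by blast
  qed
qed

section \<open>Laws of random sequences\<close>

text \<open>After division by the common mass, found at s = 0, the weighted laws of \<open>f\<close>
  and \<open>g\<close> are probability measures on the line with equal characteristic functions, so
  Levy's uniqueness theorem applies. Mass 0 cannot be normalised and is treated apart.\<close>

lemma finite_measure_weight_eq:
  fixes M :: "'a measure" and N :: "'b measure" and w f :: "'a \<Rightarrow> real" and v g :: "'b \<Rightarrow> real"
  assumes M: "prob_space M" and N: "prob_space N"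
    and meas[measurable]: "w \<in> borel_measurable M" "f \<in> borel_measurable M"
      "v \<in> borel_measurable N" "g \<in> borel_measurable N"
    and w: "\<And>x. 0 \<le> w x" "\<And>x. w x \<le> K" and v: "\<And>x. 0 \<le> v x" "\<And>x. v x \<le> K"
    and eq: "\<And>s. (CLINT x|M. w x * iexp (s * f x)) = (CLINT x|N. v x * iexp (s * g x))"
    and B[measurable]: "B \<in> sets borel"
  shows "(\<integral>x. w x * indicator B (f x) \<partial>M) = (\<integral>x. v x * indicator B (g x) \<partial>N)"
proof -
  interpret M: prob_space M by fact
  interpret N: prob_space N by fact
  have iw: "integrable M w" by (rule M.integrable_const_bound[of _ K]) (use w in auto)
  have iv: "integrable N v" by (rule N.integrable_const_bound[of _ K]) (use v in auto)
  define m where "m = (\<integral>x. w x \<partial>M)"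
  have "complex_of_real (\<integral>x. w x \<partial>M) = complex_of_real (\<integral>x. v x \<partial>N)"
    using eq[of 0] by simp
  then have mv: "m = (\<integral>x. v x \<partial>N)" unfolding m_def of_real_eq_iff .
  have m0: "0 \<le> m" unfolding m_def using w by simp
  show ?thesis
  proof (cases "m = 0")
    case True
    have "AE x in M. w x = 0"
      using integral_nonneg_eq_0_iff_AE[OF iw] w True m_def by simp
    then have "AE x in M. w x * indicator B (f x) = 0" by eventually_elim simp
    then have 1: "(\<integral>x. w x * indicator B (f x) \<partial>M) = 0" by (rule integral_eq_zero_AE)
    have "AE x in N. v x = 0"
      using integral_nonneg_eq_0_iff_AE[OF iv] v True mv by simp
    then have "AE x in N. v x * indicator B (g x) = 0" by eventually_elim simp
    then have 2: "(\<integral>x. v x * indicator B (g x) \<partial>N) = 0" by (rule integral_eq_zero_AE)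
    show ?thesis using 1 2 by simp
  next
    case False
    then have m: "0 < m" using m0 by simp
    have dist: "real_distribution (distr (density L (\<lambda>x. ennreal (u x / m))) borel h) \<and>
        char (distr (density L (\<lambda>x. ennreal (u x / m))) borel h) = (\<lambda>s. (CLINT x|L. u x * iexp (s * h x)) / m) \<and>
        measure (distr (density L (\<lambda>x. ennreal (u x / m))) borel h) B = (\<integral>x. u x * indicator B (h x) \<partial>L) / m"
      if L: "prob_space L" and [measurable]: "u \<in> borel_measurable L" "h \<in> borel_measurable L"
        and u: "\<And>x. 0 \<le> u x" "integrable L u" "(\<integral>x. u x \<partial>L) = m"
      for L :: "'c measure" and u h
    proof -
      interpret L: prob_space L by fact
      have "emeasure (density L (\<lambda>x. ennreal (u x / m))) (space L) = (\<integral>\<^sup>+x. ennreal (u x / m) \<partial>L)"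
        by (simp add: emeasure_density cong: nn_integral_cong)
      also have "\<dots> = ennreal (\<integral>x. u x / m \<partial>L)"
        using u m by (intro nn_integral_eq_integral) auto
      also have "\<dots> = 1" using u m by simp
      finally interpret D: prob_space "density L (\<lambda>x. ennreal (u x / m))"
        by (intro prob_spaceI) simp
      have rd: "real_distribution (distr (density L (\<lambda>x. ennreal (u x / m))) borel h)"
        by (rule D.real_distribution_distr) simp
      have ch: "char (distr (density L (\<lambda>x. ennreal (u x / m))) borel h) s = (CLINT x|L. u x * iexp (s * h x)) / m" for s
      proof -
        have "char (distr (density L (\<lambda>x. ennreal (u x / m))) borel h) s
            = (CLINT x|density L (\<lambda>x. ennreal (u x / m)). iexp (s * h x))"
          unfolding char_def by (subst integral_distr) auto
        also have "\<dots> = (CLINT x|L. (u x / m) *\<^sub>R iexp (s * h x))"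
          using u m by (subst integral_density) auto
        also have "\<dots> = (CLINT x|L. (u x * iexp (s * h x)) / m)"
          by (simp add: scaleR_conv_of_real)
        also have "\<dots> = (CLINT x|L. u x * iexp (s * h x)) / m" by simp
        finally show ?thesis .
      qed
      have "emeasure (distr (density L (\<lambda>x. ennreal (u x / m))) borel h) B
          = (\<integral>\<^sup>+x. ennreal (u x / m) * indicator (h -` B \<inter> space L) x \<partial>L)"
        by (simp add: emeasure_distr emeasure_density)
      also have "\<dots> = (\<integral>\<^sup>+x. ennreal (u x * indicator B (h x) / m) \<partial>L)"
        by (intro nn_integral_cong) (auto simp: indicator_def)
      also have "\<dots> = ennreal (\<integral>x. u x * indicator B (h x) / m \<partial>L)"
        using u m by (intro nn_integral_eq_integral integrable_divide Bochner_Integration.integrable_bound[OF u(2)])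
          (auto simp: indicator_def)
      finally have "measure (distr (density L (\<lambda>x. ennreal (u x / m))) borel h) B
          = (\<integral>x. u x * indicator B (h x) / m \<partial>L)"
        unfolding measure_def using u m by (simp add: integral_nonneg_AE)
      then show ?thesis using rd ch by auto
    qed
    note dM = dist[OF M meas(1,2) w(1) iw m_def[symmetric]]
    note dN = dist[OF N meas(3,4) v(1) iv mv[symmetric]]
    have "distr (density M (\<lambda>x. ennreal (w x / m))) borel f = distr (density N (\<lambda>x. ennreal (v x / m))) borel g"
      using dM dN eq by (intro Levy_uniqueness) auto
    then show ?thesis using dM dN m by simp
  qed
qed

lemma iexp_add: "iexp (a + b) = iexp a * iexp b"
  by (simp add: distrib_left exp_add)

text \<open>Characteristic functions determine a law on \<open>\<real>\<^sup>\<nat>\<close>: the coordinates are fixed one after the other,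
  weighting with $1 + \cos(\theta + \varphi)$ instead of $e^{i\theta}$ to stay within positive measures.\<close>

lemma sequence_law_eqI:
  fixes M N :: "(nat \<Rightarrow> real) measure"
  assumes M: "prob_space M" "sets M = sets borel" and N: "prob_space N" "sets N = sets borel"
    and eq: "\<And>n c. (CLINT u|M. iexp (\<Sum>k<n. c k * u k)) = (CLINT u|N. iexp (\<Sum>k<n. c k * u k))"
  shows "M = N"
proof -
  interpret M: prob_space M by fact
  interpret N: prob_space N by fact
  note [measurable_cong] = M(2) N(2)
  have [measurable]: "(\<lambda>u::nat \<Rightarrow> real. u k) \<in> borel_measurable borel" for k
    by (rule measurable_product_then_coordinatewise) simp
  \<comment> \<open>The indicator of a cylinder over the first \<open>m\<close> coordinates. The
    induction in \<open>main\<close> adds one such factor per step while keeping an arbitrary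
    exponential next to it.\<close>
  define Z :: "(nat \<Rightarrow> real set) \<Rightarrow> nat \<Rightarrow> (nat \<Rightarrow> real) \<Rightarrow> real"
    where "Z B m u = (\<Prod>k<m. indicator (B k) (u k))" for B m u
  have Z[measurable]: "Z B m \<in> borel_measurable borel" if "\<And>k. B k \<in> sets borel" for B m
    unfolding Z_def using that by measurable
  have Z01: "0 \<le> Z B m u" "Z B m u \<le> 1" for B m u
    unfolding Z_def by (auto intro!: prod_nonneg prod_le_1)
  have main: "(CLINT u|M. Z B m u * iexp (\<Sum>k<n. c k * u k)) = (CLINT u|N. Z B m u * iexp (\<Sum>k<n. c k * u k))"
    if B: "\<And>k. B k \<in> sets borel" for B m n c
  proof (induction m arbitrary: n c)
    case 0 then show ?case using eq by (simp add: Z_def)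
  next
    case (Suc m)
    have [measurable]: "B k \<in> sets borel" for k by (rule B)
    note [measurable] = Z[OF B]
    define \<theta> where "\<theta> n c u = (\<Sum>k<n. c k * u k)" for n and c u :: "nat \<Rightarrow> real"
    have [measurable]: "\<theta> n c \<in> borel_measurable borel" for n c unfolding \<theta>_def by measurable
    have IH: "(CLINT u|M. Z B m u * iexp (\<theta> n c u)) = (CLINT u|N. Z B m u * iexp (\<theta> n c u))" for n c
      using Suc.IH[of c n] by (simp add: \<theta>_def)
    \<comment> \<open>Exponents stay of the same kind: a multiple of coordinate \<open>m\<close> is
      absorbed by enlarging the number of terms to at least \<open>Suc m\<close>.\<close>
    have comb: "\<exists>n' c'. \<forall>u. s * u m + a * \<theta> n c u = \<theta> n' c' u" for s a n c
    proof (intro exI allI)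
      fix u
      define L where "L = max n (Suc m)"
      have "(\<Sum>k<n. c k * u k) = (\<Sum>k<L. (if k < n then c k else 0) * u k)"
        by (rule sum.mono_neutral_cong_left) (auto simp: L_def)
      moreover have "s * u m = (\<Sum>k<L. (if k = m then s else 0) * u k)"
        by (simp add: L_def if_distrib[of "\<lambda>x. x * _"] sum.delta' cong: if_cong) 
      ultimately show "s * u m + a * \<theta> n c u
          = \<theta> (max n (Suc m)) (\<lambda>k. (if k = m then s else 0) + a * (if k < n then c k else 0)) u"
        unfolding \<theta>_def L_def by (simp add: sum_distrib_left sum.distrib[symmetric] distrib_right mult.assoc)
    qed
    have step: "(\<integral>u. Z B m u * (1 + cos (\<theta> n c u + \<phi>)) * indicator (B m) (u m) \<partial>M)
        = (\<integral>u. Z B m u * (1 + cos (\<theta> n c u + \<phi>)) * indicator (B m) (u m) \<partial>N)" for n c \<phi>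
    proof (rule finite_measure_weight_eq[OF M(1) N(1), where K = 2])
      fix s
      \<comment> \<open>The cosine splits into exponentials of \<theta> and -\<theta>, so the
        characteristic function of coordinate \<open>m\<close> under the weight is a combination of
        three integrals covered by the induction hypothesis.\<close>
      have expand: "complex_of_real (Z B m u * (1 + cos (\<theta> n c u + \<phi>))) * iexp (s * u m)
          = Z B m u * iexp (s * u m + 0 * \<theta> n c u)
            + (iexp \<phi> / 2) * (Z B m u * iexp (s * u m + 1 * \<theta> n c u))
            + (iexp (- \<phi>) / 2) * (Z B m u * iexp (s * u m + (- 1) * \<theta> n c u))" for u
      proof -
        have "complex_of_real (cos (\<theta> n c u + \<phi>)) = (iexp (\<theta> n c u) * iexp \<phi> + iexp (- \<theta> n c u) * iexp (- \<phi>)) / 2"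
        proof -
          have "complex_of_real (cos x) = (iexp x + iexp (- x)) / 2" for x
            by (simp add: cos_of_real[symmetric] cos_exp_eq del: cos_of_real)
          then show ?thesis by (simp only: iexp_add minus_add_distrib)
        qed
        then have "complex_of_real (Z B m u * (1 + cos (\<theta> n c u + \<phi>))) * iexp (s * u m)
            = Z B m u * (1 + (iexp (\<theta> n c u) * iexp \<phi> + iexp (- \<theta> n c u) * iexp (- \<phi>)) / 2) * iexp (s * u m)"
          by simp
        moreover have "iexp (s * u m + 1 * \<theta> n c u) = iexp (s * u m) * iexp (\<theta> n c u)"
          "iexp (s * u m + (- 1) * \<theta> n c u) = iexp (s * u m) * iexp (- \<theta> n c u)"
          "iexp (s * u m + 0 * \<theta> n c u) = iexp (s * u m)"
          by (simp_all only: iexp_add mult_1 mult_minus1 mult_zero_left add_0_right)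
        moreover have "z * (1 + (F * P + F' * P') / 2) * E = z * E + P / 2 * (z * (E * F)) + P' / 2 * (z * (E * F'))"
          for z F P F' P' E :: complex by (simp add: field_simps)
        ultimately show ?thesis by (simp only:)
      qed
      have intM: "integrable M (\<lambda>u. Z B m u * iexp (s * u m + a * \<theta> n c u))" for a
        by (rule M.integrable_const_bound[of _ 1]) (use Z01 in \<open>auto simp: norm_mult\<close>)
      have intN: "integrable N (\<lambda>u. Z B m u * iexp (s * u m + a * \<theta> n c u))" for a
        by (rule N.integrable_const_bound[of _ 1]) (use Z01 in \<open>auto simp: norm_mult\<close>)
      have same: "(CLINT u|M. Z B m u * iexp (s * u m + a * \<theta> n c u))
          = (CLINT u|N. Z B m u * iexp (s * u m + a * \<theta> n c u))" for a
      proof -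
        obtain n' c' where "\<And>u. s * u m + a * \<theta> n c u = \<theta> n' c' u" using comb by blast
        then show ?thesis by (simp only: IH)
      qed
      have lin3: "(CLINT u|L. f u + a * g u + b * h u) = (CLINT u|L. f u) + a * (CLINT u|L. g u) + b * (CLINT u|L. h u)"
        if "integrable L f" "integrable L g" "integrable L h" for L :: "(nat \<Rightarrow> real) measure" and f g h a b
        using that by simp
      show "(CLINT u|M. complex_of_real (Z B m u * (1 + cos (\<theta> n c u + \<phi>))) * iexp (s * u m))
          = (CLINT u|N. complex_of_real (Z B m u * (1 + cos (\<theta> n c u + \<phi>))) * iexp (s * u m))"
        unfolding expand lin3[OF intM[of 0] intM[of 1] intM[of "- 1"]] lin3[OF intN[of 0] intN[of 1] intN[of "- 1"]] same ..
    next
      fix u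
      have "1 + cos (\<theta> n c u + \<phi>) \<le> 2" "0 \<le> 1 + cos (\<theta> n c u + \<phi>)"
        using cos_le_one[of "\<theta> n c u + \<phi>"] cos_ge_minus_one[of "\<theta> n c u + \<phi>"] by linarith+
      then show "0 \<le> Z B m u * (1 + cos (\<theta> n c u + \<phi>))" "Z B m u * (1 + cos (\<theta> n c u + \<phi>)) \<le> 2"
        "0 \<le> Z B m u * (1 + cos (\<theta> n c u + \<phi>))" "Z B m u * (1 + cos (\<theta> n c u + \<phi>)) \<le> 2"
        using Z01[of B m u] mult_mono[of "Z B m u" 1 "1 + cos (\<theta> n c u + \<phi>)" 2] by auto
    qed measurable
    have ZS: "Z B (Suc m) u = Z B m u * indicator (B m) (u m)" for u by (simp add: Z_def)
    have bM: "integrable M (\<lambda>u. Z B (Suc m) u * h (\<theta> n c u + \<phi>))"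
      and bN: "integrable N (\<lambda>u. Z B (Suc m) u * h (\<theta> n c u + \<phi>))"
      if "h = cos \<or> h = (\<lambda>_. 1)" for h :: "real \<Rightarrow> real" and n c \<phi>
    proof -
      have [measurable]: "h \<in> borel_measurable borel" using that by auto
      have h: "\<bar>h x\<bar> \<le> 1" for x using that by auto
      have "\<bar>Z B (Suc m) u * h (\<theta> n c u + \<phi>)\<bar> \<le> 1" for u
        using Z01[of B "Suc m" u] h[of "\<theta> n c u + \<phi>"] by (simp add: abs_mult mult_le_one)
      then show "integrable M (\<lambda>u. Z B (Suc m) u * h (\<theta> n c u + \<phi>))"
        "integrable N (\<lambda>u. Z B (Suc m) u * h (\<theta> n c u + \<phi>))"
        by (auto intro!: M.integrable_const_bound[of _ 1] N.integrable_const_bound[of _ 1])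
    qed
    have split: "Z B m u * (1 + cos (\<theta> n c u + \<phi>)) * indicator (B m) (u m)
        = Z B (Suc m) u * 1 + Z B (Suc m) u * cos (\<theta> n c u + \<phi>)" for n c \<phi> u
      by (simp add: ZS algebra_simps)
    have sum: "(\<integral>u. Z B (Suc m) u * 1 \<partial>M) + (\<integral>u. Z B (Suc m) u * cos (\<theta> n c u + \<phi>) \<partial>M)
        = (\<integral>u. Z B (Suc m) u * 1 \<partial>N) + (\<integral>u. Z B (Suc m) u * cos (\<theta> n c u + \<phi>) \<partial>N)" for n c \<phi>
    proof -
      have "(\<integral>u. Z B (Suc m) u * 1 + Z B (Suc m) u * cos (\<theta> n c u + \<phi>) \<partial>M)
        = (\<integral>u. Z B (Suc m) u * 1 + Z B (Suc m) u * cos (\<theta> n c u + \<phi>) \<partial>N)"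
        using step[of n c \<phi>] unfolding split .
      then show ?thesis
        using bM[of "\<lambda>_. 1"] bM[of cos n c \<phi>] bN[of "\<lambda>_. 1"] bN[of cos n c \<phi>]
        by (subst (asm) (1 2) Bochner_Integration.integral_add) auto
    qed
    \<comment> \<open>With no terms and phase 0 the cosine is 1, so \<open>sum\<close> yields twice
      the bare integral; subtracting it later isolates the cosine part.\<close>
    have one: "(\<integral>u. Z B (Suc m) u \<partial>M) = (\<integral>u. Z B (Suc m) u \<partial>N)"
      using sum[of 0 "\<lambda>_. 0" 0] by (simp add: \<theta>_def)
    have cosE: "(\<integral>u. Z B (Suc m) u * cos (\<theta> n c u + \<phi>) \<partial>M) = (\<integral>u. Z B (Suc m) u * cos (\<theta> n c u + \<phi>) \<partial>N)" for n c \<phi>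
      using sum[of n c \<phi>] one by simp
    \<comment> \<open>The phase -pi/2 turns the cosine into the sine, which recovers the complex
      exponential from two real integrals.\<close>
    have cis: "Z B (Suc m) u * iexp (\<theta> n c u) = complex_of_real (Z B (Suc m) u * cos (\<theta> n c u + 0))
        + \<i> * complex_of_real (Z B (Suc m) u * cos (\<theta> n c u + (- (pi / 2))))" for u n c
    proof -
      have "cos (\<theta> n c u + (- (pi / 2))) = sin (\<theta> n c u)" by (simp add: cos_diff)
      moreover have "iexp (\<theta> n c u) = complex_of_real (cos (\<theta> n c u)) + \<i> * complex_of_real (sin (\<theta> n c u))"
        by (simp add: exp_Euler cos_of_real sin_of_real)
      ultimately show ?thesis by (simp add: algebra_simps)
    qed
    have "(CLINT u|M. Z B (Suc m) u * iexp (\<theta> n c u)) = (CLINT u|N. Z B (Suc m) u * iexp (\<theta> n c u))"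
      unfolding cis
      using bM[of cos n c 0] bM[of cos n c "- (pi / 2)"] bN[of cos n c 0] bN[of cos n c "- (pi / 2)"] cosE[of n c 0] cosE[of n c "- (pi/2)"]
      by (subst (1 2) Bochner_Integration.integral_add) (auto simp del: of_real_mult)
    then show ?case by (simp add: \<theta>_def)
  qed
  show ?thesis
  proof (rule measure_eqI_PiM_infinite[where I = UNIV and M = "\<lambda>_. borel"])
    show "sets M = sets (Pi\<^sub>M UNIV (\<lambda>_. borel))" "sets N = sets (Pi\<^sub>M UNIV (\<lambda>_. borel))"
      using M(2) N(2) by (simp_all add: sets_PiM_equal_borel)
    show "finite_measure M" by (rule M.finite_measure_axioms)
    fix A :: "nat \<Rightarrow> real set" and J :: "nat set" assume J: "finite J" and A: "\<And>i. i \<in> J \<Longrightarrow> A i \<in> sets borel"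
    obtain m where m: "J \<subseteq> {..<m}" using J finite_nat_iff_bounded by auto
    define B where "B k = (if k \<in> J then A k else UNIV)" for k
    have B: "B k \<in> sets borel" for k using A by (simp add: B_def)
    have Zi: "Z B m u = indicator (prod_emb UNIV (\<lambda>_. borel) J (Pi\<^sub>E J A)) u" for u
    proof -
      have "Z B m u = (\<Prod>k<m. if k \<in> J then indicator (A k) (u k) else 1)"
        unfolding Z_def B_def by (intro prod.cong) auto
      also have "\<dots> = (\<Prod>k\<in>J. indicator (A k) (u k))"
        using m by (simp add: prod.If_cases Int_absorb1)
      also have "\<dots> = (if \<forall>k\<in>J. u k \<in> A k then 1 else 0)"
        using J by (auto simp: indicator_def intro!: prod.neutral)
      also have "\<dots> = indicator (prod_emb UNIV (\<lambda>_. borel) J (Pi\<^sub>E J A)) u"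
        by (auto simp: prod_emb_def indicator_def PiE_iff)
      finally show ?thesis .
    qed
    have emb[measurable]: "prod_emb UNIV (\<lambda>_. borel) J (Pi\<^sub>E J A) \<in> sets borel"
      unfolding sets_PiM_equal_borel[symmetric] using A J by (intro sets_PiM_I) auto
    have "complex_of_real (\<integral>u. Z B m u \<partial>M) = complex_of_real (\<integral>u. Z B m u \<partial>N)"
      using main[of B m "\<lambda>_. 0" 0] B by simp
    then have "(\<integral>u. Z B m u \<partial>M) = (\<integral>u. Z B m u \<partial>N)" unfolding of_real_eq_iff .
    then have "measure M (prod_emb UNIV (\<lambda>_. borel) J (Pi\<^sub>E J A)) = measure N (prod_emb UNIV (\<lambda>_. borel) J (Pi\<^sub>E J A))"
      unfolding Zi using emb M(2) N(2) by simp
    then show "emeasure M (prod_emb UNIV (\<lambda>_. borel) J (Pi\<^sub>E J A)) = emeasure N (prod_emb UNIV (\<lambda>_. borel) J (Pi\<^sub>E J A))"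
      by (simp add: M.emeasure_eq_measure N.emeasure_eq_measure)
  qed
qed

lemma sequence_law_distr_eqI:
  fixes X :: "'a \<Rightarrow> nat \<Rightarrow> real" and Y :: "'b \<Rightarrow> nat \<Rightarrow> real"
  assumes M: "prob_space M" and N: "prob_space N"
    and X: "X \<in> borel_measurable M" and Y: "Y \<in> borel_measurable N"
    and eq: "\<And>n c. (CLINT w|M. iexp (\<Sum>k<n. c k * X w k)) = (CLINT w|N. iexp (\<Sum>k<n. c k * Y w k))"
  shows "distr M borel X = distr N borel Y"
proof (rule sequence_law_eqI)
  have [measurable]: "(\<lambda>u::nat \<Rightarrow> real. u k) \<in> borel_measurable borel" for k
    by (rule measurable_product_then_coordinatewise) simp
  show "prob_space (distr M borel X)" "prob_space (distr N borel Y)"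
    using prob_space.prob_space_distr[OF M X] prob_space.prob_space_distr[OF N Y] by auto
  show "(CLINT u|distr M borel X. iexp (\<Sum>k<n. c k * u k)) = (CLINT u|distr N borel Y. iexp (\<Sum>k<n. c k * u k))" for n c
    using X Y eq[where n = n and c = c] by (simp add: integral_distr)
qed simp_all

section \<open>Gaussian sequences\<close>

definition psd :: "(nat \<Rightarrow> nat \<Rightarrow> real) \<Rightarrow> bool" where
  "psd q \<longleftrightarrow> (\<forall>j k. q j k = q k j) \<and> (\<forall>n c. 0 \<le> (\<Sum>j<n. \<Sum>k<n. c j * c k * q j k))"

lemma psd_sym: "psd q \<Longrightarrow> q j k = q k j"
  by (simp add: psd_def)

lemma psd_nonneg: "psd q \<Longrightarrow> 0 \<le> (\<Sum>j<n. \<Sum>k<n. c j * c k * q j k)"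
  by (simp add: psd_def)

text \<open>The quadratic form at c + t e_m, seen as a polynomial in \<open>t\<close>: its minimum
  gives positivity of the eliminated matrix, its behaviour for large \<open>t\<close> the vanishing
  of rows with zero pivot.\<close>

lemma psd_pencil:
  assumes q: "psd q" and m: "m < n"
  shows "0 \<le> (\<Sum>j<n. \<Sum>k<n. c j * c k * q j k) + 2 * t * (\<Sum>j<n. c j * q j m) + t\<^sup>2 * q m m"
proof -
  define e where "e = (\<lambda>k. if k = m then 1 else (0::real))"
  have e1: "(\<Sum>k<n. e k * f k) = f m" for f
    using m by (simp add: e_def if_distrib[of "\<lambda>x. x * _"] sum.delta' cong: if_cong)
  have "(\<Sum>j<n. \<Sum>k<n. (c j + t * e j) * (c k + t * e k) * q j k)
      = (\<Sum>j<n. \<Sum>k<n. c j * c k * q j k + t * (e k * (c j * q j k)) + t * (e j * (c k * q j k))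
          + t\<^sup>2 * (e j * (e k * q j k)))"
    by (intro sum.cong refl) (simp add: power2_eq_square algebra_simps)
  also have "\<dots> = (\<Sum>j<n. \<Sum>k<n. c j * c k * q j k) + t * (\<Sum>j<n. \<Sum>k<n. e k * (c j * q j k))
        + t * (\<Sum>j<n. e j * (\<Sum>k<n. c k * q j k)) + t\<^sup>2 * (\<Sum>j<n. e j * (\<Sum>k<n. e k * q j k))"
    by (simp add: sum_distrib_left sum.distrib)
  also have "\<dots> = (\<Sum>j<n. \<Sum>k<n. c j * c k * q j k) + t * (\<Sum>j<n. c j * q j m)
      + t * (\<Sum>k<n. c k * q m k) + t\<^sup>2 * q m m"
    by (simp only: e1)
  also have "(\<Sum>k<n. c k * q m k) = (\<Sum>j<n. c j * q j m)"
    by (intro sum.cong refl) (simp add: psd_sym[OF q, of m])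
  finally show ?thesis
    using psd_nonneg[OF q, where n = n and c = "\<lambda>j. c j + t * e j"] by (simp add: algebra_simps)
qed

lemma psd_diag_nonneg:
  assumes "psd q"
  shows "0 \<le> q m m"
  using psd_pencil[OF assms, of m "Suc m" "\<lambda>_. 0" 1] by simp

lemma psd_zero_diag:
  assumes q: "psd q" and z: "q m m = 0"
  shows "q j m = 0"
proof (cases "j = m")
  case False
  define n where "n = Suc (max j m)"
  define c where "c = (\<lambda>k. if k = j then 1 else (0::real))"
  have c1: "(\<Sum>k<n. c k * f k) = f j" for f
    by (simp add: c_def n_def if_distrib[of "\<lambda>x. x * _"] sum.delta' cong: if_cong)
  have "(\<Sum>i<n. \<Sum>k<n. c i * c k * q i k) = (\<Sum>i<n. c i * (\<Sum>k<n. c k * q i k))"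
    by (simp add: sum_distrib_left mult.assoc)
  then have Q: "(\<Sum>i<n. \<Sum>k<n. c i * c k * q i k) = q j j" by (simp only: c1)
  have P: "0 \<le> q j j + 2 * t * q j m" for t
    using psd_pencil[OF q, of m n c t] unfolding Q c1 z by (simp add: n_def)
  show ?thesis
  proof (rule ccontr)
    assume ne: "q j m \<noteq> 0"
    \<comment> \<open>At this \<open>t\<close> the affine function in \<open>P\<close> takes the
      value -1.\<close>
    from P[of "- (q j j + 1) / (2 * q j m)"] ne show False by (simp add: field_simps)
  qed
qed (use z in simp)

text \<open>One step of Gaussian elimination. If the pivot vanishes, division by zero leaves \<open>q\<close> unchanged.\<close>

definition psd_elim :: "nat \<Rightarrow> (nat \<Rightarrow> nat \<Rightarrow> real) \<Rightarrow> nat \<Rightarrow> nat \<Rightarrow> real" where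
  "psd_elim m q j k = q j k - q j m * q k m / q m m"

text \<open>For a nonzero pivot the eliminated matrix is a Schur complement, and its form at
  \<open>c\<close> is the minimum over \<open>t\<close> of the pencil through
  \<open>c\<close>.\<close>

lemma psd_elim:
  assumes q: "psd q"
  shows "psd (psd_elim m q)"
  unfolding psd_def
proof (intro conjI allI)
  show "psd_elim m q j k = psd_elim m q k j" for j k
    by (simp add: psd_elim_def psd_sym[OF q, of j k] mult.commute)
  fix n and c :: "nat \<Rightarrow> real"
  define L where "L = max n (Suc m)"
  define d where "d k = (if k < n then c k else 0)" for k
  have ext: "(\<Sum>k<n. c k * f k) = (\<Sum>k<L. d k * f k)" for f :: "nat \<Rightarrow> real"
    by (rule sum.mono_neutral_cong_left) (auto simp: L_def d_def)
  define S where "S = (\<Sum>j<L. d j * q j m)"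
  have "(\<Sum>j<n. \<Sum>k<n. c j * c k * psd_elim m q j k) = (\<Sum>j<n. c j * (\<Sum>k<n. c k * psd_elim m q j k))"
    by (simp add: sum_distrib_left mult.assoc)
  also have "\<dots> = (\<Sum>j<L. d j * (\<Sum>k<L. d k * psd_elim m q j k))" by (simp only: ext)
  also have "\<dots> = (\<Sum>j<L. \<Sum>k<L. d j * d k * q j k) - S * S / q m m"
    unfolding S_def psd_elim_def
    by (simp add: sum_distrib_left sum_distrib_right sum_product sum_subtractf sum_divide_distrib algebra_simps)
  finally have eq: "(\<Sum>j<n. \<Sum>k<n. c j * c k * psd_elim m q j k)
      = (\<Sum>j<L. \<Sum>k<L. d j * d k * q j k) - S * S / q m m" .
  \<comment> \<open>The minimiser is t = -S / q_mm. For a zero pivot the quotient is 0 and the claim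
    reduces to positivity of \<open>q\<close>.\<close>
  have "0 \<le> (\<Sum>j<L. \<Sum>k<L. d j * d k * q j k) + 2 * (- S / q m m) * S + (- S / q m m)\<^sup>2 * q m m"
    unfolding S_def by (rule psd_pencil[OF q]) (simp add: L_def)
  also have "\<dots> = (\<Sum>j<L. \<Sum>k<L. d j * d k * q j k) - S * S / q m m"
    by (cases "q m m = 0") (simp_all add: power2_eq_square field_simps)
  finally show "0 \<le> (\<Sum>j<n. \<Sum>k<n. c j * c k * psd_elim m q j k)" by (simp add: eq)
qed

text \<open>Repeated elimination clears row and column \<open>m\<close> in step \<open>m\<close>,
  and \<open>a m\<close> is the removed row divided by the root of its pivot. Telescoping gives an
  exact finite sum because row \<open>j\<close> of the residual is zero after n > j steps.\<close>

lemma psd_cholesky: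
  assumes q: "psd q"
  obtains a :: "nat \<Rightarrow> nat \<Rightarrow> real"
  where "\<And>m j. j < m \<Longrightarrow> a m j = 0" "\<And>j k n. j < n \<Longrightarrow> q j k = (\<Sum>m<n. a m j * a m k)"
proof -
  define R where "R = rec_nat q psd_elim"
  have R0: "R 0 = q" and RS: "R (Suc m) = psd_elim m (R m)" for m by (simp_all add: R_def)
  have psdR: "psd (R m)" for m by (induction m) (simp_all add: R0 RS q psd_elim)
  have zero: "j < m \<Longrightarrow> R m j k = 0" for m j k
  proof (induction m arbitrary: j k)
    case (Suc m)
    show ?case
    proof (cases "j = m")
      case True
      then show ?thesis
        using psd_zero_diag[OF psdR[of m], of m k] psd_sym[OF psdR[of m], of m k]
        by (cases "R m m m = 0") (auto simp: RS psd_elim_def)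
    next
      case False
      then show ?thesis using Suc by (simp add: RS psd_elim_def)
    qed
  qed simp
  define a where "a m j = R m j m / sqrt (R m m m)" for m j
  have aa: "a m j * a m k = R m j m * R m k m / R m m m" for m j k
    using psd_diag_nonneg[OF psdR[of m], of m] by (simp add: a_def)
  have tele: "q j k = R n j k + (\<Sum>m<n. a m j * a m k)" for n j k
    by (induction n) (simp_all add: R0 RS psd_elim_def aa)
  show ?thesis
  proof (rule that[of a])
    show "j < m \<Longrightarrow> a m j = 0" for m j by (simp add: a_def zero)
    show "j < n \<Longrightarrow> q j k = (\<Sum>m<n. a m j * a m k)" for j k n
      using tele[of j k n] zero[of j n k] by simp
  qed
qed

section \<open>Gaussian sequences with prescribed covariance\<close>

abbreviation gauss_seq :: "(nat \<Rightarrow> real) measure" where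
  "gauss_seq \<equiv> Pi\<^sub>M UNIV (\<lambda>_. std_normal_distribution)"

lemma prob_space_gauss_seq: "prob_space gauss_seq"
  by (intro prob_space_PiM prob_space_normal_density) simp

lemma measurable_gauss_seq_component: "(\<lambda>u. u k) \<in> borel_measurable gauss_seq"
proof -
  have "(\<lambda>u. u k) \<in> measurable gauss_seq std_normal_distribution"
    by (rule measurable_component_singleton) simp
  then show ?thesis by simp
qed

lemma gauss_seq_char:
  "(CLINT u|gauss_seq. iexp (\<Sum>m<n. d m * u m)) = exp (- (\<Sum>m<n. (d m)\<^sup>2) / 2)"
proof -
  interpret G: prob_space gauss_seq by (rule prob_space_gauss_seq)
  interpret P: product_prob_space "\<lambda>_::nat. std_normal_distribution" UNIV
    by (intro product_prob_spaceI prob_space_normal_density) simp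
  have comp: "distr gauss_seq std_normal_distribution (\<lambda>u. u k) = std_normal_distribution" for k
    by (rule P.PiM_component) simp
  have "G.indep_vars (\<lambda>_. std_normal_distribution) (\<lambda>k u. u k) UNIV"
    by (subst G.indep_vars_iff_distr_eq_PiM) (simp_all add: comp restrict_UNIV distr_id2 cong: PiM_cong)
  then have "G.indep_vars (\<lambda>_. std_normal_distribution) (\<lambda>k u. u k) {..<n}"
    by (rule G.indep_vars_subset) simp
  then have "G.indep_vars (\<lambda>_. borel) (\<lambda>k. (\<lambda>x. d k * x) \<circ> (\<lambda>u. u k)) {..<n}"
    by (rule G.indep_vars_compose) simp
  then have ind: "G.indep_vars (\<lambda>_. borel) (\<lambda>k u. d k * u k) {..<n}" by (simp add: comp_def)
  have [measurable]: "(\<lambda>u. u k) \<in> borel_measurable gauss_seq" for k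
    by (rule measurable_gauss_seq_component)
  have cd: "char (distr gauss_seq borel (\<lambda>u. d k * u k)) 1 = complex_of_real (exp (- (d k)\<^sup>2 / 2))" for k
  proof -
    have "char (distr gauss_seq borel (\<lambda>u. d k * u k)) 1 = (CLINT u|gauss_seq. iexp (d k * u k))"
      unfolding char_def by (subst integral_distr) auto
    also have "\<dots> = (CLINT x|distr gauss_seq std_normal_distribution (\<lambda>u. u k). iexp (d k * x))"
      by (subst integral_distr) auto
    also have "\<dots> = char std_normal_distribution (d k)" unfolding comp char_def ..
    finally show ?thesis by (simp add: char_std_normal_distribution)
  qed
  have "(CLINT u|gauss_seq. iexp (\<Sum>m<n. d m * u m)) = char (distr gauss_seq borel (\<lambda>u. \<Sum>m<n. d m * u m)) 1"
    unfolding char_def by (subst integral_distr) auto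
  also have "\<dots> = (\<Prod>m<n. complex_of_real (exp (- (d m)\<^sup>2 / 2)))"
    by (subst G.char_distr_sum[OF ind]) (simp add: cd)
  also have "\<dots> = complex_of_real (\<Prod>m<n. exp (- (d m)\<^sup>2 / 2))" by simp
  also have "(\<Prod>m<n. exp (- (d m)\<^sup>2 / 2)) = exp (\<Sum>m<n. - (d m)\<^sup>2 / 2)" by (simp add: exp_sum)
  also have "(\<Sum>m<n. - (d m)\<^sup>2 / 2) = - (\<Sum>m<n. (d m)\<^sup>2) / 2" by (simp add: sum_negf sum_divide_distrib)
  finally show ?thesis .
qed

text \<open>Since the factor from \<open>psd_cholesky\<close> is triangular, each coordinate is a
  finite combination of independent standard normals, and no question of convergence arises.\<close>

lemma gaussian_sequence_exists:
  assumes q: "psd q"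
  obtains X :: "(nat \<Rightarrow> real) \<Rightarrow> nat \<Rightarrow> real"
  where "X \<in> borel_measurable gauss_seq"
    "\<And>n c. (CLINT u|gauss_seq. iexp (\<Sum>k<n. c k * X u k)) = exp (- (\<Sum>j<n. \<Sum>k<n. c j * c k * q j k) / 2)"
proof -
  obtain a where a0: "\<And>m j. j < m \<Longrightarrow> a m j = 0" and qa: "\<And>j k n. j < n \<Longrightarrow> q j k = (\<Sum>m<n. a m j * a m k)"
    using psd_cholesky[OF q] by blast
  define X where "X u j = (\<Sum>m<Suc j. a m j * u m)" for u :: "nat \<Rightarrow> real" and j
  have [measurable]: "(\<lambda>u. u k) \<in> borel_measurable gauss_seq" for k
    by (rule measurable_gauss_seq_component)
  show ?thesis
  proof (rule that[of X])
    show "X \<in> borel_measurable gauss_seq"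
      by (rule measurable_coordinatewise_then_product) (simp add: X_def)
    fix n and c :: "nat \<Rightarrow> real"
    \<comment> \<open>Entries with m > j vanish, so all coordinates below \<open>n\<close> may be
      written with the same \<open>n\<close> summands.\<close>
    have Xn: "X u j = (\<Sum>m<n. a m j * u m)" if "j < n" for u j
      unfolding X_def by (rule sum.mono_neutral_left) (use that a0 in auto)
    define d where "d m = (\<Sum>j<n. c j * a m j)" for m
    have lin: "(\<Sum>k<n. c k * X u k) = (\<Sum>m<n. d m * u m)" for u
    proof -
      have "(\<Sum>k<n. c k * X u k) = (\<Sum>k<n. \<Sum>m<n. c k * a m k * u m)"
        by (intro sum.cong refl) (simp add: Xn sum_distrib_left mult.assoc)
      also have "\<dots> = (\<Sum>m<n. \<Sum>k<n. c k * a m k * u m)" by (rule sum.swap)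
      also have "\<dots> = (\<Sum>m<n. d m * u m)" by (simp add: d_def sum_distrib_right)
      finally show ?thesis .
    qed
    have "(\<Sum>m<n. (d m)\<^sup>2) = (\<Sum>m<n. \<Sum>j<n. \<Sum>k<n. c j * c k * (a m j * a m k))"
      unfolding d_def power2_eq_square sum_product by (simp add: mult_ac)
    also have "\<dots> = (\<Sum>j<n. \<Sum>m<n. \<Sum>k<n. c j * c k * (a m j * a m k))" by (rule sum.swap)
    also have "\<dots> = (\<Sum>j<n. \<Sum>k<n. \<Sum>m<n. c j * c k * (a m j * a m k))"
      by (intro sum.cong refl sum.swap)
    also have "\<dots> = (\<Sum>j<n. \<Sum>k<n. c j * c k * q j k)"
      by (intro sum.cong refl) (simp add: sum_distrib_left[symmetric] qa[where n = n])
    finally show "(CLINT u|gauss_seq. iexp (\<Sum>k<n. c k * X u k)) = exp (- (\<Sum>j<n. \<Sum>k<n. c j * c k * q j k) / 2)"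
      unfolding lin gauss_seq_char by simp
  qed
qed

section \<open>Centred Gaussian laws on the line in terms of their variance\<close>

lemma normal_density_eq_distr:
  assumes s: "0 < s"
  shows "density lborel (\<lambda>x. ennreal (normal_density 0 s x)) = distr std_normal_distribution borel (\<lambda>x. s * x)"
proof -
  interpret N: prob_space std_normal_distribution by (rule prob_space_normal_density) simp
  have "distributed std_normal_distribution lborel (\<lambda>x. x) (normal_density 0 1)"
    by (simp add: distributed_def distr_id2)
  from N.normal_density_affine[OF this _ less_imp_neq[OF s, symmetric], of 0]
  have "distributed std_normal_distribution lborel (\<lambda>x. s * x) (normal_density 0 s)" using s by simp
  then have "distr std_normal_distribution lborel (\<lambda>x. s * x) = density lborel (normal_density 0 s)"
    by (simp add: distributed_def)
  moreover have "distr std_normal_distribution borel (\<lambda>x. s * x) = distr std_normal_distribution lborel (\<lambda>x. s * x)"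
    by (rule distr_cong) auto
  ultimately show ?thesis by simp
qed

text \<open>Merges the point mass, as v = 0, with the densities, so that later arguments only see a
  characteristic function and a second moment.\<close>

lemma centred_gaussian_realE:
  assumes "centred_gaussian_real \<nu>"
  obtains v where "0 \<le> v" "real_distribution \<nu>" "\<And>t. char \<nu> t = exp (- (v * t\<^sup>2) / 2)"
    "integrable \<nu> (\<lambda>x. x\<^sup>2)" "(\<integral>x. x\<^sup>2 \<partial>\<nu>) = v"
  using assms unfolding centred_gaussian_real_def
proof (elim disjE exE conjE)
  assume \<nu>: "\<nu> = return borel 0"
  show thesis
  proof (rule that[of 0])
    show "real_distribution \<nu>"
      unfolding \<nu> by (intro real_distribution.intro prob_space_return real_distribution_axioms.intro) auto
    show "char \<nu> t = exp (- (0 * t\<^sup>2) / 2)" for t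
      unfolding \<nu> char_def by (subst integral_return) auto
    show "integrable \<nu> (\<lambda>x. x\<^sup>2)"
      unfolding \<nu> by (rule finite_measure.integrable_const_bound[where B = 0])
        (auto intro!: prob_space.finite_measure prob_space_return simp: AE_return)
    show "(\<integral>x. x\<^sup>2 \<partial>\<nu>) = 0" unfolding \<nu> by (subst integral_return) auto
  qed simp
next
  fix s :: real assume s: "0 < s" and "\<nu> = density lborel (\<lambda>x. ennreal (normal_density 0 s x))"
  then have \<nu>: "\<nu> = distr std_normal_distribution borel (\<lambda>x. s * x)" by (simp only: normal_density_eq_distr[OF s])
  interpret N: real_distribution std_normal_distribution by (rule real_dist_normal_dist)
  show thesis
  proof (rule that[of "s\<^sup>2"])
    show "real_distribution \<nu>" unfolding \<nu> by (rule N.real_distribution_distr) simp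
    show "char \<nu> t = exp (- (s\<^sup>2 * t\<^sup>2) / 2)" for t
    proof -
      have "char \<nu> t = char std_normal_distribution (t * s)"
        unfolding \<nu> char_def by (subst integral_distr) (auto simp: mult.assoc)
      then show ?thesis by (simp add: char_std_normal_distribution power_mult_distrib mult.commute)
    qed
    have int: "integrable std_normal_distribution (\<lambda>x. x\<^sup>2)" by (rule integrable_std_normal_distribution_moment)
    show "integrable \<nu> (\<lambda>x. x\<^sup>2)"
      unfolding \<nu> by (subst integrable_distr_eq) (auto simp: power_mult_distrib int)
    show "(\<integral>x. x\<^sup>2 \<partial>\<nu>) = s\<^sup>2"
      unfolding \<nu> using std_normal_distribution_even_moments(1)[of 1]
      by (subst integral_distr) (auto simp: power_mult_distrib)
  qed simp
qed

lemma centred_gaussian_realI: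
  assumes \<nu>: "real_distribution \<nu>" and v: "0 \<le> v" and char: "\<And>t. char \<nu> t = exp (- (v * t\<^sup>2) / 2)"
  shows "centred_gaussian_real \<nu>"
proof (cases "v = 0")
  case True
  have "\<nu> = return borel 0"
  proof (rule Levy_uniqueness[OF \<nu>])
    show "real_distribution (return borel 0)"
      by (intro real_distribution.intro prob_space_return real_distribution_axioms.intro) auto
    show "char \<nu> = char (return borel 0)"
    proof
      show "char \<nu> t = char (return borel 0) t" for t
        unfolding char True unfolding char_def by (subst integral_return) auto
    qed
  qed
  then show ?thesis by (simp add: centred_gaussian_real_def)
next
  case False
  define s where "s = sqrt v"
  have s: "0 < s" and sv: "s\<^sup>2 = v" using v False by (simp_all add: s_def)
  have g: "centred_gaussian_real (density lborel (\<lambda>x. ennreal (normal_density 0 s x)))"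
    using s unfolding centred_gaussian_real_def by blast
  interpret N: real_distribution std_normal_distribution by (rule real_dist_normal_dist)
  have "\<nu> = distr std_normal_distribution borel (\<lambda>x. s * x)"
  proof (rule Levy_uniqueness[OF \<nu>])
    show "real_distribution (distr std_normal_distribution borel (\<lambda>x. s * x))"
      by (rule N.real_distribution_distr) simp
    show "char \<nu> = char (distr std_normal_distribution borel (\<lambda>x. s * x))"
    proof
      fix t
      have "char (distr std_normal_distribution borel (\<lambda>x. s * x)) t = char std_normal_distribution (t * s)"
        unfolding char_def by (subst integral_distr) (auto simp: mult.assoc)
      then show "char \<nu> t = char (distr std_normal_distribution borel (\<lambda>x. s * x)) t"
        unfolding char by (simp add: char_std_normal_distribution power_mult_distrib sv[symmetric] mult.commute)
    qed
  qed
  then show ?thesis using g by (simp only: normal_density_eq_distr[OF s])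
qed

section \<open>Strong measurability\<close>

text \<open>Taking the least index at which a dense sequence comes close enough to
  \<open>f x\<close> makes the choice measurable. The resulting countably valued functions stand in
  for simple functions.\<close>

lemma strongly_measurable_approx:
  assumes f: "strongly_measurable M f"
  shows "\<exists>(N :: nat \<Rightarrow> 'a \<Rightarrow> nat) (d :: nat \<Rightarrow> 'b::real_normed_vector).
    (\<forall>n. N n \<in> measurable M (count_space UNIV)) \<and> (\<forall>n. \<forall>x\<in>space M. dist (f x) (d (N n x)) < 1 / real (Suc n))"
proof -
  obtain D where D: "countable D" "f ` space M \<subseteq> closure D" and [measurable]: "f \<in> borel_measurable M"
    using f unfolding strongly_measurable_def by blast
  define d where "d = from_nat_into (insert 0 D)"
  have rd: "range d = insert 0 D" unfolding d_def using D(1) by (intro range_from_nat_into) auto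
  have ex: "\<exists>k. dist (f x) (d k) < e" if x: "x \<in> space M" and e: "0 < e" for x e
  proof -
    have "f x \<in> closure D" using x D(2) by blast
    then obtain y where "y \<in> D" "dist y (f x) < e" using e unfolding closure_approachable by blast
    then show ?thesis using rd by (metis dist_commute imageE insertI2)
  qed
  define N where "N n x = (LEAST k. dist (f x) (d k) < 1 / real (Suc n))" for n x
  show ?thesis
  proof (intro exI[of _ N] exI[of _ d] conjI allI ballI)
    have [measurable]: "Measurable.pred M (\<lambda>x. dist (f x) (d k) < e)" for k e
    proof -
      have "open {y. dist y (d k) < e}" by (intro open_Collect_less continuous_intros)
      then have "f -` {y. dist y (d k) < e} \<inter> space M \<in> sets M" by (intro measurable_sets[of f M borel]) auto
      moreover have "f -` {y. dist y (d k) < e} \<inter> space M = {x \<in> space M. dist (f x) (d k) < e}" by auto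
      ultimately show ?thesis by (simp add: pred_def)
    qed
    show "N n \<in> measurable M (count_space UNIV)" for n unfolding N_def by measurable
    show "dist (f x) (d (N n x)) < 1 / real (Suc n)" if "x \<in> space M" for x n
      unfolding N_def by (rule LeastI_ex) (use ex that in simp)
  qed
qed

lemma inner_strongly_measurable:
  fixes f g :: "'a \<Rightarrow> 'h::real_inner"
  assumes f: "strongly_measurable M f" and g: "strongly_measurable M g"
  shows "(\<lambda>x. inner (f x) (g x)) \<in> borel_measurable M"
proof -
  obtain N :: "nat \<Rightarrow> 'a \<Rightarrow> nat" and d where N: "\<forall>n. N n \<in> measurable M (count_space UNIV)"
    and dN: "\<forall>n. \<forall>x\<in>space M. dist (f x) (d (N n x)) < 1 / real (Suc n)"
    using strongly_measurable_approx[OF f] by blast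
  note N[rule_format, measurable]
  have [measurable]: "g \<in> borel_measurable M" using g by (simp add: strongly_measurable_def)
  have [measurable]: "(\<lambda>x. inner (d k) (g x)) \<in> borel_measurable M" for k
    by (rule borel_measurable_continuous_on[of "inner (d k)"]) (auto intro!: continuous_intros)
  show ?thesis
  proof (rule borel_measurable_LIMSEQ_real)
    show "(\<lambda>x. inner (d (N n x)) (g x)) \<in> borel_measurable M" for n
      by (rule measurable_compose_countable[OF _ N[rule_format]]) measurable
    fix x assume x: "x \<in> space M"
    have "(\<lambda>n. dist (d (N n x)) (f x)) \<longlonglongrightarrow> 0"
    proof (rule tendsto_sandwich[of "\<lambda>_. 0"])
      show "\<forall>\<^sub>F n in sequentially. dist (d (N n x)) (f x) \<le> 1 / real (Suc n)"
        using dN x by (intro always_eventually allI less_imp_le) (simp add: dist_commute)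
      show "(\<lambda>n. 1 / real (Suc n)) \<longlonglongrightarrow> 0" by (rule LIMSEQ_Suc[OF lim_1_over_n])
    qed auto
    then have "(\<lambda>n. d (N n x)) \<longlonglongrightarrow> f x" by (subst tendsto_dist_iff)
    then show "(\<lambda>n. inner (d (N n x)) (g x)) \<longlonglongrightarrow> inner (f x) (g x)" by (intro tendsto_intros)
  qed
qed

text \<open>Closing under rational combinations keeps the set countable, and limits of rational
  coefficients supply the real ones.\<close>

lemma countable_subspace_closure:
  fixes V :: "'a::real_normed_vector set"
  assumes V: "countable V"
  obtains D where "countable D" "V \<subseteq> D" "subspace (closure D)"
proof -
  define F where "F A = (\<lambda>(a, b, x, y). a *\<^sub>R x + b *\<^sub>R y) ` (\<rat> \<times> \<rat> \<times> A \<times> A)" for A :: "'a set"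
  define E where "E n = (F ^^ n) (insert 0 V)" for n
  have E0: "E 0 = insert 0 V" and ES: "E (Suc n) = F (E n)" for n by (simp_all add: E_def)
  have cE: "countable (E n)" for n
    by (induction n) (auto simp: E0 ES F_def V countable_rat intro!: countable_image countable_SIGMA)
  have FI: "a *\<^sub>R x + b *\<^sub>R y \<in> F A" if "a \<in> \<rat>" "b \<in> \<rat>" "x \<in> A" "y \<in> A" for a b x y A
    unfolding F_def using that by (intro image_eqI[of _ _ "(a, b, x, y)"]) auto
  have mono1: "E n \<subseteq> E (Suc n)" for n
  proof
    fix x assume "x \<in> E n"
    then show "x \<in> E (Suc n)" using FI[of 1 0 x "E n" x] by (simp add: ES)
  qed
  have mono: "m \<le> n \<Longrightarrow> E m \<subseteq> E n" for m n by (rule lift_Suc_mono_le[of E, OF mono1])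
  define D where "D = (\<Union>n. E n)"
  have Dc: "a *\<^sub>R x + b *\<^sub>R y \<in> D" if "a \<in> \<rat>" "b \<in> \<rat>" "x \<in> D" "y \<in> D" for a b x y
  proof -
    obtain m n where "x \<in> E m" "y \<in> E n" using \<open>x \<in> D\<close> \<open>y \<in> D\<close> unfolding D_def by blast
    then have "x \<in> E (max m n)" "y \<in> E (max m n)" using mono[of m "max m n"] mono[of n "max m n"] by auto
    then have "a *\<^sub>R x + b *\<^sub>R y \<in> E (Suc (max m n))" unfolding ES using that(1,2) by (intro FI)
    then show ?thesis unfolding D_def by blast
  qed
  have clc: "a *\<^sub>R x + b *\<^sub>R y \<in> closure D" if x: "x \<in> closure D" and y: "y \<in> closure D" for a b x y
  proof -
    obtain X where X: "\<And>n. X n \<in> D" "X \<longlonglongrightarrow> x" using x unfolding closure_sequential by blast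
    obtain Y where Y: "\<And>n. Y n \<in> D" "Y \<longlonglongrightarrow> y" using y unfolding closure_sequential by blast
    have "a \<in> closure \<rat>" "b \<in> closure \<rat>" by (simp_all add: Rats_closure_real)
    then obtain A B where A: "\<And>n. A n \<in> \<rat>" "A \<longlonglongrightarrow> a" and B: "\<And>n. B n \<in> \<rat>" "B \<longlonglongrightarrow> b"
      unfolding closure_sequential by blast
    show ?thesis unfolding closure_sequential
    proof (intro exI conjI allI)
      show "(\<lambda>n. A n *\<^sub>R X n + B n *\<^sub>R Y n) \<longlonglongrightarrow> a *\<^sub>R x + b *\<^sub>R y" by (intro tendsto_intros A B X Y)
      show "A n *\<^sub>R X n + B n *\<^sub>R Y n \<in> D" for n by (intro Dc A B X Y)
    qed
  qed
  show ?thesis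
  proof (rule that[of D])
    show "countable D" unfolding D_def using cE by auto
    show "V \<subseteq> D" unfolding D_def using E0 by blast
    show "subspace (closure D)" unfolding subspace_def
    proof (intro conjI allI ballI)
      have "0 \<in> D" unfolding D_def using E0 by blast
      then show "0 \<in> closure D" using closure_subset by blast
      show "x + y \<in> closure D" if "x \<in> closure D" "y \<in> closure D" for x y
        using clc[OF that, of 1 1] by simp
      show "c *\<^sub>R x \<in> closure D" if "x \<in> closure D" for c x
        using clc[OF that that, of c 0] by simp
    qed
  qed
qed

text \<open>Pettis' theorem. As f x - d stays in the closed subspace, membership of
  \<open>f x\<close> in a ball around \<open>d\<close> is decided by inner products with the
  countable set \<open>D\<close>; the preimage of an open set is then a countable union of preimages
  of such balls.\<close>

lemma pettis_measurability:
  fixes f :: "'a \<Rightarrow> 'h::real_inner"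
  assumes weak: "\<And>k. (\<lambda>x. inner k (f x)) \<in> borel_measurable M"
    and D: "countable D" "subspace (closure D)" "f ` space M \<subseteq> closure D"
  shows "strongly_measurable M f"
proof -
  have ball: "{x \<in> space M. norm (f x - d) \<le> r} \<in> sets M" if "d \<in> D" for d r
  proof -
    have "{x \<in> space M. norm (f x - d) \<le> r} = {x \<in> space M. 0 \<le> r \<and> (\<forall>e\<in>D. inner e (f x) - inner e d \<le> r * norm e)}"
      (is "?A = ?B")
    proof (intro set_eqI iffI)
      fix x assume x: "x \<in> ?A"
      then have r: "norm (f x - d) \<le> r" by simp
      have "inner e (f x) - inner e d \<le> r * norm e" for e
      proof -
        have "inner e (f x - d) \<le> norm e * norm (f x - d)" by (rule norm_cauchy_schwarz)
        also have "\<dots> \<le> norm e * r" using r by (intro mult_left_mono) auto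
        finally show ?thesis by (simp add: inner_diff_right mult.commute)
      qed
      moreover have "0 \<le> r" using order_trans[OF norm_ge_zero r] .
      ultimately show "x \<in> ?B" using x by blast
    next
      fix x assume x: "x \<in> ?B"
      then have xM: "x \<in> space M" and r0: "0 \<le> r"
        and xe: "\<And>e. e \<in> D \<Longrightarrow> inner e (f x) - inner e d \<le> r * norm e" by blast+
      have "f x \<in> closure D" using xM D(3) by blast
      moreover have "d \<in> closure D" using that closure_subset by blast
      ultimately have "f x - d \<in> closure D" by (rule subspace_diff[OF D(2)])
      \<comment> \<open>Testing with elements of \<open>D\<close> that converge to f x - d recovers
        its norm.\<close>
      then obtain e where e: "\<And>n. e n \<in> D" "e \<longlonglongrightarrow> f x - d" unfolding closure_sequential by blast
      have "inner (f x - d) (f x - d) \<le> r * norm (f x - d)"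
      proof (rule LIMSEQ_le)
        show "(\<lambda>n. inner (e n) (f x - d)) \<longlonglongrightarrow> inner (f x - d) (f x - d)" by (intro tendsto_intros e)
        show "(\<lambda>n. r * norm (e n)) \<longlonglongrightarrow> r * norm (f x - d)" by (intro tendsto_intros e)
        show "\<exists>N. \<forall>n\<ge>N. inner (e n) (f x - d) \<le> r * norm (e n)"
          using xe[OF e(1)] by (simp add: inner_diff_right)
      qed
      then have "norm (f x - d) * norm (f x - d) \<le> r * norm (f x - d)"
        by (simp only: power2_norm_eq_inner[symmetric] power2_eq_square)
      then have "norm (f x - d) \<le> r" using r0 by (cases "norm (f x - d) = 0") auto
      then show "x \<in> ?A" using xM by simp
    qed
    moreover have "?B \<in> sets M"
    proof -
      have "{x \<in> space M. \<forall>e\<in>D. inner e (f x) - inner e d \<le> r * norm e} \<in> sets M"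
      proof -
        have meas: "{x \<in> space M. r * norm e < inner e (f x) - inner e d} \<in> sets M" for e
          by (rule borel_measurable_less[OF borel_measurable_const borel_measurable_diff[OF weak borel_measurable_const]])
        have "{x \<in> space M. \<forall>e\<in>D. inner e (f x) - inner e d \<le> r * norm e}
            = space M - (\<Union>e\<in>D. {x \<in> space M. r * norm e < inner e (f x) - inner e d})"
          unfolding set_eq_iff Diff_iff UN_iff mem_Collect_eq not_less[symmetric] by blast
        also have "\<dots> \<in> sets M" by (intro sets.Diff sets.top sets.countable_UN' D(1) image_subsetI meas)
        finally show ?thesis .
      qed
      then show ?thesis by (cases "0 \<le> r") simp_all
    qed
    ultimately show ?thesis by (simp only:)
  qed
  have "f \<in> borel_measurable M"
  proof (rule borel_measurableI)
    fix U :: "'h set" assume U: "open U"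
    define I where "I = {(d, r). d \<in> D \<and> r \<in> \<rat> \<and> cball d r \<subseteq> U}"
    have "countable I"
      by (rule countable_subset[of _ "D \<times> \<rat>"]) (auto simp: I_def D(1) countable_rat intro!: countable_SIGMA)
    have "f -` U \<inter> space M = (\<Union>(d, r)\<in>I. {x \<in> space M. norm (f x - d) \<le> r})"
    proof (intro set_eqI iffI)
      fix x assume x: "x \<in> f -` U \<inter> space M"
      then obtain e where e: "0 < e" "cball (f x) e \<subseteq> U" using U open_contains_cball by blast
      obtain r where r: "r \<in> \<rat>" "0 < r" "r < e / 2" using Rats_dense_in_real[of 0 "e / 2"] e by auto
      have "f x \<in> closure D" using x D(3) by blast
      then obtain d where d: "d \<in> D" "dist d (f x) < r" using r(2) unfolding closure_approachable by blast
      have "cball d r \<subseteq> U"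
      proof
        fix y assume "y \<in> cball d r"
        then have "dist (f x) y \<le> e" using d(2) r(3) dist_triangle[of "f x" y d] by (simp add: dist_commute)
        then show "y \<in> U" using e(2) by auto
      qed
      then have "(d, r) \<in> I" using d(1) r(1) by (simp add: I_def)
      moreover have "norm (f x - d) \<le> r" using d(2) by (simp add: dist_norm norm_minus_commute)
      ultimately show "x \<in> (\<Union>(d, r)\<in>I. {x \<in> space M. norm (f x - d) \<le> r})"
        using x by (intro UN_I[of "(d, r)"]) simp_all
    next
      fix x assume "x \<in> (\<Union>(d, r)\<in>I. {x \<in> space M. norm (f x - d) \<le> r})"
      then obtain d r where dr: "(d, r) \<in> I" "x \<in> space M" "norm (f x - d) \<le> r" by auto
      then have "f x \<in> cball d r" by (simp add: dist_norm norm_minus_commute)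
      moreover have "cball d r \<subseteq> U" using dr(1) by (simp add: I_def)
      ultimately show "x \<in> f -` U \<inter> space M" using dr(2) by auto
    qed
    also have "\<dots> \<in> sets M"
    proof (intro sets.countable_UN' image_subsetI)
      fix z assume "z \<in> I"
      then show "(case z of (d, r) \<Rightarrow> {x \<in> space M. norm (f x - d) \<le> r}) \<in> sets M"
        by (cases z) (simp add: I_def ball)
    qed (rule \<open>countable I\<close>)
    finally show "f -` U \<inter> space M \<in> sets M" .
  qed
  then show ?thesis unfolding strongly_measurable_def using D(1,3) by blast
qed

section \<open>Covariance of the stochastic convolutions\<close>

lemma Lp_two_iff: "f \<in> Lp 2 M \<longleftrightarrow> strongly_measurable M f \<and> integrable M (\<lambda>x. (norm (f x))\<^sup>2)"
  by (simp add: Lp_def)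

lemma strongly_measurable_borel: "strongly_measurable M f \<Longrightarrow> f \<in> borel_measurable M"
  by (simp add: strongly_measurable_def)

lemma strongly_measurable_If:
  fixes f :: "'a \<Rightarrow> 'b::real_normed_vector"
  assumes f: "strongly_measurable (restrict_space M J) f" and J: "J \<in> sets M" "J \<subseteq> \<Omega>" "\<Omega> \<in> sets M"
  shows "strongly_measurable (restrict_space M \<Omega>) (\<lambda>x. if x \<in> J then f x else 0)"
proof -
  obtain D where D: "countable D" "f ` space (restrict_space M J) \<subseteq> closure D"
    and f1: "f \<in> borel_measurable (restrict_space M J)"
    using f unfolding strongly_measurable_def by blast
  have J': "J \<in> sets (restrict_space M \<Omega>)" using J by (simp add: sets_restrict_space_iff)
  have "restrict_space (restrict_space M \<Omega>) J = restrict_space M J"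
    using J by (subst restrict_restrict_space) (auto simp: Int_absorb1)
  then have "(\<lambda>x. if x \<in> J then f x else 0) \<in> borel_measurable (restrict_space M \<Omega>)"
    using f1 J' by (intro measurable_If_restrict_space_iff[THEN iffD2]) (auto simp: restrict_restrict_space Int_absorb1)
  moreover have "(\<lambda>x. if x \<in> J then f x else 0) ` space (restrict_space M \<Omega>) \<subseteq> closure (insert 0 D)"
  proof clarify
    fix x assume "x \<in> space (restrict_space M \<Omega>)"
    show "(if x \<in> J then f x else 0) \<in> closure (insert 0 D)"
    proof (cases "x \<in> J")
      case True
      then have "x \<in> space (restrict_space M J)" using J sets.sets_into_space by (auto simp: space_restrict_space)
      then have "f x \<in> closure D" using D(2) by blast
      then show ?thesis using True closure_mono[of D "insert 0 D"] by auto
    next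
      case False
      then show ?thesis using closure_subset[of "insert 0 D"] by auto
    qed
  qed
  ultimately show ?thesis unfolding strongly_measurable_def using D(1) by blast
qed

locale restricted_semigroup =
  fixes S :: "real \<Rightarrow> ('e::banach \<Rightarrow>\<^sub>L 'e)"
    and i :: "'h::{real_inner,complete_space} \<Rightarrow>\<^sub>L 'e"
    and S\<^sub>H :: "real \<Rightarrow> ('h \<Rightarrow>\<^sub>L 'h)"
  assumes semigroup: "C0_semigroup S"
    and I_infty_defined:
      "\<And>g. g \<in> Lp 2 (restrict_space lborel {0<..}) \<Longrightarrow> (\<lambda>s. S s (i (g s))) integrable_on {0<..}"
    and I_infty_bounded: "bounded_linear_L2 (restrict_space lborel {0<..}) (conv_op S i {0<..})"
    and semigroup_H: "C0_semigroup S\<^sub>H"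
    and restricts: "\<And>t. 0 \<le> t \<Longrightarrow> S t o\<^sub>L i = i o\<^sub>L S\<^sub>H t"
begin

text \<open>The function s -> i^* S(s)^* x', which represents the adjoint of
  \<open>conv_op S i J\<close> at \<open>x'\<close> for every Borel set J of positive times.\<close>

definition adj :: "('e \<Rightarrow>\<^sub>L real) \<Rightarrow> real \<Rightarrow> 'h" where
  "adj x' s = H_adjoint i (x' o\<^sub>L S s)"

text \<open>The pairing of I I^* x' with y' for I = \<open>conv_op S i J\<close>, as
  \<open>L2_TTstar_covf\<close> shows.\<close>

definition covf :: "real set \<Rightarrow> ('e \<Rightarrow>\<^sub>L real) \<Rightarrow> ('e \<Rightarrow>\<^sub>L real) \<Rightarrow> real" where
  "covf J x' y' = (\<integral>s. inner (adj x' s) (adj y' s) \<partial>restrict_space lborel J)"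

lemma inner_adj: "inner k (adj x' s) = x' (S s (i k))"
  by (simp add: adj_def inner_H_adjoint)

lemma S_i: "0 \<le> s \<Longrightarrow> S s (i k) = i (S\<^sub>H s k)"
  using restricts[of s] by (metis blinfun_apply_blinfun_compose)

lemma inner_adj_H: "0 \<le> s \<Longrightarrow> inner k (adj x' s) = x' (i (S\<^sub>H s k))"
  by (simp add: inner_adj S_i)

lemma adj_add: "adj (x' + y') s = adj x' s + adj y' s"
  by (rule eq_if_inner_eq) (simp add: inner_add_right inner_adj blinfun.add_left)

lemma adj_scaleR: "adj (c *\<^sub>R x') s = c *\<^sub>R adj x' s"
  by (rule eq_if_inner_eq) (simp add: inner_adj blinfun.scaleR_left)

lemma S_add: "0 \<le> s \<Longrightarrow> 0 \<le> t \<Longrightarrow> S (s + t) = S s o\<^sub>L S t"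
  using semigroup by (simp add: C0_semigroup_def)

lemma S_H_add: "0 \<le> s \<Longrightarrow> 0 \<le> t \<Longrightarrow> S\<^sub>H (s + t) = S\<^sub>H s o\<^sub>L S\<^sub>H t"
  using semigroup_H by (simp add: C0_semigroup_def)

lemma adj_shift: "0 \<le> s \<Longrightarrow> 0 \<le> t \<Longrightarrow> adj x' (t + s) = adj (x' o\<^sub>L S t) s"
  by (rule eq_if_inner_eq) (simp add: inner_adj S_add)

lemma adj_bound:
  obtains B where "\<And>s. 0 \<le> s \<Longrightarrow> s \<le> T \<Longrightarrow> norm (adj x' s) \<le> B"
proof -
  obtain C where C: "\<And>s. s \<in> {0..T} \<Longrightarrow> norm (S\<^sub>H s) \<le> C"
    using C0_semigroup_local_bound[OF semigroup_H, of T] unfolding bdd_above_def by force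
  have "norm (adj x' s) \<le> norm x' * (norm i * C)" if "0 \<le> s" "s \<le> T" for s
  proof (cases "adj x' s = 0")
    case True
    have "0 \<le> C" using order_trans[OF norm_ge_zero C[of s]] that by simp
    then show ?thesis using True by simp
  next
    case False
    \<comment> \<open>Testing \<open>adj x' s\<close> against itself turns the bound on functional
      values into a bound on its norm.\<close>
    define k where "k = adj x' s"
    have "inner k k = x' (i (S\<^sub>H s k))" using inner_adj_H[OF that(1), of k x'] by (simp add: k_def)
    also have "\<dots> \<le> norm (x' (i (S\<^sub>H s k)))" by simp
    also have "\<dots> \<le> norm x' * norm (i (S\<^sub>H s k))" by (rule norm_blinfun)
    also have "\<dots> \<le> norm x' * (norm i * norm (S\<^sub>H s k))" by (intro mult_left_mono norm_blinfun) auto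
    also have "\<dots> \<le> norm x' * (norm i * (norm (S\<^sub>H s) * norm k))"
      by (intro mult_left_mono norm_blinfun) auto
    also have "\<dots> \<le> norm x' * (norm i * (C * norm k))"
      using C[of s] that by (intro mult_left_mono mult_right_mono) auto
    finally have "norm k * norm k \<le> (norm x' * (norm i * C)) * norm k"
      by (simp add: power2_norm_eq_inner[symmetric] power2_eq_square mult.assoc)
    then show ?thesis using False by (simp add: k_def)
  qed
  then show thesis using that by blast
qed

lemma continuous_inner_adj: "continuous_on {0..} (\<lambda>s. inner k (adj x' s))"
proof -
  have "continuous_on {0..} (\<lambda>s. x' (i (S\<^sub>H s k)))"
    by (intro continuous_intros C0_semigroup_continuous_on[OF semigroup_H])
  then show ?thesis by (rule continuous_on_cong[THEN iffD1, rotated 2]) (simp_all add: inner_adj_H)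
qed

text \<open>Only weak continuity of the adjoint orbit is known. It gives weak measurability, and it
  keeps the whole orbit in a separable closed subspace containing the values at rational times, so
  Pettis' theorem applies.\<close>

lemma strongly_measurable_adj:
  assumes J: "J \<in> sets borel" "J \<subseteq> {0..}"
  shows "strongly_measurable (restrict_space lborel J) (adj x')"
proof -
  have "countable (adj x' ` (\<rat> \<inter> {0..}))" by (intro countable_image countable_Int1 countable_rat)
  then obtain D where D: "countable D" "adj x' ` (\<rat> \<inter> {0..}) \<subseteq> D" "subspace (closure D)"
    using countable_subspace_closure by blast
  show ?thesis
  proof (rule pettis_measurability[OF _ D(1,3)])
    fix k
    have "continuous_on J (\<lambda>s. inner k (adj x' s))"
      by (rule continuous_on_subset[OF continuous_inner_adj J(2)])
    then have "(\<lambda>s. inner k (adj x' s)) \<in> borel_measurable (restrict_space borel J)"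
      by (rule borel_measurable_continuous_on_restrict)
    then show "(\<lambda>s. inner k (adj x' s)) \<in> borel_measurable (restrict_space lborel J)"
      by (simp add: measurable_cong_sets[OF sets_restrict_space_cong[OF sets_lborel] refl])
  next
    have "adj x' s \<in> closure D" if s: "0 \<le> s" for s
    proof -
      \<comment> \<open>The residual \<open>w\<close> of the projection is orthogonal to all values
        at rational times, hence by weak continuity to \<open>adj x' s\<close>; being also
        orthogonal to \<open>m\<close>, it vanishes.\<close>
      obtain m where m: "m \<in> closure D" "\<And>k. k \<in> closure D \<Longrightarrow> inner k (adj x' s - m) = 0"
        using real_inner_closest_point[OF D(3) closed_closure, of "adj x' s"] by metis
      define w where "w = adj x' s - m"
      have wq: "inner w (adj x' q) = 0" if "q \<in> \<rat>" "0 \<le> q" for q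
      proof -
        have "adj x' q \<in> D" using that D(2) by blast
        then have "adj x' q \<in> closure D" using closure_subset by blast
        from m(2)[OF this] show ?thesis by (simp add: w_def inner_commute)
      qed
      have "inner w (adj x' s) = 0"
      proof -
        \<comment> \<open>Rational times are taken to the right of \<open>s\<close>, so that they
          stay nonnegative even for s = 0.\<close>
        have "\<exists>q. q \<in> \<rat> \<and> s < q \<and> q < s + 1 / real (Suc n)" for n
          using Rats_dense_in_real[of s "s + 1 / real (Suc n)"] by auto
        then obtain q where q: "\<And>n. q n \<in> \<rat>" "\<And>n. s < q n" "\<And>n. q n < s + 1 / real (Suc n)" by metis
        have "q \<longlonglongrightarrow> s"
        proof (rule tendsto_sandwich[of "\<lambda>_. s"])
          show "\<forall>\<^sub>F n in sequentially. s \<le> q n" using q(2) by (simp add: less_imp_le)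
          show "\<forall>\<^sub>F n in sequentially. q n \<le> s + 1 / real (Suc n)" using q(3) by (intro always_eventually allI less_imp_le)
          have "(\<lambda>n. s + 1 / real (Suc n)) \<longlonglongrightarrow> s + 0" by (intro tendsto_intros LIMSEQ_Suc[OF lim_1_over_n])
          then show "(\<lambda>n. s + 1 / real (Suc n)) \<longlonglongrightarrow> s" by simp
        qed (rule tendsto_const)
        have q0: "0 \<le> q n" for n using q(2)[of n] s by linarith
        have "(\<lambda>n. inner w (adj x' (q n))) \<longlonglongrightarrow> inner w (adj x' s)"
          by (rule continuous_on_tendsto_compose[OF continuous_inner_adj \<open>q \<longlonglongrightarrow> s\<close>]) (use s q0 in auto)
        then have "(\<lambda>n. 0::real) \<longlonglongrightarrow> inner w (adj x' s)" by (simp add: wq q(1) q0)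
        then show ?thesis by (simp add: LIMSEQ_const_iff)
      qed
      moreover have "inner w m = 0" using m by (simp add: w_def inner_commute)
      ultimately have "inner w w = 0" by (simp add: w_def inner_diff_right)
      then show ?thesis using m(1) by (simp add: w_def)
    qed
    then show "adj x' ` space (restrict_space lborel J) \<subseteq> closure D"
      using J(2) by (auto simp: space_restrict_space)
  qed
qed

text \<open>The functional passes through the gauge integral, and the integrability premise
  identifies the resulting scalar gauge integral with the Lebesgue integral.\<close>

lemma functional_conv_op:
  assumes g: "g \<in> Lp 2 (restrict_space lborel {0<..})"
    and int: "integrable (restrict_space lborel {0<..}) (\<lambda>s. inner (g s) (adj x' s))"
  shows "x' (conv_op S i {0<..} g) = (\<integral>s. inner (g s) (adj x' s) \<partial>restrict_space lborel {0<..})"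
proof -
  have "x' (conv_op S i {0<..} g) = integral {0<..} (blinfun_apply x' \<circ> (\<lambda>s. S s (i (g s))))"
    unfolding conv_op_def
    by (rule integral_linear[OF I_infty_defined[OF g] blinfun.bounded_linear_right, symmetric])
  also have "\<dots> = integral {0<..} (\<lambda>s. inner (g s) (adj x' s))" by (simp add: comp_def inner_adj)
  also have "\<dots> = (LINT s:{0<..}|lborel. inner (g s) (adj x' s))"
    using int by (intro set_borel_integral_eq_integral(2)[symmetric]) (simp add: set_integrable_def integrable_restrict_space)
  also have "\<dots> = (\<integral>s. inner (g s) (adj x' s) \<partial>restrict_space lborel {0<..})"
    by (simp add: set_lebesgue_integral_def integral_restrict_space)
  finally show ?thesis .
qed

lemma integrable_inner_L2:
  fixes f g :: "'a \<Rightarrow> 'h"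
  assumes f: "f \<in> Lp 2 M" and g: "g \<in> Lp 2 M"
  shows "integrable M (\<lambda>s. inner (f s) (g s))"
proof (rule Bochner_Integration.integrable_bound[of _ "\<lambda>s. (norm (f s))\<^sup>2 + (norm (g s))\<^sup>2"])
  show "integrable M (\<lambda>s. (norm (f s))\<^sup>2 + (norm (g s))\<^sup>2)"
    using f g by (simp add: Lp_two_iff)
  show "(\<lambda>s. inner (f s) (g s)) \<in> borel_measurable M"
    using f g by (intro inner_strongly_measurable) (simp_all add: Lp_two_iff)
  show "AE s in M. norm (inner (f s) (g s)) \<le> norm ((norm (f s))\<^sup>2 + (norm (g s))\<^sup>2)"
  proof (rule AE_I2)
    fix s
    have "norm (inner (f s) (g s)) \<le> norm (f s) * norm (g s)" using Cauchy_Schwarz_ineq2 by simp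
    also have "\<dots> \<le> (norm (f s))\<^sup>2 + (norm (g s))\<^sup>2"
      using sum_squares_bound[of "norm (f s)" "norm (g s)"] mult_nonneg_nonneg[OF norm_ge_zero norm_ge_zero, of "f s" "g s"]
      unfolding mult.assoc by linarith
    finally show "norm (inner (f s) (g s)) \<le> norm ((norm (f s))\<^sup>2 + (norm (g s))\<^sup>2)" by simp
  qed
qed

text \<open>Boundedness of I_infty is tested on truncations b_n of \<open>adj x'\<close> itself: x'
  (I_infty b_n) equals the squared norm of b_n and is at most norm x' times K times its norm, which
  bounds that norm uniformly in n. The truncations are square integrable because
  \<open>adj x'\<close> is locally bounded; monotone convergence finishes.\<close>

lemma adj_in_L2_infty: "adj x' \<in> Lp 2 (restrict_space lborel {0<..})"
proof -
  let ?M = "restrict_space lborel {0<..} :: real measure"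
  have sm: "strongly_measurable ?M (adj x')" by (intro strongly_measurable_adj) auto
  note adj_meas[measurable] = strongly_measurable_borel[OF sm]
  define b where "b n s = (if s \<in> {0<..real n} then adj x' s else 0)" for n :: nat and s
  obtain K where K: "\<And>f. f \<in> Lp 2 ?M \<Longrightarrow> norm (conv_op S i {0<..} f) \<le> K * Lp_norm 2 ?M f"
    using I_infty_bounded unfolding bounded_linear_L2_def by blast
  have bL: "b n \<in> Lp 2 ?M" for n
  proof -
    obtain B where B: "\<And>s. 0 \<le> s \<Longrightarrow> s \<le> real n \<Longrightarrow> norm (adj x' s) \<le> B" using adj_bound by blast
    have "strongly_measurable (restrict_space lborel {0<..real n}) (adj x')"
      by (intro strongly_measurable_adj) auto
    then have sb: "strongly_measurable ?M (b n)"
      unfolding b_def by (rule strongly_measurable_If) auto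
    moreover have "integrable ?M (\<lambda>s. (norm (b n s))\<^sup>2)"
    proof (rule Bochner_Integration.integrable_bound)
      show "integrable ?M (\<lambda>s. indicator {0<..real n} s *\<^sub>R B\<^sup>2)"
      proof -
        have eq: "indicator {0<..} s *\<^sub>R (indicator {0<..real n} s *\<^sub>R B\<^sup>2) = indicator {0<..real n} s *\<^sub>R B\<^sup>2" for s
          by (auto simp: indicator_def)
        have "integrable lborel (\<lambda>s. indicator {0<..real n} s *\<^sub>R B\<^sup>2)"
          by (intro integrable_scaleR_left integrable_real_indicator) auto
        then show ?thesis by (subst integrable_restrict_space) (simp_all only: eq, simp)
      qed
      show "(\<lambda>s. (norm (b n s))\<^sup>2) \<in> borel_measurable ?M"
        using strongly_measurable_borel[OF sb] by measurable
      show "AE s in ?M. norm ((norm (b n s))\<^sup>2) \<le> norm (indicator {0<..real n} s *\<^sub>R B\<^sup>2)"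
        using B by (intro AE_I2) (auto simp: b_def indicator_def power_mono)
    qed
    ultimately show ?thesis by (simp add: Lp_two_iff)
  qed
  have ib: "inner (b n s) (adj x' s) = (norm (b n s))\<^sup>2" for n s by (simp add: b_def power2_norm_eq_inner)
  have bound: "(\<integral>s. (norm (b n s))\<^sup>2 \<partial>?M) \<le> (norm x' * K)\<^sup>2" for n
  proof -
    define I where "I = (\<integral>s. (norm (b n s))\<^sup>2 \<partial>?M)"
    have I0: "0 \<le> I" by (simp add: I_def)
    have "x' (conv_op S i {0<..} (b n)) = I"
      unfolding I_def using bL[of n] by (subst functional_conv_op) (auto simp: ib Lp_two_iff)
    then have "I \<le> norm x' * norm (conv_op S i {0<..} (b n))"
      using norm_blinfun[of x' "conv_op S i {0<..} (b n)"] by simp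
    also have "\<dots> \<le> norm x' * (K * Lp_norm 2 ?M (b n))" by (intro mult_left_mono K bL) auto
    also have "Lp_norm 2 ?M (b n) = sqrt I" by (simp add: Lp_norm_def I_def powr_half_sqrt)
    finally have "I \<le> norm x' * K * sqrt I" by (simp add: mult.assoc)
    then have "sqrt I * sqrt I \<le> (norm x' * K) * sqrt I" using I0 by simp
    also have "\<dots> \<le> \<bar>norm x' * K\<bar> * sqrt I" using I0 by (intro mult_right_mono) auto
    finally have le: "sqrt I * sqrt I \<le> \<bar>norm x' * K\<bar> * sqrt I" .
    have "sqrt I \<le> \<bar>norm x' * K\<bar>"
    proof (cases "I = 0")
      case False
      then have "0 < sqrt I" using I0 by simp
      with le show ?thesis by (rule mult_right_le_imp_le)
    qed simp
    then have "(sqrt I)\<^sup>2 \<le> \<bar>norm x' * K\<bar>\<^sup>2" by (intro power_mono) (simp_all add: I0)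
    then show ?thesis using I0 by (simp add: I_def)
  qed
  have "(\<integral>\<^sup>+s. ennreal ((norm (adj x' s))\<^sup>2) \<partial>?M) = (\<integral>\<^sup>+s. (SUP n. ennreal ((norm (b n s))\<^sup>2)) \<partial>?M)"
  proof (rule nn_integral_cong)
    fix s assume "s \<in> space ?M"
    then have s: "0 < s" by (simp add: space_restrict_space)
    obtain m where m: "s \<le> real m" using real_arch_simple by blast
    show "ennreal ((norm (adj x' s))\<^sup>2) = (SUP n. ennreal ((norm (b n s))\<^sup>2))"
    proof (rule antisym)
      have "ennreal ((norm (adj x' s))\<^sup>2) = ennreal ((norm (b m s))\<^sup>2)" using s m by (simp add: b_def)
      also have "\<dots> \<le> (SUP n. ennreal ((norm (b n s))\<^sup>2))" by (rule SUP_upper) simp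
      finally show "ennreal ((norm (adj x' s))\<^sup>2) \<le> (SUP n. ennreal ((norm (b n s))\<^sup>2))" .
      show "(SUP n. ennreal ((norm (b n s))\<^sup>2)) \<le> ennreal ((norm (adj x' s))\<^sup>2)"
        by (rule SUP_least) (auto simp: b_def)
    qed
  qed
  also have "\<dots> = (SUP n. \<integral>\<^sup>+s. ennreal ((norm (b n s))\<^sup>2) \<partial>?M)"
  proof (rule nn_integral_monotone_convergence_SUP)
    show "incseq (\<lambda>n s. ennreal ((norm (b n s))\<^sup>2))"
      by (auto simp: incseq_def le_fun_def b_def)
    show "(\<lambda>s. ennreal ((norm (b n s))\<^sup>2)) \<in> borel_measurable ?M" for n
      using bL[of n] by (auto simp: Lp_two_iff dest: borel_measurable_integrable)
  qed
  also have "\<dots> \<le> ennreal ((norm x' * K)\<^sup>2)"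
  proof (rule SUP_least)
    fix n
    have "(\<integral>\<^sup>+s. ennreal ((norm (b n s))\<^sup>2) \<partial>?M) = ennreal (\<integral>s. (norm (b n s))\<^sup>2 \<partial>?M)"
      using bL[of n] by (intro nn_integral_eq_integral) (auto simp: Lp_two_iff)
    also have "\<dots> \<le> ennreal ((norm x' * K)\<^sup>2)" by (intro ennreal_leI bound)
    finally show "(\<integral>\<^sup>+s. ennreal ((norm (b n s))\<^sup>2) \<partial>?M) \<le> ennreal ((norm x' * K)\<^sup>2)" .
  qed
  also have "\<dots> < \<infinity>" by simp
  finally have "integrable ?M (\<lambda>s. (norm (adj x' s))\<^sup>2)"
    by (intro integrableI_bounded) auto
  then show ?thesis using sm by (simp add: Lp_two_iff)
qed

lemma adj_in_L2:
  assumes J: "J \<in> sets borel" "J \<subseteq> {0<..}"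
  shows "adj x' \<in> Lp 2 (restrict_space lborel J)"
proof -
  have "strongly_measurable (restrict_space lborel J) (adj x')"
    using J by (intro strongly_measurable_adj) auto
  moreover have "set_integrable lborel {0<..} (\<lambda>s. (norm (adj x' s))\<^sup>2)"
    using adj_in_L2_infty[of x'] by (simp add: Lp_two_iff integrable_restrict_space set_integrable_def)
  then have "set_integrable lborel J (\<lambda>s. (norm (adj x' s))\<^sup>2)"
    by (rule set_integrable_subset) (use J in auto)
  ultimately show ?thesis
    using J by (simp add: Lp_two_iff integrable_restrict_space set_integrable_def)
qed

lemma is_L2_adjoint_adj:
  assumes J: "J \<in> sets borel" "J \<subseteq> {0<..}"
  shows "is_L2_adjoint (restrict_space lborel J) (conv_op S i J) x' (adj x')"
  unfolding is_L2_adjoint_def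
proof (intro conjI ballI)
  let ?M = "restrict_space lborel {0<..} :: real measure"
  let ?MJ = "restrict_space lborel J :: real measure"
  show "adj x' \<in> Lp 2 ?MJ" by (rule adj_in_L2[OF J])
  fix f :: "real \<Rightarrow> 'h" assume f: "f \<in> Lp 2 ?MJ"
  \<comment> \<open>Extension by zero turns the operator over \<open>J\<close> into the one over (0,
    \<infinity>), for which the functional formula is known.\<close>
  define f0 where "f0 s = (if s \<in> J then f s else 0)" for s
  have ind: "indicator {0<..} s *\<^sub>R g (f0 s) = indicator J s *\<^sub>R g (f s)" if "g 0 = 0" for g :: "'h \<Rightarrow> real" and s
    using J(2) that by (auto simp: f0_def indicator_def)
  have f0: "f0 \<in> Lp 2 ?M"
  proof -
    have "strongly_measurable ?M f0"
      unfolding f0_def using f J by (intro strongly_measurable_If) (auto simp: Lp_two_iff)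
    moreover have "integrable ?M (\<lambda>s. (norm (f0 s))\<^sup>2)"
      using f J ind[of "\<lambda>h. (norm h)\<^sup>2"] by (simp add: Lp_two_iff integrable_restrict_space)
    ultimately show ?thesis by (simp add: Lp_two_iff)
  qed
  have "conv_op S i J f = integral {0<..} (\<lambda>s. if s \<in> J then S s (i (f s)) else 0)"
    unfolding conv_op_def using J(2) by (simp add: integral_restrict_Int inf_absorb1)
  also have "\<dots> = conv_op S i {0<..} f0"
    unfolding conv_op_def by (intro arg_cong[where f = "integral {0<..}"]) (auto simp: f0_def blinfun.zero_right)
  finally have conv: "conv_op S i J f = conv_op S i {0<..} f0" .
  have "x' (conv_op S i J f) = (\<integral>s. inner (f0 s) (adj x' s) \<partial>?M)"
    unfolding conv by (rule functional_conv_op[OF f0 integrable_inner_L2[OF f0 adj_in_L2_infty]])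
  also have "\<dots> = (\<integral>s. indicator {0<..} s *\<^sub>R inner (f0 s) (adj x' s) \<partial>lborel)"
    by (simp add: integral_restrict_space)
  also have "\<dots> = (\<integral>s. indicator J s *\<^sub>R inner (f s) (adj x' s) \<partial>lborel)"
    using J(2) by (intro Bochner_Integration.integral_cong) (auto simp: f0_def indicator_def)
  also have "\<dots> = (\<integral>s. inner (f s) (adj x' s) \<partial>?MJ)"
    using J by (simp add: integral_restrict_space)
  finally show "x' (conv_op S i J f) = (\<integral>s. inner (f s) (adj x' s) \<partial>?MJ)" .
qed

text \<open>The representative \<open>g\<close> picked by \<open>SOME\<close> need not be
  \<open>adj x'\<close>. It enters only through its pairing with \<open>adj y'\<close>, and there
  every representative of the adjoint gives the same value.\<close>

lemma L2_TTstar_covf: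
  fixes x' y' :: "'e \<Rightarrow>\<^sub>L real"
  assumes J: "J \<in> sets borel" "J \<subseteq> {0<..}"
  shows "y' (L2_TTstar (restrict_space lborel J) (conv_op S i J) x') = covf J x' y'"
proof -
  let ?M = "restrict_space lborel J :: real measure"
  define g where "g = (SOME g. is_L2_adjoint ?M (conv_op S i J) x' g)"
  have g: "is_L2_adjoint ?M (conv_op S i J) x' g"
    unfolding g_def by (rule someI[where P = "is_L2_adjoint ?M (conv_op S i J) x'"]) (rule is_L2_adjoint_adj[OF J])
  have adjD: "z' (conv_op S i J f) = (\<integral>s. inner (f s) (h s) \<partial>?M)"
    if "is_L2_adjoint ?M (conv_op S i J) z' h" "f \<in> Lp 2 ?M" for z' h f
    using bspec[OF conjunct2[OF that(1)[unfolded is_L2_adjoint_def]] that(2)] .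
  have gL: "g \<in> Lp 2 ?M" using g unfolding is_L2_adjoint_def by (rule conjunct1)
  have "y' (L2_TTstar ?M (conv_op S i J) x') = (\<integral>s. inner (g s) (adj y' s) \<partial>?M)"
    unfolding L2_TTstar_def g_def[symmetric] by (rule adjD[OF is_L2_adjoint_adj[OF J] gL])
  also have "\<dots> = (\<integral>s. inner (adj y' s) (g s) \<partial>?M)" by (simp add: inner_commute)
  also have "\<dots> = x' (conv_op S i J (adj y'))"
    by (rule adjD[OF g adj_in_L2[OF J], symmetric])
  also have "\<dots> = (\<integral>s. inner (adj y' s) (adj x' s) \<partial>?M)"
    by (rule adjD[OF is_L2_adjoint_adj[OF J] adj_in_L2[OF J]])
  also have "\<dots> = covf J x' y'" by (simp add: covf_def inner_commute)
  finally show ?thesis .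
qed

lemma covf_commute: "covf J x' y' = covf J y' x'"
  by (simp add: covf_def inner_commute)

lemma integrable_covf:
  assumes "J \<in> sets borel" "J \<subseteq> {0<..}"
  shows "integrable (restrict_space lborel J) (\<lambda>s. inner (adj x' s) (adj y' s))"
  by (intro integrable_inner_L2 adj_in_L2 assms)

lemma covf_add_left:
  assumes "J \<in> sets borel" "J \<subseteq> {0<..}"
  shows "covf J (x' + z') y' = covf J x' y' + covf J z' y'"
  by (simp add: covf_def adj_add inner_add_left integrable_covf[OF assms])

lemma covf_scaleR_left: "covf J (c *\<^sub>R x') y' = c * covf J x' y'"
  by (simp add: covf_def adj_scaleR)

lemma covf_nonneg: "0 \<le> covf J x' x'"
  by (simp add: covf_def)

text \<open>Supplies the domination through which \<open>mu_t\<close> inherits its existence from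
  \<open>mu_infty\<close>.\<close>

lemma covf_le_infty:
  assumes J: "J \<in> sets borel" "J \<subseteq> {0<..}"
  shows "covf J x' x' \<le> covf {0<..} x' x'"
proof -
  have "set_lebesgue_integral lborel J (\<lambda>s. inner (adj x' s) (adj x' s))
      \<le> set_lebesgue_integral lborel {0<..} (\<lambda>s. inner (adj x' s) (adj x' s))"
    unfolding set_lebesgue_integral_def
  proof (rule integral_mono)
    show "integrable lborel (\<lambda>s. indicator J s *\<^sub>R inner (adj x' s) (adj x' s))"
      using integrable_covf[OF J, of x' x'] J by (simp add: integrable_restrict_space)
    show "integrable lborel (\<lambda>s. indicator {0<..} s *\<^sub>R inner (adj x' s) (adj x' s))"
      using integrable_covf[of "{0<..}" x' x'] by (simp add: integrable_restrict_space)
    show "indicator J s *\<^sub>R inner (adj x' s) (adj x' s) \<le> indicator {0<..} s *\<^sub>R inner (adj x' s) (adj x' s)" for s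
      using J by (intro scaleR_right_mono) (auto simp: indicator_def)
  qed
  then show ?thesis using J by (simp add: covf_def integral_restrict_space set_lebesgue_integral_def)
qed

text \<open>The part over (t, \<infinity>) is shifted back to (0, \<infinity>). In operator form
  this reads Q_infty = Q_t + S(t) Q_infty S(t)^*, the identity behind the invariance of
  \<open>mu_infty\<close>.\<close>

lemma covf_split:
  assumes t: "0 < t"
  shows "covf {0<..} x' y' = covf {0<..<t} x' y' + covf {0<..} (x' o\<^sub>L S t) (y' o\<^sub>L S t)"
proof -
  define F where "F s = inner (adj x' s) (adj y' s)" for s
  have cov: "covf J x' y' = (\<integral>s. indicator J s *\<^sub>R F s \<partial>lborel)" if "J \<in> sets borel" for J
    using that by (simp add: covf_def F_def integral_restrict_space)
  have int: "integrable lborel (\<lambda>s. indicator J s *\<^sub>R F s)" if "J \<in> sets borel" "J \<subseteq> {0<..}" for J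
    using integrable_covf[OF that, of x' y'] that by (simp add: F_def integrable_restrict_space)
  have "covf {0<..} x' y' = (\<integral>s. indicator {0<..<t} s *\<^sub>R F s + indicator {t<..} s *\<^sub>R F s \<partial>lborel)"
  proof (subst cov)
    have "AE s in lborel. s \<noteq> t" by (rule AE_lborel_singleton)
    then have ae: "AE s in lborel. indicator {0<..} s *\<^sub>R F s = indicator {0<..<t} s *\<^sub>R F s + indicator {t<..} s *\<^sub>R F s"
      by eventually_elim (use t in \<open>auto simp: indicator_def\<close>)
    show "(\<integral>s. indicator {0<..} s *\<^sub>R F s \<partial>lborel)
        = (\<integral>s. indicator {0<..<t} s *\<^sub>R F s + indicator {t<..} s *\<^sub>R F s \<partial>lborel)"
    proof (rule integral_cong_AE[OF _ _ ae])
      show "(\<lambda>s. indicator {0<..} s *\<^sub>R F s) \<in> borel_measurable lborel"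
        by (rule borel_measurable_integrable[OF int]) auto
      show "(\<lambda>s. indicator {0<..<t} s *\<^sub>R F s + indicator {t<..} s *\<^sub>R F s) \<in> borel_measurable lborel"
        using t by (intro borel_measurable_integrable Bochner_Integration.integrable_add int) auto
    qed
  qed simp
  also have "\<dots> = covf {0<..<t} x' y' + (\<integral>s. indicator {t<..} s *\<^sub>R F s \<partial>lborel)"
  proof -
    have 1: "integrable lborel (\<lambda>s. indicator {0<..<t} s *\<^sub>R F s)" by (rule int) auto
    have 2: "integrable lborel (\<lambda>s. indicator {t<..} s *\<^sub>R F s)" by (rule int) (use t in auto)
    show ?thesis unfolding Bochner_Integration.integral_add[OF 1 2] by (simp add: cov)
  qed
  also have "(\<integral>s. indicator {t<..} s *\<^sub>R F s \<partial>lborel)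
      = (\<integral>s. indicator {t<..} (t + 1 * s) *\<^sub>R F (t + 1 * s) \<partial>lborel)"
    by (subst lborel_integral_real_affine[where c = 1 and t = t]) simp_all
  also have "\<dots> = (\<integral>s. indicator {0<..} s *\<^sub>R inner (adj (x' o\<^sub>L S t) s) (adj (y' o\<^sub>L S t) s) \<partial>lborel)"
    using t by (intro Bochner_Integration.integral_cong refl) (auto simp: indicator_def F_def adj_shift)
  also have "\<dots> = covf {0<..} (x' o\<^sub>L S t) (y' o\<^sub>L S t)"
    by (simp add: covf_def integral_restrict_space)
  finally show ?thesis .
qed

text \<open>Since $S(t) i h = S(s) i\, S_H(t-s) h$ for every $s \in (0,t)$, the vector $S(t) i h$ lies in the
  Cameron--Martin space of $\mu_t$, with norm at most $\kappa(t) \|h\| / \sqrt t$.\<close>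

lemma covf_dominates:
  fixes x' :: "'e \<Rightarrow>\<^sub>L real"
  assumes t: "0 < t" and K: "\<And>s. 0 \<le> s \<Longrightarrow> s \<le> t \<Longrightarrow> norm (S\<^sub>H s) \<le> K"
  shows "t * (x' (S t (i h)))\<^sup>2 \<le> (K * norm h)\<^sup>2 * covf {0<..<t} x' x'"
proof -
  let ?M = "restrict_space lborel {0<..<t} :: real measure"
  have mt: "measure ?M (space ?M) = t" "emeasure ?M (space ?M) \<noteq> \<infinity>"
    using t by (simp_all add: measure_restrict_space emeasure_restrict_space space_restrict_space)
  \<comment> \<open>The constant is integrated over an interval of length \<open>t\<close>, and each
    \<open>s\<close> provides its own Cauchy-Schwarz bound. Instead of an explicit preimage g of
    S(t) i h, this produces an inequality against the variance, the dual description of the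
    Cameron-Martin norm.\<close>
  have "t * (x' (S t (i h)))\<^sup>2 = (\<integral>s. (x' (S t (i h)))\<^sup>2 \<partial>?M)"
    using mt by simp
  also have "\<dots> \<le> (\<integral>s. (K * norm h)\<^sup>2 * inner (adj x' s) (adj x' s) \<partial>?M)"
  proof (rule integral_mono)
    show "integrable ?M (\<lambda>s. (x' (S t (i h)))\<^sup>2)" by (intro finite_measure.integrable_const finite_measureI mt(2))
    show "integrable ?M (\<lambda>s. (K * norm h)\<^sup>2 * inner (adj x' s) (adj x' s))"
      using t by (intro integrable_mult_right integrable_covf) auto
    fix s assume "s \<in> space ?M"
    then have s: "0 < s" "s < t" by (auto simp: space_restrict_space)
    have "S t (i h) = i (S\<^sub>H s (S\<^sub>H (t - s) h))"
      using S_H_add[of s "t - s"] s t by (simp add: S_i)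
    then have "x' (S t (i h)) = inner (S\<^sub>H (t - s) h) (adj x' s)" using s by (simp add: inner_adj_H)
    then have "\<bar>x' (S t (i h))\<bar> \<le> norm (S\<^sub>H (t - s) h) * norm (adj x' s)"
      by (simp add: Cauchy_Schwarz_ineq2)
    also have "\<dots> \<le> (norm (S\<^sub>H (t - s)) * norm h) * norm (adj x' s)"
      by (intro mult_right_mono norm_blinfun) auto
    also have "\<dots> \<le> (K * norm h) * norm (adj x' s)"
      using s by (intro mult_right_mono K) auto
    finally have "\<bar>x' (S t (i h))\<bar>\<^sup>2 \<le> ((K * norm h) * norm (adj x' s))\<^sup>2" by (rule power_mono) simp
    then show "(x' (S t (i h)))\<^sup>2 \<le> (K * norm h)\<^sup>2 * inner (adj x' s) (adj x' s)"
      by (simp add: power_mult_distrib power2_norm_eq_inner)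
  qed
  also have "\<dots> = (K * norm h)\<^sup>2 * covf {0<..<t} x' x'" by (simp add: covf_def)
  finally show ?thesis .
qed

end

section \<open>Gaussian Radon measures\<close>

lemma measurable_blinfun_real: "blinfun_apply (x' :: 'e::real_normed_vector \<Rightarrow>\<^sub>L real) \<in> borel_measurable borel"
  by (intro borel_measurable_continuous_onI continuous_intros)

lemma pair_char:
  fixes f :: "'a \<Rightarrow> real" and g :: "'b \<Rightarrow> real"
  assumes M: "prob_space M" and N: "prob_space N"
    and f[measurable]: "f \<in> borel_measurable M" and g[measurable]: "g \<in> borel_measurable N"
  shows "(CLINT z|M \<Otimes>\<^sub>M N. iexp (f (fst z) + g (snd z))) = (CLINT x|M. iexp (f x)) * (CLINT y|N. iexp (g y))"
proof -
  interpret M: prob_space M by fact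
  interpret N: prob_space N by fact
  interpret P: pair_prob_space M N ..
  have int: "integrable (M \<Otimes>\<^sub>M N) (\<lambda>(x, y). iexp (f x + g y))"
    by (rule P.integrable_const_bound[of _ 1]) (simp_all add: split_beta')
  have "(CLINT z|M \<Otimes>\<^sub>M N. iexp (f (fst z) + g (snd z))) = (CLINT x|M. CLINT y|N. iexp (f x + g y))"
    using P.integral_fst'[OF int] by (simp add: split_beta')
  also have "\<dots> = (CLINT x|M. iexp (f x) * (CLINT y|N. iexp (g y)))"
    by (simp only: iexp_add integral_mult_right_zero)
  also have "\<dots> = (CLINT x|M. iexp (f x)) * (CLINT y|N. iexp (g y))"
    by (rule integral_mult_left_zero)
  finally show ?thesis .
qed

lemma gaussian_radonD:
  fixes \<mu> :: "'e::real_normed_vector measure"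
  assumes "centred_gaussian_radon \<mu>"
  shows "sets \<mu> = sets borel" "prob_space \<mu>" "space \<mu> = UNIV"
    "B \<in> sets borel \<Longrightarrow> emeasure \<mu> B = (SUP K\<in>{K. K \<subseteq> B \<and> compact K}. emeasure \<mu> K)"
    "centred_gaussian_real (distr \<mu> borel (blinfun_apply x'))"
  using assms sets_eq_imp_space_eq[of \<mu> borel] unfolding centred_gaussian_radon_def by auto

lemma gaussian_radon_square_integrable:
  fixes \<mu> :: "'e::real_normed_vector measure" and x' :: "'e \<Rightarrow>\<^sub>L real"
  assumes "centred_gaussian_radon \<mu>"
  shows "integrable \<mu> (\<lambda>x. (x' x)\<^sup>2)"
    and "(CLINT x|\<mu>. iexp (x' x)) = exp (- (\<integral>x. (x' x)\<^sup>2 \<partial>\<mu>) / 2)"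
proof -
  note \<mu> = gaussian_radonD[OF assms]
  have [measurable]: "blinfun_apply x' \<in> borel_measurable \<mu>"
    using measurable_blinfun_real[of x'] by (simp add: measurable_cong_sets[OF \<mu>(1) refl])
  obtain v where "0 \<le> v" "real_distribution (distr \<mu> borel (blinfun_apply x'))"
    and v: "\<And>t. char (distr \<mu> borel (blinfun_apply x')) t = exp (- (v * t\<^sup>2) / 2)"
    "integrable (distr \<mu> borel (blinfun_apply x')) (\<lambda>x. x\<^sup>2)"
    "(\<integral>x. x\<^sup>2 \<partial>distr \<mu> borel (blinfun_apply x')) = v"
    using centred_gaussian_realE[OF \<mu>(5)[of x']] by blast
  show "integrable \<mu> (\<lambda>x. (x' x)\<^sup>2)"
    using v(2) by (subst (asm) integrable_distr_eq) auto
  have "(\<integral>x. (x' x)\<^sup>2 \<partial>\<mu>) = v"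
    using v(3) by (subst (asm) integral_distr) auto
  moreover have "(CLINT x|\<mu>. iexp (x' x)) = char (distr \<mu> borel (blinfun_apply x')) 1"
    unfolding char_def by (subst integral_distr) auto
  ultimately show "(CLINT x|\<mu>. iexp (x' x)) = exp (- (\<integral>x. (x' x)\<^sup>2 \<partial>\<mu>) / 2)"
    using v(1)[of 1] by simp
qed

text \<open>Polarisation, so that the variances alone determine the covariance.\<close>

lemma gaussian_radon_integrable_mult:
  fixes \<mu> :: "'e::real_normed_vector measure" and x' y' :: "'e \<Rightarrow>\<^sub>L real"
  assumes g: "centred_gaussian_radon \<mu>"
  shows "integrable \<mu> (\<lambda>x. x' x * y' x)"
    and "(\<integral>x. x' x * y' x \<partial>\<mu>) = ((\<integral>x. ((x' + y') x)\<^sup>2 \<partial>\<mu>) - (\<integral>x. (x' x)\<^sup>2 \<partial>\<mu>) - (\<integral>x. (y' x)\<^sup>2 \<partial>\<mu>)) / 2"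
proof -
  have eq: "x' x * y' x = (((x' + y') x)\<^sup>2 - (x' x)\<^sup>2 - (y' x)\<^sup>2) / 2" for x
    by (simp add: blinfun.add_left power2_eq_square algebra_simps)
  have i: "integrable \<mu> (\<lambda>x. ((x' + y') x)\<^sup>2)" "integrable \<mu> (\<lambda>x. (x' x)\<^sup>2)" "integrable \<mu> (\<lambda>x. (y' x)\<^sup>2)"
    by (rule gaussian_radon_square_integrable[OF g])+
  show "integrable \<mu> (\<lambda>x. x' x * y' x)"
    unfolding eq by (intro integrable_divide Bochner_Integration.integrable_diff i)
  show "(\<integral>x. x' x * y' x \<partial>\<mu>) = ((\<integral>x. ((x' + y') x)\<^sup>2 \<partial>\<mu>) - (\<integral>x. (x' x)\<^sup>2 \<partial>\<mu>) - (\<integral>x. (y' x)\<^sup>2 \<partial>\<mu>)) / 2"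
    unfolding eq integral_divide_zero Bochner_Integration.integral_diff[OF Bochner_Integration.integrable_diff[OF i(1,2)] i(3)]
      Bochner_Integration.integral_diff[OF i(1,2)] ..
qed

lemma functional_combination: "blinfun_apply (\<Sum>k<n. c k *\<^sub>R \<xi> k) x = (\<Sum>k<n. c k * blinfun_apply (\<xi> k) x)"
  by (simp add: blinfun.sum_left blinfun.scaleR_left)

section \<open>Reduction to \<sigma>-compact sets and countably many functionals\<close>

lemma compact_imp_separable:
  fixes K :: "'a::metric_space set"
  assumes "compact K"
  shows "\<exists>D. countable D \<and> K \<subseteq> closure D"
proof -
  have "\<forall>n. \<exists>k. finite k \<and> K \<subseteq> (\<Union>x\<in>k. ball x (1 / real (Suc n)))"
    using assms unfolding compact_eq_totally_bounded by simp
  then obtain k where k: "\<And>n. finite (k n)" "\<And>n. K \<subseteq> (\<Union>x\<in>k n. ball x (1 / real (Suc n)))" by metis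
  have "K \<subseteq> closure (\<Union>n. k n)"
  proof
    fix x assume x: "x \<in> K"
    show "x \<in> closure (\<Union>n. k n)"
      unfolding closure_approachable
    proof (intro allI impI)
      fix e :: real assume "0 < e"
      then obtain n where n: "1 / real (Suc n) < e" using nat_approx_posE by blast
      obtain y where "y \<in> k n" "dist y x < 1 / real (Suc n)" using k(2)[of n] x by auto
      then show "\<exists>y\<in>\<Union>n. k n. dist y x < e" using n by (meson UN_I UNIV_I order_less_trans)
    qed
  qed
  moreover have "countable (\<Union>n. k n)" using k(1) by (intro countable_UN) (auto intro: countable_finite)
  ultimately show ?thesis by blast
qed

text \<open>On a \<open>\<sigma>\<close>-compact set, countably many functionals separate points and approximate every functional
  pointwise. This replaces separability of \<open>E\<close>.\<close>

lemma sigma_compact_functionals: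
  fixes K :: "nat \<Rightarrow> 'e::real_normed_vector set"
  assumes K: "\<And>n. compact (K n)"
  shows "\<exists>\<xi> :: nat \<Rightarrow> 'e \<Rightarrow>\<^sub>L real. inj_on (\<lambda>x n. blinfun_apply (\<xi> n) x) (\<Union>n. K n) \<and>
    (\<forall>x' :: 'e \<Rightarrow>\<^sub>L real. norm x' \<le> 1 \<longrightarrow> (\<exists>r :: nat \<Rightarrow> nat. \<forall>x\<in>(\<Union>n. K n). \<forall>y\<in>(\<Union>n. K n).
       (\<lambda>j. blinfun_apply (\<xi> (r j)) (x - y)) \<longlonglongrightarrow> blinfun_apply x' (x - y)))"
proof -
  define X where "X = (\<Union>n. K n)"
  have "\<forall>n. \<exists>D. countable D \<and> K n \<subseteq> closure D" using compact_imp_separable[OF K] by blast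
  then obtain D where D: "\<And>n. countable (D n)" "\<And>n. K n \<subseteq> closure (D n)" by metis
  define DD where "DD = (\<Union>n. D n)"
  have cD: "countable DD" unfolding DD_def using D(1) by (intro countable_UN) auto
  have XD: "X \<subseteq> closure DD"
  proof
    fix x assume "x \<in> X"
    then obtain n where "x \<in> K n" unfolding X_def by blast
    then have "x \<in> closure (D n)" using D(2) by blast
    moreover have "closure (D n) \<subseteq> closure DD" by (rule closure_mono) (auto simp: DD_def)
    ultimately show "x \<in> closure DD" by blast
  qed
  define E where "E = (\<lambda>(a, b). a - b) ` (DD \<times> DD)"
  have cE: "countable E" unfolding E_def using cD by (intro countable_image countable_SIGMA) auto
  \<comment> \<open>Differences of points of \<open>X\<close>, since separating two points means not
    vanishing on their difference.\<close>
  define Z where "Z = (\<lambda>(a, b). a - b) ` (X \<times> X)"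
  have ZE: "Z \<subseteq> closure E"
  proof
    fix z assume "z \<in> Z"
    then obtain x y where xy: "x \<in> X" "y \<in> X" "z = x - y" unfolding Z_def by auto
    have "x \<in> closure DD" "y \<in> closure DD" using XD xy by auto
    obtain f where f: "\<And>n. f n \<in> DD" "f \<longlonglongrightarrow> x"
      using \<open>x \<in> closure DD\<close> unfolding closure_sequential by auto
    obtain g where g: "\<And>n. g n \<in> DD" "g \<longlonglongrightarrow> y"
      using \<open>y \<in> closure DD\<close> unfolding closure_sequential by auto
    show "z \<in> closure E" unfolding closure_sequential xy(3)
    proof (intro exI conjI allI)
      show "(\<lambda>n. f n - g n) \<longlonglongrightarrow> x - y" by (intro tendsto_intros f g)
      show "f n - g n \<in> E" for n unfolding E_def using f(1) g(1) by (intro image_eqI[of _ _ "(f n, g n)"]) auto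
    qed
  qed
  obtain \<xi> :: "nat \<Rightarrow> 'e \<Rightarrow>\<^sub>L real" where
    \<xi>: "\<forall>x' :: 'e \<Rightarrow>\<^sub>L real. norm x' \<le> 1 \<longrightarrow>
        (\<exists>r :: nat \<Rightarrow> nat. \<forall>z\<in>Z. (\<lambda>j. blinfun_apply (\<xi> (r j)) z) \<longlonglongrightarrow> blinfun_apply x' z)"
    using countable_pointwise_dense_functionals[OF cE ZE] by (elim exE conjE) (rule that)
  have Z: "x - y \<in> Z" if "x \<in> X" "y \<in> X" for x y
    unfolding Z_def using that by (intro image_eqI[of _ _ "(x, y)"]) auto
  show ?thesis unfolding X_def[symmetric]
  proof (intro exI[of _ \<xi>] conjI allI impI)
    show "inj_on (\<lambda>x n. blinfun_apply (\<xi> n) x) X"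
    proof (rule inj_onI)
      fix x y assume xy: "x \<in> X" "y \<in> X" and eq: "(\<lambda>n. blinfun_apply (\<xi> n) x) = (\<lambda>n. blinfun_apply (\<xi> n) y)"
      have zero: "blinfun_apply (\<xi> n) (x - y) = 0" for n using fun_cong[OF eq, of n] by (simp add: blinfun.diff_right)
      \<comment> \<open>A functional norming x - y is on \<open>Z\<close> a pointwise limit of
        functionals among the \<xi> n; as all of these vanish at x - y, so does its norm.\<close>
      obtain f :: "'e \<Rightarrow>\<^sub>L real" where f: "norm f \<le> 1" "f (x - y) = norm (x - y)"
        by (rule hahn_banach_norming)
      obtain r where "\<forall>z\<in>Z. (\<lambda>j. blinfun_apply (\<xi> (r j)) z) \<longlonglongrightarrow> blinfun_apply f z" using \<xi> f(1) by blast
      then have "(\<lambda>j. blinfun_apply (\<xi> (r j)) (x - y)) \<longlonglongrightarrow> blinfun_apply f (x - y)" using Z[OF xy] by blast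
      then have "(\<lambda>j. 0::real) \<longlonglongrightarrow> norm (x - y)" unfolding zero f(2) .
      then have "norm (x - y) = 0" unfolding LIMSEQ_const_iff by simp
      then show "x = y" by simp
    qed
    fix x' :: "'e \<Rightarrow>\<^sub>L real" assume "norm x' \<le> 1"
    with \<xi> obtain r where "\<forall>z\<in>Z. (\<lambda>j. blinfun_apply (\<xi> (r j)) z) \<longlonglongrightarrow> blinfun_apply x' z" by blast
    then show "\<exists>r :: nat \<Rightarrow> nat. \<forall>x\<in>X. \<forall>y\<in>X.
       (\<lambda>j. blinfun_apply (\<xi> (r j)) (x - y)) \<longlonglongrightarrow> blinfun_apply x' (x - y)"
      using Z by blast
  qed
qed

text \<open>For closed sets the image is a countable union of compact sets. The sets with Borel
  image form a \<sigma>-algebra; injectivity on the union of the \<open>K n\<close> is what makes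
  complements work.\<close>

lemma borel_image_sigma_compact:
  fixes J :: "'a::metric_space \<Rightarrow> 'b::metric_space"
  assumes K: "\<And>n::nat. compact (K n)" and J: "continuous_on UNIV J" and inj: "inj_on J (\<Union>n. K n)"
    and B: "B \<in> sets borel"
  shows "J ` (B \<inter> (\<Union>n. K n)) \<in> sets borel"
proof -
  define X where "X = (\<Union>n. K n)"
  have closed: "J ` (C \<inter> X) \<in> sets borel" if C: "closed C" for C
  proof -
    have "J ` (C \<inter> X) = (\<Union>n. J ` (C \<inter> K n))" unfolding X_def by blast
    also have "\<dots> \<in> sets borel"
    proof (intro sets.countable_UN image_subsetI)
      fix n
      have "compact (C \<inter> K n)" by (rule closed_Int_compact[OF C K])
      then have "compact (J ` (C \<inter> K n))"
        by (intro compact_continuous_image continuous_on_subset[OF J]) auto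
      then show "J ` (C \<inter> K n) \<in> sets borel" by (rule borel_compact)
    qed
    finally show ?thesis .
  qed
  have "B \<in> sigma_sets UNIV (Collect closed)" using B by (simp add: borel_eq_closed)
  then have "J ` (B \<inter> X) \<in> sets borel"
  proof (induction rule: sigma_sets.induct)
    case (Basic a) then show ?case using closed by blast
  next
    case Empty then show ?case by simp
  next
    case (Compl a)
    have "J ` ((UNIV - a) \<inter> X) = J ` (UNIV \<inter> X) - J ` (a \<inter> X)"
      using inj unfolding X_def[symmetric] inj_on_def by blast
    moreover have "J ` (UNIV \<inter> X) \<in> sets borel" by (rule closed) simp
    ultimately show ?case using Compl.IH by (simp only: sets.Diff)
  next
    case (Union a)
    have "J ` ((\<Union>n. a n) \<inter> X) = (\<Union>n. J ` (a n \<inter> X))" by blast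
    then show ?case using Union.IH by (simp only:) (intro sets.countable_UN image_subsetI, simp)
  qed
  then show ?thesis unfolding X_def .
qed

text \<open>Inner regularity of the whole space. The explicit masses are recorded because the
  tightness argument for dominated covariances compares them.\<close>

lemma radon_compact_exhaustion:
  assumes \<mu>: "centred_gaussian_radon \<mu>"
  obtains K where "\<And>n::nat. compact (K n)" "\<And>n. 1 - 1 / real (Suc n) < measure \<mu> (K n)"
    "AE x in \<mu>. x \<in> (\<Union>n. K n)"
proof -
  note \<mu>D = gaussian_radonD[OF \<mu>]
  interpret prob_space \<mu> by (rule \<mu>D)
  have "\<exists>K. compact K \<and> 1 - 1 / real (Suc n) < measure \<mu> K" for n
  proof -
    have "ennreal (1 - 1 / real (Suc n)) < 1" using ennreal_lessI[of 1 "1 - 1 / real (Suc n)"] by simp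
    also have "1 = emeasure \<mu> UNIV" using emeasure_space_1 \<mu>D(3) by simp
    also have "\<dots> = (SUP K\<in>{K. K \<subseteq> UNIV \<and> compact K}. emeasure \<mu> K)" by (rule \<mu>D(4)) simp
    finally obtain K where "compact K" "ennreal (1 - 1 / real (Suc n)) < emeasure \<mu> K"
      unfolding less_SUP_iff by blast
    then show ?thesis unfolding emeasure_eq_measure by (subst (asm) ennreal_less_iff) auto
  qed
  then obtain K where K: "\<And>n. compact (K n)" "\<And>n. 1 - 1 / real (Suc n) < measure \<mu> (K n)" by metis
  have KS: "K n \<in> sets \<mu>" for n unfolding \<mu>D(1) by (rule borel_compact[OF K(1)])
  then have US: "(\<Union>n. K n) \<in> sets \<mu>" by blast
  have "1 \<le> measure \<mu> (\<Union>n. K n)"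
  proof (rule LIMSEQ_le_const2)
    have "(\<lambda>n. 1 - 1 / real (Suc n)) \<longlonglongrightarrow> 1 - 0" by (intro tendsto_intros LIMSEQ_Suc[OF lim_1_over_n])
    then show "(\<lambda>n. 1 - 1 / real (Suc n)) \<longlonglongrightarrow> 1" by simp
    have "1 - 1 / real (Suc n) \<le> measure \<mu> (\<Union>n. K n)" for n
      using K(2)[of n] finite_measure_mono[OF _ US, of "K n"] by fastforce
    then show "\<exists>N. \<forall>n\<ge>N. 1 - 1 / real (Suc n) \<le> measure \<mu> (\<Union>n. K n)" by blast
  qed
  then have "measure \<mu> (\<Union>n. K n) = 1" using prob_le_1 antisym by blast
  then have "AE x in \<mu>. x \<in> (\<Union>n. K n)" by (subst (asm) prob_eq_1[OF US])
  with K that show thesis by blast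
qed

lemma gaussian_sequence_char:
  fixes \<xi> :: "nat \<Rightarrow> 'e::real_normed_vector \<Rightarrow>\<^sub>L real"
  assumes \<mu>: "centred_gaussian_radon \<mu>"
  shows "(CLINT x|\<mu>. iexp (\<Sum>k<n. c k * \<xi> k x)) = exp (- (\<integral>x. (blinfun_apply (\<Sum>k<n. c k *\<^sub>R \<xi> k) x)\<^sup>2 \<partial>\<mu>) / 2)"
  using gaussian_radon_square_integrable(2)[OF \<mu>, of "\<Sum>k<n. c k *\<^sub>R \<xi> k"] unfolding functional_combination .

text \<open>On a \<sigma>-compact set carrying both measures the coordinate map \<open>J\<close> is
  injective with Borel images, so each measure is recovered from the law of \<open>J\<close>. The
  characteristic functions of that law involve the variances only.\<close>

lemma gaussian_radon_unique:
  fixes \<mu> \<nu> :: "'e::real_normed_vector measure"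
  assumes \<mu>: "centred_gaussian_radon \<mu>" and \<nu>: "centred_gaussian_radon \<nu>"
    and var: "\<And>x' :: 'e \<Rightarrow>\<^sub>L real. (\<integral>x. (x' x)\<^sup>2 \<partial>\<mu>) = (\<integral>x. (x' x)\<^sup>2 \<partial>\<nu>)"
  shows "\<mu> = \<nu>"
proof -
  note \<mu>D = gaussian_radonD[OF \<mu>]
  note \<nu>D = gaussian_radonD[OF \<nu>]
  obtain K1 where K1: "\<And>n::nat. compact (K1 n)" "\<And>n. 1 - 1 / real (Suc n) < measure \<mu> (K1 n)"
    "AE x in \<mu>. x \<in> (\<Union>n. K1 n)"
    using radon_compact_exhaustion[OF \<mu>] by blast
  obtain K2 where K2: "\<And>n::nat. compact (K2 n)" "\<And>n. 1 - 1 / real (Suc n) < measure \<nu> (K2 n)"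
    "AE x in \<nu>. x \<in> (\<Union>n. K2 n)"
    using radon_compact_exhaustion[OF \<nu>] by blast
  define K where "K n = K1 n \<union> K2 n" for n
  define X where "X = (\<Union>n. K n)"
  have K: "compact (K n)" for n unfolding K_def by (intro compact_Un K1 K2)
  have X1: "AE x in \<mu>. x \<in> X" using K1(3) by eventually_elim (auto simp: X_def K_def)
  have X2: "AE x in \<nu>. x \<in> X" using K2(3) by eventually_elim (auto simp: X_def K_def)
  obtain \<xi> :: "nat \<Rightarrow> 'e \<Rightarrow>\<^sub>L real" where inj: "inj_on (\<lambda>x n. blinfun_apply (\<xi> n) x) X"
    using sigma_compact_functionals[of K, OF K] unfolding X_def[symmetric] by blast
  define J where "J x = (\<lambda>n. blinfun_apply (\<xi> n) x)" for x
  have Jc: "continuous_on UNIV J"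
    unfolding J_def by (intro continuous_on_coordinatewise_then_product continuous_intros)
  have J: "J \<in> borel_measurable borel" by (rule borel_measurable_continuous_onI[OF Jc])
  have J1: "J \<in> borel_measurable \<mu>" and J2: "J \<in> borel_measurable \<nu>"
    using J \<mu>D(1) \<nu>D(1) by (simp_all cong: measurable_cong_sets)
  have law: "distr \<mu> borel J = distr \<nu> borel J"
  proof (rule sequence_law_distr_eqI[OF \<mu>D(2) \<nu>D(2) J1 J2])
    show "(CLINT x|\<mu>. iexp (\<Sum>k<n. c k * J x k)) = (CLINT x|\<nu>. iexp (\<Sum>k<n. c k * J x k))" for n c
      unfolding J_def gaussian_sequence_char[OF \<mu>] gaussian_sequence_char[OF \<nu>] var ..
  qed
  show ?thesis
  proof (rule measure_eqI)
    show "sets \<mu> = sets \<nu>" using \<mu>D \<nu>D by simp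
    fix B assume "B \<in> sets \<mu>"
    then have B: "B \<in> sets borel" using \<mu>D by simp
    have JB: "J ` (B \<inter> X) \<in> sets borel"
      unfolding X_def
      by (rule borel_image_sigma_compact[OF K Jc _ B]) (use inj in \<open>simp add: J_def[abs_def] X_def\<close>)
    have pull: "emeasure m B = emeasure (distr m borel J) (J ` (B \<inter> X))"
      if m: "sets m = sets borel" "AE x in m. x \<in> X" "J \<in> borel_measurable m" for m
    proof -
      have "AE x in m. x \<in> B \<longleftrightarrow> x \<in> J -` (J ` (B \<inter> X)) \<inter> space m"
      proof (use m(2) in eventually_elim)
        fix x assume x: "x \<in> X"
        have "J x \<in> J ` (B \<inter> X) \<longleftrightarrow> x \<in> B"
          using inj x unfolding J_def[abs_def, symmetric] inj_on_def by blast
        then show "x \<in> B \<longleftrightarrow> x \<in> J -` (J ` (B \<inter> X)) \<inter> space m"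
          using sets_eq_imp_space_eq[OF m(1)] by simp
      qed
      then have "emeasure m B = emeasure m (J -` (J ` (B \<inter> X)) \<inter> space m)"
        using B m JB by (intro emeasure_eq_AE measurable_sets[OF m(3)]) auto
      then show ?thesis using JB m(3) by (simp add: emeasure_distr)
    qed
    show "emeasure \<mu> B = emeasure \<nu> B"
      using pull[OF \<mu>D(1) X1 J1] pull[OF \<nu>D(1) X2 J2] law by simp
  qed
qed

section \<open>Domination of Gaussian Radon measures\<close>

lemma bilinear_form_sum:
  fixes q :: "'v::real_vector \<Rightarrow> 'v \<Rightarrow> real"
  assumes add: "\<And>x y z. q (x + y) z = q x z + q y z" and scale: "\<And>c x z. q (c *\<^sub>R x) z = c * q x z"
    and comm: "\<And>x y. q x y = q y x"
  shows "q (\<Sum>k<n. c k *\<^sub>R \<xi> k) (\<Sum>k<n. c k *\<^sub>R \<xi> k) = (\<Sum>j<n. \<Sum>k<(n::nat). c j * c k * q (\<xi> j) (\<xi> k))"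
proof -
  have z0: "q 0 z = 0" for z using scale[of 0 0 z] by simp
  have left: "q (\<Sum>k<n. c k *\<^sub>R \<xi> k) z = (\<Sum>k<n. c k * q (\<xi> k) z)" for z
    by (induction n) (simp_all add: z0 add scale)
  have "q (\<xi> j) (\<Sum>k<n. c k *\<^sub>R \<xi> k) = (\<Sum>k<n. c k * q (\<xi> j) (\<xi> k))" for j
    using left[of "\<xi> j"] by (simp add: comm[of "\<xi> j"])
  then show ?thesis unfolding left by (simp add: sum_distrib_left mult.assoc)
qed

lemma bilinear_form_psd:
  fixes q :: "'v::real_vector \<Rightarrow> 'v \<Rightarrow> real"
  assumes "\<And>x y z. q (x + y) z = q x z + q y z" "\<And>c x z. q (c *\<^sub>R x) z = c * q x z"
    "\<And>x y. q x y = q y x" "\<And>x. 0 \<le> q x x"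
  shows "psd (\<lambda>j k. q (\<xi> j) (\<xi> k))"
  unfolding psd_def bilinear_form_sum[of q, OF assms(1-3), symmetric] using assms(3,4) by blast

lemma bilinear_form_Cauchy_Schwarz:
  fixes q :: "'v::real_vector \<Rightarrow> 'v \<Rightarrow> real"
  assumes add: "\<And>x y z. q (x + y) z = q x z + q y z" and scale: "\<And>c x z. q (c *\<^sub>R x) z = c * q x z"
    and comm: "\<And>x y. q x y = q y x" and nonneg: "\<And>x. 0 \<le> q x x"
  shows "(q x y)\<^sup>2 \<le> q x x * q y y"
proof -
  have expand: "q (x + t *\<^sub>R y) (x + t *\<^sub>R y) = q x x + 2 * t * q x y + t\<^sup>2 * q y y" for t
  proof -
    have "q (x + t *\<^sub>R y) (x + t *\<^sub>R y) = q x (x + t *\<^sub>R y) + t * q y (x + t *\<^sub>R y)" by (simp only: add scale)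
    also have "\<dots> = q (x + t *\<^sub>R y) x + t * q (x + t *\<^sub>R y) y" by (simp only: comm)
    also have "\<dots> = q x x + t * q y x + t * (q x y + t * q y y)" by (simp only: add scale)
    finally show ?thesis by (simp add: comm[of y x] power2_eq_square algebra_simps)
  qed
  have pos: "0 \<le> q x x + 2 * t * q x y + t\<^sup>2 * q y y" for t using nonneg[of "x + t *\<^sub>R y"] unfolding expand .
  show ?thesis
  proof (cases "q y y = 0")
    case True
    have "q x y = 0"
    proof (rule ccontr)
      assume "q x y \<noteq> 0"
      with pos[of "- (q x x + 1) / (2 * q x y)"] True show False by (simp add: field_simps)
    qed
    then show ?thesis using True by simp
  next
    case False
    then have "0 < q y y" using nonneg[of y] by simp
    moreover have "0 \<le> q x x - (q x y)\<^sup>2 / q y y"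
      using pos[of "- q x y / q y y"] False by (simp add: power2_eq_square field_simps)
    ultimately show ?thesis by (simp add: field_simps)
  qed
qed

text \<open>For centred Gaussian laws the characteristic function at the single point 1 already
  determines the variance, through the logarithm.\<close>

lemma tendsto_char_imp_variance:
  fixes v :: "nat \<Rightarrow> real"
  assumes "(\<lambda>j. complex_of_real (exp (- v j / 2))) \<longlonglongrightarrow> 1"
  shows "v \<longlonglongrightarrow> 0"
proof -
  have "(\<lambda>j. exp (- v j / 2)) \<longlonglongrightarrow> 1"
    using tendsto_Re[OF assms] by simp
  then have "(\<lambda>j. - 2 * ln (exp (- v j / 2))) \<longlonglongrightarrow> - 2 * ln 1" by (intro tendsto_intros) auto
  then show ?thesis by simp
qed

text \<open>If the laws of \<open>Y\<^sub>1 + Y\<^sub>2\<close> and \<open>Y\<^sub>1 - Y\<^sub>2\<close> both charge the compact set \<open>K\<close> with mass close to one, then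
  \<open>Y\<^sub>1\<close> lies in the compact set \<open>(K + K) / 2\<close> with probability close to one. This yields tightness without
  Anderson's inequality.\<close>

lemma gaussian_radon_dominated:
  fixes \<mu> :: "'e::real_normed_vector measure" and q :: "('e \<Rightarrow>\<^sub>L real) \<Rightarrow> ('e \<Rightarrow>\<^sub>L real) \<Rightarrow> real"
  assumes \<mu>: "centred_gaussian_radon \<mu>"
    and add: "\<And>x y z. q (x + y) z = q x z + q y z" and scale: "\<And>c x z. q (c *\<^sub>R x) z = c * q x z"
    and comm: "\<And>x y. q x y = q y x" and nonneg: "\<And>x. 0 \<le> q x x"
    and dom: "\<And>x'. q x' x' \<le> (\<integral>x. (blinfun_apply x' x)\<^sup>2 \<partial>\<mu>)"
  shows "\<exists>\<nu>. centred_gaussian_radon \<nu> \<and> (\<forall>x' y'. (\<integral>x. blinfun_apply x' x * blinfun_apply y' x \<partial>\<nu>) = q x' y')"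
proof -
  note \<mu>D = gaussian_radonD[OF \<mu>]
  interpret \<mu>: prob_space \<mu> by (rule \<mu>D)
  define r where "r x' y' = (\<integral>x. blinfun_apply x' x * blinfun_apply y' x \<partial>\<mu>)" for x' y' :: "'e \<Rightarrow>\<^sub>L real"
  have rr: "r x' x' = (\<integral>x. (blinfun_apply x' x)\<^sup>2 \<partial>\<mu>)" for x' by (simp add: r_def power2_eq_square)
  have r_add: "r (x + y) z = r x z + r y z" for x y z
    unfolding r_def using gaussian_radon_integrable_mult(1)[OF \<mu>]
    by (simp add: blinfun.add_left distrib_right)
  have r_scale: "r (c *\<^sub>R x) z = c * r x z" for c x z
    unfolding r_def by (simp add: blinfun.scaleR_left mult.assoc)
  have r_comm: "r x y = r y x" for x y unfolding r_def by (simp add: mult.commute)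
  \<comment> \<open>The covariance left over. Independent \<open>Y1\<close> and \<open>Y2\<close>
    with forms \<open>q\<close> and \<open>q'\<close> make the sum and the difference both
    distributed like \<open>J\<close> under \<mu>.\<close>
  define q' where "q' x' y' = r x' y' - q x' y'" for x' y'
  have q'_add: "q' (x + y) z = q' x z + q' y z" for x y z by (simp add: q'_def r_add add)
  have q'_scale: "q' (c *\<^sub>R x) z = c * q' x z" for c x z by (simp add: q'_def r_scale scale algebra_simps)
  have q'_comm: "q' x y = q' y x" for x y by (simp add: q'_def r_comm[of x] comm[of x])
  have q'_nonneg: "0 \<le> q' x x" for x using dom[of x] by (simp add: q'_def rr)
  obtain K0 where K0: "\<And>n::nat. compact (K0 n)" "\<And>n. 1 - 1 / real (Suc n) < measure \<mu> (K0 n)"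
    "AE x in \<mu>. x \<in> (\<Union>n. K0 n)"
    using radon_compact_exhaustion[OF \<mu>] by blast
  \<comment> \<open>Adding 0 puts it into \<open>X\<close>, where it serves as default value of the
    inverse \<open>g\<close> and as the second point in the approximation property of the \<xi>
    n.\<close>
  define K where "K n = insert 0 (K0 n)" for n
  have K: "compact (K n)" for n unfolding K_def by (intro compact_insert K0)
  define L0 where "L0 n = (\<lambda>(a, b). (1/2) *\<^sub>R (a + b)) ` (K n \<times> K n)" for n
  have L0: "compact (L0 n)" for n
    unfolding L0_def by (intro compact_continuous_image compact_Times K) (auto simp: split_beta intro!: continuous_intros)
  \<comment> \<open>Cumulative unions make the compact sets increasing, which the inner regularity
    argument uses for continuity from below.\<close>
  define L where "L n = (\<Union>m\<le>n. L0 m)" for n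
  have L: "compact (L n)" for n unfolding L_def by (intro compact_UN L0) auto
  have L0L: "L0 n \<subseteq> L n" for n unfolding L_def by auto
  have Lmono: "L m \<subseteq> L n" if "m \<le> n" for m n unfolding L_def using that by (intro UN_mono) auto
  have KL: "K n \<subseteq> L n" for n
  proof
    fix a assume "a \<in> K n"
    then have "(1/2) *\<^sub>R (a + a) \<in> L0 n" unfolding L0_def by (intro image_eqI[of _ _ "(a, a)"]) auto
    moreover have "(1/2) *\<^sub>R (a + a) = a" by (simp add: scaleR_2[symmetric])
    ultimately show "a \<in> L n" using L0L by auto
  qed
  define X where "X = (\<Union>n. L n)"
  have zeroX: "0 \<in> X" using KL[of 0] by (auto simp: X_def K_def)
  have \<mu>X: "AE x in \<mu>. x \<in> X"
    using K0(3) by eventually_elim (use KL in \<open>auto simp: X_def K_def\<close>)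
  obtain \<xi> :: "nat \<Rightarrow> 'e \<Rightarrow>\<^sub>L real" where inj: "inj_on (\<lambda>x n. blinfun_apply (\<xi> n) x) X"
    and \<xi>: "\<forall>x' :: 'e \<Rightarrow>\<^sub>L real. norm x' \<le> 1 \<longrightarrow> (\<exists>r :: nat \<Rightarrow> nat. \<forall>x\<in>X. \<forall>y\<in>X.
       (\<lambda>j. blinfun_apply (\<xi> (r j)) (x - y)) \<longlonglongrightarrow> blinfun_apply x' (x - y))"
    using sigma_compact_functionals[of L, OF L] unfolding X_def[symmetric] by (elim exE conjE) (rule that)
  define J where "J x = (\<lambda>n. blinfun_apply (\<xi> n) x)" for x
  have injJ: "inj_on J X" using inj unfolding J_def[abs_def] .
  have Jc: "continuous_on UNIV J"
    unfolding J_def by (intro continuous_on_coordinatewise_then_product continuous_intros)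
  have J: "J \<in> borel_measurable borel" by (rule borel_measurable_continuous_onI[OF Jc])
  have J\<mu>: "J \<in> borel_measurable \<mu>" using J \<mu>D(1) by (simp cong: measurable_cong_sets)
  have JBX: "J ` (B \<inter> X) \<in> sets borel" if "B \<in> sets borel" for B
    unfolding X_def by (rule borel_image_sigma_compact[where K = L, OF _ Jc _ that], rule L, rule injJ[unfolded X_def])
  have JX: "J ` X \<in> sets borel" using JBX[of UNIV] by simp
  have JC: "J ` C \<in> sets borel" if "compact C" for C
    by (intro borel_compact compact_continuous_image continuous_on_subset[OF Jc] that) auto

  interpret G: prob_space gauss_seq by (rule prob_space_gauss_seq)
  obtain Y1 :: "(nat \<Rightarrow> real) \<Rightarrow> nat \<Rightarrow> real" where Y1m: "Y1 \<in> borel_measurable gauss_seq"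
    and Y1: "\<And>n c. (CLINT u|gauss_seq. iexp (\<Sum>k<n. c k * Y1 u k)) = exp (- (\<Sum>j<n. \<Sum>k<n. c j * c k * q (\<xi> j) (\<xi> k)) / 2)"
    using gaussian_sequence_exists[OF bilinear_form_psd[of q \<xi>, OF add scale comm nonneg]] by blast
  obtain Y2 :: "(nat \<Rightarrow> real) \<Rightarrow> nat \<Rightarrow> real" where Y2m: "Y2 \<in> borel_measurable gauss_seq"
    and Y2: "\<And>n c. (CLINT u|gauss_seq. iexp (\<Sum>k<n. c k * Y2 u k)) = exp (- (\<Sum>j<n. \<Sum>k<n. c j * c k * q' (\<xi> j) (\<xi> k)) / 2)"
    using gaussian_sequence_exists[OF bilinear_form_psd[of q' \<xi>, OF q'_add q'_scale q'_comm q'_nonneg]] by blast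
  have Y1c[measurable]: "(\<lambda>u. Y1 u k) \<in> borel_measurable gauss_seq" for k
    by (rule measurable_product_then_coordinatewise[OF Y1m])
  have Y2c[measurable]: "(\<lambda>u. Y2 u k) \<in> borel_measurable gauss_seq" for k
    by (rule measurable_product_then_coordinatewise[OF Y2m])
  let ?\<Omega> = "gauss_seq \<Otimes>\<^sub>M gauss_seq"
  interpret P: pair_prob_space gauss_seq gauss_seq ..
  define W where "W s z = (\<lambda>k. Y1 (fst z) k + s * Y2 (snd z) k)" for s :: real and z
  have Wm: "W s \<in> borel_measurable ?\<Omega>" for s
    unfolding W_def by (rule measurable_coordinatewise_then_product) measurable
  \<comment> \<open>Only the square of \<open>s\<close> enters the characteristic function, so both
    signs give the law of \<open>J\<close>.\<close>
  have law: "distr ?\<Omega> borel (W s) = distr \<mu> borel J" if s: "s\<^sup>2 = 1" for s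
  proof (rule sequence_law_distr_eqI[OF P.prob_space_axioms \<mu>.prob_space_axioms Wm J\<mu>])
    fix n c
    define A where "A = (\<Sum>j<n. \<Sum>k<n. c j * c k * q (\<xi> j) (\<xi> k))"
    define B where "B = (\<Sum>j<n. \<Sum>k<n. c j * c k * q' (\<xi> j) (\<xi> k))"
    have "(CLINT z|?\<Omega>. iexp (\<Sum>k<n. c k * W s z k))
        = (CLINT z|?\<Omega>. iexp ((\<Sum>k<n. c k * Y1 (fst z) k) + (\<Sum>k<n. (s * c k) * Y2 (snd z) k)))"
      unfolding W_def by (simp only: distrib_left sum.distrib mult.assoc mult.left_commute)
    also have "\<dots> = (CLINT u|gauss_seq. iexp (\<Sum>k<n. c k * Y1 u k)) * (CLINT u|gauss_seq. iexp (\<Sum>k<n. (s * c k) * Y2 u k))"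
      by (rule pair_char) (simp_all add: prob_space_gauss_seq)
    also have "(CLINT u|gauss_seq. iexp (\<Sum>k<n. (s * c k) * Y2 u k)) = complex_of_real (exp (- B / 2))"
    proof -
      have "s * c j * (s * c k) * q' (\<xi> j) (\<xi> k) = s\<^sup>2 * (c j * c k * q' (\<xi> j) (\<xi> k))" for j k
        by (simp only: power2_eq_square mult_ac)
      then show ?thesis unfolding Y2 B_def s mult_1 by (simp only:)
    qed
    also have "(CLINT u|gauss_seq. iexp (\<Sum>k<n. c k * Y1 u k)) = complex_of_real (exp (- A / 2))"
      unfolding Y1 A_def ..
    also have "complex_of_real (exp (- A / 2)) * complex_of_real (exp (- B / 2)) = complex_of_real (exp (- (A + B) / 2))"
      by (simp add: exp_add[symmetric] add_divide_distrib diff_divide_distrib flip: of_real_mult)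
    also have "A + B = (\<Sum>j<n. \<Sum>k<n. c j * c k * r (\<xi> j) (\<xi> k))"
      unfolding A_def B_def q'_def by (simp add: sum.distrib[symmetric] algebra_simps)
    also have "\<dots> = r (\<Sum>k<n. c k *\<^sub>R \<xi> k) (\<Sum>k<n. c k *\<^sub>R \<xi> k)"
      by (rule bilinear_form_sum[of r, OF r_add r_scale r_comm, symmetric])
    also have "complex_of_real (exp (- r (\<Sum>k<n. c k *\<^sub>R \<xi> k) (\<Sum>k<n. c k *\<^sub>R \<xi> k) / 2)) = (CLINT x|\<mu>. iexp (\<Sum>k<n. c k * J x k))"
      unfolding J_def gaussian_sequence_char[OF \<mu>] rr ..
    finally show "(CLINT z|?\<Omega>. iexp (\<Sum>k<n. c k * W s z k)) = (CLINT x|\<mu>. iexp (\<Sum>k<n. c k * J x k))" .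
  qed
  define m where "m = distr gauss_seq borel Y1"
  interpret m: prob_space m unfolding m_def by (rule G.prob_space_distr[OF Y1m])
  have sm: "sets m = sets borel" "space m = UNIV" by (simp_all add: m_def)
  have tight: "1 - 2 / real (Suc n) \<le> measure m (J ` X)" for n
  proof -
    have CK: "J ` K n \<in> sets borel" by (rule JC[OF K])
    have W1: "1 - 1 / real (Suc n) \<le> measure ?\<Omega> (W s -` (J ` K n) \<inter> space ?\<Omega>)" if s: "s\<^sup>2 = 1" for s
    proof -
      have "measure \<mu> (K0 n) \<le> measure \<mu> (J -` (J ` K n) \<inter> space \<mu>)"
        using measurable_sets[OF J\<mu> CK] by (intro \<mu>.finite_measure_mono) (auto simp: \<mu>D(3) K_def)
      also have "\<dots> = measure (distr \<mu> borel J) (J ` K n)" using J\<mu> CK by (simp add: measure_distr)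
      also have "\<dots> = measure ?\<Omega> (W s -` (J ` K n) \<inter> space ?\<Omega>)"
        unfolding law[OF s, symmetric] using Wm CK by (simp add: measure_distr)
      finally show ?thesis using K0(2)[of n] by linarith
    qed
    define A where "A s = W s -` (J ` K n) \<inter> space ?\<Omega>" for s
    have As: "A s \<in> sets ?\<Omega>" for s unfolding A_def by (rule measurable_sets[OF Wm CK])
    define B where "B = Y1 -` (J ` X) \<inter> space gauss_seq"
    have Bs: "B \<in> sets gauss_seq" unfolding B_def by (rule measurable_sets[OF Y1m JX])
    \<comment> \<open>Averaging the two identities removes \<open>Y2\<close> and exhibits
      \<open>Y1\<close> as the image of the midpoint (a + b) / 2.\<close>
    have sub: "A 1 \<inter> A (- 1) \<subseteq> B \<times> space gauss_seq"
    proof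
      fix z assume z: "z \<in> A 1 \<inter> A (- 1)"
      then have zs: "fst z \<in> space gauss_seq" "snd z \<in> space gauss_seq"
        by (auto simp: A_def space_pair_measure)
      obtain a where a: "a \<in> K n" "W 1 z = J a" using z by (auto simp: A_def)
      obtain b where b: "b \<in> K n" "W (- 1) z = J b" using z by (auto simp: A_def)
      have "Y1 (fst z) = J ((1/2) *\<^sub>R (a + b))"
      proof
        fix k
        have "2 * Y1 (fst z) k = W 1 z k + W (- 1) z k" by (simp add: W_def)
        also have "\<dots> = \<xi> k a + \<xi> k b" unfolding a(2) b(2) by (simp add: J_def)
        finally show "Y1 (fst z) k = J ((1/2) *\<^sub>R (a + b)) k"
          by (simp add: J_def blinfun.scaleR_right blinfun.add_right)
      qed
      moreover have "(1/2) *\<^sub>R (a + b) \<in> L0 n"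
        unfolding L0_def using a(1) b(1) by (intro image_eqI[of _ _ "(a, b)"]) auto
      then have "(1/2) *\<^sub>R (a + b) \<in> X" using L0L[of n] by (auto simp: X_def)
      ultimately have "fst z \<in> B" using zs by (auto simp: B_def)
      then show "z \<in> B \<times> space gauss_seq" using zs by (simp add: mem_Times_iff)
    qed
    have "1 - 2 / real (Suc n) \<le> measure ?\<Omega> (A 1) + measure ?\<Omega> (A (- 1)) - 1"
      using W1[of 1] W1[of "- 1"] unfolding A_def by (simp add: field_simps)
    also have "\<dots> = measure ?\<Omega> (A 1) - measure ?\<Omega> (space ?\<Omega> - A (- 1))"
      using P.prob_compl[OF As[of "- 1"]] by simp
    also have "\<dots> \<le> measure ?\<Omega> (A 1 \<inter> A (- 1))"
    proof -
      have "measure ?\<Omega> (A 1) \<le> measure ?\<Omega> ((A 1 \<inter> A (- 1)) \<union> (space ?\<Omega> - A (- 1)))"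
        using As by (intro P.finite_measure_mono) (auto simp: A_def)
      also have "\<dots> \<le> measure ?\<Omega> (A 1 \<inter> A (- 1)) + measure ?\<Omega> (space ?\<Omega> - A (- 1))"
        using As by (intro measure_Un_le) auto
      finally show ?thesis by simp
    qed
    also have "\<dots> \<le> measure ?\<Omega> (B \<times> space gauss_seq)"
      using Bs by (intro P.finite_measure_mono sub) auto
    also have "\<dots> = measure gauss_seq B * measure gauss_seq (space gauss_seq)"
      using Bs by (simp add: measure_def G.emeasure_pair_measure_Times enn2real_mult)
    also have "\<dots> = measure m (J ` X)"
      unfolding m_def B_def using JX Y1m by (simp add: measure_distr G.prob_space)
    finally show ?thesis .
  qed
  have mX: "measure m (J ` X) = 1"
  proof (rule antisym[OF m.prob_le_1])
    have "(\<lambda>n. 1 - 2 * (1 / real (Suc n))) \<longlonglongrightarrow> 1 - 2 * 0" by (intro tendsto_intros LIMSEQ_Suc[OF lim_1_over_n])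
    then have "(\<lambda>n. 1 - 2 / real (Suc n)) \<longlonglongrightarrow> 1" by simp
    then show "1 \<le> measure m (J ` X)" by (rule LIMSEQ_le_const2) (use tight in blast)
  qed
  then have AEm: "AE w in m. w \<in> J ` X" using JX sm by (subst (asm) m.prob_eq_1) auto
  \<comment> \<open>The inverse of \<open>J\<close> on the image of \<open>X\<close>, extended by 0.
    It is measurable because \<open>J\<close> has Borel images, and it transports the law of
    \<open>Y1\<close> back to E.\<close>
  define g where "g w = (if w \<in> J ` X then inv_into X J w else 0)" for w
  have gJ: "g (J x) = x" if "x \<in> X" for x using that injJ by (simp add: g_def)
  have gX: "g w \<in> X" for w using zeroX by (simp add: g_def inv_into_into)
  have Jg: "J (g w) = w" if "w \<in> J ` X" for w using that by (simp add: g_def f_inv_into_f)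
  have gpre: "g w \<in> B \<longleftrightarrow> w \<in> J ` (B \<inter> X)" if "w \<in> J ` X" for w B
  proof
    assume "g w \<in> B"
    then have "J (g w) \<in> J ` (B \<inter> X)" using gX by blast
    then show "w \<in> J ` (B \<inter> X)" by (simp add: Jg[OF that])
  next
    assume "w \<in> J ` (B \<inter> X)"
    then show "g w \<in> B" using gJ by auto
  qed
  have gm: "g \<in> borel_measurable borel"
  proof (rule measurableI)
    fix B :: "'e set" assume B: "B \<in> sets borel"
    have "g -` B \<inter> space borel = J ` (B \<inter> X) \<union> (if 0 \<in> B then - (J ` X) else {})"
    proof (intro set_eqI)
      fix w
      show "w \<in> g -` B \<inter> space borel \<longleftrightarrow> w \<in> J ` (B \<inter> X) \<union> (if 0 \<in> B then - (J ` X) else {})"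
      proof (cases "w \<in> J ` X")
        case True then show ?thesis using gpre[OF True] by simp
      next
        case False
        then have "w \<notin> J ` (B \<inter> X)" by blast
        then show ?thesis using False by (simp add: g_def)
      qed
    qed
    also have "\<dots> \<in> sets borel" using JBX[OF B] JX by (auto intro!: sets.Un borel_comp)
    finally show "g -` B \<inter> space borel \<in> sets borel" .
  qed simp
  have gmm: "g \<in> borel_measurable m" using gm sm by (simp cong: measurable_cong_sets)
  define \<nu> where "\<nu> = distr m borel g"
  interpret \<nu>: prob_space \<nu> unfolding \<nu>_def by (rule m.prob_space_distr[OF gmm])
  have s\<nu>: "sets \<nu> = sets borel" "space \<nu> = UNIV" by (simp_all add: \<nu>_def)
  have \<nu>B: "emeasure \<nu> B = emeasure m (J ` (B \<inter> X))" if B: "B \<in> sets borel" for B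
  proof -
    have "emeasure \<nu> B = emeasure m (g -` B \<inter> space m)" unfolding \<nu>_def using gmm B by (simp add: emeasure_distr)
    also have "\<dots> = emeasure m (J ` (B \<inter> X))"
    proof (rule emeasure_eq_AE)
      show "AE x in m. x \<in> g -` B \<inter> space m \<longleftrightarrow> x \<in> J ` (B \<inter> X)"
        using AEm by eventually_elim (simp add: gpre sm)
      show "g -` B \<inter> space m \<in> sets m" by (rule measurable_sets[OF gmm B])
      show "J ` (B \<inter> X) \<in> sets m" using JBX[OF B] sm by simp
    qed
    finally show ?thesis .
  qed
  \<comment> \<open>The sequence space is Polish, so inner regularity holds there. A compact
    \<open>C\<close> inside the image of \<open>B\<close> is exhausted by the images of its
    preimages in the compact sets \<open>L n\<close>.\<close>
  have radon: "emeasure \<nu> B = (SUP K\<in>{K. K \<subseteq> B \<and> compact K}. emeasure \<nu> K)" if B: "B \<in> sets borel" for B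
  proof (rule antisym)
    have "emeasure \<nu> B = emeasure m (J ` (B \<inter> X))" by (rule \<nu>B[OF B])
    also have "\<dots> = (SUP C\<in>{C. C \<subseteq> J ` (B \<inter> X) \<and> compact C}. emeasure m C)"
      by (rule inner_regular[OF sm(1) _ JBX[OF B]]) (simp add: m.emeasure_eq_measure)
    also have "\<dots> \<le> (SUP K\<in>{K. K \<subseteq> B \<and> compact K}. emeasure \<nu> K)"
    proof (rule SUP_least)
      fix C assume "C \<in> {C. C \<subseteq> J ` (B \<inter> X) \<and> compact C}"
      then have C: "C \<subseteq> J ` (B \<inter> X)" "compact C" by auto
      define D where "D n = J -` C \<inter> L n" for n
      have D: "compact (D n)" for n
        unfolding D_def
        by (intro closed_Int_compact L closed_vimage compact_imp_closed C(2) Jc)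
      have DB: "D n \<subseteq> B" for n
      proof
        fix x assume x: "x \<in> D n"
        then have xX: "x \<in> X" by (auto simp: D_def X_def)
        obtain y where y: "y \<in> B \<inter> X" "J x = J y" using x C(1) by (auto simp: D_def)
        then have "x = y" using inj_onD[OF injJ y(2)] xX by blast
        then show "x \<in> B" using y by simp
      qed
      have Ds: "J ` D n \<in> sets m" for n using JC[OF D] sm by simp
      have "C = (\<Union>n. J ` D n)"
      proof (intro set_eqI iffI)
        fix w assume w: "w \<in> C"
        then obtain x where x: "x \<in> X" "w = J x" using C(1) by auto
        then obtain n where "x \<in> L n" by (auto simp: X_def)
        then have "x \<in> D n" using w x by (simp add: D_def)
        then show "w \<in> (\<Union>n. J ` D n)" using x by blast
      qed (auto simp: D_def)
      moreover have "(SUP n. emeasure m (J ` D n)) = emeasure m (\<Union>n. J ` D n)"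
      proof (rule SUP_emeasure_incseq)
        show "range (\<lambda>n. J ` D n) \<subseteq> sets m" using Ds by (intro image_subsetI)
        show "incseq (\<lambda>n. J ` D n)"
          unfolding incseq_def D_def using Lmono by (intro allI impI image_mono Int_mono) auto
      qed
      ultimately have "emeasure m C = (SUP n. emeasure m (J ` D n))" by simp
      also have "\<dots> \<le> (SUP K\<in>{K. K \<subseteq> B \<and> compact K}. emeasure \<nu> K)"
      proof (rule SUP_least)
        fix n
        have "D n \<inter> X = D n" by (auto simp: D_def X_def)
        then have "emeasure m (J ` D n) = emeasure \<nu> (D n)" using \<nu>B[OF borel_compact[OF D]] by simp
        also have "\<dots> \<le> (SUP K\<in>{K. K \<subseteq> B \<and> compact K}. emeasure \<nu> K)"
          using D DB by (intro SUP_upper) auto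
        finally show "emeasure m (J ` D n) \<le> (SUP K\<in>{K. K \<subseteq> B \<and> compact K}. emeasure \<nu> K)" .
      qed
      finally show "emeasure m C \<le> (SUP K\<in>{K. K \<subseteq> B \<and> compact K}. emeasure \<nu> K)" .
    qed
    finally show "emeasure \<nu> B \<le> (SUP K\<in>{K. K \<subseteq> B \<and> compact K}. emeasure \<nu> K)" .
    show "(SUP K\<in>{K. K \<subseteq> B \<and> compact K}. emeasure \<nu> K) \<le> emeasure \<nu> B"
      using B s\<nu> by (intro SUP_least emeasure_mono) auto
  qed
  have blm[measurable]: "blinfun_apply x' \<in> borel_measurable \<nu>" for x' :: "'e \<Rightarrow>\<^sub>L real"
    using measurable_blinfun_real[of x'] s\<nu>(1) by (simp cong: measurable_cong_sets)
  have bl\<mu>[measurable]: "blinfun_apply x' \<in> borel_measurable \<mu>" for x' :: "'e \<Rightarrow>\<^sub>L real"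
    using measurable_blinfun_real[of x'] \<mu>D(1) by (simp cong: measurable_cong_sets)
  have \<nu>X: "AE x in \<nu>. x \<in> X"
  proof -
    have "X \<in> sets borel" unfolding X_def by (intro sets.countable_UN image_subsetI borel_compact L)
    then show ?thesis unfolding \<nu>_def using gX by (subst AE_distr_iff[OF gmm]) auto
  qed
  have char_\<xi>: "(CLINT x|\<nu>. iexp (t * \<xi> n x)) = exp (- (q (\<xi> n) (\<xi> n) * t\<^sup>2) / 2)" for n t
  proof -
    define c where "c k = (if k = n then t else 0)" for k
    have c1: "(\<Sum>k<Suc n. c k * f k) = t * f n" for f :: "nat \<Rightarrow> real"
      by (simp add: c_def)
    have "(CLINT x|\<nu>. iexp (t * \<xi> n x)) = (CLINT w|m. iexp (t * \<xi> n (g w)))"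
      unfolding \<nu>_def by (rule integral_distr[OF gmm, where f = "\<lambda>x. iexp (t * \<xi> n x)"])
        (intro borel_measurable_continuous_onI continuous_intros)
    also have "\<dots> = (CLINT w|m. iexp (t * w n))"
    proof (rule integral_cong_AE)
      have [measurable]: "(\<lambda>w::nat \<Rightarrow> real. w n) \<in> borel_measurable m"
        using measurable_product_then_coordinatewise[of "\<lambda>w. w" borel n] sm by (simp cong: measurable_cong_sets)
      show "(\<lambda>w. iexp (t * w n)) \<in> borel_measurable m" by measurable
      have [measurable]: "(\<lambda>w. \<xi> n (g w)) \<in> borel_measurable m"
        using measurable_comp[OF gmm measurable_blinfun_real[of "\<xi> n"]] by (simp add: comp_def)
      show "(\<lambda>w. iexp (t * \<xi> n (g w))) \<in> borel_measurable m" by measurable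
      show "AE w in m. iexp (t * \<xi> n (g w)) = iexp (t * w n)"
        using AEm
      proof eventually_elim
        case (elim w)
        have "\<xi> n (g w) = J (g w) n" by (simp add: J_def)
        then show ?case by (simp add: Jg[OF elim])
      qed
    qed
    also have "\<dots> = (CLINT u|gauss_seq. iexp (t * Y1 u n))"
      unfolding m_def
    proof (rule integral_distr[OF Y1m, where f = "\<lambda>w. iexp (t * w n)"])
      have [measurable]: "(\<lambda>w::nat \<Rightarrow> real. w n) \<in> borel_measurable borel"
        by (rule measurable_product_then_coordinatewise) simp
      show "(\<lambda>w. iexp (t * w n)) \<in> borel_measurable borel" by measurable
    qed
    also have "\<dots> = (CLINT u|gauss_seq. iexp (\<Sum>k<Suc n. c k * Y1 u k))" by (simp only: c1)
    also have "\<dots> = exp (- (\<Sum>j<Suc n. \<Sum>k<Suc n. c j * c k * q (\<xi> j) (\<xi> k)) / 2)" by (rule Y1)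
    also have "(\<Sum>j<Suc n. \<Sum>k<Suc n. c j * c k * q (\<xi> j) (\<xi> k)) = (\<Sum>j<Suc n. c j * (\<Sum>k<Suc n. c k * q (\<xi> j) (\<xi> k)))"
      by (simp only: sum_distrib_left mult.assoc)
    also have "\<dots> = q (\<xi> n) (\<xi> n) * t\<^sup>2" unfolding c1 by (simp add: power2_eq_square)
    finally show ?thesis .
  qed
  \<comment> \<open>Passage from the \<xi> n to a functional of norm at most 1. Pointwise
    convergence on \<open>X\<close> makes the differences tend to 0 in variance under \<mu>; since
    \<open>q\<close> is dominated by that variance, the values of \<open>q\<close> converge
    too.\<close>
  have char1: "(CLINT x|\<nu>. iexp (t * x' x)) = exp (- (q x' x' * t\<^sup>2) / 2)" if x': "norm x' \<le> 1" for x' :: "'e \<Rightarrow>\<^sub>L real" and t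
  proof -
    obtain \<rho> :: "nat \<Rightarrow> nat" where \<rho>: "\<forall>x\<in>X. \<forall>y\<in>X. (\<lambda>j. blinfun_apply (\<xi> (\<rho> j)) (x - y)) \<longlonglongrightarrow> blinfun_apply x' (x - y)"
      using \<xi> x' by blast
    have lim: "(\<lambda>j. \<xi> (\<rho> j) x) \<longlonglongrightarrow> x' x" if "x \<in> X" for x
      using \<rho>[rule_format, OF that zeroX] by simp
    define d where "d j = \<xi> (\<rho> j) - x'" for j
    have dlim: "(\<lambda>j. d j x) \<longlonglongrightarrow> 0" if "x \<in> X" for x
      using tendsto_diff[OF lim[OF that] tendsto_const[of "x' x"]] by (simp add: d_def blinfun.diff_left)
    have "(\<lambda>j. CLINT x|\<mu>. iexp (d j x)) \<longlonglongrightarrow> (CLINT x|\<mu>. 1)"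
    proof (rule integral_dominated_convergence[where w = "\<lambda>_. 1"])
      show "AE x in \<mu>. (\<lambda>j. iexp (d j x)) \<longlonglongrightarrow> 1"
        using \<mu>X
      proof eventually_elim
        case (elim x)
        have "(\<lambda>j. iexp (d j x)) \<longlonglongrightarrow> iexp 0" by (intro tendsto_intros dlim elim)
        then show ?case by simp
      qed
    qed auto
    then have "(\<lambda>j. complex_of_real (exp (- r (d j) (d j) / 2))) \<longlonglongrightarrow> 1"
      unfolding gaussian_radon_square_integrable(2)[OF \<mu>] rr by (simp add: \<mu>.prob_space)
    then have rd: "(\<lambda>j. r (d j) (d j)) \<longlonglongrightarrow> 0" by (rule tendsto_char_imp_variance)
    have qd: "(\<lambda>j. q (d j) (d j)) \<longlonglongrightarrow> 0"
      by (rule tendsto_sandwich[OF _ _ tendsto_const rd]) (use nonneg dom in \<open>simp_all add: rr\<close>)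
    have qx: "(\<lambda>j. q x' (d j)) \<longlonglongrightarrow> 0"
    proof -
      have "(\<lambda>j. sqrt (q x' x' * q (d j) (d j))) \<longlonglongrightarrow> sqrt (q x' x' * 0)" by (intro tendsto_intros qd)
      then have s0: "(\<lambda>j. sqrt (q x' x' * q (d j) (d j))) \<longlonglongrightarrow> 0" by simp
      have "\<bar>q x' (d j)\<bar> \<le> sqrt (q x' x' * q (d j) (d j))" for j
        by (rule real_le_rsqrt) (use bilinear_form_Cauchy_Schwarz[of q x' "d j", OF add scale comm nonneg] in simp)
      then show ?thesis by (intro Lim_null_comparison[OF _ s0]) (simp add: always_eventually)
    qed
    have qlim: "(\<lambda>j. q (\<xi> (\<rho> j)) (\<xi> (\<rho> j))) \<longlonglongrightarrow> q x' x'"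
    proof -
      have "q (\<xi> (\<rho> j)) (\<xi> (\<rho> j)) = q x' x' + 2 * q x' (d j) + q (d j) (d j)" for j
      proof -
        have "\<xi> (\<rho> j) = x' + d j" by (simp add: d_def)
        then have "q (\<xi> (\<rho> j)) (\<xi> (\<rho> j)) = q x' (x' + d j) + q (d j) (x' + d j)" by (simp only: add)
        also have "\<dots> = q (x' + d j) x' + q (x' + d j) (d j)" by (simp only: comm)
        also have "\<dots> = q x' x' + q (d j) x' + (q x' (d j) + q (d j) (d j))" by (simp only: add)
        finally show ?thesis by (simp add: comm[of "d j" x'])
      qed
      moreover have "(\<lambda>j. q x' x' + 2 * q x' (d j) + q (d j) (d j)) \<longlonglongrightarrow> q x' x' + 2 * 0 + 0"
        by (intro tendsto_intros qx qd)
      ultimately show ?thesis by simp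
    qed
    have "(\<lambda>j. CLINT x|\<nu>. iexp (t * \<xi> (\<rho> j) x)) \<longlonglongrightarrow> (CLINT x|\<nu>. iexp (t * x' x))"
    proof (rule integral_dominated_convergence[where w = "\<lambda>_. 1"])
      show "AE x in \<nu>. (\<lambda>j. iexp (t * \<xi> (\<rho> j) x)) \<longlonglongrightarrow> iexp (t * x' x)"
        using \<nu>X by eventually_elim (intro tendsto_intros lim)
    qed auto
    moreover have "(\<lambda>j. complex_of_real (exp (- (q (\<xi> (\<rho> j)) (\<xi> (\<rho> j)) * t\<^sup>2) / 2))) \<longlonglongrightarrow> complex_of_real (exp (- (q x' x' * t\<^sup>2) / 2))"
      by (intro tendsto_intros qlim) auto
    ultimately show ?thesis unfolding char_\<xi> using LIMSEQ_unique by blast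
  qed
  have charq: "(CLINT x|\<nu>. iexp (t * x' x)) = exp (- (q x' x' * t\<^sup>2) / 2)" for x' :: "'e \<Rightarrow>\<^sub>L real" and t
  proof -
    \<comment> \<open>Scaling into the unit ball; the added 1 keeps \<open>a\<close> positive for x'
      = 0.\<close>
    define a where "a = norm x' + 1"
    have a: "0 < a" by (simp add: a_def add_nonneg_pos)
    define y' where "y' = (1 / a) *\<^sub>R x'"
    have "norm y' \<le> 1" using a by (simp add: y'_def a_def field_simps)
    from char1[OF this, of "t * a"] have "(CLINT x|\<nu>. iexp (t * a * y' x)) = exp (- (q y' y' * (t * a)\<^sup>2) / 2)" .
    moreover have "t * a * y' x = t * x' x" for x using a by (simp add: y'_def blinfun.scaleR_left)
    moreover have "q y' y' * (t * a)\<^sup>2 = q x' x' * t\<^sup>2"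
    proof -
      have "q y' y' = (1 / a) * q x' y'" by (simp only: y'_def scale)
      also have "q x' y' = q y' x'" by (rule comm)
      also have "\<dots> = (1 / a) * q x' x'" by (simp only: y'_def scale)
      finally have "q y' y' = (1 / a) * ((1 / a) * q x' x')" .
      then show ?thesis using a by (simp add: power2_eq_square field_simps)
    qed
    ultimately show ?thesis by simp
  qed
  have cg: "centred_gaussian_real (distr \<nu> borel (blinfun_apply x'))" for x' :: "'e \<Rightarrow>\<^sub>L real"
  proof (rule centred_gaussian_realI[OF _ nonneg[of x']])
    show "real_distribution (distr \<nu> borel (blinfun_apply x'))" by (rule \<nu>.real_distribution_distr) simp
    show "char (distr \<nu> borel (blinfun_apply x')) t = exp (- (q x' x' * t\<^sup>2) / 2)" for t
      unfolding char_def charq[symmetric] by (subst integral_distr) auto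
  qed
  have \<nu>g: "centred_gaussian_radon \<nu>"
    unfolding centred_gaussian_radon_def using s\<nu>(1) \<nu>.prob_space_axioms radon cg by blast
  have var: "(\<integral>x. (x' x)\<^sup>2 \<partial>\<nu>) = q x' x'" for x' :: "'e \<Rightarrow>\<^sub>L real"
  proof -
    have "complex_of_real (exp (- (\<integral>x. (x' x)\<^sup>2 \<partial>\<nu>) / 2)) = complex_of_real (exp (- q x' x' / 2))"
      using gaussian_radon_square_integrable(2)[OF \<nu>g, of x'] charq[of 1 x'] by simp
    then show ?thesis unfolding of_real_eq_iff by simp
  qed
  have "(\<integral>x. x' x * y' x \<partial>\<nu>) = q x' y'" for x' y' :: "'e \<Rightarrow>\<^sub>L real"
  proof -
    have "q (x' + y') (x' + y') = q x' (x' + y') + q y' (x' + y')" by (rule add)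
    also have "\<dots> = q (x' + y') x' + q (x' + y') y'" by (simp only: comm)
    also have "\<dots> = q x' x' + q y' x' + (q x' y' + q y' y')" by (simp only: add)
    finally have "q (x' + y') (x' + y') = q x' x' + 2 * q x' y' + q y' y'" by (simp add: comm[of y' x'])
    then show ?thesis unfolding gaussian_radon_integrable_mult(2)[OF \<nu>g] var by simp
  qed
  with \<nu>g show ?thesis by blast
qed

section \<open>Cylindrical functions\<close>

lemma tendsto_sequenceI:
  fixes f :: "'a \<Rightarrow> nat \<Rightarrow> real"
  assumes "\<And>k. ((\<lambda>x. f x k) \<longlongrightarrow> l k) F"
  shows "(f \<longlongrightarrow> l) F"
proof -
  have "limitin (product_topology (\<lambda>_. euclidean) UNIV) f l F"
    unfolding limitin_componentwise using assms by simp
  then show ?thesis by (simp add: euclidean_product_topology)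
qed

lemma Cb1_dep: "Cb1 N \<phi> \<Longrightarrow> (\<And>j. j < N \<Longrightarrow> u j = v j) \<Longrightarrow> \<phi> u = \<phi> v"
  unfolding Cb1_def by blast

lemma Cb1_continuous: "Cb1 N \<phi> \<Longrightarrow> continuous_on UNIV \<phi>"
  by (simp add: Cb1_def)

lemma Cb1_bounded: "Cb1 N \<phi> \<Longrightarrow> \<exists>B. \<forall>u. \<bar>\<phi> u\<bar> \<le> B"
  by (auto simp: Cb1_def bounded_iff)

lemma Cb1_partial_continuous: "Cb1 N \<phi> \<Longrightarrow> n < N \<Longrightarrow> continuous_on UNIV (partial_deriv n \<phi>)"
  by (simp add: Cb1_def)

lemma Cb1_partial_bounded: "Cb1 N \<phi> \<Longrightarrow> n < N \<Longrightarrow> \<exists>B. \<forall>u. \<bar>partial_deriv n \<phi> u\<bar> \<le> B"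
  by (auto simp: Cb1_def bounded_iff)

lemma Cb1_DERIV:
  assumes "Cb1 N \<phi>" "n < N"
  shows "((\<lambda>s. \<phi> (u(n := s))) has_real_derivative partial_deriv n \<phi> (u(n := r))) (at r)"
proof -
  have "(\<lambda>s. \<phi> ((u(n := r))(n := s))) field_differentiable at ((u(n := r)) n)"
    using assms unfolding Cb1_def by blast
  then have "((\<lambda>s. \<phi> ((u(n := r))(n := s))) has_real_derivative
      deriv (\<lambda>s. \<phi> ((u(n := r))(n := s))) ((u(n := r)) n)) (at ((u(n := r)) n))"
    by (rule field_differentiable_derivI)
  then show ?thesis unfolding partial_deriv_def by simp
qed

lemma Cb1I:
  assumes dep: "\<And>u v. (\<And>j. j < N \<Longrightarrow> u j = v j) \<Longrightarrow> \<phi> u = \<phi> v"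
    and cont: "continuous_on UNIV \<phi>" and bdd: "\<And>u. \<bar>\<phi> u\<bar> \<le> B"
    and deriv: "\<And>n u. n < N \<Longrightarrow> ((\<lambda>s. \<phi> (u(n := s))) has_real_derivative p n u) (at (u n))"
    and pcont: "\<And>n. n < N \<Longrightarrow> continuous_on UNIV (p n)" and pbdd: "\<And>n u. n < N \<Longrightarrow> \<bar>p n u\<bar> \<le> C n"
  shows "Cb1 N \<phi>" and "n < N \<Longrightarrow> partial_deriv n \<phi> = p n"
proof -
  have pd: "partial_deriv n \<phi> = p n" if "n < N" for n
    unfolding partial_deriv_def using DERIV_imp_deriv[OF deriv[OF that]] by blast
  then show "n < N \<Longrightarrow> partial_deriv n \<phi> = p n" .
  show "Cb1 N \<phi>"
    unfolding Cb1_def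
  proof (intro conjI allI impI)
    show "\<phi> u = \<phi> v" if "\<forall>j<N. u j = v j" for u v using dep that by blast
    show "bounded (range \<phi>)" unfolding bounded_iff using bdd by (intro exI[of _ B]) auto
    show "(\<lambda>s. \<phi> (u(n := s))) field_differentiable at (u n)" if "n < N" for n u
      using deriv[OF that] unfolding field_differentiable_def by blast
    show "continuous_on UNIV (partial_deriv n \<phi>)" if "n < N" for n unfolding pd[OF that] by (rule pcont[OF that])
    show "bounded (range (partial_deriv n \<phi>))" if "n < N" for n
      unfolding pd[OF that] bounded_iff using pbdd[OF that] by (intro exI[of _ "C n"]) auto
  qed (rule cont)
qed

text \<open>\<open>Cb1\<close> provides partial derivatives only. Coordinates are switched on one at
  a time, each increment is expressed by the mean value theorem, and continuity of the partial
  derivatives gives the limit.\<close>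

lemma Cb1_directional_derivative:
  assumes \<phi>: "Cb1 N \<phi>"
  shows "((\<lambda>\<epsilon>. \<phi> (\<lambda>k. u k + \<epsilon> * v k)) has_real_derivative (\<Sum>n<N. v n * partial_deriv n \<phi> u)) (at 0)"
proof -
  define w where "w m \<epsilon> k = (if k < m then u k + \<epsilon> * v k else u k)" for m k :: nat and \<epsilon> :: real
  have w0: "w m 0 = u" for m by (auto simp: w_def)
  have step: "((\<lambda>\<epsilon>. \<phi> (w (Suc m) \<epsilon>) - \<phi> (w m \<epsilon>)) has_real_derivative v m * partial_deriv m \<phi> u) (at 0)"
    if m: "m < N" for m
  proof -
    have upd: "w (Suc m) \<epsilon> = (w m \<epsilon>)(m := u m + \<epsilon> * v m)" "w m \<epsilon> = (w m \<epsilon>)(m := u m)" for \<epsilon>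
      by (auto simp: w_def fun_eq_iff)
    have ex: "\<exists>\<xi>. \<bar>\<xi> - u m\<bar> \<le> \<bar>\<epsilon> * v m\<bar> \<and>
        \<phi> (w (Suc m) \<epsilon>) - \<phi> (w m \<epsilon>) = \<epsilon> * v m * partial_deriv m \<phi> ((w m \<epsilon>)(m := \<xi>))" for \<epsilon>
    proof -
      define \<psi> where "\<psi> s = \<phi> ((w m \<epsilon>)(m := s))" for s
      define \<psi>' where "\<psi>' s = partial_deriv m \<phi> ((w m \<epsilon>)(m := s))" for s
      have d: "(\<psi> has_real_derivative \<psi>' s) (at s)" for s
        unfolding \<psi>_def \<psi>'_def by (rule Cb1_DERIV[OF \<phi> m])
      have mvt: "\<exists>\<xi>. \<bar>\<xi> - a\<bar> \<le> \<bar>b - a\<bar> \<and> \<psi> b - \<psi> a = (b - a) * \<psi>' \<xi>" for a b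
      proof (cases a b rule: linorder_cases)
        case less
        obtain z where "a < z" "z < b" "\<psi> b - \<psi> a = (b - a) * \<psi>' z" using MVT2[OF less d] by auto
        then show ?thesis by (intro exI[of _ z]) auto
      next
        case greater
        obtain z where "b < z" "z < a" "\<psi> a - \<psi> b = (a - b) * \<psi>' z" using MVT2[OF greater d] by auto
        then show ?thesis by (intro exI[of _ z]) (auto simp: algebra_simps)
      qed auto
      from mvt[of "u m" "u m + \<epsilon> * v m"] obtain \<xi> where
        "\<bar>\<xi> - u m\<bar> \<le> \<bar>\<epsilon> * v m\<bar>" "\<psi> (u m + \<epsilon> * v m) - \<psi> (u m) = \<epsilon> * v m * \<psi>' \<xi>" by auto
      then show ?thesis using upd[of \<epsilon>] unfolding \<psi>_def \<psi>'_def by (intro exI[of _ \<xi>]) (simp only: simp_thms)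
    qed
    then obtain \<xi> where \<xi>: "\<And>\<epsilon>. \<bar>\<xi> \<epsilon> - u m\<bar> \<le> \<bar>\<epsilon> * v m\<bar>"
      "\<And>\<epsilon>. \<phi> (w (Suc m) \<epsilon>) - \<phi> (w m \<epsilon>) = \<epsilon> * v m * partial_deriv m \<phi> ((w m \<epsilon>)(m := \<xi> \<epsilon>))" by metis
    have "((\<lambda>\<epsilon>. (w m \<epsilon>)(m := \<xi> \<epsilon>)) \<longlongrightarrow> u) (at 0)"
    proof (rule tendsto_sequenceI)
      fix k
      show "((\<lambda>\<epsilon>. ((w m \<epsilon>)(m := \<xi> \<epsilon>)) k) \<longlongrightarrow> u k) (at 0)"
      proof (cases "k = m")
        case True
        have "((\<lambda>\<epsilon>. \<bar>\<epsilon> * v m\<bar>) \<longlongrightarrow> \<bar>0 * v m\<bar>) (at 0)" by (intro tendsto_intros)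
        then have z: "((\<lambda>\<epsilon>. \<bar>\<epsilon> * v m\<bar>) \<longlongrightarrow> 0) (at 0)" by simp
        have "((\<lambda>\<epsilon>. \<xi> \<epsilon> - u m) \<longlongrightarrow> 0) (at 0)"
          by (rule Lim_null_comparison[OF _ z]) (simp add: \<xi>(1))
        then show ?thesis using True by (simp add: LIM_zero_iff)
      next
        case False
        have "((\<lambda>\<epsilon>. u k + \<epsilon> * v k) \<longlongrightarrow> u k + 0 * v k) (at 0)" by (intro tendsto_intros)
        then show ?thesis using False by (cases "k < m") (simp_all add: w_def)
      qed
    qed
    moreover have "isCont (partial_deriv m \<phi>) u"
      by (rule bspec[OF iffD1[OF continuous_on_eq_continuous_at[OF open_UNIV] Cb1_partial_continuous[OF \<phi> m]] UNIV_I])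
    ultimately have "((\<lambda>\<epsilon>. partial_deriv m \<phi> ((w m \<epsilon>)(m := \<xi> \<epsilon>))) \<longlongrightarrow> partial_deriv m \<phi> u) (at 0)"
      by (rule isCont_tendsto_compose[rotated])
    then have lim: "((\<lambda>\<epsilon>. v m * partial_deriv m \<phi> ((w m \<epsilon>)(m := \<xi> \<epsilon>))) \<longlongrightarrow> v m * partial_deriv m \<phi> u) (at 0)"
      by (intro tendsto_intros)
    have "((\<lambda>\<epsilon>. (\<phi> (w (Suc m) (0 + \<epsilon>)) - \<phi> (w m (0 + \<epsilon>)) - (\<phi> (w (Suc m) 0) - \<phi> (w m 0))) / \<epsilon>) \<longlongrightarrow> v m * partial_deriv m \<phi> u) (at 0)"
    proof (rule Lim_transform_eventually[OF lim])
      show "\<forall>\<^sub>F \<epsilon> in at 0. v m * partial_deriv m \<phi> ((w m \<epsilon>)(m := \<xi> \<epsilon>))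
          = (\<phi> (w (Suc m) (0 + \<epsilon>)) - \<phi> (w m (0 + \<epsilon>)) - (\<phi> (w (Suc m) 0) - \<phi> (w m 0))) / \<epsilon>"
        unfolding eventually_at_topological by (intro exI[of _ UNIV]) (auto simp: w0 \<xi>(2))
    qed
    then show ?thesis unfolding DERIV_def .
  qed
  have "((\<lambda>\<epsilon>. \<phi> (w m \<epsilon>)) has_real_derivative (\<Sum>n<m. v n * partial_deriv n \<phi> u)) (at 0)" if "m \<le> N" for m
    using that
  proof (induction m)
    case 0
    have "w 0 \<epsilon> = u" for \<epsilon> by (auto simp: w_def)
    then show ?case by simp
  next
    case (Suc m)
    have "((\<lambda>\<epsilon>. \<phi> (w m \<epsilon>) + (\<phi> (w (Suc m) \<epsilon>) - \<phi> (w m \<epsilon>))) has_real_derivative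
        (\<Sum>n<m. v n * partial_deriv n \<phi> u) + v m * partial_deriv m \<phi> u) (at 0)"
      using Suc by (intro DERIV_add step) auto
    then show ?case by simp
  qed
  from this[of N] have "((\<lambda>\<epsilon>. \<phi> (w N \<epsilon>)) has_real_derivative (\<Sum>n<N. v n * partial_deriv n \<phi> u)) (at 0)" by simp
  moreover have "\<phi> (w N \<epsilon>) = \<phi> (\<lambda>k. u k + \<epsilon> * v k)" for \<epsilon>
    by (rule Cb1_dep[OF \<phi>]) (simp add: w_def)
  ultimately show ?thesis by simp
qed

lemma Cb1_line_derivative:
  assumes \<phi>: "Cb1 N \<phi>"
  shows "((\<lambda>\<epsilon>. \<phi> (\<lambda>k. u k + \<epsilon> * v k)) has_real_derivative
    (\<Sum>n<N. v n * partial_deriv n \<phi> (\<lambda>k. u k + t * v k))) (at t)"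
proof -
  have "((\<lambda>\<epsilon>. \<phi> (\<lambda>k. (u k + t * v k) + \<epsilon> * v k)) has_real_derivative
    (\<Sum>n<N. v n * partial_deriv n \<phi> (\<lambda>k. u k + t * v k))) (at 0)"
    by (rule Cb1_directional_derivative[OF \<phi>])
  then have "((\<lambda>\<epsilon>. \<phi> (\<lambda>k. u k + (\<epsilon> + t) * v k)) has_real_derivative
    (\<Sum>n<N. v n * partial_deriv n \<phi> (\<lambda>k. u k + t * v k))) (at 0)"
    by (simp add: algebra_simps)
  then show ?thesis using DERIV_shift[of "\<lambda>\<epsilon>. \<phi> (\<lambda>k. u k + \<epsilon> * v k)" _ 0 t] by simp
qed

text \<open>The gradient computed from one chosen representation of the function.\<close>

definition cyl_grad :: "('h::real_inner \<Rightarrow>\<^sub>L 'e::real_normed_vector) \<Rightarrow> nat \<Rightarrow> ((nat \<Rightarrow> real) \<Rightarrow> real) \<Rightarrow>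
    (nat \<Rightarrow> 'e \<Rightarrow>\<^sub>L real) \<Rightarrow> 'e \<Rightarrow> 'h" where
  "cyl_grad i N \<phi> x' x = (\<Sum>n<N. partial_deriv n \<phi> (\<lambda>j. x' j x) *\<^sub>R H_adjoint i (x' n))"

lemma cyl_grad_derivative:
  fixes i :: "'h::{real_inner,complete_space} \<Rightarrow>\<^sub>L 'e::real_normed_vector"
  assumes "cyl_rep f N \<phi> x'"
  shows "((\<lambda>\<epsilon>. f (x + \<epsilon> *\<^sub>R i h)) has_real_derivative inner h (cyl_grad i N \<phi> x' x)) (at 0)"
proof -
  have \<phi>: "Cb1 N \<phi>" and f: "\<And>x. f x = \<phi> (\<lambda>n. x' n x)" using assms by (auto simp: cyl_rep_def)
  have "((\<lambda>\<epsilon>. \<phi> (\<lambda>k. x' k x + \<epsilon> * x' k (i h))) has_real_derivative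
      (\<Sum>n<N. x' n (i h) * partial_deriv n \<phi> (\<lambda>j. x' j x))) (at 0)"
    by (rule Cb1_directional_derivative[OF \<phi>])
  moreover have "(\<Sum>n<N. x' n (i h) * partial_deriv n \<phi> (\<lambda>j. x' j x)) = inner h (cyl_grad i N \<phi> x' x)"
    unfolding cyl_grad_def by (simp add: inner_sum_right inner_H_adjoint mult.commute)
  ultimately show ?thesis by (simp add: f blinfun.add_right blinfun.scaleR_right)
qed

text \<open>Inner products with \<open>h\<close> are directional derivatives of \<open>f\<close>
  itself, hence independent of the representation; this gives the uniqueness required by the
  \<open>THE\<close> in \<open>DH\<close>.\<close>

lemma DH_eq_cyl_grad:
  fixes i :: "'h::{real_inner,complete_space} \<Rightarrow>\<^sub>L 'e::real_normed_vector"
  assumes rep: "cyl_rep f N \<phi> x'"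
  shows "DH i f = cyl_grad i N \<phi> x'"
  unfolding DH_def
proof (rule the_equality)
  show "\<exists>N' \<phi>' y'. cyl_rep f N' \<phi>' y' \<and> cyl_grad i N \<phi> x' = (\<lambda>x. \<Sum>n<N'. partial_deriv n \<phi>' (\<lambda>j. y' j x) *\<^sub>R H_adjoint i (y' n))"
    using rep unfolding cyl_grad_def[abs_def] by blast
  fix D assume "\<exists>N' \<phi>' y'. cyl_rep f N' \<phi>' y' \<and> D = (\<lambda>x. \<Sum>n<N'. partial_deriv n \<phi>' (\<lambda>j. y' j x) *\<^sub>R H_adjoint i (y' n))"
  then obtain N' \<phi>' y' where rep': "cyl_rep f N' \<phi>' y'" and D: "D = cyl_grad i N' \<phi>' y'"
    unfolding cyl_grad_def[abs_def] by blast
  show "D = cyl_grad i N \<phi> x'"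
  proof
    fix x
    show "D x = cyl_grad i N \<phi> x' x"
      unfolding D
      by (rule eq_if_inner_eq, rule DERIV_unique[OF cyl_grad_derivative[OF rep'] cyl_grad_derivative[OF rep]])
  qed
qed

lemma DH_derivative:
  fixes i :: "'h::{real_inner,complete_space} \<Rightarrow>\<^sub>L 'e::real_normed_vector"
  assumes "f \<in> FCb1"
  shows "((\<lambda>\<epsilon>. f (x + \<epsilon> *\<^sub>R i h)) has_real_derivative inner h (DH i f x)) (at 0)"
proof -
  obtain N \<phi> x' where "cyl_rep f N \<phi> x'" using assms unfolding FCb1_def by blast
  then show ?thesis using cyl_grad_derivative DH_eq_cyl_grad by metis
qed

text \<open>The gradient factors through the separable sequence space, so its range is separable
  although E and H need not be. Both conclusions together give strong measurability.\<close>

lemma continuous_cyl_grad: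
  assumes "cyl_rep f N \<phi> x'"
  shows "continuous_on UNIV (cyl_grad i N \<phi> x')" "\<exists>D. countable D \<and> range (cyl_grad i N \<phi> x') \<subseteq> closure D"
proof -
  have \<phi>: "Cb1 N \<phi>" using assms by (simp add: cyl_rep_def)
  define G where "G u = (\<Sum>n<N. partial_deriv n \<phi> u *\<^sub>R H_adjoint i (x' n))" for u
  have G: "continuous_on UNIV G"
    unfolding G_def by (intro continuous_intros Cb1_partial_continuous[OF \<phi>]) auto
  have J: "continuous_on UNIV (\<lambda>x j. blinfun_apply (x' j) x)"
    by (intro continuous_on_coordinatewise_then_product continuous_intros)
  have eq: "cyl_grad i N \<phi> x' = (\<lambda>x. G (\<lambda>j. blinfun_apply (x' j) x))"
    by (auto simp: cyl_grad_def G_def)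
  show "continuous_on UNIV (cyl_grad i N \<phi> x')"
    unfolding eq by (rule continuous_on_compose2[OF G J]) simp
  obtain T :: "(nat \<Rightarrow> real) set" where T: "countable T" "UNIV \<subseteq> closure T" using separable[of UNIV] by auto
  have "range G \<subseteq> closure (G ` T)"
    using continuous_image_closure_subset[OF G, of T] T(2) by auto
  then have "range (cyl_grad i N \<phi> x') \<subseteq> closure (G ` T)" unfolding eq by auto
  moreover have "countable (G ` T)" using T(1) by simp
  ultimately show "\<exists>D. countable D \<and> range (cyl_grad i N \<phi> x') \<subseteq> closure D" by blast
qed

section \<open>Linear structure of the cylindrical functions\<close>

lemma FCb1_continuous: "f \<in> FCb1 \<Longrightarrow> continuous_on UNIV f"
proof -
  assume "f \<in> FCb1"
  then obtain N \<phi> x' where rep: "cyl_rep f N \<phi> x'" unfolding FCb1_def by blast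
  then have f: "f = (\<lambda>x. \<phi> (\<lambda>n. blinfun_apply (x' n) x))" and \<phi>: "Cb1 N \<phi>" by (auto simp: cyl_rep_def)
  have "continuous_on UNIV (\<lambda>x j. blinfun_apply (x' j) x)"
    by (intro continuous_on_coordinatewise_then_product continuous_intros)
  then show ?thesis unfolding f by (rule continuous_on_compose2[OF Cb1_continuous[OF \<phi>]]) simp
qed

lemma FCb1_bounded: "f \<in> FCb1 \<Longrightarrow> \<exists>B. \<forall>x. \<bar>f x\<bar> \<le> B"
proof -
  assume "f \<in> FCb1"
  then obtain N \<phi> x' where f: "\<And>x. f x = \<phi> (\<lambda>n. blinfun_apply (x' n) x)" and \<phi>: "Cb1 N \<phi>"
    unfolding FCb1_def cyl_rep_def by auto
  show ?thesis using Cb1_bounded[OF \<phi>] unfolding f by auto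
qed

text \<open>The lists of functionals are concatenated: the first \<open>N\<close> coordinates feed
  \<open>\<phi>\<close>, and the next \<open>M\<close>, shifted down by \<open>N\<close>, feed
  \<open>\<psi>\<close>.\<close>

lemma FCb1_add:
  assumes "f \<in> FCb1" "g \<in> FCb1"
  shows "(\<lambda>x. f x + g x) \<in> FCb1"
proof -
  obtain N \<phi> x' where f: "1 \<le> N" "Cb1 N \<phi>" "\<And>x. f x = \<phi> (\<lambda>n. blinfun_apply (x' n) x)"
    using assms(1) unfolding FCb1_def cyl_rep_def by auto
  obtain M \<psi> y' where g: "1 \<le> M" "Cb1 M \<psi>" "\<And>x. g x = \<psi> (\<lambda>n. blinfun_apply (y' n) x)"
    using assms(2) unfolding FCb1_def cyl_rep_def by auto
  define shf where "shf u k = u (k + N)" for u :: "nat \<Rightarrow> real" and k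
  define \<eta> where "\<eta> u = \<phi> u + \<psi> (shf u)" for u
  define p where "p n u = (if n < N then partial_deriv n \<phi> u else partial_deriv (n - N) \<psi> (shf u))" for n u
  define z' where "z' k = (if k < N then x' k else y' (k - N))" for k
  have shc: "continuous_on UNIV shf"
    unfolding shf_def by (intro continuous_on_coordinatewise_then_product continuous_on_product_coordinates)
  obtain B1 B2 where B: "\<And>u. \<bar>\<phi> u\<bar> \<le> B1" "\<And>u. \<bar>\<psi> u\<bar> \<le> B2" using Cb1_bounded[OF f(2)] Cb1_bounded[OF g(2)] by blast
  have "Cb1 (N + M) \<eta>"
  proof (rule Cb1I(1)[where p = p and B = "B1 + B2" and C = "\<lambda>n. if n < N then (SOME C. \<forall>u. \<bar>partial_deriv n \<phi> u\<bar> \<le> C) else (SOME C. \<forall>u. \<bar>partial_deriv (n - N) \<psi> u\<bar> \<le> C)"])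
    show "\<eta> u = \<eta> v" if "\<And>j. j < N + M \<Longrightarrow> u j = v j" for u v
    proof -
      have "\<phi> u = \<phi> v" by (rule Cb1_dep[OF f(2)]) (simp add: that)
      moreover have "\<psi> (shf u) = \<psi> (shf v)" by (rule Cb1_dep[OF g(2)]) (simp add: that shf_def)
      ultimately show ?thesis by (simp add: \<eta>_def)
    qed
    show "continuous_on UNIV \<eta>"
      unfolding \<eta>_def by (intro continuous_on_add Cb1_continuous[OF f(2)] continuous_on_compose2[OF Cb1_continuous[OF g(2)] shc]) simp
    show "\<bar>\<eta> u\<bar> \<le> B1 + B2" for u using B(1)[of u] B(2)[of "shf u"] unfolding \<eta>_def by linarith
    show "((\<lambda>s. \<eta> (u(n := s))) has_real_derivative p n u) (at (u n))" if "n < N + M" for n u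
    proof (cases "n < N")
      case True
      have "shf (u(n := s)) = shf u" for s using True by (auto simp: shf_def)
      moreover have "((\<lambda>s. \<phi> (u(n := s)) + \<psi> (shf u)) has_real_derivative partial_deriv n \<phi> (u(n := u n)) + 0) (at (u n))"
        by (intro DERIV_add Cb1_DERIV[OF f(2) True] DERIV_const)
      ultimately show ?thesis using True by (simp add: \<eta>_def p_def)
    next
      case False
      have "\<phi> (u(n := s)) = \<phi> u" for s by (rule Cb1_dep[OF f(2)]) (use False in auto)
      moreover have "shf (u(n := s)) = (shf u)(n - N := s)" for s using False by (auto simp: shf_def fun_eq_iff)
      moreover have "((\<lambda>s. \<phi> u + \<psi> ((shf u)(n - N := s))) has_real_derivative 0 + partial_deriv (n - N) \<psi> ((shf u)(n - N := u n))) (at (u n))"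
        using that False by (intro DERIV_add Cb1_DERIV[OF g(2)] DERIV_const) auto
      moreover have "(shf u)(n - N := u n) = shf u" using False by (auto simp: shf_def fun_eq_iff)
      ultimately show ?thesis using False by (simp add: \<eta>_def p_def)
    qed
    show "continuous_on UNIV (p n)" if "n < N + M" for n
      using that unfolding p_def
      by (cases "n < N") (auto intro!: Cb1_partial_continuous[OF f(2)] continuous_on_compose2[OF Cb1_partial_continuous[OF g(2)] shc])
    show "\<bar>p n u\<bar> \<le> (if n < N then (SOME C. \<forall>u. \<bar>partial_deriv n \<phi> u\<bar> \<le> C) else (SOME C. \<forall>u. \<bar>partial_deriv (n - N) \<psi> u\<bar> \<le> C))"
      if "n < N + M" for n u
    proof (cases "n < N")
      case True
      show ?thesis using someI_ex[OF Cb1_partial_bounded[OF f(2) True]] True by (simp add: p_def)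
    next
      case False
      then have "n - N < M" using that by simp
      from someI_ex[OF Cb1_partial_bounded[OF g(2) this]] show ?thesis using False by (simp add: p_def)
    qed
  qed
  moreover have "f x + g x = \<eta> (\<lambda>n. blinfun_apply (z' n) x)" for x
  proof -
    have "\<phi> (\<lambda>n. blinfun_apply (z' n) x) = \<phi> (\<lambda>n. blinfun_apply (x' n) x)"
      by (rule Cb1_dep[OF f(2)]) (simp add: z'_def)
    moreover have "shf (\<lambda>n. blinfun_apply (z' n) x) = (\<lambda>n. blinfun_apply (y' n) x)" by (auto simp: shf_def z'_def)
    ultimately show ?thesis by (simp add: \<eta>_def f(3) g(3))
  qed
  ultimately have "cyl_rep (\<lambda>x. f x + g x) (N + M) \<eta> z'" using f(1) by (simp add: cyl_rep_def)
  then show ?thesis unfolding FCb1_def by blast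
qed

lemma FCb1_scale:
  assumes "f \<in> FCb1"
  shows "(\<lambda>x. c * f x) \<in> FCb1"
proof -
  obtain N \<phi> x' where f: "1 \<le> N" "Cb1 N \<phi>" "\<And>x. f x = \<phi> (\<lambda>n. blinfun_apply (x' n) x)"
    using assms unfolding FCb1_def cyl_rep_def by auto
  obtain B where B: "\<And>u. \<bar>\<phi> u\<bar> \<le> B" using Cb1_bounded[OF f(2)] by blast
  have "Cb1 N (\<lambda>u. c * \<phi> u)"
  proof (rule Cb1I(1)[where p = "\<lambda>n u. c * partial_deriv n \<phi> u" and B = "\<bar>c\<bar> * B" and C = "\<lambda>n. \<bar>c\<bar> * (SOME C. \<forall>u. \<bar>partial_deriv n \<phi> u\<bar> \<le> C)"])
    show "c * \<phi> u = c * \<phi> v" if "\<And>j. j < N \<Longrightarrow> u j = v j" for u v using Cb1_dep[OF f(2) that] by simp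
    show "continuous_on UNIV (\<lambda>u. c * \<phi> u)" by (intro continuous_intros Cb1_continuous[OF f(2)])
    show "\<bar>c * \<phi> u\<bar> \<le> \<bar>c\<bar> * B" for u unfolding abs_mult by (intro mult_left_mono B) auto
    show "((\<lambda>s. c * \<phi> (u(n := s))) has_real_derivative c * partial_deriv n \<phi> u) (at (u n))" if "n < N" for n u
      using DERIV_cmult[OF Cb1_DERIV[OF f(2) that, of u "u n"], of c] by simp
    show "continuous_on UNIV (\<lambda>u. c * partial_deriv n \<phi> u)" if "n < N" for n
      by (intro continuous_intros Cb1_partial_continuous[OF f(2) that])
    show "\<bar>c * partial_deriv n \<phi> u\<bar> \<le> \<bar>c\<bar> * (SOME C. \<forall>u. \<bar>partial_deriv n \<phi> u\<bar> \<le> C)" if "n < N" for n u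
      unfolding abs_mult using someI_ex[OF Cb1_partial_bounded[OF f(2) that]] by (intro mult_left_mono) auto
  qed
  then have "cyl_rep (\<lambda>x. c * f x) N (\<lambda>u. c * \<phi> u) x'" using f by (simp add: cyl_rep_def)
  then show ?thesis unfolding FCb1_def by blast
qed

text \<open>Both sides are compared through directional derivatives, which avoids relating the
  gradients of three representations.\<close>

lemma DH_add:
  fixes i :: "'h::{real_inner,complete_space} \<Rightarrow>\<^sub>L 'e::real_normed_vector"
  assumes "f \<in> FCb1" "g \<in> FCb1"
  shows "DH i (\<lambda>x. f x + g x) x = DH i f x + DH i g x"
proof (rule eq_if_inner_eq)
  fix k
  have "((\<lambda>\<epsilon>. f (x + \<epsilon> *\<^sub>R i k) + g (x + \<epsilon> *\<^sub>R i k)) has_real_derivative inner k (DH i f x) + inner k (DH i g x)) (at 0)"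
    by (intro DERIV_add DH_derivative assms)
  from DERIV_unique[OF DH_derivative[OF FCb1_add[OF assms]] this]
  show "inner k (DH i (\<lambda>x. f x + g x) x) = inner k (DH i f x + DH i g x)" by (simp add: inner_add_right)
qed

lemma DH_scale:
  fixes i :: "'h::{real_inner,complete_space} \<Rightarrow>\<^sub>L 'e::real_normed_vector"
  assumes "f \<in> FCb1"
  shows "DH i (\<lambda>x. c * f x) x = c *\<^sub>R DH i f x"
proof (rule eq_if_inner_eq)
  fix k
  have "((\<lambda>\<epsilon>. c * f (x + \<epsilon> *\<^sub>R i k)) has_real_derivative c * inner k (DH i f x)) (at 0)"
    by (intro DERIV_cmult DH_derivative assms)
  from DERIV_unique[OF DH_derivative[OF FCb1_scale[OF assms]] this]
  show "inner k (DH i (\<lambda>x. c * f x) x) = inner k (c *\<^sub>R DH i f x)" by simp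
qed

text \<open>Differentiation under the integral: the mean value theorem bounds the difference
  quotients by a constant, so dominated convergence applies. This is what keeps P(t) f
  cylindrical.\<close>

lemma Cb1_average:
  fixes Y :: "'a \<Rightarrow> nat \<Rightarrow> real"
  assumes M: "prob_space M" and Y: "Y \<in> borel_measurable M" and \<phi>: "Cb1 N \<phi>"
  shows "Cb1 N (\<lambda>u. \<integral>y. \<phi> (\<lambda>k. u k + Y y k) \<partial>M)"
    and "n < N \<Longrightarrow> partial_deriv n (\<lambda>u. \<integral>y. \<phi> (\<lambda>k. u k + Y y k) \<partial>M)
      = (\<lambda>u. \<integral>y. partial_deriv n \<phi> (\<lambda>k. u k + Y y k) \<partial>M)"
proof -
  interpret prob_space M by fact
  have Yk[measurable]: "(\<lambda>y. Y y k) \<in> borel_measurable M" for k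
    by (rule measurable_product_then_coordinatewise[OF Y])
  have shift: "(\<lambda>y k. u k + Y y k) \<in> borel_measurable M" for u :: "nat \<Rightarrow> real"
    by (rule measurable_coordinatewise_then_product) measurable
  have meas: "(\<lambda>y. \<psi> (\<lambda>k. u k + Y y k)) \<in> borel_measurable M" if "continuous_on UNIV \<psi>" for \<psi> :: "(nat \<Rightarrow> real) \<Rightarrow> real" and u
    by (rule borel_measurable_continuous_on[OF that shift])
  have int: "integrable M (\<lambda>y. \<psi> (\<lambda>k. u k + Y y k))" if "continuous_on UNIV \<psi>" "\<And>u. \<bar>\<psi> u\<bar> \<le> B" for \<psi> :: "(nat \<Rightarrow> real) \<Rightarrow> real" and u B
    by (rule integrable_const_bound[of _ B]) (use that meas in auto)
  have bnd: "\<bar>\<integral>y. \<psi> (\<lambda>k. u k + Y y k) \<partial>M\<bar> \<le> B" if "continuous_on UNIV \<psi>" "\<And>u. \<bar>\<psi> u\<bar> \<le> B" for \<psi> :: "(nat \<Rightarrow> real) \<Rightarrow> real" and u B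
  proof -
    have "\<bar>\<integral>y. \<psi> (\<lambda>k. u k + Y y k) \<partial>M\<bar> \<le> (\<integral>y. \<bar>\<psi> (\<lambda>k. u k + Y y k)\<bar> \<partial>M)" by (rule integral_abs_bound)
    also have "\<dots> \<le> (\<integral>y. B \<partial>M)" using int[OF that] that(2) by (intro integral_mono) auto
    finally show ?thesis by (simp add: prob_space)
  qed
  have cont: "continuous_on UNIV (\<lambda>u. \<integral>y. \<psi> (\<lambda>k. u k + Y y k) \<partial>M)"
    if c: "continuous_on UNIV \<psi>" and b: "\<And>u. \<bar>\<psi> u\<bar> \<le> B" for \<psi> :: "(nat \<Rightarrow> real) \<Rightarrow> real" and B
    unfolding continuous_on_sequentially
  proof (intro allI ballI impI, elim conjE)
    fix x :: "nat \<Rightarrow> nat \<Rightarrow> real" and a assume x: "x \<longlonglongrightarrow> a"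
    have xk: "(\<lambda>j. x j k) \<longlonglongrightarrow> a k" for k
      by (rule continuous_on_tendsto_compose[OF continuous_on_product_coordinates x]) auto
    have "(\<lambda>j. \<integral>y. \<psi> (\<lambda>k. x j k + Y y k) \<partial>M) \<longlonglongrightarrow> (\<integral>y. \<psi> (\<lambda>k. a k + Y y k) \<partial>M)"
    proof (rule integral_dominated_convergence[where w = "\<lambda>_. B"])
      show "AE y in M. (\<lambda>j. \<psi> (\<lambda>k. x j k + Y y k)) \<longlonglongrightarrow> \<psi> (\<lambda>k. a k + Y y k)"
        by (intro AE_I2 continuous_on_tendsto_compose[OF c] tendsto_sequenceI tendsto_intros xk) auto
    qed (use meas[OF c] b in auto)
    then show "((\<lambda>u. \<integral>y. \<psi> (\<lambda>k. u k + Y y k) \<partial>M) \<circ> x) \<longlonglongrightarrow> (\<integral>y. \<psi> (\<lambda>k. a k + Y y k) \<partial>M)"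
      by (simp add: comp_def)
  qed
  obtain B where B: "\<And>u. \<bar>\<phi> u\<bar> \<le> B" using Cb1_bounded[OF \<phi>] by blast
  define C where "C n = (SOME C. \<forall>u. \<bar>partial_deriv n \<phi> u\<bar> \<le> C)" for n
  have C: "\<bar>partial_deriv n \<phi> u\<bar> \<le> C n" if "n < N" for n u
    unfolding C_def using someI_ex[OF Cb1_partial_bounded[OF \<phi> that]] by blast
  define \<Phi> where "\<Phi> u = (\<integral>y. \<phi> (\<lambda>k. u k + Y y k) \<partial>M)" for u
  define p where "p n u = (\<integral>y. partial_deriv n \<phi> (\<lambda>k. u k + Y y k) \<partial>M)" for n u
  have deriv: "((\<lambda>s. \<Phi> (u(n := s))) has_real_derivative p n u) (at (u n))" if n: "n < N" for n u
  proof -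
    define \<psi> where "\<psi> y s = \<phi> ((\<lambda>k. u k + Y y k)(n := s + Y y n))" for y s
    have eq: "\<phi> (\<lambda>k. (u(n := s)) k + Y y k) = \<psi> y s" for s y
      unfolding \<psi>_def by (rule arg_cong[where f = \<phi>]) auto
    have d: "(\<psi> y has_real_derivative partial_deriv n \<phi> ((\<lambda>k. u k + Y y k)(n := s + Y y n))) (at s)" for y s
      unfolding \<psi>_def using DERIV_shift[of "\<lambda>s. \<phi> ((\<lambda>k. u k + Y y k)(n := s))" _ s "Y y n"] Cb1_DERIV[OF \<phi> n, of "\<lambda>k. u k + Y y k" "s + Y y n"] by simp
    have lip: "\<bar>\<psi> y b - \<psi> y a\<bar> \<le> C n * \<bar>b - a\<bar>" for y a b
    proof (cases a b rule: linorder_cases)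
      case less
      obtain z where "\<psi> y b - \<psi> y a = (b - a) * partial_deriv n \<phi> ((\<lambda>k. u k + Y y k)(n := z + Y y n))"
        using MVT2[OF less d] by auto
      then show ?thesis using C[OF n] less by (simp add: abs_mult mult.commute mult_left_mono)
    next
      case greater
      obtain z where "\<psi> y a - \<psi> y b = (a - b) * partial_deriv n \<phi> ((\<lambda>k. u k + Y y k)(n := z + Y y n))"
        using MVT2[OF greater d] by auto
      then have "\<bar>\<psi> y a - \<psi> y b\<bar> \<le> C n * \<bar>a - b\<bar>" using C[OF n] greater by (simp add: abs_mult mult.commute mult_left_mono)
      then show ?thesis by (simp add: abs_minus_commute)
    qed simp
    have mpsi: "(\<lambda>y. \<psi> y s) \<in> borel_measurable M" for s
      unfolding eq[symmetric] by (rule meas[OF Cb1_continuous[OF \<phi>]])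
    have ipsi: "integrable M (\<lambda>y. \<psi> y s)" for s
      unfolding eq[symmetric] by (rule int[OF Cb1_continuous[OF \<phi>] B])
    have "((\<lambda>h. (\<Phi> (u(n := u n + h)) - \<Phi> (u(n := u n))) / h) \<longlongrightarrow> p n u) (at 0)"
      unfolding tendsto_at_iff_sequentially
    proof (intro allI impI)
      fix X :: "nat \<Rightarrow> real" assume X0: "\<forall>j. X j \<in> UNIV - {0}" and X: "X \<longlonglongrightarrow> 0"
      have "(\<lambda>j. \<integral>y. (\<psi> y (u n + X j) - \<psi> y (u n)) / X j \<partial>M) \<longlonglongrightarrow> (\<integral>y. partial_deriv n \<phi> (\<lambda>k. u k + Y y k) \<partial>M)"
      proof (rule integral_dominated_convergence[where w = "\<lambda>_. C n"])
        show "AE y in M. (\<lambda>j. (\<psi> y (u n + X j) - \<psi> y (u n)) / X j) \<longlonglongrightarrow> partial_deriv n \<phi> (\<lambda>k. u k + Y y k)"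
        proof (rule AE_I2)
          fix y
          have "((\<lambda>h. (\<psi> y (u n + h) - \<psi> y (u n)) / h) \<longlongrightarrow> partial_deriv n \<phi> ((\<lambda>k. u k + Y y k)(n := u n + Y y n))) (at 0)"
            using d[of y "u n"] unfolding DERIV_def .
          then have "((\<lambda>h. (\<psi> y (u n + h) - \<psi> y (u n)) / h) \<circ> X) \<longlonglongrightarrow> partial_deriv n \<phi> ((\<lambda>k. u k + Y y k)(n := u n + Y y n))"
            unfolding tendsto_at_iff_sequentially using X0 X by blast
          moreover have "(\<lambda>k. u k + Y y k)(n := u n + Y y n) = (\<lambda>k. u k + Y y k)" by auto
          ultimately show "(\<lambda>j. (\<psi> y (u n + X j) - \<psi> y (u n)) / X j) \<longlonglongrightarrow> partial_deriv n \<phi> (\<lambda>k. u k + Y y k)"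
            by (simp only: comp_def)
        qed
        show "AE y in M. norm ((\<psi> y (u n + X j) - \<psi> y (u n)) / X j) \<le> C n" for j
        proof (rule AE_I2)
          fix y
          have "X j \<noteq> 0" using X0 by auto
          then show "norm ((\<psi> y (u n + X j) - \<psi> y (u n)) / X j) \<le> C n"
            using lip[of y "u n + X j" "u n"] by (simp add: divide_le_eq)
        qed
        show "(\<lambda>y. (\<psi> y (u n + X j) - \<psi> y (u n)) / X j) \<in> borel_measurable M" for j
          using mpsi by measurable
        show "(\<lambda>y. partial_deriv n \<phi> (\<lambda>k. u k + Y y k)) \<in> borel_measurable M"
          by (rule meas[OF Cb1_partial_continuous[OF \<phi> n]])
      qed simp
      moreover have "(\<integral>y. (\<psi> y (u n + h) - \<psi> y (u n)) / h \<partial>M) = (\<Phi> (u(n := u n + h)) - \<Phi> (u(n := u n))) / h" for h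
        unfolding \<Phi>_def eq by (simp add: ipsi)
      ultimately show "((\<lambda>h. (\<Phi> (u(n := u n + h)) - \<Phi> (u(n := u n))) / h) \<circ> X) \<longlonglongrightarrow> p n u"
        by (simp only: comp_def p_def)
    qed
    then show ?thesis unfolding DERIV_def .
  qed
  have res: "Cb1 N \<Phi> \<and> (\<forall>n<N. partial_deriv n \<Phi> = p n)"
  proof -
    have dep: "\<Phi> u = \<Phi> v" if "\<And>j. j < N \<Longrightarrow> u j = v j" for u v
      unfolding \<Phi>_def by (intro Bochner_Integration.integral_cong refl Cb1_dep[OF \<phi>]) (simp add: that)
    have "continuous_on UNIV \<Phi>" unfolding \<Phi>_def by (rule cont[OF Cb1_continuous[OF \<phi>] B])
    moreover have "\<bar>\<Phi> u\<bar> \<le> B" for u unfolding \<Phi>_def by (rule bnd[OF Cb1_continuous[OF \<phi>] B])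
    moreover have "continuous_on UNIV (p n)" if "n < N" for n
      unfolding p_def by (rule cont[OF Cb1_partial_continuous[OF \<phi> that] C[OF that]])
    moreover have "\<bar>p n u\<bar> \<le> C n" if "n < N" for n u
      unfolding p_def by (rule bnd[OF Cb1_partial_continuous[OF \<phi> that] C[OF that]])
    ultimately show ?thesis
      using Cb1I[of N \<Phi> B p C, OF dep _ _ deriv] by blast
  qed
  show "Cb1 N (\<lambda>u. \<integral>y. \<phi> (\<lambda>k. u k + Y y k) \<partial>M)"
    using res unfolding \<Phi>_def[abs_def] by blast
  show "n < N \<Longrightarrow> partial_deriv n (\<lambda>u. \<integral>y. \<phi> (\<lambda>k. u k + Y y k) \<partial>M)
      = (\<lambda>u. \<integral>y. partial_deriv n \<phi> (\<lambda>k. u k + Y y k) \<partial>M)"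
    using res unfolding \<Phi>_def[abs_def] p_def[abs_def] by blast
qed

section \<open>The Gaussian gradient bound\<close>

text \<open>A crude decay rate, enough to remove the boundary terms in the integration by
  parts.\<close>

lemma std_normal_density_le_inverse: "x \<noteq> 0 \<Longrightarrow> std_normal_density x \<le> inverse \<bar>x\<bar>"
proof -
  assume x: "x \<noteq> 0"
  have "0 \<le> (\<bar>x\<bar> - 1)\<^sup>2 + 1" by simp
  then have "\<bar>x\<bar> \<le> 1 + x\<^sup>2 / 2" by (simp add: power2_diff)
  also have "\<dots> \<le> exp (x\<^sup>2 / 2)" by (rule exp_ge_add_one_self)
  finally have "exp (- (x\<^sup>2 / 2)) \<le> inverse \<bar>x\<bar>"
    unfolding exp_minus using x by (intro le_imp_inverse_le) auto
  moreover have "1 / sqrt (2 * pi) \<le> 1" using pi_ge_two by simp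
  ultimately have "1 / sqrt (2 * pi) * exp (- (x\<^sup>2 / 2)) \<le> 1 * inverse \<bar>x\<bar>" by (intro mult_mono) auto
  then show ?thesis by (simp add: std_normal_density_def)
qed

text \<open>Stein's identity. The density n satisfies n'(x) = -x n(x), so the derivative of \<psi> n
  is the difference of the two integrands, and \<psi> n vanishes at infinity.\<close>

lemma std_normal_integration_by_parts:
  fixes \<psi> \<psi>' :: "real \<Rightarrow> real"
  assumes d: "\<And>x. (\<psi> has_real_derivative \<psi>' x) (at x)" and c: "continuous_on UNIV \<psi>'"
    and B: "\<And>x. \<bar>\<psi> x\<bar> \<le> B" and C: "\<And>x. \<bar>\<psi>' x\<bar> \<le> C"
  shows "(\<integral>x. \<psi>' x \<partial>std_normal_distribution) = (\<integral>x. \<psi> x * x \<partial>std_normal_distribution)"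
    and "integrable std_normal_distribution (\<lambda>x. \<psi> x * x)"
proof -
  let ?n = std_normal_density
  have \<psi>c: "continuous_on UNIV \<psi>" by (intro continuous_at_imp_continuous_on ballI DERIV_isCont[OF d])
  note [measurable] = borel_measurable_continuous_onI[OF c] borel_measurable_continuous_onI[OF \<psi>c]
  have dn: "(?n has_real_derivative - x * ?n x) (at x)" for x
  proof -
    define a where "a = 1 / sqrt (2 * pi)"
    have n: "?n = (\<lambda>x. a * exp (- x\<^sup>2 / 2))" by (simp add: std_normal_density_def a_def fun_eq_iff)
    show ?thesis unfolding n by (auto intro!: derivative_eq_intros)
  qed
  define F where "F x = \<psi> x * ?n x" for x
  define f where "f x = \<psi>' x * ?n x - \<psi> x * x * ?n x" for x
  have dF: "(F has_real_derivative f x) (at x)" for x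
    unfolding F_def f_def using DERIV_mult[OF d dn] by (simp add: algebra_simps)
  have fc: "isCont f x" for x
  proof -
    have "isCont \<psi>' x" by (rule bspec[OF iffD1[OF continuous_on_eq_continuous_at[OF open_UNIV] c] UNIV_I])
    then show ?thesis unfolding f_def by (intro continuous_intros DERIV_isCont[OF d] DERIV_isCont[OF dn])
  qed
  have i0: "integrable lborel (\<lambda>x. ?n x)" using integrable_std_normal_moment[of 0] by simp
  have i1: "integrable lborel (\<lambda>x. ?n x * x)" using integrable_std_normal_moment[of 1] by simp
  have j1: "integrable lborel (\<lambda>x. \<psi>' x * ?n x)"
  proof (rule Bochner_Integration.integrable_bound[OF integrable_mult_right[OF i0, of C]])
    show "AE x in lborel. norm (\<psi>' x * ?n x) \<le> norm (C * ?n x)"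
      using C by (intro AE_I2) (auto simp: abs_mult intro!: mult_right_mono order_trans[OF C])
  qed measurable
  have j2: "integrable lborel (\<lambda>x. \<psi> x * x * ?n x)"
  proof (rule Bochner_Integration.integrable_bound[OF integrable_mult_right[OF i1, of B]])
    have "norm (\<psi> x * x * ?n x) \<le> norm (B * (?n x * x))" for x
    proof -
      have "\<bar>\<psi> x\<bar> * (\<bar>x\<bar> * \<bar>?n x\<bar>) \<le> \<bar>B\<bar> * (\<bar>x\<bar> * \<bar>?n x\<bar>)"
        by (intro mult_right_mono order_trans[OF B abs_ge_self]) auto
      then show ?thesis by (simp add: abs_mult mult_ac)
    qed
    then show "AE x in lborel. norm (\<psi> x * x * ?n x) \<le> norm (B * (?n x * x))" by (intro AE_I2)
  qed measurable
  have jf: "integrable lborel f" unfolding f_def by (intro Bochner_Integration.integrable_diff j1 j2)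
  have F0: "(F \<longlongrightarrow> 0) at_infinity"
  proof (rule Lim_null_comparison)
    have "((\<lambda>x::real. \<bar>B\<bar> * norm (inverse x)) \<longlongrightarrow> \<bar>B\<bar> * norm (0::real)) at_infinity"
      by (intro tendsto_intros tendsto_inverse_0)
    then show "((\<lambda>x::real. \<bar>B\<bar> * norm (inverse x)) \<longlongrightarrow> 0) at_infinity" by simp
    have "norm (F x) \<le> \<bar>B\<bar> * norm (inverse x)" if "x \<noteq> 0" for x
    proof -
      have "norm (F x) = \<bar>\<psi> x\<bar> * ?n x" by (simp add: F_def abs_mult normal_density_nonneg)
      also have "\<dots> \<le> \<bar>B\<bar> * inverse \<bar>x\<bar>"
        by (intro mult_mono order_trans[OF B abs_ge_self] std_normal_density_le_inverse that) auto
      finally show ?thesis by simp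
    qed
    moreover have "\<forall>\<^sub>F x in at_infinity. x \<noteq> (0::real)"
      unfolding eventually_at_infinity by (intro exI[of _ 1]) auto
    ultimately show "\<forall>\<^sub>F x in at_infinity. norm (F x) \<le> \<bar>B\<bar> * norm (inverse x)"
      by (auto elim: eventually_mono)
  qed
  have "(LBINT x=-\<infinity>..\<infinity>. f x) = 0 - 0"
  proof (rule interval_integral_FTC_integrable[where F = F])
    show "(F has_vector_derivative f x) (at x)" for x
      using dF by (simp add: has_real_derivative_iff_has_vector_derivative)
    show "set_integrable lborel (einterval (-\<infinity>) \<infinity>) f" using jf by (simp add: set_integrable_def)
    show "((F \<circ> real_of_ereal) \<longlongrightarrow> 0) (at_right (-\<infinity>))"
      unfolding at_right_MInf filterlim_filtermap comp_def real_of_ereal.simps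
      by (rule tendsto_mono[OF at_bot_le_at_infinity F0])
    show "((F \<circ> real_of_ereal) \<longlongrightarrow> 0) (at_left \<infinity>)"
      unfolding at_left_PInf filterlim_filtermap comp_def real_of_ereal.simps
      by (rule tendsto_mono[OF at_top_le_at_infinity F0])
  qed (simp_all add: fc)
  then have "(\<integral>x. f x \<partial>lborel) = 0"
    by (simp add: interval_lebesgue_integral_def set_lebesgue_integral_def)
  then have "(\<integral>x. \<psi>' x * ?n x \<partial>lborel) = (\<integral>x. \<psi> x * x * ?n x \<partial>lborel)"
    unfolding f_def by (simp add: Bochner_Integration.integral_diff[OF j1 j2])
  moreover have "(\<integral>x. g x \<partial>std_normal_distribution) = (\<integral>x. g x * ?n x \<partial>lborel)"
    if "g \<in> borel_measurable borel" for g
    using that by (subst integral_density) (auto simp: normal_density_nonneg mult.commute)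
  ultimately show "(\<integral>x. \<psi>' x \<partial>std_normal_distribution) = (\<integral>x. \<psi> x * x \<partial>std_normal_distribution)" by simp
  show "integrable std_normal_distribution (\<lambda>x. \<psi> x * x)"
    using j2 by (subst integrable_density) (auto simp: normal_density_nonneg mult.commute)
qed

text \<open>Fractional powers are dominated by 1 plus an even integer moment.\<close>

lemma integrable_std_normal_powr:
  assumes "0 \<le> r"
  shows "integrable std_normal_distribution (\<lambda>x. \<bar>x\<bar> powr r)"
proof -
  interpret N: prob_space std_normal_distribution by (rule prob_space_normal_density) simp
  obtain k :: nat where k: "r \<le> real k" using real_arch_simple by blast
  have int: "integrable std_normal_distribution (\<lambda>x. 1 + x ^ (2 * k))"
    by (intro Bochner_Integration.integrable_add integrable_std_normal_distribution_moment N.integrable_const)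
  have le: "\<bar>x\<bar> powr r \<le> 1 + x ^ (2 * k)" for x :: real
  proof (cases "\<bar>x\<bar> \<le> 1")
    case True
    then have "\<bar>x\<bar> powr r \<le> 1" using assms by (simp add: powr_le1)
    then show ?thesis by (simp add: add_increasing2)
  next
    case False
    then have "\<bar>x\<bar> powr r \<le> \<bar>x\<bar> powr real (2 * k)" using k by (intro powr_mono) auto
    also have "\<dots> = \<bar>x\<bar> ^ (2 * k)" using False by (subst powr_realpow) auto
    finally show ?thesis by (simp add: power_even_abs)
  qed
  show ?thesis
  proof (rule Bochner_Integration.integrable_bound[OF int])
    show "AE x in std_normal_distribution. norm (\<bar>x\<bar> powr r) \<le> norm (1 + x ^ (2 * k))"
      by (intro AE_I2) (use order_trans[OF le abs_ge_self] in simp)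
  qed simp
qed

lemma pair_integral_snd:
  fixes h :: "'b \<Rightarrow> real"
  assumes M: "prob_space M" and N: "prob_space N" and h: "integrable N h"
  shows "integrable (M \<Otimes>\<^sub>M N) (\<lambda>z. h (snd z))" "(\<integral>z. h (snd z) \<partial>(M \<Otimes>\<^sub>M N)) = (\<integral>y. h y \<partial>N)"
proof -
  interpret M: prob_space M by fact
  interpret N: prob_space N by fact
  interpret P: pair_prob_space M N ..
  have [measurable]: "h \<in> borel_measurable N" using h by (rule borel_measurable_integrable)
  show i: "integrable (M \<Otimes>\<^sub>M N) (\<lambda>z. h (snd z))"
    by (rule P.Fubini_integrable) (use h in auto)
  show "(\<integral>z. h (snd z) \<partial>(M \<Otimes>\<^sub>M N)) = (\<integral>y. h y \<partial>N)"
    using P.integral_fst'[OF i] by (simp add: M.prob_space)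
qed

definition gauss_abs_moment :: "real \<Rightarrow> real" where
  "gauss_abs_moment r = (\<integral>x. \<bar>x\<bar> powr r \<partial>std_normal_distribution)"

lemma gauss_abs_moment_nonneg: "0 \<le> gauss_abs_moment r"
  by (simp add: gauss_abs_moment_def)

text \<open>A Gaussian sequence whose covariance dominates \<open>v \<otimes> v / \<sigma>\<^sup>2\<close> has the law of \<open>Y + (v / \<sigma>) \<gamma>\<close> with
  a standard Gaussian \<open>\<gamma>\<close> independent of \<open>Y\<close>. Integrating by parts in \<open>\<gamma>\<close> and applying Young's
  inequality bounds the derivative in the direction \<open>v\<close>.\<close>

lemma gaussian_gradient_bound:
  fixes X :: "'a \<Rightarrow> nat \<Rightarrow> real"
  assumes M: "prob_space M" and X: "X \<in> borel_measurable M" and q: "psd q"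
    and char: "\<And>n c. (CLINT y|M. iexp (\<Sum>k<n. c k * X y k)) = exp (- (\<Sum>j<n. \<Sum>k<n. c j * c k * q j k) / 2)"
    and \<sigma>: "0 < \<sigma>" and dom: "\<And>n c. (\<Sum>k<n. c k * v k)\<^sup>2 \<le> \<sigma>\<^sup>2 * (\<Sum>j<n. \<Sum>k<n. c j * c k * q j k)"
    and \<phi>: "Cb1 N \<phi>" and p: "1 < p" and \<alpha>: "0 < \<alpha>"
    and A: "(\<integral>y. \<bar>\<phi> (\<lambda>k. z k + X y k)\<bar> powr p \<partial>M) \<le> \<alpha> powr p"
  shows "\<bar>\<integral>y. (\<Sum>n<N. v n * partial_deriv n \<phi> (\<lambda>k. z k + X y k)) \<partial>M\<bar>
    \<le> \<sigma> * \<alpha> * (1 + gauss_abs_moment (p / (p - 1)))"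
proof -
  interpret M: prob_space M by fact
  interpret G: prob_space gauss_seq by (rule prob_space_gauss_seq)
  interpret S: real_distribution std_normal_distribution by (rule real_dist_normal_dist)
  interpret P: pair_prob_space gauss_seq std_normal_distribution ..
  define r where "r = p / (p - 1)"
  \<comment> \<open>The covariance that remains after splitting off the rank one part in the
    direction \<open>v\<close>; \<open>dom\<close> is exactly its positivity.\<close>
  define q0 where "q0 j k = q j k - v j * v k / \<sigma>\<^sup>2" for j k
  have q0sum: "(\<Sum>j<n. \<Sum>k<n. c j * c k * q0 j k) = (\<Sum>j<n. \<Sum>k<n. c j * c k * q j k) - (\<Sum>k<n. c k * v k)\<^sup>2 / \<sigma>\<^sup>2" for n c
  proof -
    have "(\<Sum>j<n. \<Sum>k<n. c j * c k * q0 j k) = (\<Sum>j<n. \<Sum>k<n. c j * c k * q j k) - (\<Sum>j<n. \<Sum>k<n. (c j * v j) * (c k * v k) / \<sigma>\<^sup>2)"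
      by (simp add: q0_def sum_subtractf[symmetric] algebra_simps)
    also have "(\<Sum>j<n. \<Sum>k<n. (c j * v j) * (c k * v k) / \<sigma>\<^sup>2) = (\<Sum>k<n. c k * v k)\<^sup>2 / \<sigma>\<^sup>2"
      unfolding power2_eq_square sum_product sum_divide_distrib ..
    finally show ?thesis .
  qed
  have "psd q0"
    unfolding psd_def
  proof (intro conjI allI)
    show "q0 j k = q0 k j" for j k by (simp add: q0_def psd_sym[OF q, of j k] mult.commute)
    show "0 \<le> (\<Sum>j<n. \<Sum>k<n. c j * c k * q0 j k)" for n c
      unfolding q0sum using dom[of c n] \<sigma> by (simp add: field_simps)
  qed
  then obtain Y :: "(nat \<Rightarrow> real) \<Rightarrow> nat \<Rightarrow> real" where Ym: "Y \<in> borel_measurable gauss_seq"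
    and Y: "\<And>n c. (CLINT u|gauss_seq. iexp (\<Sum>k<n. c k * Y u k)) = exp (- (\<Sum>j<n. \<Sum>k<n. c j * c k * q0 j k) / 2)"
    using gaussian_sequence_exists by blast
  have Yc[measurable]: "(\<lambda>u. Y u k) \<in> borel_measurable gauss_seq" for k
    by (rule measurable_product_then_coordinatewise[OF Ym])
  let ?\<Omega> = "gauss_seq \<Otimes>\<^sub>M std_normal_distribution"
  define W where "W w = (\<lambda>k. Y (fst w) k + snd w * (v k / \<sigma>))" for w
  have Wm: "W \<in> borel_measurable ?\<Omega>"
    unfolding W_def by (rule measurable_coordinatewise_then_product) measurable
  have law: "distr M borel X = distr ?\<Omega> borel W"
  proof (rule sequence_law_distr_eqI[OF M P.prob_space_axioms X Wm])
    fix n c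
    define V where "V = (\<Sum>k<n. c k * v k)"
    define Q where "Q = (\<Sum>j<n. \<Sum>k<n. c j * c k * q j k)"
    have lin: "(\<Sum>k<n. c k * W w k) = (\<Sum>k<n. c k * Y (fst w) k) + (V / \<sigma>) * snd w" for w
      by (simp add: W_def V_def distrib_left sum.distrib sum_divide_distrib sum_distrib_left sum_distrib_right mult_ac)
    have "(CLINT w|?\<Omega>. iexp (\<Sum>k<n. c k * W w k))
        = (CLINT u|gauss_seq. iexp (\<Sum>k<n. c k * Y u k)) * (CLINT g|std_normal_distribution. iexp ((V / \<sigma>) * g))"
      unfolding lin by (rule pair_char) (simp_all add: prob_space_gauss_seq S.prob_space_axioms)
    also have "(CLINT g|std_normal_distribution. iexp ((V / \<sigma>) * g)) = complex_of_real (exp (- ((V / \<sigma>)\<^sup>2) / 2))"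
      using fun_cong[OF char_std_normal_distribution, of "V / \<sigma>"] by (simp only: char_def)
    also have "(CLINT u|gauss_seq. iexp (\<Sum>k<n. c k * Y u k)) = complex_of_real (exp (- (Q - V\<^sup>2 / \<sigma>\<^sup>2) / 2))"
      unfolding Y q0sum Q_def V_def ..
    also have "complex_of_real (exp (- (Q - V\<^sup>2 / \<sigma>\<^sup>2) / 2)) * complex_of_real (exp (- ((V / \<sigma>)\<^sup>2) / 2)) = complex_of_real (exp (- Q / 2))"
      unfolding of_real_mult[symmetric] exp_add[symmetric] by (simp add: power_divide field_simps)
    also have "\<dots> = (CLINT y|M. iexp (\<Sum>k<n. c k * X y k))" unfolding char Q_def ..
    finally show "(CLINT y|M. iexp (\<Sum>k<n. c k * X y k)) = (CLINT w|?\<Omega>. iexp (\<Sum>k<n. c k * W w k))" by simp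
  qed
  have shift[measurable]: "(\<lambda>w k. z k + w k) \<in> borel_measurable borel"
    by (intro borel_measurable_continuous_onI continuous_on_coordinatewise_then_product continuous_intros continuous_on_product_coordinates)
  have change: "(\<integral>y. \<psi> (\<lambda>k. z k + X y k) \<partial>M) = (\<integral>w. \<psi> (\<lambda>k. z k + W w k) \<partial>?\<Omega>)"
    if \<psi>: "\<psi> \<in> borel_measurable borel" for \<psi> :: "(nat \<Rightarrow> real) \<Rightarrow> real"
  proof -
    have m: "(\<lambda>w. \<psi> (\<lambda>k. z k + w k)) \<in> borel_measurable borel"
      using measurable_comp[OF shift \<psi>] by (simp add: comp_def)
    have "(\<integral>y. \<psi> (\<lambda>k. z k + X y k) \<partial>M) = (\<integral>w. \<psi> (\<lambda>k. z k + w k) \<partial>distr M borel X)"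
      by (rule integral_distr[OF X m, symmetric])
    also have "\<dots> = (\<integral>w. \<psi> (\<lambda>k. z k + W w k) \<partial>?\<Omega>)"
      unfolding law by (rule integral_distr[OF Wm m])
    finally show ?thesis .
  qed
  have Wz: "(\<lambda>w k. z k + W w k) \<in> borel_measurable ?\<Omega>"
    using measurable_comp[OF Wm shift] by (simp add: comp_def)
  have \<phi>b[measurable]: "\<phi> \<in> borel_measurable borel" by (rule borel_measurable_continuous_onI[OF Cb1_continuous[OF \<phi>]])
  have \<phi>W[measurable]: "(\<lambda>w. \<phi> (\<lambda>k. z k + W w k)) \<in> borel_measurable ?\<Omega>"
    using measurable_comp[OF Wz \<phi>b] by (simp add: comp_def)
  define D where "D u = (\<Sum>n<N. v n * partial_deriv n \<phi> u)" for u
  have Dc: "continuous_on UNIV D"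
    unfolding D_def by (intro continuous_intros Cb1_partial_continuous[OF \<phi>]) auto
  have Dm[measurable]: "D \<in> borel_measurable borel" by (rule borel_measurable_continuous_onI[OF Dc])
  have DW[measurable]: "(\<lambda>w. D (\<lambda>k. z k + W w k)) \<in> borel_measurable ?\<Omega>"
    using measurable_comp[OF Wz Dm] by (simp add: comp_def)
  obtain B where B: "\<And>u. \<bar>\<phi> u\<bar> \<le> B" using Cb1_bounded[OF \<phi>] by blast
  define C where "C n = (SOME C. \<forall>u. \<bar>partial_deriv n \<phi> u\<bar> \<le> C)" for n
  have C: "\<bar>partial_deriv n \<phi> u\<bar> \<le> C n" if "n < N" for n u
    unfolding C_def using someI_ex[OF Cb1_partial_bounded[OF \<phi> that]] by blast
  define DB where "DB = (\<Sum>n<N. \<bar>v n\<bar> * C n)"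
  have DB: "\<bar>D u\<bar> \<le> DB" for u
    unfolding D_def DB_def
    by (rule order_trans[OF sum_abs]) (auto simp: abs_mult intro!: sum_mono mult_left_mono C)
  \<comment> \<open>For fixed \<open>u\<close> the argument moves along a line with direction v /
    \<sigma> as \<open>g\<close> varies; the factor \<sigma> compensates for this scaling.\<close>
  have stein: "(\<integral>g. D (\<lambda>k. z k + W (u, g) k) \<partial>std_normal_distribution) = \<sigma> * (\<integral>g. \<phi> (\<lambda>k. z k + W (u, g) k) * g \<partial>std_normal_distribution)" for u
  proof -
    have arg: "(\<lambda>k. z k + W (u, g) k) = (\<lambda>k. (z k + Y u k) + g * (v k / \<sigma>))" for g
      by (simp add: W_def add.assoc)
    have line: "continuous_on UNIV (\<lambda>g k. (z k + Y u k) + g * (v k / \<sigma>))"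
      by (intro continuous_on_coordinatewise_then_product continuous_intros)
    have "(\<integral>g. D (\<lambda>k. (z k + Y u k) + g * (v k / \<sigma>)) / \<sigma> \<partial>std_normal_distribution)
        = (\<integral>g. \<phi> (\<lambda>k. (z k + Y u k) + g * (v k / \<sigma>)) * g \<partial>std_normal_distribution)"
    proof (rule std_normal_integration_by_parts(1))
      show "((\<lambda>g. \<phi> (\<lambda>k. (z k + Y u k) + g * (v k / \<sigma>))) has_real_derivative D (\<lambda>k. (z k + Y u k) + g * (v k / \<sigma>)) / \<sigma>) (at g)" for g
        using Cb1_line_derivative[OF \<phi>, of "\<lambda>k. z k + Y u k" "\<lambda>k. v k / \<sigma>" g]
        by (simp add: D_def sum_divide_distrib)
      show "continuous_on UNIV (\<lambda>g. D (\<lambda>k. (z k + Y u k) + g * (v k / \<sigma>)) / \<sigma>)"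
        using \<sigma> by (intro continuous_intros continuous_on_compose2[OF Dc line]) auto
      show "\<bar>\<phi> (\<lambda>k. (z k + Y u k) + g * (v k / \<sigma>))\<bar> \<le> B" for g by (rule B)
      show "\<bar>D (\<lambda>k. (z k + Y u k) + g * (v k / \<sigma>)) / \<sigma>\<bar> \<le> DB / \<sigma>" for g
        using \<sigma> DB by (simp add: divide_right_mono)
    qed
    then show ?thesis unfolding arg using \<sigma> by (simp add: field_simps)
  qed
  have id1: "integrable std_normal_distribution (\<lambda>x::real. \<bar>x\<bar>)"
    using integrable_std_normal_powr[of 1] by simp
  have ig: "integrable ?\<Omega> (\<lambda>w. \<bar>snd w\<bar>)"
    using pair_integral_snd(1)[OF prob_space_gauss_seq S.prob_space_axioms id1] .
  have iphi: "integrable ?\<Omega> (\<lambda>w. \<phi> (\<lambda>k. z k + W w k) * snd w)"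
  proof (rule Bochner_Integration.integrable_bound[OF integrable_mult_right[OF ig, of B]])
    show "AE w in ?\<Omega>. norm (\<phi> (\<lambda>k. z k + W w k) * snd w) \<le> norm (B * \<bar>snd w\<bar>)"
      by (intro AE_I2) (simp add: abs_mult mult_right_mono order_trans[OF B abs_ge_self])
  qed measurable
  have iD: "integrable ?\<Omega> (\<lambda>w. D (\<lambda>k. z k + W w k))"
    by (rule P.integrable_const_bound[of _ DB]) (use DB in auto)
  have "(\<integral>y. D (\<lambda>k. z k + X y k) \<partial>M) = (\<integral>w. D (\<lambda>k. z k + W w k) \<partial>?\<Omega>)" by (rule change[OF Dm])
  also have "\<dots> = (\<integral>u. \<integral>g. D (\<lambda>k. z k + W (u, g) k) \<partial>std_normal_distribution \<partial>gauss_seq)"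
    by (rule P.integral_fst'[OF iD, symmetric])
  also have "\<dots> = \<sigma> * (\<integral>u. \<integral>g. \<phi> (\<lambda>k. z k + W (u, g) k) * g \<partial>std_normal_distribution \<partial>gauss_seq)"
    unfolding stein by simp
  also have "(\<integral>u. \<integral>g. \<phi> (\<lambda>k. z k + W (u, g) k) * g \<partial>std_normal_distribution \<partial>gauss_seq) = (\<integral>w. \<phi> (\<lambda>k. z k + W w k) * snd w \<partial>?\<Omega>)"
    using P.integral_fst'[OF iphi] by simp
  finally have eq: "(\<integral>y. D (\<lambda>k. z k + X y k) \<partial>M) = \<sigma> * (\<integral>w. \<phi> (\<lambda>k. z k + W w k) * snd w \<partial>?\<Omega>)" .
  have r: "1 < r" "1 / p + 1 / r = 1" using p by (simp_all add: r_def field_simps)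
  have ir: "integrable std_normal_distribution (\<lambda>x::real. \<bar>x\<bar> powr r)"
    using r by (intro integrable_std_normal_powr) simp
  have irO: "integrable ?\<Omega> (\<lambda>w. \<bar>snd w\<bar> powr r)"
    and intr: "(\<integral>w. \<bar>snd w\<bar> powr r \<partial>?\<Omega>) = gauss_abs_moment r"
    using pair_integral_snd[OF prob_space_gauss_seq S.prob_space_axioms ir] by (simp_all add: gauss_abs_moment_def)
  have ip: "integrable ?\<Omega> (\<lambda>w. \<bar>\<phi> (\<lambda>k. z k + W w k)\<bar> powr p)"
  proof (rule P.integrable_const_bound[of _ "B powr p"])
    show "AE w in ?\<Omega>. norm (\<bar>\<phi> (\<lambda>k. z k + W w k)\<bar> powr p) \<le> B powr p"
      using p by (intro AE_I2) (simp add: powr_mono2 B)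
  qed measurable
  have A': "(\<integral>w. \<bar>\<phi> (\<lambda>k. z k + W w k)\<bar> powr p \<partial>?\<Omega>) \<le> \<alpha> powr p"
    using A change[of "\<lambda>u. \<bar>\<phi> u\<bar> powr p"] by simp
  have "\<bar>\<integral>w. \<phi> (\<lambda>k. z k + W w k) * snd w \<partial>?\<Omega>\<bar> \<le> (\<integral>w. \<bar>\<phi> (\<lambda>k. z k + W w k) * snd w\<bar> \<partial>?\<Omega>)"
    by (rule integral_abs_bound)
  \<comment> \<open>Young's inequality for |\<phi>| / \<alpha> and |g|. Dividing by \<alpha> first
    makes the p-th moment of the first factor at most 1, which gives the bound the homogeneity of
    Hoelder's inequality.\<close>
  also have "\<dots> \<le> (\<integral>w. \<alpha> * (\<bar>\<phi> (\<lambda>k. z k + W w k)\<bar> powr p / \<alpha> powr p / p + \<bar>snd w\<bar> powr r / r) \<partial>?\<Omega>)"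
  proof (rule integral_mono)
    show "integrable ?\<Omega> (\<lambda>w. \<bar>\<phi> (\<lambda>k. z k + W w k) * snd w\<bar>)" using iphi by simp
    show "integrable ?\<Omega> (\<lambda>w. \<alpha> * (\<bar>\<phi> (\<lambda>k. z k + W w k)\<bar> powr p / \<alpha> powr p / p + \<bar>snd w\<bar> powr r / r))"
      by (intro integrable_mult_right Bochner_Integration.integrable_add integrable_divide ip irO)
    fix w
    have "(\<bar>\<phi> (\<lambda>k. z k + W w k)\<bar> / \<alpha>) * \<bar>snd w\<bar> \<le> (\<bar>\<phi> (\<lambda>k. z k + W w k)\<bar> / \<alpha>) powr p / p + \<bar>snd w\<bar> powr r / r"
      using \<alpha> by (intro Youngs_inequality p r) auto
    then have "\<alpha> * ((\<bar>\<phi> (\<lambda>k. z k + W w k)\<bar> / \<alpha>) * \<bar>snd w\<bar>)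
        \<le> \<alpha> * ((\<bar>\<phi> (\<lambda>k. z k + W w k)\<bar> / \<alpha>) powr p / p + \<bar>snd w\<bar> powr r / r)"
      using \<alpha> by (intro mult_left_mono) auto
    then show "\<bar>\<phi> (\<lambda>k. z k + W w k) * snd w\<bar> \<le> \<alpha> * (\<bar>\<phi> (\<lambda>k. z k + W w k)\<bar> powr p / \<alpha> powr p / p + \<bar>snd w\<bar> powr r / r)"
      using \<alpha> by (simp add: abs_mult powr_divide)
  qed
  also have "\<dots> = \<alpha> * ((\<integral>w. \<bar>\<phi> (\<lambda>k. z k + W w k)\<bar> powr p \<partial>?\<Omega>) / \<alpha> powr p / p + gauss_abs_moment r / r)"
    using ip irO by (simp add: intr)
  also have "\<dots> \<le> \<alpha> * (1 + gauss_abs_moment r)"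
  \<comment> \<open>The factors 1/p and 1/r from Young's inequality are bounded by 1.\<close>
  proof (intro mult_left_mono add_mono)
    have "(\<integral>w. \<bar>\<phi> (\<lambda>k. z k + W w k)\<bar> powr p \<partial>?\<Omega>) / \<alpha> powr p \<le> 1" using A' \<alpha> by simp
    then have "(\<integral>w. \<bar>\<phi> (\<lambda>k. z k + W w k)\<bar> powr p \<partial>?\<Omega>) / \<alpha> powr p / p \<le> 1 / p"
      using p by (intro divide_right_mono) auto
    also have "1 / p \<le> 1" using p by simp
    finally show "(\<integral>w. \<bar>\<phi> (\<lambda>k. z k + W w k)\<bar> powr p \<partial>?\<Omega>) / \<alpha> powr p / p \<le> 1" .
    show "gauss_abs_moment r / r \<le> gauss_abs_moment r"
      using r gauss_abs_moment_nonneg[of r] by (simp add: divide_le_eq mult_le_cancel_left1)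
  qed (use \<alpha> in simp)
  finally have le: "\<bar>\<integral>w. \<phi> (\<lambda>k. z k + W w k) * snd w \<partial>?\<Omega>\<bar> \<le> \<alpha> * (1 + gauss_abs_moment r)" .
  have "\<bar>\<integral>y. D (\<lambda>k. z k + X y k) \<partial>M\<bar> = \<sigma> * \<bar>\<integral>w. \<phi> (\<lambda>k. z k + W w k) * snd w \<partial>?\<Omega>\<bar>"
    unfolding eq using \<sigma> by (simp add: abs_mult)
  also have "\<dots> \<le> \<sigma> * (\<alpha> * (1 + gauss_abs_moment r))" using le \<sigma> by (intro mult_left_mono) auto
  finally show ?thesis by (simp add: D_def r_def mult.assoc)
qed

section \<open>The Ornstein-Uhlenbeck semigroup\<close>

locale ornstein_uhlenbeck = restricted_semigroup S i S\<^sub>H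
  for S :: "real \<Rightarrow> ('e::banach \<Rightarrow>\<^sub>L 'e)"
    and i :: "'h::{real_inner,complete_space} \<Rightarrow>\<^sub>L 'e"
    and S\<^sub>H :: "real \<Rightarrow> ('h \<Rightarrow>\<^sub>L 'h)" +
  assumes I_infty_radonifying: "gamma_radonifying (restrict_space lborel {0<..}) (conv_op S i {0<..})"
begin

text \<open>Evaluates the \<open>THE\<close> in \<open>gaussian_measure\<close>: existence is a
  premise, uniqueness is \<open>gaussian_radon_unique\<close>.\<close>

lemma gaussian_measure_covf:
  assumes J: "J \<in> sets borel" "J \<subseteq> {0<..}"
    and \<mu>: "centred_gaussian_radon \<mu>" "\<And>x' y'. (\<integral>x. blinfun_apply x' x * blinfun_apply y' x \<partial>\<mu>) = covf J x' y'"
  shows "OU_measure S i J = \<mu>"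
  unfolding OU_measure_def gaussian_measure_def
proof (rule the_equality)
  show "centred_gaussian_radon \<mu> \<and> has_covariance \<mu> (L2_TTstar (restrict_space lborel J) (conv_op S i J))"
    unfolding has_covariance_def L2_TTstar_covf[OF J] using \<mu> by simp
  fix \<nu> assume \<nu>: "centred_gaussian_radon \<nu> \<and> has_covariance \<nu> (L2_TTstar (restrict_space lborel J) (conv_op S i J))"
  then have c: "(\<integral>x. blinfun_apply x' x * blinfun_apply y' x \<partial>\<nu>) = covf J x' y'" for x' y'
    unfolding has_covariance_def L2_TTstar_covf[OF J] by simp
  show "\<nu> = \<mu>"
  proof (rule gaussian_radon_unique)
    show "(\<integral>x. (blinfun_apply x' x)\<^sup>2 \<partial>\<nu>) = (\<integral>x. (blinfun_apply x' x)\<^sup>2 \<partial>\<mu>)" for x' :: "'e \<Rightarrow>\<^sub>L real"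
      using c[of x' x'] \<mu>(2)[of x' x'] by (simp add: power2_eq_square)
  qed (use \<nu> \<mu> in auto)
qed

lemma mu_infty_gaussian:
  "centred_gaussian_radon (mu_infty S i)"
  "(\<integral>x. blinfun_apply x' x * blinfun_apply y' x \<partial>mu_infty S i) = covf {0<..} x' y'"
proof -
  obtain \<mu> where \<mu>: "centred_gaussian_radon \<mu>"
      "has_covariance \<mu> (L2_TTstar (restrict_space lborel {0<..}) (conv_op S i {0<..}))"
    using I_infty_radonifying unfolding gamma_radonifying_def by blast
  have J: "{0::real<..} \<in> sets borel" "{0::real<..} \<subseteq> {0<..}" by auto
  have c: "(\<integral>x. blinfun_apply x' x * blinfun_apply y' x \<partial>\<mu>) = covf {0<..} x' y'" for x' y'
    using \<mu>(2) unfolding has_covariance_def L2_TTstar_covf[OF J] by simp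
  have eq: "mu_infty S i = \<mu>" by (rule gaussian_measure_covf[OF J \<mu>(1) c])
  show "centred_gaussian_radon (mu_infty S i)" unfolding eq by (rule \<mu>)
  show "(\<integral>x. blinfun_apply x' x * blinfun_apply y' x \<partial>mu_infty S i) = covf {0<..} x' y'" unfolding eq by (rule c)
qed

text \<open>Radonification is assumed for I_infty only. Since the covariance over (0, t) is
  dominated by that of \<open>mu_infty\<close>, the domination theorem provides a Gaussian Radon
  measure for it.\<close>

lemma mu_t_gaussian:
  shows "centred_gaussian_radon (mu_t S i t)"
    and "(\<integral>x. blinfun_apply x' x * blinfun_apply y' x \<partial>mu_t S i t) = covf {0<..<t} x' y'"
proof -
  have J: "{0<..<t} \<in> sets borel" "{0<..<t} \<subseteq> {0<..}" by auto
  have "\<exists>\<nu>. centred_gaussian_radon \<nu> \<and> (\<forall>x' y'. (\<integral>x. blinfun_apply x' x * blinfun_apply y' x \<partial>\<nu>) = covf {0<..<t} x' y')"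
  proof (rule gaussian_radon_dominated[OF mu_infty_gaussian(1)])
    show "covf {0<..<t} (x + y) z = covf {0<..<t} x z + covf {0<..<t} y z" for x y z by (rule covf_add_left[OF J])
    show "covf {0<..<t} (c *\<^sub>R x) z = c * covf {0<..<t} x z" for c x z by (rule covf_scaleR_left)
    show "covf {0<..<t} x y = covf {0<..<t} y x" for x y by (rule covf_commute)
    show "0 \<le> covf {0<..<t} x x" for x by (rule covf_nonneg)
    show "covf {0<..<t} x' x' \<le> (\<integral>x. (blinfun_apply x' x)\<^sup>2 \<partial>mu_infty S i)" for x'
      using covf_le_infty[OF J, of x'] mu_infty_gaussian(2)[of x' x'] by (simp add: power2_eq_square)
  qed
  then obtain \<nu> where \<nu>: "centred_gaussian_radon \<nu>" "\<And>x' y'. (\<integral>x. blinfun_apply x' x * blinfun_apply y' x \<partial>\<nu>) = covf {0<..<t} x' y'"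
    by blast
  have eq: "mu_t S i t = \<nu>" by (rule gaussian_measure_covf[OF J \<nu>])
  show "centred_gaussian_radon (mu_t S i t)" unfolding eq by (rule \<nu>)
  show "(\<integral>x. blinfun_apply x' x * blinfun_apply y' x \<partial>mu_t S i t) = covf {0<..<t} x' y'" unfolding eq by (rule \<nu>)
qed

lemma covf_sum:
  fixes n :: nat
  assumes "J \<in> sets borel" "J \<subseteq> {0<..}"
  shows "covf J (\<Sum>k<n. c k *\<^sub>R \<xi> k) (\<Sum>k<n. c k *\<^sub>R \<xi> k) = (\<Sum>j<n. \<Sum>k<n. c j * c k * covf J (\<xi> j) (\<xi> k))"
  by (rule bilinear_form_sum[of "covf J", OF covf_add_left[OF assms] covf_scaleR_left covf_commute])

lemma mu_t_char:
  fixes n :: nat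
  shows "(CLINT y|mu_t S i t. iexp (\<Sum>k<n. c k * blinfun_apply (\<xi> k) y)) = exp (- (\<Sum>j<n. \<Sum>k<n. c j * c k * covf {0<..<t} (\<xi> j) (\<xi> k)) / 2)"
proof -
  have J: "{0<..<t} \<in> sets borel" "{0<..<t} \<subseteq> {0<..}" by auto
  show ?thesis
    using gaussian_sequence_char[OF mu_t_gaussian(1)[of t], where n = n and c = c and \<xi> = \<xi>]
      mu_t_gaussian(2)[where t = t and x' = "\<Sum>k<n. c k *\<^sub>R \<xi> k" and y' = "\<Sum>k<n. c k *\<^sub>R \<xi> k"]
      covf_sum[OF J, where n = n and c = c and \<xi> = \<xi>] by (simp add: power2_eq_square)
qed

lemma mu_infty_char:
  fixes n :: nat
  shows "(CLINT y|mu_infty S i. iexp (\<Sum>k<n. c k * blinfun_apply (\<xi> k) y)) = exp (- (\<Sum>j<n. \<Sum>k<n. c j * c k * covf {0<..} (\<xi> j) (\<xi> k)) / 2)"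
  using gaussian_sequence_char[OF mu_infty_gaussian(1), where n = n and c = c and \<xi> = \<xi>] mu_infty_gaussian(2)[of "\<Sum>k<n. c k *\<^sub>R \<xi> k" "\<Sum>k<n. c k *\<^sub>R \<xi> k"]
    covf_sum[where J = "{0<..}" and n = n and c = c and \<xi> = \<xi>] by (simp add: power2_eq_square)

lemmas mu_t_sets = gaussian_radonD(1)[OF mu_t_gaussian(1)]
lemmas mu_t_prob = gaussian_radonD(2)[OF mu_t_gaussian(1)]
lemmas mu_infty_sets = gaussian_radonD(1)[OF mu_infty_gaussian(1)]
lemmas mu_infty_prob = gaussian_radonD(2)[OF mu_infty_gaussian(1)]

lemma measurable_functionals:
  fixes \<xi> :: "nat \<Rightarrow> 'e \<Rightarrow>\<^sub>L real"
  assumes "sets \<mu> = sets borel"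
  shows "(\<lambda>y k. blinfun_apply (\<xi> k) y) \<in> borel_measurable \<mu>"
proof (rule measurable_coordinatewise_then_product)
  show "(\<lambda>y. blinfun_apply (\<xi> k) y) \<in> borel_measurable \<mu>" for k
    using measurable_blinfun_real[of "\<xi> k"] by (simp add: measurable_cong_sets[OF assms refl])
qed

text \<open>With the functionals composed with S(t), the semigroup acts on \<phi> by averaging over
  translates in the coordinate space, so \<open>Cb1_average\<close> applies.\<close>

lemma OU_cyl_rep:
  fixes t :: real
  assumes rep: "cyl_rep f N \<phi> x'"
  defines "\<Phi> \<equiv> \<lambda>u. \<integral>y. \<phi> (\<lambda>k. u k + blinfun_apply (x' k) y) \<partial>mu_t S i t"
  shows "cyl_rep (OU S i t f) N \<Phi> (\<lambda>k. x' k o\<^sub>L S t)"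
    and "n < N \<Longrightarrow> partial_deriv n \<Phi> = (\<lambda>u. \<integral>y. partial_deriv n \<phi> (\<lambda>k. u k + blinfun_apply (x' k) y) \<partial>mu_t S i t)"
proof -
  have \<phi>: "1 \<le> N" "Cb1 N \<phi>" "\<And>x. f x = \<phi> (\<lambda>n. blinfun_apply (x' n) x)" using rep by (auto simp: cyl_rep_def)
  have m: "(\<lambda>y k. blinfun_apply (x' k) y) \<in> borel_measurable (mu_t S i t)"
    by (rule measurable_functionals[OF mu_t_sets])
  note av = Cb1_average[OF mu_t_prob m \<phi>(2), folded \<Phi>_def]
  show "cyl_rep (OU S i t f) N \<Phi> (\<lambda>k. x' k o\<^sub>L S t)"
    unfolding cyl_rep_def using \<phi>(1) av(1) by (simp add: OU_def \<phi>(3) \<Phi>_def blinfun.add_right)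
  show "n < N \<Longrightarrow> partial_deriv n \<Phi> = (\<lambda>u. \<integral>y. partial_deriv n \<phi> (\<lambda>k. u k + blinfun_apply (x' k) y) \<partial>mu_t S i t)"
    using av(2) by simp
qed

lemma OU_FCb1: "f \<in> FCb1 \<Longrightarrow> OU S i t f \<in> FCb1"
  unfolding FCb1_def using OU_cyl_rep(1) by blast

text \<open>The directional estimate is applied in the direction of the gradient \<open>D\<close>
  itself, where the derivative equals the squared norm of \<open>D\<close>; one factor of the norm
  cancels.\<close>

lemma norm_DH_OU_le:
  assumes f: "f \<in> FCb1" and t: "0 < t" and p: "1 < p"
    and K: "\<And>s. 0 \<le> s \<Longrightarrow> s \<le> t \<Longrightarrow> norm (S\<^sub>H s) \<le> K"
  shows "norm (DH i (OU S i t f) x) powr p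
    \<le> ((1 + gauss_abs_moment (p / (p - 1))) * K / sqrt t) powr p * (\<integral>y. \<bar>f (S t x + y)\<bar> powr p \<partial>mu_t S i t)"
proof -
  obtain N \<phi> x' where rep: "cyl_rep f N \<phi> x'" using f unfolding FCb1_def by auto
  have \<phi>: "Cb1 N \<phi>" "\<And>x. f x = \<phi> (\<lambda>n. blinfun_apply (x' n) x)" using rep by (auto simp: cyl_rep_def)
  define G where "G = 1 + gauss_abs_moment (p / (p - 1))"
  have G: "0 < G" using gauss_abs_moment_nonneg[of "p / (p - 1)"] by (simp add: G_def)
  define D where "D = DH i (OU S i t f) x"
  define A where "A = (\<integral>y. \<bar>f (S t x + y)\<bar> powr p \<partial>mu_t S i t)"
  have A0: "0 \<le> A" by (simp add: A_def)
  interpret \<mu>: prob_space "mu_t S i t" by (rule mu_t_prob)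
  have J: "{0<..<t} \<in> sets borel" "{0<..<t} \<subseteq> {0<..}" by auto
  show ?thesis
  proof (cases "D = 0")
    case True
    then show ?thesis using A0 p by (simp add: D_def A_def)
  next
    case False
    define v where "v k = blinfun_apply (x' k) (S t (i D))" for k
    define z where "z k = blinfun_apply (x' k) (S t x)" for k
    have "S\<^sub>H 0 = id_blinfun" using semigroup_H by (simp add: C0_semigroup_def)
    then have "norm D \<le> norm (S\<^sub>H 0) * norm D" using norm_blinfun[of "S\<^sub>H 0" D] by simp
    also have "\<dots> \<le> K * norm D" using t by (intro mult_right_mono K) auto
    finally have K1: "1 \<le> K" using False by simp
    \<comment> \<open>With this \<sigma>, \<open>covf_dominates\<close> says that the covariance of
      \<open>mu_t\<close> dominates v \<otimes> v / \<sigma>^2. Positivity uses K \<ge> 1, which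
      holds because the semigroup on H is the identity at time 0.\<close>
    define \<sigma> where "\<sigma> = K * norm D / sqrt t"
    have \<sigma>: "0 < \<sigma>" using K1 False t by (simp add: \<sigma>_def)
    have intD: "integrable (mu_t S i t) (\<lambda>y. partial_deriv n \<phi> (\<lambda>k. z k + blinfun_apply (x' k) y))" if n: "n < N" for n
    proof -
      obtain B where B: "\<And>u. \<bar>partial_deriv n \<phi> u\<bar> \<le> B" using Cb1_partial_bounded[OF \<phi>(1) n] by blast
      have "(\<lambda>y k. z k + blinfun_apply (x' k) y) \<in> borel_measurable (mu_t S i t)"
      proof (rule measurable_coordinatewise_then_product)
        show "(\<lambda>y. z k + blinfun_apply (x' k) y) \<in> borel_measurable (mu_t S i t)" for k
          using measurable_blinfun_real[of "x' k"] by (simp add: measurable_cong_sets[OF mu_t_sets refl])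
      qed
      from borel_measurable_continuous_on[OF Cb1_partial_continuous[OF \<phi>(1) n] this]
      show ?thesis by (intro \<mu>.integrable_const_bound[of _ B]) (use B in auto)
    qed
    have "inner D D = (\<Sum>n<N. v n * (\<integral>y. partial_deriv n \<phi> (\<lambda>k. z k + blinfun_apply (x' k) y) \<partial>mu_t S i t))"
    proof -
      have "D = cyl_grad i N (\<lambda>u. \<integral>y. \<phi> (\<lambda>k. u k + blinfun_apply (x' k) y) \<partial>mu_t S i t) (\<lambda>k. x' k o\<^sub>L S t) x"
        unfolding D_def DH_eq_cyl_grad[OF OU_cyl_rep(1)[OF rep]] ..
      also have "\<dots> = (\<Sum>n<N. (\<integral>y. partial_deriv n \<phi> (\<lambda>k. z k + blinfun_apply (x' k) y) \<partial>mu_t S i t) *\<^sub>R H_adjoint i (x' n o\<^sub>L S t))"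
        unfolding cyl_grad_def by (intro sum.cong refl) (simp add: OU_cyl_rep(2)[OF rep] z_def)
      finally have "inner D D = inner D (\<Sum>n<N. (\<integral>y. partial_deriv n \<phi> (\<lambda>k. z k + blinfun_apply (x' k) y) \<partial>mu_t S i t) *\<^sub>R H_adjoint i (x' n o\<^sub>L S t))"
        by simp
      then show ?thesis by (simp add: inner_sum_right inner_H_adjoint v_def mult.commute)
    qed
    also have "\<dots> = (\<integral>y. (\<Sum>n<N. v n * partial_deriv n \<phi> (\<lambda>k. z k + blinfun_apply (x' k) y)) \<partial>mu_t S i t)"
      using intD by (subst Bochner_Integration.integral_sum) auto
    finally have DD: "inner D D = (\<integral>y. (\<Sum>n<N. v n * partial_deriv n \<phi> (\<lambda>k. z k + blinfun_apply (x' k) y)) \<partial>mu_t S i t)" .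
    have key: "norm D \<le> G * K / sqrt t * \<alpha>" if \<alpha>: "0 < \<alpha>" "A \<le> \<alpha> powr p" for \<alpha>
    proof -
      have "\<bar>\<integral>y. (\<Sum>n<N. v n * partial_deriv n \<phi> (\<lambda>k. z k + blinfun_apply (x' k) y)) \<partial>mu_t S i t\<bar> \<le> \<sigma> * \<alpha> * (1 + gauss_abs_moment (p / (p - 1)))"
      proof (rule gaussian_gradient_bound[OF mu_t_prob measurable_functionals[OF mu_t_sets] _ mu_t_char \<sigma> _ \<phi>(1) p \<alpha>(1)])
        show "psd (\<lambda>j k. covf {0<..<t} (x' j) (x' k))"
          by (rule bilinear_form_psd[of "covf {0<..<t}", OF covf_add_left[OF J] covf_scaleR_left covf_commute covf_nonneg])
        show "(\<Sum>k<n. c k * v k)\<^sup>2 \<le> \<sigma>\<^sup>2 * (\<Sum>j<n. \<Sum>k<n. c j * c k * covf {0<..<t} (x' j) (x' k))" for n c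
        proof -
          have "t * (\<Sum>k<n. c k * v k)\<^sup>2 \<le> (K * norm D)\<^sup>2 * (\<Sum>j<n. \<Sum>k<n. c j * c k * covf {0<..<t} (x' j) (x' k))"
            using covf_dominates[OF t K, of "\<Sum>k<n. c k *\<^sub>R x' k" D] unfolding functional_combination covf_sum[OF J] v_def .
          then have "(\<Sum>k<n. c k * v k)\<^sup>2 \<le> (K * norm D)\<^sup>2 * (\<Sum>j<n. \<Sum>k<n. c j * c k * covf {0<..<t} (x' j) (x' k)) / t"
            using t by (simp add: pos_le_divide_eq mult.commute)
          also have "\<dots> = \<sigma>\<^sup>2 * (\<Sum>j<n. \<Sum>k<n. c j * c k * covf {0<..<t} (x' j) (x' k))"
            using t by (simp add: \<sigma>_def power_divide)
          finally show ?thesis .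
        qed
        show "(\<integral>y. \<bar>\<phi> (\<lambda>k. z k + blinfun_apply (x' k) y)\<bar> powr p \<partial>mu_t S i t) \<le> \<alpha> powr p"
          using \<alpha>(2) by (simp add: A_def \<phi>(2) z_def blinfun.add_right)
      qed
      then have "inner D D \<le> \<sigma> * \<alpha> * G" unfolding DD[symmetric] G_def by simp
      then have "norm D * norm D \<le> (G * K / sqrt t * \<alpha>) * norm D"
        by (simp add: \<sigma>_def mult_ac flip: power2_norm_eq_inner power2_eq_square)
      then show ?thesis by (rule mult_right_le_imp_le) (simp add: False)
    qed
    have "norm D powr p \<le> (G * K / sqrt t) powr p * A"
    \<comment> \<open>If A = 0 every positive \<alpha> is admissible, and the choice below gives
      norm D \<le> norm D / 2, which is absurd. Otherwise \<alpha> = A^(1/p) is the smallest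
      admissible value.\<close>
    proof (cases "A = 0")
      case True
      define c where "c = G * K / sqrt t"
      have c: "0 < c" using G K1 t by (simp add: c_def)
      have "norm D \<le> c * (norm D / (2 * c))" unfolding c_def[symmetric]
        using key[of "norm D / (2 * c)"] False c True by (simp add: c_def[symmetric])
      then show ?thesis using c False by simp
    next
      case A: False
      define \<alpha> where "\<alpha> = A powr (1 / p)"
      have \<alpha>: "0 < \<alpha>" "\<alpha> powr p = A" using A A0 p by (simp_all add: \<alpha>_def powr_powr)
      have "norm D powr p \<le> (G * K / sqrt t * \<alpha>) powr p"
        using key[of \<alpha>] \<alpha> p by (intro powr_mono2) auto
      also have "\<dots> = (G * K / sqrt t) powr p * A"
        using \<alpha> G K1 t by (subst powr_mult) auto
      finally show ?thesis .
    qed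
    then show ?thesis by (simp add: D_def G_def A_def)
  qed
qed

text \<open>Restricted to functions of a sequence of functionals, since S(t) x + y need not be
  measurable on the product of two non-separable spaces. The sequence of its coordinates is
  measurable, and the characteristic functions agree by \<open>covf_split\<close>.\<close>

lemma mu_infty_invariant:
  fixes \<psi> :: "(nat \<Rightarrow> real) \<Rightarrow> real" and x' :: "nat \<Rightarrow> 'e \<Rightarrow>\<^sub>L real"
  assumes t: "0 < t" and \<psi>: "continuous_on UNIV \<psi>" and B: "\<And>u. \<bar>\<psi> u\<bar> \<le> B"
  shows "(\<integral>x. \<integral>y. \<psi> (\<lambda>k. x' k (S t x + y)) \<partial>mu_t S i t \<partial>mu_infty S i) = (\<integral>x. \<psi> (\<lambda>k. x' k x) \<partial>mu_infty S i)"
    and "integrable (mu_infty S i) (\<lambda>x. \<integral>y. \<psi> (\<lambda>k. x' k (S t x + y)) \<partial>mu_t S i t)"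
proof -
  interpret M: prob_space "mu_infty S i" by (rule mu_infty_prob)
  interpret N: prob_space "mu_t S i t" by (rule mu_t_prob)
  interpret P: pair_prob_space "mu_infty S i" "mu_t S i t" ..
  let ?P = "mu_infty S i \<Otimes>\<^sub>M mu_t S i t"
  define W where "W w = (\<lambda>k. (x' k o\<^sub>L S t) (fst w) + x' k (snd w))" for w
  have m1[measurable]: "blinfun_apply (\<xi> :: 'e \<Rightarrow>\<^sub>L real) \<in> borel_measurable (mu_infty S i)" for \<xi>
    using measurable_blinfun_real[of \<xi>] by (simp add: measurable_cong_sets[OF mu_infty_sets refl])
  have m2[measurable]: "blinfun_apply (\<xi> :: 'e \<Rightarrow>\<^sub>L real) \<in> borel_measurable (mu_t S i t)" for \<xi>
    using measurable_blinfun_real[of \<xi>] by (simp add: measurable_cong_sets[OF mu_t_sets refl])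
  have Wm: "W \<in> borel_measurable ?P"
    unfolding W_def by (rule measurable_coordinatewise_then_product) measurable
  have Xm: "(\<lambda>x k. x' k x) \<in> borel_measurable (mu_infty S i)" by (rule measurable_functionals[OF mu_infty_sets])
  have law: "distr ?P borel W = distr (mu_infty S i) borel (\<lambda>x k. x' k x)"
  proof (rule sequence_law_distr_eqI[OF P.prob_space_axioms M.prob_space_axioms Wm Xm])
    fix n c
    have lin: "(\<Sum>k<n. c k * W w k) = (\<Sum>k<n. c k * (x' k o\<^sub>L S t) (fst w)) + (\<Sum>k<n. c k * x' k (snd w))" for w
      by (simp add: W_def distrib_left sum.distrib)
    define Q1 where "Q1 = (\<Sum>j<n. \<Sum>k<n. c j * c k * covf {0<..} (x' j o\<^sub>L S t) (x' k o\<^sub>L S t))"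
    define Q2 where "Q2 = (\<Sum>j<n. \<Sum>k<n. c j * c k * covf {0<..<t} (x' j) (x' k))"
    have "(CLINT w|?P. iexp (\<Sum>k<n. c k * W w k))
        = (CLINT x|mu_infty S i. iexp (\<Sum>k<n. c k * (x' k o\<^sub>L S t) x)) * (CLINT y|mu_t S i t. iexp (\<Sum>k<n. c k * x' k y))"
      unfolding lin by (rule pair_char) (simp_all add: mu_infty_prob mu_t_prob del: blinfun_apply_blinfun_compose)
    also have "\<dots> = complex_of_real (exp (- Q1 / 2)) * complex_of_real (exp (- Q2 / 2))"
      unfolding mu_infty_char mu_t_char Q1_def Q2_def ..
    also have "\<dots> = complex_of_real (exp (- (Q1 + Q2) / 2))"
      unfolding of_real_mult[symmetric] exp_add[symmetric] by (simp add: field_simps)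
    also have "Q1 + Q2 = (\<Sum>j<n. \<Sum>k<n. c j * c k * covf {0<..} (x' j) (x' k))"
      unfolding Q1_def Q2_def covf_split[OF t, of "x' _" "x' _"] by (simp add: sum.distrib[symmetric] distrib_left add.commute)
    also have "complex_of_real (exp (- (\<Sum>j<n. \<Sum>k<n. c j * c k * covf {0<..} (x' j) (x' k)) / 2)) = (CLINT x|mu_infty S i. iexp (\<Sum>k<n. c k * x' k x))"
      unfolding mu_infty_char ..
    finally show "(CLINT w|?P. iexp (\<Sum>k<n. c k * W w k)) = (CLINT x|mu_infty S i. iexp (\<Sum>k<n. c k * x' k x))" .
  qed
  have \<psi>m: "\<psi> \<in> borel_measurable borel" by (rule borel_measurable_continuous_onI[OF \<psi>])
  have \<psi>W[measurable]: "(\<lambda>w. \<psi> (W w)) \<in> borel_measurable ?P" by (rule borel_measurable_continuous_on[OF \<psi> Wm])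
  have int: "integrable ?P (\<lambda>w. \<psi> (W w))" by (rule P.integrable_const_bound[of _ B]) (use B in auto)
  have Wxy: "W (x, y) = (\<lambda>k. x' k (S t x + y))" for x y by (simp add: W_def blinfun.add_right)
  have "(\<integral>x. \<integral>y. \<psi> (\<lambda>k. x' k (S t x + y)) \<partial>mu_t S i t \<partial>mu_infty S i) = (\<integral>w. \<psi> (W w) \<partial>?P)"
    using P.integral_fst'[OF int] unfolding Wxy .
  also have "\<dots> = (\<integral>u. \<psi> u \<partial>distr ?P borel W)" by (rule integral_distr[OF Wm \<psi>m, symmetric])
  also have "\<dots> = (\<integral>x. \<psi> (\<lambda>k. x' k x) \<partial>mu_infty S i)" unfolding law by (rule integral_distr[OF Xm \<psi>m])
  finally show "(\<integral>x. \<integral>y. \<psi> (\<lambda>k. x' k (S t x + y)) \<partial>mu_t S i t \<partial>mu_infty S i) = (\<integral>x. \<psi> (\<lambda>k. x' k x) \<partial>mu_infty S i)" .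
  show "integrable (mu_infty S i) (\<lambda>x. \<integral>y. \<psi> (\<lambda>k. x' k (S t x + y)) \<partial>mu_t S i t)"
    using P.integrable_fst'[OF int] unfolding Wxy .
qed

lemma DH_OU_continuous:
  assumes "f \<in> FCb1"
  shows "continuous_on UNIV (DH i (OU S i t f))" "\<exists>D. countable D \<and> range (DH i (OU S i t f)) \<subseteq> closure D"
proof -
  obtain N \<phi> x' where rep: "cyl_rep (OU S i t f) N \<phi> x'" using OU_FCb1[OF assms] unfolding FCb1_def by blast
  show "continuous_on UNIV (DH i (OU S i t f))" "\<exists>D. countable D \<and> range (DH i (OU S i t f)) \<subseteq> closure D"
    unfolding DH_eq_cyl_grad[OF rep] by (rule continuous_cyl_grad[OF rep])+
qed

lemma DH_OU_Lp_bound: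
  assumes f: "f \<in> FCb1" and t: "0 < t" and p: "1 < p"
    and K: "\<And>s. 0 \<le> s \<Longrightarrow> s \<le> t \<Longrightarrow> norm (S\<^sub>H s) \<le> K"
  shows "integrable (mu_infty S i) (\<lambda>x. norm (DH i (OU S i t f) x) powr p)"
    and "(\<integral>x. norm (DH i (OU S i t f) x) powr p \<partial>mu_infty S i)
      \<le> ((1 + gauss_abs_moment (p / (p - 1))) * K / sqrt t) powr p * (\<integral>x. \<bar>f x\<bar> powr p \<partial>mu_infty S i)"
proof -
  obtain N \<phi> x' where rep: "cyl_rep f N \<phi> x'" using f unfolding FCb1_def by auto
  have \<phi>: "Cb1 N \<phi>" "\<And>x. f x = \<phi> (\<lambda>n. blinfun_apply (x' n) x)" using rep by (auto simp: cyl_rep_def)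
  define c where "c = ((1 + gauss_abs_moment (p / (p - 1))) * K / sqrt t) powr p"
  obtain B where B: "\<And>u. \<bar>\<phi> u\<bar> \<le> B" using Cb1_bounded[OF \<phi>(1)] by blast
  \<comment> \<open>|f|^p is again a bounded continuous function of the functionals, so the
    invariance lemma applies to it directly.\<close>
  define \<psi> where "\<psi> u = \<bar>\<phi> u\<bar> powr p" for u
  have \<psi>c: "continuous_on UNIV \<psi>"
    unfolding \<psi>_def using p by (intro continuous_on_powr' continuous_intros Cb1_continuous[OF \<phi>(1)]) auto
  have \<psi>B: "\<bar>\<psi> u\<bar> \<le> B powr p" for u unfolding \<psi>_def using p B[of u] by (simp add: powr_mono2)
  note inv = mu_infty_invariant[OF t \<psi>c \<psi>B, of x']
  have eq1: "(\<integral>y. \<psi> (\<lambda>k. x' k (S t x + y)) \<partial>mu_t S i t) = (\<integral>y. \<bar>f (S t x + y)\<bar> powr p \<partial>mu_t S i t)" for x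
    by (simp add: \<psi>_def \<phi>(2))
  have eq2: "(\<integral>x. \<psi> (\<lambda>k. x' k x) \<partial>mu_infty S i) = (\<integral>x. \<bar>f x\<bar> powr p \<partial>mu_infty S i)"
    by (simp add: \<psi>_def \<phi>(2))
  have i2: "integrable (mu_infty S i) (\<lambda>x. c * (\<integral>y. \<bar>f (S t x + y)\<bar> powr p \<partial>mu_t S i t))"
    using inv(2) unfolding eq1 by (rule integrable_mult_right)
  have le: "norm (DH i (OU S i t f) x) powr p \<le> c * (\<integral>y. \<bar>f (S t x + y)\<bar> powr p \<partial>mu_t S i t)" for x
    unfolding c_def by (rule norm_DH_OU_le[OF f t p K])
  have m: "(\<lambda>x. norm (DH i (OU S i t f) x) powr p) \<in> borel_measurable (mu_infty S i)"
  proof -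
    have "continuous_on UNIV (\<lambda>x. norm (DH i (OU S i t f) x))"
      by (intro continuous_intros DH_OU_continuous[OF f])
    then have "(\<lambda>x. norm (DH i (OU S i t f) x)) \<in> borel_measurable borel" by (rule borel_measurable_continuous_onI)
    then have "(\<lambda>x. norm (DH i (OU S i t f) x) powr p) \<in> borel_measurable borel" by measurable
    then show ?thesis by (simp add: measurable_cong_sets[OF mu_infty_sets refl])
  qed
  show i1: "integrable (mu_infty S i) (\<lambda>x. norm (DH i (OU S i t f) x) powr p)"
  proof (rule Bochner_Integration.integrable_bound[OF i2 m])
    show "AE x in mu_infty S i. norm (norm (DH i (OU S i t f) x) powr p) \<le> norm (c * (\<integral>y. \<bar>f (S t x + y)\<bar> powr p \<partial>mu_t S i t))"
      by (intro AE_I2) (use order_trans[OF le abs_ge_self] in simp)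
  qed
  have "(\<integral>x. norm (DH i (OU S i t f) x) powr p \<partial>mu_infty S i) \<le> (\<integral>x. c * (\<integral>y. \<bar>f (S t x + y)\<bar> powr p \<partial>mu_t S i t) \<partial>mu_infty S i)"
    by (rule integral_mono[OF i1 i2 le])
  also have "\<dots> = c * (\<integral>x. \<bar>f x\<bar> powr p \<partial>mu_infty S i)"
    using inv(1) unfolding eq1 eq2 by simp
  finally show "(\<integral>x. norm (DH i (OU S i t f) x) powr p \<partial>mu_infty S i)
      \<le> ((1 + gauss_abs_moment (p / (p - 1))) * K / sqrt t) powr p * (\<integral>x. \<bar>f x\<bar> powr p \<partial>mu_infty S i)"
    unfolding c_def .
qed

end

section \<open>Density of cylindrical functions\<close>

text \<open>From a + b \<le> 2 max a b. It takes the place of Minkowski's inequality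
  throughout.\<close>

lemma powr_add_le:
  fixes a b :: real
  assumes "0 \<le> a" "0 \<le> b" "0 < p"
  shows "(a + b) powr p \<le> 2 powr p * (a powr p + b powr p)"
proof -
  have "(a + b) powr p \<le> (2 * max a b) powr p" using assms by (intro powr_mono2) auto
  also have "\<dots> = 2 powr p * max a b powr p" using assms by (subst powr_mult) auto
  also have "max a b powr p \<le> a powr p + b powr p" by (auto simp: max_def)
  finally show ?thesis by simp
qed

lemma integrable_powr_add:
  fixes f g :: "'a \<Rightarrow> real"
  assumes p: "0 < p" and f: "f \<in> borel_measurable M" "integrable M (\<lambda>x. \<bar>f x\<bar> powr p)"
    and g: "g \<in> borel_measurable M" "integrable M (\<lambda>x. \<bar>g x\<bar> powr p)"
  shows "integrable M (\<lambda>x. \<bar>f x + g x\<bar> powr p)"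
    and "(\<integral>x. \<bar>f x + g x\<bar> powr p \<partial>M) \<le> 2 powr p * ((\<integral>x. \<bar>f x\<bar> powr p \<partial>M) + (\<integral>x. \<bar>g x\<bar> powr p \<partial>M))"
proof -
  note [measurable] = f(1) g(1)
  have le: "\<bar>f x + g x\<bar> powr p \<le> 2 powr p * (\<bar>f x\<bar> powr p + \<bar>g x\<bar> powr p)" for x
  proof -
    have "\<bar>f x + g x\<bar> powr p \<le> (\<bar>f x\<bar> + \<bar>g x\<bar>) powr p" using p by (intro powr_mono2) auto
    also have "\<dots> \<le> 2 powr p * (\<bar>f x\<bar> powr p + \<bar>g x\<bar> powr p)" by (rule powr_add_le) (use p in auto)
    finally show ?thesis .
  qed
  have i: "integrable M (\<lambda>x. 2 powr p * (\<bar>f x\<bar> powr p + \<bar>g x\<bar> powr p))"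
    by (intro integrable_mult_right Bochner_Integration.integrable_add f g)
  show i1: "integrable M (\<lambda>x. \<bar>f x + g x\<bar> powr p)"
  proof (rule Bochner_Integration.integrable_bound[OF i])
    show "AE x in M. norm (\<bar>f x + g x\<bar> powr p) \<le> norm (2 powr p * (\<bar>f x\<bar> powr p + \<bar>g x\<bar> powr p))"
      by (intro AE_I2) (use order_trans[OF le abs_ge_self] in simp)
  qed measurable
  have "(\<integral>x. \<bar>f x + g x\<bar> powr p \<partial>M) \<le> (\<integral>x. 2 powr p * (\<bar>f x\<bar> powr p + \<bar>g x\<bar> powr p) \<partial>M)"
    by (rule integral_mono[OF i1 i le])
  also have "\<dots> = 2 powr p * ((\<integral>x. \<bar>f x\<bar> powr p \<partial>M) + (\<integral>x. \<bar>g x\<bar> powr p \<partial>M))"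
    using f(2) g(2) by simp
  finally show "(\<integral>x. \<bar>f x + g x\<bar> powr p \<partial>M) \<le> 2 powr p * ((\<integral>x. \<bar>f x\<bar> powr p \<partial>M) + (\<integral>x. \<bar>g x\<bar> powr p \<partial>M))" .
qed

text \<open>Built for products of one-dimensional smooth steps, which approximate indicators of
  cylinders. The bound 1 on each factor keeps the product of the others from enlarging a partial
  derivative.\<close>

lemma Cb1_prod:
  fixes \<eta> \<eta>' :: "nat \<Rightarrow> real \<Rightarrow> real"
  assumes d: "\<And>k s. (\<eta> k has_real_derivative \<eta>' k s) (at s)" and c: "\<And>k. continuous_on UNIV (\<eta>' k)"
    and b: "\<And>k s. \<bar>\<eta> k s\<bar> \<le> 1" and b': "\<And>k s. \<bar>\<eta>' k s\<bar> \<le> C k"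
  shows "Cb1 N (\<lambda>u. \<Prod>k<N. \<eta> k (u k))"
proof (rule Cb1I(1)[where p = "\<lambda>n u. \<eta>' n (u n) * (\<Prod>k\<in>{..<N} - {n}. \<eta> k (u k))" and B = 1 and C = C])
  have \<eta>c: "continuous_on UNIV (\<eta> k)" for k by (intro continuous_at_imp_continuous_on ballI DERIV_isCont[OF d])
  have \<eta>u: "continuous_on UNIV (\<lambda>u. \<eta> k (u k))" for k
    by (rule continuous_on_compose2[OF \<eta>c continuous_on_product_coordinates]) simp
  have \<eta>'u: "continuous_on UNIV (\<lambda>u. \<eta>' k (u k))" for k
    by (rule continuous_on_compose2[OF c continuous_on_product_coordinates]) simp
  show "(\<Prod>k<N. \<eta> k (u k)) = (\<Prod>k<N. \<eta> k (v k))" if "\<And>j. j < N \<Longrightarrow> u j = v j" for u v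
    by (intro prod.cong refl) (simp add: that)
  show "continuous_on UNIV (\<lambda>u. \<Prod>k<N. \<eta> k (u k))" by (intro continuous_on_prod \<eta>u)
  have pb: "\<bar>\<Prod>k\<in>A. \<eta> k (u k)\<bar> \<le> 1" for A u unfolding abs_prod by (intro prod_le_1) (auto simp: b)
  show "\<bar>\<Prod>k<N. \<eta> k (u k)\<bar> \<le> 1" for u by (rule pb)
  show "((\<lambda>s. \<Prod>k<N. \<eta> k ((u(n := s)) k)) has_real_derivative \<eta>' n (u n) * (\<Prod>k\<in>{..<N} - {n}. \<eta> k (u k))) (at (u n))" if "n < N" for n u
  proof -
    have "(\<Prod>k<N. \<eta> k ((u(n := s)) k)) = \<eta> n s * (\<Prod>k\<in>{..<N} - {n}. \<eta> k (u k))" for s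
    proof -
      have "(\<Prod>k<N. \<eta> k ((u(n := s)) k)) = \<eta> n ((u(n := s)) n) * (\<Prod>k\<in>{..<N} - {n}. \<eta> k ((u(n := s)) k))"
        using that by (intro prod.remove) auto
      also have "(\<Prod>k\<in>{..<N} - {n}. \<eta> k ((u(n := s)) k)) = (\<Prod>k\<in>{..<N} - {n}. \<eta> k (u k))"
        by (intro prod.cong) auto
      finally show ?thesis by simp
    qed
    then show ?thesis using DERIV_cmult_right[OF d] by simp
  qed
  show "continuous_on UNIV (\<lambda>u. \<eta>' n (u n) * (\<Prod>k\<in>{..<N} - {n}. \<eta> k (u k)))" for n
    by (intro continuous_on_mult continuous_on_prod \<eta>u \<eta>'u)
  show "\<bar>\<eta>' n (u n) * (\<Prod>k\<in>{..<N} - {n}. \<eta> k (u k))\<bar> \<le> C n" for n u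
  proof -
    have "\<bar>\<eta>' n (u n) * (\<Prod>k\<in>{..<N} - {n}. \<eta> k (u k))\<bar> \<le> C n * 1"
      unfolding abs_mult by (intro mult_mono b' pb) (use order_trans[OF abs_ge_zero b'] in auto)
    then show ?thesis by simp
  qed
qed

text \<open>The shift by \<open>m\<close> makes the limit at \<open>a\<close> equal to \<open>0\<close>.\<close>

definition smooth_step :: "real \<Rightarrow> real \<Rightarrow> real \<Rightarrow> real" where
  "smooth_step a m s = 1 / 2 + arctan (m\<^sup>2 * (s - a) - m) / pi"

lemma smooth_step_bounds: "0 \<le> smooth_step a m s" "smooth_step a m s \<le> 1"
  using arctan_lbound[of "m\<^sup>2 * (s - a) - m"] arctan_ubound[of "m\<^sup>2 * (s - a) - m"] pi_gt_zero
  by (auto simp: smooth_step_def field_simps)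

lemma smooth_step_deriv:
  "(smooth_step a m has_real_derivative m\<^sup>2 / (1 + (m\<^sup>2 * (s - a) - m)\<^sup>2) / pi) (at s)"
proof -
  have "((\<lambda>s. m\<^sup>2 * (s - a) - m) has_real_derivative m\<^sup>2 * (1 - 0) - 0) (at s)"
    by (intro DERIV_diff DERIV_cmult DERIV_ident DERIV_const)
  from DERIV_add[OF DERIV_const DERIV_cdivide[OF DERIV_chain2[OF DERIV_arctan this]], of "1 / 2" pi]
  have "(smooth_step a m has_real_derivative 0 + inverse (1 + (m\<^sup>2 * (s - a) - m)\<^sup>2) * (m\<^sup>2 * (1 - 0) - 0) / pi) (at s)"
    unfolding smooth_step_def .
  moreover have "0 + inverse Y * (m\<^sup>2 * (1 - 0) - 0) / pi = m\<^sup>2 / Y / pi" for Y :: real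
    by (simp add: divide_inverse)
  ultimately show ?thesis by (simp only:)
qed

text \<open>For s > a the quadratic term outweighs the shift and the argument tends to +infinity;
  for s \<le> a it is at most -m. The point s = a thus falls on the lower side, matching the open
  half-line.\<close>

lemma smooth_step_tendsto:
  "(\<lambda>m. smooth_step a (real m) s) \<longlonglongrightarrow> indicator {a<..} s"
proof (cases "a < s")
  case True
  have "filterlim (\<lambda>m. (real m)\<^sup>2 * (s - a) - real m) at_top sequentially"
  proof (rule filterlim_at_top_mono[OF filterlim_real_sequentially])
    obtain M :: nat where M: "2 / (s - a) \<le> real M" using real_arch_simple by blast
    show "\<forall>\<^sub>F m in sequentially. real m \<le> (real m)\<^sup>2 * (s - a) - real m"
      unfolding eventually_sequentially
    proof (intro exI[of _ M] allI impI)
      fix m assume "M \<le> m"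
      then have "2 / (s - a) \<le> real m" using M by linarith
      then have "2 \<le> real m * (s - a)" using True by (simp add: field_simps)
      then have "real m * 2 \<le> real m * (real m * (s - a))" by (intro mult_left_mono) auto
      then show "real m \<le> (real m)\<^sup>2 * (s - a) - real m" by (simp add: power2_eq_square mult.assoc)
    qed
  qed
  from filterlim_compose[OF tendsto_arctan_at_top this]
  have "(\<lambda>m. 1 / 2 + arctan ((real m)\<^sup>2 * (s - a) - real m) / pi) \<longlonglongrightarrow> 1 / 2 + (pi / 2) / pi"
    by (intro tendsto_intros) auto
  then show ?thesis using True by (simp add: smooth_step_def)
next
  case False
  have "filterlim (\<lambda>m. - real m) at_bot sequentially"
    using filterlim_real_sequentially by (simp add: filterlim_uminus_at_bot)
  then have "filterlim (\<lambda>m. (real m)\<^sup>2 * (s - a) - real m) at_bot sequentially"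
    by (rule filterlim_at_bot_mono) (use False in \<open>auto intro!: always_eventually mult_nonneg_nonpos\<close>)
  from filterlim_compose[OF tendsto_arctan_at_bot this]
  have "(\<lambda>m. 1 / 2 + arctan ((real m)\<^sup>2 * (s - a) - real m) / pi) \<longlonglongrightarrow> 1 / 2 + (- (pi / 2)) / pi"
    by (intro tendsto_intros) auto
  then show ?thesis using False by (simp add: smooth_step_def)
qed

text \<open>A generator of the Borel sets that is stable under intersection and whose indicators are
  limits of products of smooth steps. An empty \<open>F\<close> yields the whole space.\<close>

definition half_space_cylinders :: "(nat \<Rightarrow> real) set set" where
  "half_space_cylinders = {{w. \<forall>k\<in>F. a k < w k} | F a. finite F}"

lemma Int_stable_half_space_cylinders: "Int_stable half_space_cylinders"
  unfolding Int_stable_def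
proof (intro ballI)
  fix A B assume "A \<in> half_space_cylinders" "B \<in> half_space_cylinders"
  then obtain F a G b where A: "A = {w. \<forall>k\<in>F. a k < w k}" "finite F" and B: "B = {w. \<forall>k\<in>G. b k < w k}" "finite G"
    unfolding half_space_cylinders_def by auto
  define c where "c k = (if k \<in> F then (if k \<in> G then max (a k) (b k) else a k) else b k)" for k
  have "A \<inter> B = {w. \<forall>k\<in>F \<union> G. c k < w k}"
  proof (intro set_eqI)
    fix w
    have "c k < w k \<longleftrightarrow> (k \<in> F \<longrightarrow> a k < w k) \<and> (k \<in> G \<longrightarrow> b k < w k)" if "k \<in> F \<union> G" for k
      using that by (auto simp: c_def)
    then show "w \<in> A \<inter> B \<longleftrightarrow> w \<in> {w. \<forall>k\<in>F \<union> G. c k < w k}" unfolding A B by blast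
  qed
  moreover have "finite (F \<union> G)" using A B by simp
  ultimately show "A \<inter> B \<in> half_space_cylinders"
    unfolding half_space_cylinders_def by (intro CollectI exI[of _ "F \<union> G"] exI[of _ c] conjI)
qed

text \<open>One inclusion is measurability of the identity, tested on coordinates and open
  half-lines; the other holds because these cylinders are open.\<close>

lemma sets_half_space_cylinders: "sets borel = sigma_sets UNIV half_space_cylinders"
proof (rule antisym)
  let ?S = "sigma UNIV half_space_cylinders :: (nat \<Rightarrow> real) measure"
  have sS: "sets ?S = sigma_sets UNIV half_space_cylinders" by (simp add: sets_measure_of)
  have "(\<lambda>w. w) \<in> borel_measurable ?S"
  proof (rule measurable_coordinatewise_then_product, rule borel_measurableI_greater)
    fix k y
    have "{w. \<forall>j\<in>{k}. (\<lambda>_. y) j < w j} \<in> half_space_cylinders"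
      unfolding half_space_cylinders_def by (intro CollectI exI[of _ "{k}"] exI[of _ "\<lambda>_. y"] conjI refl) simp
    then show "{w \<in> space ?S. y < w k} \<in> sets ?S" unfolding sS by (simp add: space_measure_of_conv sigma_sets.Basic)
  qed
  then have "A \<in> sets ?S" if "A \<in> sets borel" for A
    using measurable_sets[OF _ that, of "\<lambda>w. w" ?S] by (simp add: space_measure_of_conv)
  then show "sets borel \<subseteq> sigma_sets UNIV half_space_cylinders" unfolding sS by blast
  have "A \<in> sets borel" if A0: "A \<in> half_space_cylinders" for A
  proof -
    obtain F a where A: "A = {w. \<forall>k\<in>F. a k < w k}" "finite F" using A0 unfolding half_space_cylinders_def by auto
    have "A = (\<Inter>k\<in>F. {w. a k < w k})" unfolding A by auto
    moreover have "open {w. a k < w k}" for k :: nat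
      by (intro open_Collect_less continuous_intros continuous_on_product_coordinates)
    ultimately have "open A" using A(2) by auto
    then show ?thesis by simp
  qed
  then show "sigma_sets UNIV half_space_cylinders \<subseteq> sets borel"
    using sets.sigma_sets_subset[of half_space_cylinders borel] by (simp add: subset_iff)
qed

text \<open>The closure of the cylindrical functions in L^p is a linear space stable under dominated
  limits. It contains the indicators of half-space cylinders in the coordinates \<xi> n, hence by
  Dynkin's argument those of all events determined by these coordinates; on a \<sigma>-compact
  carrier these are all Borel sets up to null sets.\<close>

lemma FCb1_dense:
  fixes \<mu> :: "'e::real_normed_vector measure" and f :: "'e \<Rightarrow> real"
  assumes \<mu>: "centred_gaussian_radon \<mu>" and p: "0 < p"
    and f: "f \<in> borel_measurable \<mu>" "integrable \<mu> (\<lambda>x. \<bar>f x\<bar> powr p)" and e: "0 < e"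
  shows "\<exists>g\<in>FCb1. (\<integral>x. \<bar>f x - g x\<bar> powr p \<partial>\<mu>) < e"
proof -
  note \<mu>D = gaussian_radonD[OF \<mu>]
  interpret prob_space \<mu> by (rule \<mu>D)
  have gm: "g \<in> borel_measurable \<mu>" if "g \<in> FCb1" for g :: "'e \<Rightarrow> real"
    using borel_measurable_continuous_onI[OF FCb1_continuous[OF that]] by (simp add: measurable_cong_sets[OF \<mu>D(1) refl])
  have bint: "integrable \<mu> (\<lambda>x. \<bar>g x\<bar> powr p)" if m: "g \<in> borel_measurable \<mu>" and b: "\<And>x. \<bar>g x\<bar> \<le> B" for g :: "'e \<Rightarrow> real" and B
  proof -
    note [measurable] = m
    show ?thesis by (rule integrable_const_bound[of _ "B powr p"]) (use p b in \<open>auto intro!: powr_mono2\<close>)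
  qed
  have gint: "integrable \<mu> (\<lambda>x. \<bar>g x\<bar> powr p)" if g: "g \<in> FCb1" for g :: "'e \<Rightarrow> real"
  proof -
    obtain B where "\<forall>x. \<bar>g x\<bar> \<le> B" using FCb1_bounded[OF g] by blast
    then show ?thesis using bint[OF gm[OF g], of B] by blast
  qed
  define L where "L = {f \<in> borel_measurable \<mu>. integrable \<mu> (\<lambda>x. \<bar>f x\<bar> powr p)}"
  define A where "A = {f \<in> L. \<forall>e>0. \<exists>g\<in>FCb1. (\<integral>x. \<bar>f x - g x\<bar> powr p \<partial>\<mu>) < e}"
  have L_add: "(\<lambda>x. g x + h x) \<in> L" if "g \<in> L" "h \<in> L" for g h
    using that integrable_powr_add(1)[OF p] by (auto simp: L_def)
  have L_scale: "(\<lambda>x. c * g x) \<in> L" if "g \<in> L" for g c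
    using that by (auto simp: L_def abs_mult powr_mult)
  have L_diff: "(\<lambda>x. g x - h x) \<in> L" if "g \<in> L" "h \<in> L" for g h
    using L_add[OF that(1) L_scale[OF that(2), of "- 1"]] by simp
  have tri: "(\<integral>x. \<bar>g x - k x\<bar> powr p \<partial>\<mu>) \<le> 2 powr p * ((\<integral>x. \<bar>g x - h x\<bar> powr p \<partial>\<mu>) + (\<integral>x. \<bar>h x - k x\<bar> powr p \<partial>\<mu>))"
    if "g \<in> L" "h \<in> L" "k \<in> L" for g h k
    using integrable_powr_add(2)[OF p, of "\<lambda>x. g x - h x" \<mu> "\<lambda>x. h x - k x"] L_diff[OF that(1,2)] L_diff[OF that(2,3)]
    by (simp add: L_def)
  have FL: "g \<in> L" if "g \<in> FCb1" for g using gm[OF that] gint[OF that] by (simp add: L_def)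
  have two: "0 < (2::real) powr p" by simp
  \<comment> \<open>\<open>A\<close> is closed: two approximation steps cost the factor 2^p of
    \<open>tri\<close>, which the choice of \<open>d\<close> compensates.\<close>
  have AI: "h \<in> A" if h: "h \<in> L" and ap: "\<And>e. 0 < e \<Longrightarrow> \<exists>g\<in>A. (\<integral>x. \<bar>h x - g x\<bar> powr p \<partial>\<mu>) < e" for h
    unfolding A_def
  proof (intro CollectI conjI h allI impI)
    fix e :: real assume e: "0 < e"
    define d where "d = e / (2 powr p * 2)"
    have d: "0 < d" using e by (simp add: d_def)
    obtain g where g: "g \<in> A" "(\<integral>x. \<bar>h x - g x\<bar> powr p \<partial>\<mu>) < d" using ap[OF d] by blast
    then have gL: "g \<in> L" by (simp add: A_def)
    obtain k where k: "k \<in> FCb1" "(\<integral>x. \<bar>g x - k x\<bar> powr p \<partial>\<mu>) < d" using g(1) d unfolding A_def by blast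
    have "(\<integral>x. \<bar>h x - k x\<bar> powr p \<partial>\<mu>) \<le> 2 powr p * ((\<integral>x. \<bar>h x - g x\<bar> powr p \<partial>\<mu>) + (\<integral>x. \<bar>g x - k x\<bar> powr p \<partial>\<mu>))"
      by (rule tri[OF h gL FL[OF k(1)]])
    also have "\<dots> < 2 powr p * (d + d)" using g(2) k(2) two by (intro mult_strict_left_mono add_strict_mono) auto
    also have "\<dots> = e" by (simp add: d_def)
    finally show "\<exists>g\<in>FCb1. (\<integral>x. \<bar>h x - g x\<bar> powr p \<partial>\<mu>) < e" using k(1) by blast
  qed
  have FA: "g \<in> A" if "g \<in> FCb1" for g
    unfolding A_def using FL[OF that] that by (intro CollectI conjI allI impI bexI[of _ g]) auto
  have AL: "g \<in> L" if "g \<in> A" for g using that by (simp add: A_def)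
  have A_add: "(\<lambda>x. g x + h x) \<in> A" if g: "g \<in> A" and h: "h \<in> A" for g h
    unfolding A_def
  proof (intro CollectI conjI L_add[OF AL[OF g] AL[OF h]] allI impI)
    fix e :: real assume e: "0 < e"
    define d where "d = e / (2 powr p * 2)"
    have d: "0 < d" using e by (simp add: d_def)
    obtain g' where g': "g' \<in> FCb1" "(\<integral>x. \<bar>g x - g' x\<bar> powr p \<partial>\<mu>) < d" using g d unfolding A_def by blast
    obtain h' where h': "h' \<in> FCb1" "(\<integral>x. \<bar>h x - h' x\<bar> powr p \<partial>\<mu>) < d" using h d unfolding A_def by blast
    have "(\<integral>x. \<bar>(g x - g' x) + (h x - h' x)\<bar> powr p \<partial>\<mu>) \<le> 2 powr p * ((\<integral>x. \<bar>g x - g' x\<bar> powr p \<partial>\<mu>) + (\<integral>x. \<bar>h x - h' x\<bar> powr p \<partial>\<mu>))"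
      using L_diff[OF AL[OF g] FL[OF g'(1)]] L_diff[OF AL[OF h] FL[OF h'(1)]] by (intro integrable_powr_add(2)[OF p]) (auto simp: L_def)
    also have "\<dots> < 2 powr p * (d + d)" using g'(2) h'(2) two by (intro mult_strict_left_mono add_strict_mono) auto
    also have "\<dots> = e" by (simp add: d_def)
    finally have "(\<integral>x. \<bar>(g x + h x) - (g' x + h' x)\<bar> powr p \<partial>\<mu>) < e" by (simp add: algebra_simps)
    then show "\<exists>k\<in>FCb1. (\<integral>x. \<bar>(g x + h x) - k x\<bar> powr p \<partial>\<mu>) < e"
      by (rule bexI[where x = "\<lambda>x. g' x + h' x"]) (rule FCb1_add[OF g'(1) h'(1)])
  qed
  have A_scale: "(\<lambda>x. c * g x) \<in> A" if g: "g \<in> A" for g c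
    unfolding A_def
  proof (intro CollectI conjI L_scale[OF AL[OF g]] allI impI)
    fix e :: real assume e: "0 < e"
    define d where "d = e / (\<bar>c\<bar> powr p + 1)"
    have c: "0 < \<bar>c\<bar> powr p + 1" using powr_ge_zero[of "\<bar>c\<bar>" p] by linarith
    have d: "0 < d" using e c by (simp add: d_def)
    obtain g' where g': "g' \<in> FCb1" "(\<integral>x. \<bar>g x - g' x\<bar> powr p \<partial>\<mu>) < d" using g d unfolding A_def by blast
    have "\<bar>c * g x - c * g' x\<bar> powr p = \<bar>c\<bar> powr p * \<bar>g x - g' x\<bar> powr p" for x
      by (simp add: right_diff_distrib[symmetric] abs_mult powr_mult)
    then have "(\<integral>x. \<bar>c * g x - c * g' x\<bar> powr p \<partial>\<mu>) = \<bar>c\<bar> powr p * (\<integral>x. \<bar>g x - g' x\<bar> powr p \<partial>\<mu>)" by simp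
    also have "\<dots> \<le> \<bar>c\<bar> powr p * d" using g'(2) by (intro mult_left_mono) auto
    also have "\<dots> < (\<bar>c\<bar> powr p + 1) * d" using d by simp
    also have "\<dots> = e" using c by (simp add: d_def)
    finally have "(\<integral>x. \<bar>c * g x - c * g' x\<bar> powr p \<partial>\<mu>) < e" .
    then show "\<exists>k\<in>FCb1. (\<integral>x. \<bar>c * g x - k x\<bar> powr p \<partial>\<mu>) < e"
      by (rule bexI[where x = "\<lambda>x. c * g' x"]) (rule FCb1_scale[OF g'(1)])
  qed
  have A_lim: "h \<in> A" if h: "h \<in> L" and g: "\<And>n::nat. g n \<in> A" and lim: "AE x in \<mu>. (\<lambda>n. g n x) \<longlonglongrightarrow> h x"
    and w: "w \<in> L" "\<And>n x. \<bar>h x - g n x\<bar> \<le> \<bar>w x\<bar>" for h g w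
  proof (rule AI[OF h])
    fix e :: real assume e: "0 < e"
    have [measurable]: "h \<in> borel_measurable \<mu>" "\<And>n. g n \<in> borel_measurable \<mu>" using h AL[OF g] by (auto simp: L_def)
    have "(\<lambda>n. \<integral>x. \<bar>h x - g n x\<bar> powr p \<partial>\<mu>) \<longlonglongrightarrow> (\<integral>x. 0 \<partial>\<mu>)"
    proof (rule integral_dominated_convergence[where w = "\<lambda>x. \<bar>w x\<bar> powr p"])
      show "integrable \<mu> (\<lambda>x. \<bar>w x\<bar> powr p)" using w(1) by (simp add: L_def)
      show "AE x in \<mu>. (\<lambda>n. \<bar>h x - g n x\<bar> powr p) \<longlonglongrightarrow> 0"
        using lim
      proof eventually_elim
        case (elim x)
        have "(\<lambda>n. \<bar>h x - g n x\<bar>) \<longlonglongrightarrow> \<bar>h x - h x\<bar>" by (intro tendsto_intros elim)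
        then have "(\<lambda>n. \<bar>h x - g n x\<bar>) \<longlonglongrightarrow> 0" by simp
        then show ?case using p by (intro tendsto_zero_powrI[where b = p]) (auto intro: tendsto_const)
      qed
      show "AE x in \<mu>. norm (\<bar>h x - g n x\<bar> powr p) \<le> \<bar>w x\<bar> powr p" for n
        using w(2) p by (intro AE_I2) (simp add: powr_mono2)
    qed measurable
    then have "\<forall>\<^sub>F n in sequentially. (\<integral>x. \<bar>h x - g n x\<bar> powr p \<partial>\<mu>) < e"
      using e by (intro order_tendstoD(2)) auto
    then obtain n where "(\<integral>x. \<bar>h x - g n x\<bar> powr p \<partial>\<mu>) < e" by (auto simp: eventually_sequentially)
    then show "\<exists>g\<in>A. (\<integral>x. \<bar>h x - g x\<bar> powr p \<partial>\<mu>) < e" using g by blast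
  qed
  have L01: "h \<in> L" if "h \<in> borel_measurable \<mu>" "\<And>x. \<bar>h x\<bar> \<le> B" for h :: "'e \<Rightarrow> real" and B
    using bint[OF that] that(1) by (simp add: L_def)
  have oneL: "(\<lambda>_. c) \<in> L" for c :: real by (rule L01[of _ "\<bar>c\<bar>"]) auto

  obtain K where K: "\<And>n::nat. compact (K n)" "\<And>n. 1 - 1 / real (Suc n) < measure \<mu> (K n)" "AE x in \<mu>. x \<in> (\<Union>n. K n)"
    using radon_compact_exhaustion[OF \<mu>] by blast
  define X where "X = (\<Union>n. K n)"
  obtain \<xi> :: "nat \<Rightarrow> 'e \<Rightarrow>\<^sub>L real" where inj: "inj_on (\<lambda>x n. blinfun_apply (\<xi> n) x) X"
    using sigma_compact_functionals[of K, OF K(1)] unfolding X_def[symmetric] by (elim exE conjE) (rule that)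
  define J where "J x = (\<lambda>n. blinfun_apply (\<xi> n) x)" for x
  have injJ: "inj_on J X" using inj unfolding J_def[abs_def] .
  have Jc: "continuous_on UNIV J"
    unfolding J_def by (intro continuous_on_coordinatewise_then_product continuous_intros)
  have J: "J \<in> borel_measurable borel" by (rule borel_measurable_continuous_onI[OF Jc])
  have J\<mu>: "J \<in> borel_measurable \<mu>" using J \<mu>D(1) by (simp cong: measurable_cong_sets)
  have indm: "(\<lambda>x. indicator S (J x) :: real) \<in> borel_measurable \<mu>" if "S \<in> sets borel" for S
    using measurable_comp[OF J\<mu> borel_measurable_indicator[OF that]] by (simp add: comp_def)
  have indL: "(\<lambda>x. indicator S (J x)) \<in> L" if "S \<in> sets borel" for S
    by (rule L01[OF indm[OF that], of 1]) simp
  have cyl: "(\<lambda>x. indicator S (J x)) \<in> A" if S: "S \<in> half_space_cylinders" for S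
  proof -
    obtain F a where F: "S = {w. \<forall>k\<in>F. a k < w k}" "finite F" using S unfolding half_space_cylinders_def by auto
    obtain N0 where N0: "F \<subseteq> {..<N0}" using F(2) finite_nat_iff_bounded by auto
    define N where "N = Suc N0"
    have N: "F \<subseteq> {..<N}" "1 \<le> N" using N0 by (auto simp: N_def)
    have SB: "S \<in> sets borel" unfolding sets_half_space_cylinders by (rule sigma_sets.Basic[OF S])
    define \<eta> where "\<eta> m k = (if k \<in> F then smooth_step (a k) (real m) else (\<lambda>_. 1))" for m k
    define \<eta>' where "\<eta>' m k s = (if k \<in> F then (real m)\<^sup>2 / (1 + ((real m)\<^sup>2 * (s - a k) - real m)\<^sup>2) / pi else 0)" for m k s
    have \<eta>01: "0 \<le> \<eta> m k s" "\<eta> m k s \<le> 1" for m k s using smooth_step_bounds by (auto simp: \<eta>_def)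
    define \<phi> where "\<phi> m u = (\<Prod>k<N. \<eta> m k (u k))" for m u
    have \<phi>: "Cb1 N (\<phi> m)" for m
      unfolding \<phi>_def
    proof (rule Cb1_prod[where \<eta>' = "\<eta>' m" and C = "\<lambda>_. (real m)\<^sup>2"])
      show "(\<eta> m k has_real_derivative \<eta>' m k s) (at s)" for k s
        using smooth_step_deriv by (auto simp: \<eta>_def \<eta>'_def)
      have pos: "1 + x\<^sup>2 \<noteq> 0" for x :: real using zero_le_power2[of x] by linarith
      show "continuous_on UNIV (\<eta>' m k)" for k
      proof (cases "k \<in> F")
        case True
        have "continuous_on UNIV (\<lambda>s. (real m)\<^sup>2 / (1 + ((real m)\<^sup>2 * (s - a k) - real m)\<^sup>2) / pi)"
          by (intro continuous_intros ballI pos) simp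
        then show ?thesis using True by (simp add: \<eta>'_def)
      qed (simp add: \<eta>'_def)
      show "\<bar>\<eta> m k s\<bar> \<le> 1" for k s using \<eta>01[of m k s] by simp
      show "\<bar>\<eta>' m k s\<bar> \<le> (real m)\<^sup>2" for k s
      proof -
        define y where "y = ((real m)\<^sup>2 * (s - a k) - real m)\<^sup>2"
        have y: "0 \<le> y" by (simp add: y_def)
        have "(real m)\<^sup>2 / (1 + y) / pi = (real m)\<^sup>2 / ((1 + y) * pi)" by simp
        also have "\<dots> \<le> (real m)\<^sup>2 / 1"
        proof (rule divide_left_mono)
          have "1 * 1 \<le> (1 + y) * pi" using y pi_ge_two by (intro mult_mono) auto
          then show "1 \<le> (1 + y) * pi" by simp
        qed (use y in auto)
        finally show ?thesis using y by (auto simp: \<eta>'_def y_def[symmetric])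
      qed
    qed
    define g where "g m x = \<phi> m (J x)" for m x
    have gF: "g m \<in> FCb1" for m
    proof -
      have "cyl_rep (g m) N (\<phi> m) \<xi>" unfolding cyl_rep_def g_def J_def using \<phi> N(2) by simp
      then show ?thesis unfolding FCb1_def by (intro CollectI exI)
    qed
    have g01: "0 \<le> g m x" "g m x \<le> 1" for m x
      unfolding g_def \<phi>_def by (intro prod_nonneg \<eta>01) (intro prod_le_1 conjI \<eta>01)
    show ?thesis
    proof (rule A_lim[of "\<lambda>x. indicator S (J x)" g "\<lambda>_. 1", OF indL[OF SB]])
      show "g n \<in> A" for n by (rule FA[OF gF])
      show "(\<lambda>_. 1) \<in> L" by (rule oneL)
      show "\<bar>indicator S (J x) - g n x\<bar> \<le> \<bar>1\<bar>" for n x using g01[of n x] by (auto simp: indicator_def)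
      show "AE x in \<mu>. (\<lambda>n. g n x) \<longlonglongrightarrow> indicator S (J x)"
      proof (rule AE_I2)
        fix x
        have "(\<lambda>n. \<eta> n k (J x k)) \<longlonglongrightarrow> (if k \<in> F then indicator {a k<..} (J x k) else 1)" for k
          using smooth_step_tendsto[of "a k" "J x k"] by (simp add: \<eta>_def)
        then have "(\<lambda>n. g n x) \<longlonglongrightarrow> (\<Prod>k<N. if k \<in> F then indicator {a k<..} (J x k) else 1)"
          unfolding g_def \<phi>_def by (intro tendsto_prod)
        also have "(\<Prod>k<N. if k \<in> F then indicator {a k<..} (J x k) else 1) = (\<Prod>k\<in>F. indicator {a k<..} (J x k) :: real)"
          using N(1) by (simp add: prod.If_cases Int_absorb1)
        also have "\<dots> = indicator S (J x)"
          using F by (auto simp: indicator_def intro!: prod.neutral)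
        finally show "(\<lambda>n. g n x) \<longlonglongrightarrow> indicator S (J x)" .
      qed
    qed
  qed
  have one: "(\<lambda>_. 1) \<in> A"
  proof -
    have "UNIV \<in> half_space_cylinders" unfolding half_space_cylinders_def by (intro CollectI exI[of _ "{}"]) auto
    from cyl[OF this] show ?thesis by simp
  qed
  \<comment> \<open>Dynkin's argument: complements use that constants lie in \<open>A\<close>,
    disjoint unions use partial sums, whose distance to the limit is at most 1.\<close>
  have indJ: "(\<lambda>x. indicator S (J x)) \<in> A" if "S \<in> sets borel" for S
    using that unfolding sets_half_space_cylinders
  proof (induction rule: sigma_sets_induct_disjoint[OF Int_stable_half_space_cylinders Pow_UNIV[THEN equalityD2, THEN subset_trans[OF subset_UNIV]], consumes 1, case_names basic empty compl union])
    case (basic S) then show ?case by (rule cyl)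
  next
    case empty then show ?case using A_scale[OF one, of 0] by simp
  next
    case (compl S)
    have "(\<lambda>x. 1 + (- 1) * indicator S (J x)) \<in> A" by (intro A_add one A_scale compl)
    moreover have "(\<lambda>x. 1 + (- 1) * indicator S (J x) :: real) = (\<lambda>x. indicator (UNIV - S) (J x))"
      by (auto simp: indicator_def fun_eq_iff)
    ultimately show ?case by simp
  next
    case (union S)
    have Ssets: "S n \<in> sets borel" for n using union(2) unfolding sets_half_space_cylinders by auto
    have psum: "(\<lambda>x. \<Sum>k<n. indicator (S k) (J x)) \<in> A" for n
      by (induction n) (use A_scale[OF one, of 0] union(3) in \<open>auto intro!: A_add\<close>)
    have eq: "(\<Sum>k<n. indicator (S k) w) = (indicator (\<Union>k<n. S k) w :: real)" for n w
      using union(1) by (subst indicator_UN_disjoint[of "{..<n}" S]) (auto simp: disjoint_family_on_def)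
    show ?case
    proof (rule A_lim[of _ "\<lambda>n x. \<Sum>k<n. indicator (S k) (J x)" "\<lambda>_. 1"])
      show "(\<lambda>x. indicator (\<Union> (range S)) (J x)) \<in> L" using Ssets by (intro indL) auto
      show "(\<lambda>_. 1) \<in> L" by (rule oneL)
      show "\<bar>indicator (\<Union> (range S)) (J x) - (\<Sum>k<n. indicator (S k) (J x))\<bar> \<le> \<bar>1 :: real\<bar>" for n x
        unfolding eq by (auto simp: indicator_def)
      show "AE x in \<mu>. (\<lambda>n. \<Sum>k<n. indicator (S k) (J x)) \<longlonglongrightarrow> (indicator (\<Union> (range S)) (J x) :: real)"
        unfolding eq by (intro AE_I2 LIMSEQ_indicator_UN)
    qed (rule psum)
  qed
  have ind: "(\<lambda>x. indicator B x) \<in> A" if B: "B \<in> sets \<mu>" for B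
  proof -
    have B': "B \<in> sets borel" using B \<mu>D(1) by simp
    \<comment> \<open>Up to a null set \<open>B\<close> is the preimage under \<open>J\<close> of
      the image of its part in \<open>X\<close>, so a constant sequence suffices in
      \<open>A_lim\<close>.\<close>
    have JB: "J ` (B \<inter> X) \<in> sets borel"
      unfolding X_def by (rule borel_image_sigma_compact[where K = K, OF _ Jc _ B'], rule K, rule injJ[unfolded X_def])
    show ?thesis
    proof (rule A_lim[of _ "\<lambda>n x. indicator (J ` (B \<inter> X)) (J x)" "\<lambda>_. 1"])
      show "(\<lambda>x. indicator B x) \<in> L" using B by (intro L01[of _ 1]) auto
      show "(\<lambda>x. indicator (J ` (B \<inter> X)) (J x)) \<in> A" by (rule indJ[OF JB])
      show "(\<lambda>_. 1) \<in> L" by (rule oneL)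
      show "\<bar>indicator B x - indicator (J ` (B \<inter> X)) (J x)\<bar> \<le> \<bar>1 :: real\<bar>" for x by (auto simp: indicator_def)
      show "AE x in \<mu>. (\<lambda>n. indicator (J ` (B \<inter> X)) (J x)) \<longlonglongrightarrow> (indicator B x :: real)"
        using K(3) unfolding X_def[symmetric]
      proof eventually_elim
        case (elim x)
        have "J x \<in> J ` (B \<inter> X) \<longleftrightarrow> x \<in> B"
          using injJ elim unfolding inj_on_def by blast
        then have "indicator (J ` (B \<inter> X)) (J x) = (indicator B x :: real)" by (simp add: indicator_def)
        then show ?case by simp
      qed
    qed
  qed
  have simple: "s \<in> A" if s: "simple_function \<mu> s" for s :: "'e \<Rightarrow> real"
  proof -
    have fin: "finite (s ` space \<mu>)" using s by (simp add: simple_function_def)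
    have sum: "(\<lambda>x. \<Sum>y\<in>Y. y * indicator (s -` {y} \<inter> space \<mu>) x) \<in> A" if "finite Y" "Y \<subseteq> s ` space \<mu>" for Y
      using that
    proof (induction Y rule: finite_induct)
      case empty then show ?case using A_scale[OF one, of 0] by simp
    next
      case (insert y Y)
      have sm: "s -` {y} \<inter> space \<mu> \<in> sets \<mu>" by (rule simple_functionD(2)[OF s])
      have IH: "(\<lambda>x. \<Sum>y\<in>Y. y * indicator (s -` {y} \<inter> space \<mu>) x) \<in> A" using insert by blast
      show ?case
        unfolding sum.insert[OF insert(1,2)] by (intro A_add A_scale ind[OF sm] IH)
    qed
    have "s = (\<lambda>x. \<Sum>y\<in>s ` space \<mu>. y * indicator (s -` {y} \<inter> space \<mu>) x)"
    proof
      fix x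
      have x: "x \<in> space \<mu>" using \<mu>D(3) by simp
      have "(\<Sum>y\<in>s ` space \<mu>. y * indicator (s -` {y} \<inter> space \<mu>) x) = (\<Sum>y\<in>s ` space \<mu>. if y = s x then y else 0)"
        using x by (intro sum.cong) (auto simp: indicator_def)
      also have "\<dots> = s x" using fin x by simp
      finally show "s x = (\<Sum>y\<in>s ` space \<mu>. y * indicator (s -` {y} \<inter> space \<mu>) x)" by simp
    qed
    then show ?thesis using sum[OF fin order_refl] by simp
  qed
  have fL: "f \<in> L" using f by (simp add: L_def)
  obtain F where F: "\<And>n. simple_function \<mu> (F n)" "\<And>x. x \<in> space \<mu> \<Longrightarrow> (\<lambda>n. F n x) \<longlonglongrightarrow> f x"
    "\<And>n x. x \<in> space \<mu> \<Longrightarrow> dist (F n x) 0 \<le> 2 * dist (f x) 0"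
    using borel_measurable_implies_sequence_metric[OF f(1), of 0] by blast
  have "f \<in> A"
  \<comment> \<open>The dominating function is 3 f because the simple approximations satisfy |F n|
    \<le> 2 |f|.\<close>
  proof (rule A_lim[of f F "\<lambda>x. 3 * f x", OF fL])
    show "F n \<in> A" for n by (rule simple[OF F(1)])
    show "(\<lambda>x. 3 * f x) \<in> L" by (rule L_scale[OF fL])
    show "AE x in \<mu>. (\<lambda>n. F n x) \<longlonglongrightarrow> f x" by (intro AE_I2 F(2))
    show "\<bar>f x - F n x\<bar> \<le> \<bar>3 * f x\<bar>" for n x
      using F(3)[of x n] \<mu>D(3) by (simp add: dist_real_def)
  qed
  then have "f \<in> L \<and> (\<forall>e>0. \<exists>g\<in>FCb1. (\<integral>x. \<bar>f x - g x\<bar> powr p \<partial>\<mu>) < e)"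
    unfolding A_def by (rule CollectD)
  then have "\<forall>e>0. \<exists>g\<in>FCb1. (\<integral>x. \<bar>f x - g x\<bar> powr p \<partial>\<mu>) < e" by (rule conjunct2)
  from this[rule_format, OF e] show ?thesis .
qed

section \<open>Extension to Lebesgue-Bochner spaces\<close>

lemma strongly_measurable_norm:
  "strongly_measurable M f \<Longrightarrow> (\<lambda>x. norm (f x)) \<in> borel_measurable M"
  by (rule borel_measurable_continuous_on[of norm]) (simp_all add: strongly_measurable_def continuous_on_norm_id)

lemma strongly_measurable_real:
  fixes f :: "'a \<Rightarrow> real"
  shows "strongly_measurable M f \<longleftrightarrow> f \<in> borel_measurable M"
proof
  assume "f \<in> borel_measurable M"
  moreover have "countable (\<rat> :: real set)" "f ` space M \<subseteq> closure \<rat>" by (simp_all add: countable_rat Rats_closure_real)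
  ultimately show "strongly_measurable M f" unfolding strongly_measurable_def by blast
qed (simp add: strongly_measurable_def)

lemma Lp_realD:
  fixes f :: "'a \<Rightarrow> real"
  shows "f \<in> Lp p M \<longleftrightarrow> f \<in> borel_measurable M \<and> integrable M (\<lambda>x. \<bar>f x\<bar> powr p)"
  by (simp add: Lp_def strongly_measurable_real)

text \<open>The sum of the p-th powers has finite integral, hence converges almost everywhere and
  its terms tend to 0. The whole sequence converges, so no subsequences have to be managed
  later.\<close>

lemma AE_tendsto_zero_of_summable_moments:
  fixes e :: "nat \<Rightarrow> 'a \<Rightarrow> real"
  assumes p: "0 < p" and e: "\<And>n. e n \<in> borel_measurable M" "\<And>n x. 0 \<le> e n x" "\<And>n. integrable M (\<lambda>x. e n x powr p)"
    and sum: "summable (\<lambda>n. \<integral>x. e n x powr p \<partial>M)"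
  shows "AE x in M. (\<lambda>n. e n x) \<longlonglongrightarrow> 0"
proof -
  note [measurable] = e(1)
  have "(\<integral>\<^sup>+x. (\<Sum>n. ennreal (e n x powr p)) \<partial>M) = (\<Sum>n. \<integral>\<^sup>+x. ennreal (e n x powr p) \<partial>M)"
    by (rule nn_integral_suminf) measurable
  also have "\<dots> = (\<Sum>n. ennreal (\<integral>x. e n x powr p \<partial>M))"
    by (intro suminf_cong nn_integral_eq_integral e(3)) simp
  also have "\<dots> = ennreal (\<Sum>n. \<integral>x. e n x powr p \<partial>M)"
    by (rule suminf_ennreal2[OF _ sum]) simp
  finally have "(\<integral>\<^sup>+x. (\<Sum>n. ennreal (e n x powr p)) \<partial>M) \<noteq> \<infinity>" by simp
  then have "AE x in M. (\<Sum>n. ennreal (e n x powr p)) \<noteq> \<infinity>"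
    by (intro nn_integral_noteq_infinite) auto
  then show ?thesis
  proof eventually_elim
    case (elim x)
    have "summable (\<lambda>n. e n x powr p)"
      by (rule summable_suminf_not_top) (use elim in auto)
    then have "(\<lambda>n. e n x powr p) \<longlonglongrightarrow> 0" by (rule summable_LIMSEQ_zero)
    have "(\<lambda>n. (e n x powr p) powr (1 / p)) \<longlonglongrightarrow> 0"
    proof (rule tendsto_zero_powrI[OF \<open>(\<lambda>n. e n x powr p) \<longlonglongrightarrow> 0\<close> tendsto_const])
      show "0 < 1 / p" using p by simp
    qed (simp add: e(2))
    moreover have "(e n x powr p) powr (1 / p) = e n x" for n
      using p e(2)[of n x] by (simp add: powr_powr)
    ultimately show ?case by simp
  qed
qed

text \<open>The factor (1/2)^(n p) in the hypothesis allows the increments to be multiplied by 2^n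
  while their p-th moments stay summable, so almost everywhere the increments are eventually below
  (1/2)^n.\<close>

lemma AE_Cauchy_of_summable_moments:
  fixes F :: "nat \<Rightarrow> 'a \<Rightarrow> 'h::{real_normed_vector,complete_space}"
  assumes p: "1 < p" and m: "\<And>n. (\<lambda>x. norm (F (Suc n) x - F n x)) \<in> borel_measurable M"
    and i: "\<And>n. integrable M (\<lambda>x. norm (F (Suc n) x - F n x) powr p)"
    and le: "\<And>n. (\<integral>x. norm (F (Suc n) x - F n x) powr p \<partial>M) \<le> C * (1 / 2) ^ n * (1 / 2) powr (real n * p)"
  shows "AE x in M. convergent (\<lambda>n. F n x)"
proof -
  have p0: "0 < p" using p by simp
  define e where "e = (\<lambda>n x. 2 ^ n * norm (F (Suc n) x - F n x))"
  have ep: "e n x powr p = 2 powr (real n * p) * norm (F (Suc n) x - F n x) powr p" for n x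
  proof -
    have "(2 ^ n :: real) powr p = 2 powr (real n * p)"
      using powr_powr[of "2::real" "real n" p] by (simp only: powr_realpow zero_less_numeral)
    then show ?thesis unfolding e_def by (subst powr_mult) simp_all
  qed
  have ie: "(\<integral>x. e n x powr p \<partial>M) \<le> C * (1 / 2) ^ n" for n
  proof -
    have "(\<integral>x. e n x powr p \<partial>M) = 2 powr (real n * p) * (\<integral>x. norm (F (Suc n) x - F n x) powr p \<partial>M)"
      unfolding ep by simp
    also have "\<dots> \<le> 2 powr (real n * p) * (C * (1 / 2) ^ n * (1 / 2) powr (real n * p))"
      by (intro mult_left_mono le) simp
    also have "\<dots> = C * (1 / 2) ^ n * (2 powr (real n * p) * (1 / 2) powr (real n * p))" by simp
    also have "2 powr (real n * p) * (1 / 2) powr (real n * p) = (1::real)"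
      by (subst powr_mult[symmetric]) simp_all
    finally show ?thesis by simp
  qed
  have "AE x in M. (\<lambda>n. e n x) \<longlonglongrightarrow> 0"
  proof (rule AE_tendsto_zero_of_summable_moments[OF p0])
    show "e n \<in> borel_measurable M" for n unfolding e_def by (rule borel_measurable_times[OF borel_measurable_const m])
    show "integrable M (\<lambda>x. e n x powr p)" for n unfolding ep by (intro integrable_mult_right i)
    show "summable (\<lambda>n. \<integral>x. e n x powr p \<partial>M)"
    proof (rule summable_comparison_test'[of "\<lambda>n. C * (1 / 2) ^ n" 0])
      show "summable (\<lambda>n. C * (1 / 2 :: real) ^ n)" by (intro summable_mult summable_geometric) simp
      show "norm (\<integral>x. e n x powr p \<partial>M) \<le> C * (1 / 2) ^ n" for n using ie[of n] by simp
    qed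
  qed (simp add: e_def)
  then show ?thesis
  proof eventually_elim
    case (elim x)
    have "\<exists>N. \<forall>n\<ge>N. e n x < 1"
      using order_tendstoD(2)[OF elim, of 1] by (simp add: eventually_sequentially)
    then obtain N where N: "\<And>n. N \<le> n \<Longrightarrow> e n x < 1" by auto
    have le: "norm (F (Suc n) x - F n x) \<le> (1 / 2) ^ n" if "N \<le> n" for n
    proof -
      have "(1 / 2) ^ n * e n x \<le> (1 / 2) ^ n * 1" using N[OF that] by (intro mult_left_mono) simp_all
      moreover have "(1 / 2) ^ n * (2 ^ n * d) = d" for d :: real by (simp add: power_one_over)
      ultimately show ?thesis by (simp only: e_def mult_1_right)
    qed
    have sn: "summable (\<lambda>n. norm (F (Suc n) x - F n x))"
      by (rule summable_comparison_test'[of "\<lambda>n. (1 / 2::real) ^ n" N]) (simp_all add: summable_geometric le)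
    have "Cauchy (\<lambda>n. F n x)"
    proof (rule metric_CauchyI)
      fix \<epsilon> :: real assume \<epsilon>: "0 < \<epsilon>"
      have "\<exists>K. \<forall>m\<ge>K. \<forall>n. norm (\<Sum>k=m..<n. norm (F (Suc k) x - F k x)) < \<epsilon>"
        using spec[OF sn[unfolded summable_Cauchy], of \<epsilon>] \<epsilon> by (rule mp)
      then obtain K where K: "\<And>m n. K \<le> m \<Longrightarrow> norm (\<Sum>k=m..<n. norm (F (Suc k) x - F k x)) < \<epsilon>" by auto
      have close: "dist (F m x) (F n x) < \<epsilon>" if "K \<le> m" "m \<le> n" for m n
      proof -
        have "F n x - F m x = (\<Sum>k=m..<n. F (Suc k) x - F k x)" by (rule sum_Suc_diff'[OF that(2), symmetric])
        then have "norm (F n x - F m x) \<le> (\<Sum>k=m..<n. norm (F (Suc k) x - F k x))" by (simp only: norm_sum)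
        also have "\<dots> < \<epsilon>" using K[OF that(1), of n] unfolding real_norm_def by (rule le_less_trans[OF abs_ge_self])
        finally show ?thesis unfolding dist_norm by (subst norm_minus_commute)
      qed
      show "\<exists>M. \<forall>m\<ge>M. \<forall>n\<ge>M. dist (F m x) (F n x) < \<epsilon>"
      proof (intro exI[of _ K] allI impI)
        fix m n assume "K \<le> m" "K \<le> n"
        then show "dist (F m x) (F n x) < \<epsilon>"
          using close[OF \<open>K \<le> m\<close>, of n] close[OF \<open>K \<le> n\<close>, of m] linear[of m n]
          unfolding dist_commute[of "F n x"] by (elim disjE)
      qed
    qed
    then show ?case using Cauchy_convergent by blast
  qed
qed

text \<open>Measurable distances make the set of convergence measurable; outside it the limit is
  replaced by 0. For gradients the premise on distances is immediate, as their differences are again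
  gradients.\<close>

lemma strongly_measurable_limit:
  fixes F :: "nat \<Rightarrow> 'a \<Rightarrow> 'h::{real_normed_vector,complete_space}"
  assumes F: "\<And>n. strongly_measurable M (F n)"
    and d: "\<And>m n. (\<lambda>x. norm (F m x - F n x)) \<in> borel_measurable M"
  shows "strongly_measurable M (\<lambda>x. if convergent (\<lambda>n. F n x) then lim (\<lambda>n. F n x) else 0)" (is "strongly_measurable M ?L")
proof -
  note [measurable] = d
  have [measurable]: "F n \<in> borel_measurable M" for n using F by (simp add: strongly_measurable_def)
  define G where "G = {x\<in>space M. \<forall>k. \<exists>N. \<forall>m\<ge>N. \<forall>n\<ge>N. norm (F m x - F n x) < inverse (real (Suc k))}"
  have G[measurable]: "G \<in> sets M" unfolding G_def by measurable
  have GI: "convergent (\<lambda>n. F n x) \<longleftrightarrow> x \<in> G" if "x \<in> space M" for x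
  proof -
    have "convergent (\<lambda>n. F n x) \<longleftrightarrow> Cauchy (\<lambda>n. F n x)" by (rule Cauchy_convergent_iff[symmetric])
    also have "\<dots> \<longleftrightarrow> (\<forall>k. \<exists>N. \<forall>m\<ge>N. \<forall>n\<ge>N. norm (F m x - F n x) < inverse (real (Suc k)))"
      unfolding dist_norm[symmetric] by (rule metric_Cauchy_iff2)
    finally show ?thesis unfolding G_def mem_Collect_eq using that by (simp only: simp_thms)
  qed
  define H where "H n x = (if x \<in> G then F n x else 0)" for n x
  have H: "(\<lambda>n. H n x) \<longlonglongrightarrow> ?L x" if "x \<in> space M" for x
    using GI[OF that] by (auto simp: H_def convergent_LIMSEQ_iff)
  have bm: "?L \<in> borel_measurable M"
  proof (rule borel_measurable_LIMSEQ_metric)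
    show "H n \<in> borel_measurable M" for n unfolding H_def by (intro measurable_If_set) auto
  qed (rule H)
  have "\<forall>n. \<exists>D. countable D \<and> F n ` space M \<subseteq> closure D"
  proof
    fix n show "\<exists>D. countable D \<and> F n ` space M \<subseteq> closure D"
      using F[of n] unfolding strongly_measurable_def by (rule conjunct2)
  qed
  then have "\<exists>D. \<forall>n. countable (D n) \<and> F n ` space M \<subseteq> closure (D n)" by (rule choice)
  then obtain D where D': "\<forall>n. countable (D n) \<and> F n ` space M \<subseteq> closure (D n)" by (rule exE)
  have D: "countable (D n)" "F n ` space M \<subseteq> closure (D n)" for n
    using spec[OF D', of n] by simp_all
  define \<Delta> where "\<Delta> = insert 0 (\<Union>n. D n)"
  have "countable \<Delta>" using D(1) by (simp add: \<Delta>_def)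
  moreover have "?L ` space M \<subseteq> closure \<Delta>"
  proof (rule image_subsetI)
    fix x assume x: "x \<in> space M"
    have "H n x \<in> closure \<Delta>" for n
    proof -
      have "closure (D n) \<subseteq> closure \<Delta>" by (rule closure_mono) (auto simp: \<Delta>_def)
      moreover have "F n x \<in> closure (D n)" using D(2) x by blast
      moreover have "0 \<in> closure \<Delta>" by (rule subsetD[OF closure_subset]) (simp add: \<Delta>_def)
      ultimately show ?thesis unfolding H_def by auto
    qed
    then show "?L x \<in> closure \<Delta>"
      by (intro closed_sequentially[OF closed_closure _ H[OF x]]) auto
  qed
  ultimately show ?thesis using bm unfolding strongly_measurable_def by blast
qed

text \<open>Fatou's lemma for the p-th powers of the norms.\<close>

lemma Lp_limit_bound:
  fixes F :: "nat \<Rightarrow> 'a \<Rightarrow> 'h::real_normed_vector"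
  assumes p: "0 < p" and F: "\<And>n. strongly_measurable M (F n)" "\<And>n. integrable M (\<lambda>x. norm (F n x) powr p)"
    and L: "strongly_measurable M L" and lim: "AE x in M. (\<lambda>n. F n x) \<longlonglongrightarrow> L x"
    and le: "\<And>n. (\<integral>x. norm (F n x) powr p \<partial>M) \<le> B n" and B: "B \<longlonglongrightarrow> b"
  shows "integrable M (\<lambda>x. norm (L x) powr p)" and "(\<integral>x. norm (L x) powr p \<partial>M) \<le> b"
proof -
  note [measurable] = strongly_measurable_norm[OF F(1)] strongly_measurable_norm[OF L]
  have "0 \<le> B n" for n using le[of n] by (rule order_trans[rotated]) simp
  then have b: "0 \<le> b" by (intro LIMSEQ_le_const[OF B]) auto
  have "(\<integral>\<^sup>+x. ennreal (norm (L x) powr p) \<partial>M) = (\<integral>\<^sup>+x. liminf (\<lambda>n. ennreal (norm (F n x) powr p)) \<partial>M)"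
  proof (rule nn_integral_cong_AE)
    show "AE x in M. ennreal (norm (L x) powr p) = liminf (\<lambda>n. ennreal (norm (F n x) powr p))"
      using lim
    proof eventually_elim
      case (elim x)
      have "(\<lambda>n. norm (F n x) powr p) \<longlonglongrightarrow> norm (L x) powr p"
        by (rule tendsto_powr2[OF tendsto_norm[OF elim] tendsto_const]) (use p in auto)
      then have "(\<lambda>n. ennreal (norm (F n x) powr p)) \<longlonglongrightarrow> ennreal (norm (L x) powr p)"
        by (rule tendsto_ennrealI)
      from lim_imp_Liminf[OF trivial_limit_sequentially this] show ?case by simp
    qed
  qed
  also have "\<dots> \<le> liminf (\<lambda>n. \<integral>\<^sup>+x. ennreal (norm (F n x) powr p) \<partial>M)"
    by (rule nn_integral_liminf) measurable
  also have "\<dots> \<le> liminf (\<lambda>n. ennreal (B n))"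
  proof (rule Liminf_mono, rule always_eventually, rule allI)
    fix n
    have "(\<integral>\<^sup>+x. ennreal (norm (F n x) powr p) \<partial>M) = ennreal (\<integral>x. norm (F n x) powr p \<partial>M)"
      by (rule nn_integral_eq_integral[OF F(2)]) simp
    also have "\<dots> \<le> ennreal (B n)" by (rule ennreal_leI[OF le])
    finally show "(\<integral>\<^sup>+x. ennreal (norm (F n x) powr p) \<partial>M) \<le> ennreal (B n)" .
  qed
  also have "\<dots> = ennreal b"
    by (rule lim_imp_Liminf[OF trivial_limit_sequentially tendsto_ennrealI[OF B]])
  finally have fin: "(\<integral>\<^sup>+x. ennreal (norm (L x) powr p) \<partial>M) \<le> ennreal b" .
  show int: "integrable M (\<lambda>x. norm (L x) powr p)"
    by (rule integrableI_nonneg) (use fin in \<open>auto simp: le_less_trans[OF fin]\<close>)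
  have "(\<integral>\<^sup>+x. ennreal (norm (L x) powr p) \<partial>M) = ennreal (\<integral>x. norm (L x) powr p \<partial>M)"
    by (rule nn_integral_eq_integral[OF int]) simp
  then show "(\<integral>x. norm (L x) powr p \<partial>M) \<le> b" using fin b by simp
qed

lemma Lp_real_diff:
  fixes f g :: "'a \<Rightarrow> real"
  assumes p: "0 < p" and f: "f \<in> Lp p M" and g: "g \<in> Lp p M"
  shows "(\<lambda>x. f x - g x) \<in> Lp p M"
    and "(\<integral>x. \<bar>f x - g x\<bar> powr p \<partial>M) \<le> 2 powr p * ((\<integral>x. \<bar>f x\<bar> powr p \<partial>M) + (\<integral>x. \<bar>g x\<bar> powr p \<partial>M))"
proof -
  have f': "f \<in> borel_measurable M" "integrable M (\<lambda>x. \<bar>f x\<bar> powr p)" using f by (simp_all add: Lp_realD)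
  have g': "(\<lambda>x. - g x) \<in> borel_measurable M" "integrable M (\<lambda>x. \<bar>- g x\<bar> powr p)" using g by (simp_all add: Lp_realD)
  have "(\<lambda>x. f x - g x) \<in> borel_measurable M" using borel_measurable_add[OF f'(1) g'(1)] by simp
  then show "(\<lambda>x. f x - g x) \<in> Lp p M" using integrable_powr_add(1)[OF p f' g'] by (simp add: Lp_realD)
  show "(\<integral>x. \<bar>f x - g x\<bar> powr p \<partial>M) \<le> 2 powr p * ((\<integral>x. \<bar>f x\<bar> powr p \<partial>M) + (\<integral>x. \<bar>g x\<bar> powr p \<partial>M))"
    using integrable_powr_add(2)[OF p f' g'] by simp
qed

lemma Lp_norm_nonneg: "0 \<le> Lp_norm p M f"
  by (simp add: Lp_norm_def)

lemma Lp_norm_powr: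
  assumes "0 < p"
  shows "Lp_norm p M f powr p = (\<integral>x. norm (f x) powr p \<partial>M)"
proof -
  have "0 \<le> (\<integral>x. norm (f x) powr p \<partial>M)" by simp
  then show ?thesis using assms by (simp add: Lp_norm_def powr_powr)
qed

lemma Lp_norm_le_iff:
  assumes p: "0 < p" and c: "0 \<le> c"
  shows "Lp_norm p M f \<le> c * Lp_norm p M g \<longleftrightarrow>
    (\<integral>x. norm (f x) powr p \<partial>M) \<le> c powr p * (\<integral>x. norm (g x) powr p \<partial>M)"
proof -
  have cg: "0 \<le> c * Lp_norm p M g" using c Lp_norm_nonneg by (rule mult_nonneg_nonneg)
  have "(c * Lp_norm p M g) powr p = c powr p * (\<integral>x. norm (g x) powr p \<partial>M)"
    by (subst powr_mult) (simp_all add: c Lp_norm_nonneg Lp_norm_powr[OF p])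
  moreover have "Lp_norm p M f \<le> c * Lp_norm p M g \<longleftrightarrow> Lp_norm p M f powr p \<le> (c * Lp_norm p M g) powr p"
    using powr_mono2[of p "Lp_norm p M f" "c * Lp_norm p M g"] powr_less_mono2[of p "c * Lp_norm p M g" "Lp_norm p M f"] p cg Lp_norm_nonneg[of p M f]
    by (cases "Lp_norm p M f \<le> c * Lp_norm p M g") simp_all
  ultimately show ?thesis by (simp add: Lp_norm_powr[OF p])
qed

section \<open>Extension of the gradient operators by approximation\<close>

context ornstein_uhlenbeck
begin

lemma FCb1_borel: "f \<in> FCb1 \<Longrightarrow> f \<in> borel_measurable (mu_infty S i)"
  using borel_measurable_continuous_onI[OF FCb1_continuous] by (simp add: measurable_cong_sets[OF mu_infty_sets refl])

lemma FCb1_Lp: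
  assumes p: "0 < p" and f: "f \<in> FCb1"
  shows "f \<in> Lp p (mu_infty S i)"
proof -
  interpret prob_space "mu_infty S i" by (rule mu_infty_prob)
  note [measurable] = FCb1_borel[OF f]
  obtain B where B: "\<forall>x. \<bar>f x\<bar> \<le> B" using FCb1_bounded[OF f] by blast
  have "integrable (mu_infty S i) (\<lambda>x. \<bar>f x\<bar> powr p)"
    by (rule integrable_const_bound[of _ "B powr p"]) (use p B in \<open>auto intro!: powr_mono2\<close>)
  then show ?thesis using FCb1_borel[OF f] by (simp add: Lp_realD)
qed

lemma strongly_measurable_DH_OU:
  assumes "f \<in> FCb1"
  shows "strongly_measurable (mu_infty S i) (DH i (OU S i t f))"
proof -
  have "DH i (OU S i t f) \<in> borel_measurable (mu_infty S i)"
    using borel_measurable_continuous_onI[OF DH_OU_continuous(1)[OF assms, of t]] by (simp add: measurable_cong_sets[OF mu_infty_sets refl])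
  moreover obtain D where "countable D" "range (DH i (OU S i t f)) \<subseteq> closure D" using DH_OU_continuous(2)[OF assms, of t] by blast
  ultimately show ?thesis unfolding strongly_measurable_def by blast
qed

lemma OU_add:
  assumes f: "f \<in> FCb1" and g: "g \<in> FCb1"
  shows "OU S i t (\<lambda>x. f x + g x) = (\<lambda>x. OU S i t f x + OU S i t g x)"
proof
  fix x
  interpret prob_space "mu_t S i t" by (rule mu_t_prob)
  have int: "integrable (mu_t S i t) (\<lambda>y. h (S t x + y))" if h: "h \<in> FCb1" for h
  proof -
    obtain B where B: "\<forall>x. \<bar>h x\<bar> \<le> B" using FCb1_bounded[OF h] by blast
    have "continuous_on UNIV (\<lambda>y. h (S t x + y))"
      by (rule continuous_on_compose2[OF FCb1_continuous[OF h]]) (auto intro!: continuous_intros)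
    then have "(\<lambda>y. h (S t x + y)) \<in> borel_measurable (mu_t S i t)"
      using borel_measurable_continuous_onI by (simp add: measurable_cong_sets[OF mu_t_sets refl])
    then show ?thesis by (intro integrable_const_bound[of _ B]) (use B in auto)
  qed
  show "OU S i t (\<lambda>x. f x + g x) x = OU S i t f x + OU S i t g x"
    unfolding OU_def by (rule Bochner_Integration.integral_add[OF int[OF f] int[OF g]])
qed

lemma OU_scale: "OU S i t (\<lambda>x. c * f x) = (\<lambda>x. c * OU S i t f x)"
  by (simp add: OU_def fun_eq_iff)

lemma DH_OU_add:
  "f \<in> FCb1 \<Longrightarrow> g \<in> FCb1 \<Longrightarrow> DH i (OU S i t (\<lambda>x. f x + g x)) x = DH i (OU S i t f) x + DH i (OU S i t g) x"
  unfolding OU_add by (intro DH_add OU_FCb1)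

lemma DH_OU_scale: "f \<in> FCb1 \<Longrightarrow> DH i (OU S i t (\<lambda>x. c * f x)) x = c *\<^sub>R DH i (OU S i t f) x"
  unfolding OU_scale by (intro DH_scale OU_FCb1)

lemma FCb1_diff: "f \<in> FCb1 \<Longrightarrow> g \<in> FCb1 \<Longrightarrow> (\<lambda>x. f x - g x) \<in> FCb1"
  using FCb1_add[OF _ FCb1_scale[of g "- 1"], of f] by simp

lemma DH_OU_diff:
  assumes "f \<in> FCb1" "g \<in> FCb1"
  shows "DH i (OU S i t (\<lambda>x. f x - g x)) x = DH i (OU S i t f) x - DH i (OU S i t g) x"
  using DH_OU_add[OF assms(1) FCb1_scale[OF assms(2), of "- 1"], of t x] DH_OU_scale[OF assms(2), of t "- 1" x] by simp

text \<open>The factor (1/2)^n makes the errors summable; the factor (1/2)^(n p) yields almost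
  everywhere convergence of the gradients through
  \<open>AE_Cauchy_of_summable_moments\<close>.\<close>

definition approx :: "real \<Rightarrow> ('e \<Rightarrow> real) \<Rightarrow> nat \<Rightarrow> 'e \<Rightarrow> real" where
  "approx p f = (SOME F. \<forall>n. F n \<in> FCb1 \<and> (\<integral>x. \<bar>f x - F n x\<bar> powr p \<partial>mu_infty S i) < (1 / 2) ^ n * (1 / 2) powr (real n * p))"

lemma approx:
  assumes p: "0 < p" and f: "f \<in> Lp p (mu_infty S i)"
  shows "approx p f n \<in> FCb1"
    "(\<integral>x. \<bar>f x - approx p f n x\<bar> powr p \<partial>mu_infty S i) < (1 / 2) ^ n * (1 / 2) powr (real n * p)"
proof -
  have "\<forall>n. \<exists>g. g \<in> FCb1 \<and> (\<integral>x. \<bar>f x - g x\<bar> powr p \<partial>mu_infty S i) < (1 / 2) ^ n * (1 / 2) powr (real n * p)"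
  proof
    fix n
    have "0 < (1 / 2 :: real) ^ n * (1 / 2) powr (real n * p)" by simp
    then show "\<exists>g. g \<in> FCb1 \<and> (\<integral>x. \<bar>f x - g x\<bar> powr p \<partial>mu_infty S i) < (1 / 2) ^ n * (1 / 2) powr (real n * p)"
      using FCb1_dense[OF mu_infty_gaussian(1) p, of f] f unfolding Lp_realD by blast
  qed
  then have "\<exists>F. \<forall>n. F n \<in> FCb1 \<and> (\<integral>x. \<bar>f x - F n x\<bar> powr p \<partial>mu_infty S i) < (1 / 2) ^ n * (1 / 2) powr (real n * p)"
    by (rule choice)
  from someI_ex[OF this] show "approx p f n \<in> FCb1"
    "(\<integral>x. \<bar>f x - approx p f n x\<bar> powr p \<partial>mu_infty S i) < (1 / 2) ^ n * (1 / 2) powr (real n * p)"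
    unfolding approx_def[symmetric] by auto
qed

text \<open>A pointwise limit rather than one in norm, because operators act on representatives. For
  \<open>f\<close> in L^p the default 0 concerns a null set only.\<close>

definition ext :: "real \<Rightarrow> real \<Rightarrow> ('e \<Rightarrow> real) \<Rightarrow> 'e \<Rightarrow> 'h" where
  "ext p t f x = (if convergent (\<lambda>n. DH i (OU S i t (approx p f n)) x) then lim (\<lambda>n. DH i (OU S i t (approx p f n)) x) else 0)"

abbreviation grad_const :: "real \<Rightarrow> real \<Rightarrow> real \<Rightarrow> real" where
  "grad_const p t K \<equiv> (1 + gauss_abs_moment (p / (p - 1))) * K / sqrt t"

context
  fixes t p K :: real
  assumes t: "0 < t" and p: "1 < p" and K: "\<And>s. 0 \<le> s \<Longrightarrow> s \<le> t \<Longrightarrow> norm (S\<^sub>H s) \<le> K"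
begin

lemma p_pos: "0 < p"
  using p by simp

text \<open>Consecutive gradients differ by the gradient of a cylindrical function, so the p-th
  moments of the increments inherit the rate built into \<open>approx\<close>.\<close>

lemma ext_AE_convergent:
  assumes f: "f \<in> Lp p (mu_infty S i)"
  shows "AE x in mu_infty S i. (\<lambda>n. DH i (OU S i t (approx p f n)) x) \<longlonglongrightarrow> ext p t f x"
proof -
  define c where "c = grad_const p t K powr p"
  have c: "0 \<le> c" by (simp add: c_def)
  note a = approx[OF p_pos f]
  have fb: "f \<in> borel_measurable (mu_infty S i)" "integrable (mu_infty S i) (\<lambda>x. \<bar>f x\<bar> powr p)"
    using f by (simp_all add: Lp_realD)
  have ab: "approx p f n \<in> borel_measurable (mu_infty S i)" "integrable (mu_infty S i) (\<lambda>x. \<bar>approx p f n x\<bar> powr p)" for n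
    using FCb1_Lp[OF p_pos a(1)] by (simp_all add: Lp_realD)
  have fa: "(\<lambda>x. f x - approx p f n x) \<in> borel_measurable (mu_infty S i)" "integrable (mu_infty S i) (\<lambda>x. \<bar>f x - approx p f n x\<bar> powr p)" for n
    using fb(1) ab(1) integrable_powr_add(1)[OF p_pos fb, of "\<lambda>x. - approx p f n x"] ab(1)[of n] ab(2)[of n] by auto
  have "AE x in mu_infty S i. convergent (\<lambda>n. DH i (OU S i t (approx p f n)) x)"
  proof (rule AE_Cauchy_of_summable_moments[OF p])
    fix n
    have d: "(\<lambda>x. approx p f (Suc n) x - approx p f n x) \<in> FCb1" by (rule FCb1_diff[OF a(1) a(1)])
    show "(\<lambda>x. norm (DH i (OU S i t (approx p f (Suc n))) x - DH i (OU S i t (approx p f n)) x)) \<in> borel_measurable (mu_infty S i)"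
      using strongly_measurable_norm[OF strongly_measurable_DH_OU[OF d, of t]] by (simp add: DH_OU_diff[OF a(1) a(1)])
    show "integrable (mu_infty S i) (\<lambda>x. norm (DH i (OU S i t (approx p f (Suc n))) x - DH i (OU S i t (approx p f n)) x) powr p)"
      using DH_OU_Lp_bound(1)[OF d t p K] by (simp add: DH_OU_diff[OF a(1) a(1)])
    define \<epsilon> where "\<epsilon> = (1 / 2 :: real) ^ n * (1 / 2) powr (real n * p)"
    have e1: "(\<integral>x. \<bar>f x - approx p f n x\<bar> powr p \<partial>mu_infty S i) \<le> \<epsilon>" using a(2)[of n] by (simp add: \<epsilon>_def)
    have "(1 / 2 :: real) ^ Suc n \<le> (1 / 2) ^ n" by (intro power_decreasing) auto
    moreover have "(1 / 2 :: real) powr (real (Suc n) * p) \<le> (1 / 2) powr (real n * p)"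
      using p_pos by (intro powr_mono') (auto intro: mult_right_mono)
    ultimately have "(1 / 2 :: real) ^ Suc n * (1 / 2) powr (real (Suc n) * p) \<le> \<epsilon>"
      unfolding \<epsilon>_def by (intro mult_mono) auto
    then have e2: "(\<integral>x. \<bar>f x - approx p f (Suc n) x\<bar> powr p \<partial>mu_infty S i) \<le> \<epsilon>" using a(2)[of "Suc n"] by linarith
    have "(\<integral>x. \<bar>approx p f (Suc n) x - approx p f n x\<bar> powr p \<partial>mu_infty S i)
        = (\<integral>x. \<bar>(f x - approx p f n x) + - (f x - approx p f (Suc n) x)\<bar> powr p \<partial>mu_infty S i)"
      by (rule arg_cong[where f = "lebesgue_integral (mu_infty S i)"]) (simp add: fun_eq_iff)
    also have "\<dots> \<le> 2 powr p * ((\<integral>x. \<bar>f x - approx p f n x\<bar> powr p \<partial>mu_infty S i) + (\<integral>x. \<bar>- (f x - approx p f (Suc n) x)\<bar> powr p \<partial>mu_infty S i))"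
    proof (rule integrable_powr_add(2)[OF p_pos fa])
      show "(\<lambda>x. - (f x - approx p f (Suc n) x)) \<in> borel_measurable (mu_infty S i)" using fa(1) by (rule borel_measurable_uminus)
      show "integrable (mu_infty S i) (\<lambda>x. \<bar>- (f x - approx p f (Suc n) x)\<bar> powr p)" using fa(2) unfolding abs_minus_cancel .
    qed
    also have "\<dots> \<le> 2 powr p * (\<epsilon> + \<epsilon>)" unfolding abs_minus_cancel using e1 e2 by (intro mult_left_mono add_mono) simp_all
    finally have "(\<integral>x. \<bar>approx p f (Suc n) x - approx p f n x\<bar> powr p \<partial>mu_infty S i) \<le> 2 powr p * (\<epsilon> + \<epsilon>)" .
    then have "c * (\<integral>x. \<bar>approx p f (Suc n) x - approx p f n x\<bar> powr p \<partial>mu_infty S i) \<le> c * (2 powr p * (\<epsilon> + \<epsilon>))"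
      using c by (rule mult_left_mono)
    with DH_OU_Lp_bound(2)[OF d t p K, folded c_def]
    have "(\<integral>x. norm (DH i (OU S i t (approx p f (Suc n))) x - DH i (OU S i t (approx p f n)) x) powr p \<partial>mu_infty S i) \<le> c * (2 powr p * (\<epsilon> + \<epsilon>))"
      by (simp add: DH_OU_diff[OF a(1) a(1)])
    then show "(\<integral>x. norm (DH i (OU S i t (approx p f (Suc n))) x - DH i (OU S i t (approx p f n)) x) powr p \<partial>mu_infty S i) \<le> (c * 2 powr p * 2) * (1 / 2) ^ n * (1 / 2) powr (real n * p)"
      by (simp add: \<epsilon>_def)
  qed
  then show ?thesis by eventually_elim (simp add: ext_def convergent_LIMSEQ_iff)
qed

lemma strongly_measurable_ext:
  assumes f: "f \<in> Lp p (mu_infty S i)"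
  shows "strongly_measurable (mu_infty S i) (ext p t f)"
proof -
  note a = approx(1)[OF p_pos f]
  have eq: "ext p t f = (\<lambda>x. if convergent (\<lambda>n. DH i (OU S i t (approx p f n)) x) then lim (\<lambda>n. DH i (OU S i t (approx p f n)) x) else 0)"
    by (simp add: ext_def fun_eq_iff)
  show ?thesis unfolding eq
  proof (rule strongly_measurable_limit)
    show "strongly_measurable (mu_infty S i) (DH i (OU S i t (approx p f n)))" for n
      by (rule strongly_measurable_DH_OU[OF a])
    show "(\<lambda>x. norm (DH i (OU S i t (approx p f m)) x - DH i (OU S i t (approx p f n)) x)) \<in> borel_measurable (mu_infty S i)" for m n
      using strongly_measurable_norm[OF strongly_measurable_DH_OU[OF FCb1_diff[OF a[of m] a[of n]], of t]] by (simp add: DH_OU_diff[OF a a])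
  qed
qed

lemma ext_bound:
  assumes f: "f \<in> Lp p (mu_infty S i)"
  shows "integrable (mu_infty S i) (\<lambda>x. norm (ext p t f x) powr p)"
    and "(\<integral>x. norm (ext p t f x) powr p \<partial>mu_infty S i) \<le> grad_const p t K powr p * (2 powr p * (\<integral>x. \<bar>f x\<bar> powr p \<partial>mu_infty S i))"
proof -
  define c where "c = grad_const p t K powr p"
  define I where "I = (\<integral>x. \<bar>f x\<bar> powr p \<partial>mu_infty S i)"
  note a = approx[OF p_pos f]
  have fb: "f \<in> borel_measurable (mu_infty S i)" "integrable (mu_infty S i) (\<lambda>x. \<bar>f x\<bar> powr p)"
    using f by (simp_all add: Lp_realD)
  have ab: "approx p f n \<in> borel_measurable (mu_infty S i)" "integrable (mu_infty S i) (\<lambda>x. \<bar>approx p f n x\<bar> powr p)" for n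
    using FCb1_Lp[OF p_pos a(1)] by (simp_all add: Lp_realD)
  have fa: "(\<lambda>x. approx p f n x - f x) \<in> borel_measurable (mu_infty S i)" "integrable (mu_infty S i) (\<lambda>x. \<bar>approx p f n x - f x\<bar> powr p)" for n
    using fb(1) ab(1) integrable_powr_add(1)[OF p_pos ab[of n], of "\<lambda>x. - f x"] fb by auto
  \<comment> \<open>The moment bound for the n-th gradient; in the limit the error term drops out
    and the factor 2^p remains.\<close>
  define B where "B n = c * (2 powr p * (I + (1 / 2) ^ n))" for n :: nat
  have le: "(\<integral>x. norm (DH i (OU S i t (approx p f n)) x) powr p \<partial>mu_infty S i) \<le> B n" for n
  proof -
    have "(1 / 2 :: real) powr (real n * p) \<le> 1" using p_pos by (intro powr_le1) auto
    then have "(1 / 2 :: real) ^ n * (1 / 2) powr (real n * p) \<le> (1 / 2) ^ n" by (rule mult_left_le) simp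
    then have e: "(\<integral>x. \<bar>approx p f n x - f x\<bar> powr p \<partial>mu_infty S i) \<le> (1 / 2) ^ n"
      using order.trans[OF less_imp_le[OF a(2)[of n]]] abs_minus_commute[of "f _"] by simp
    have "(\<integral>x. \<bar>approx p f n x\<bar> powr p \<partial>mu_infty S i) \<le> 2 powr p * (I + (\<integral>x. \<bar>approx p f n x - f x\<bar> powr p \<partial>mu_infty S i))"
      using integrable_powr_add(2)[OF p_pos fb fa[of n]] by (simp add: I_def)
    also have "\<dots> \<le> 2 powr p * (I + (1 / 2) ^ n)" using e by (intro mult_left_mono add_left_mono) auto
    finally have "c * (\<integral>x. \<bar>approx p f n x\<bar> powr p \<partial>mu_infty S i) \<le> B n"
      unfolding B_def by (rule mult_left_mono) (simp add: c_def)
    with DH_OU_Lp_bound(2)[OF a(1) t p K, folded c_def] show ?thesis by (rule order_trans)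
  qed
  have B: "B \<longlonglongrightarrow> c * (2 powr p * (I + 0))"
    unfolding B_def by (intro tendsto_intros LIMSEQ_power_zero) simp
  note L = Lp_limit_bound[OF p_pos strongly_measurable_DH_OU[OF a(1)] DH_OU_Lp_bound(1)[OF a(1) t p K]
    strongly_measurable_ext[OF f] ext_AE_convergent[OF f] le B]
  show "integrable (mu_infty S i) (\<lambda>x. norm (ext p t f x) powr p)" by (rule L(1))
  show "(\<integral>x. norm (ext p t f x) powr p \<partial>mu_infty S i) \<le> grad_const p t K powr p * (2 powr p * (\<integral>x. \<bar>f x\<bar> powr p \<partial>mu_infty S i))"
    using L(2) by (simp add: c_def I_def)
qed

text \<open>Makes \<open>ext\<close> independent of the chosen approximations. A plain geometric
  rate suffices because the difference of the two gradient sequences only has to tend to 0. Constant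
  sequences, sums and multiples of approximations then give consistency and linearity.\<close>

lemma ext_limit:
  assumes f: "f \<in> Lp p (mu_infty S i)" and F: "\<And>n. F n \<in> FCb1"
    and le: "\<And>n. (\<integral>x. \<bar>f x - F n x\<bar> powr p \<partial>mu_infty S i) \<le> B * (1 / 2) ^ n"
  shows "AE x in mu_infty S i. (\<lambda>n. DH i (OU S i t (F n)) x) \<longlonglongrightarrow> ext p t f x"
proof -
  define c where "c = grad_const p t K powr p"
  have c: "0 \<le> c" by (simp add: c_def)
  note a = approx[OF p_pos f]
  have d: "(\<lambda>x. F n x - approx p f n x) \<in> FCb1" for n by (rule FCb1_diff[OF F a(1)])
  have D: "DH i (OU S i t (\<lambda>x. F n x - approx p f n x)) x = DH i (OU S i t (F n)) x - DH i (OU S i t (approx p f n)) x" for n x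
    by (rule DH_OU_diff[OF F a(1)])
  have dle: "(\<integral>x. \<bar>F n x - approx p f n x\<bar> powr p \<partial>mu_infty S i) \<le> 2 powr p * (1 + B) * (1 / 2) ^ n" for n
  proof -
    have "(1 / 2 :: real) powr (real n * p) \<le> 1" using p_pos by (intro powr_le1) auto
    then have "(1 / 2 :: real) ^ n * (1 / 2) powr (real n * p) \<le> (1 / 2) ^ n" by (rule mult_left_le) simp
    then have e: "(\<integral>x. \<bar>f x - approx p f n x\<bar> powr p \<partial>mu_infty S i) \<le> (1 / 2) ^ n"
      using a(2)[of n] by linarith
    have "(\<integral>x. \<bar>F n x - approx p f n x\<bar> powr p \<partial>mu_infty S i)
        = (\<integral>x. \<bar>(f x - approx p f n x) - (f x - F n x)\<bar> powr p \<partial>mu_infty S i)" by simp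
    also have "\<dots> \<le> 2 powr p * ((\<integral>x. \<bar>f x - approx p f n x\<bar> powr p \<partial>mu_infty S i) + (\<integral>x. \<bar>f x - F n x\<bar> powr p \<partial>mu_infty S i))"
      by (intro Lp_real_diff p_pos f FCb1_Lp F a(1))
    also have "\<dots> \<le> 2 powr p * ((1 / 2) ^ n + B * (1 / 2) ^ n)"
      by (intro mult_left_mono add_mono e le) simp
    finally show ?thesis by (simp add: algebra_simps)
  qed
  have "AE x in mu_infty S i. (\<lambda>n. norm (DH i (OU S i t (\<lambda>x. F n x - approx p f n x)) x)) \<longlonglongrightarrow> 0"
  proof (rule AE_tendsto_zero_of_summable_moments[OF p_pos])
    show "(\<lambda>x. norm (DH i (OU S i t (\<lambda>x. F n x - approx p f n x)) x)) \<in> borel_measurable (mu_infty S i)" for n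
      by (rule strongly_measurable_norm[OF strongly_measurable_DH_OU[OF d]])
    show "integrable (mu_infty S i) (\<lambda>x. norm (DH i (OU S i t (\<lambda>x. F n x - approx p f n x)) x) powr p)" for n
      by (rule DH_OU_Lp_bound(1)[OF d t p K])
    show "summable (\<lambda>n. \<integral>x. norm (DH i (OU S i t (\<lambda>x. F n x - approx p f n x)) x) powr p \<partial>mu_infty S i)"
    proof (rule summable_comparison_test'[of "\<lambda>n. c * (2 powr p * (1 + B) * (1 / 2) ^ n)" 0])
      show "summable (\<lambda>n. c * (2 powr p * (1 + B) * (1 / 2 :: real) ^ n))"
        by (rule summable_mult, rule summable_mult, rule summable_geometric) simp
      fix n
      have "(\<integral>x. norm (DH i (OU S i t (\<lambda>x. F n x - approx p f n x)) x) powr p \<partial>mu_infty S i) \<le> c * (2 powr p * (1 + B) * (1 / 2) ^ n)"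
        using DH_OU_Lp_bound(2)[OF d t p K, folded c_def] mult_left_mono[OF dle c] by (rule order_trans)
      then show "norm (\<integral>x. norm (DH i (OU S i t (\<lambda>x. F n x - approx p f n x)) x) powr p \<partial>mu_infty S i) \<le> c * (2 powr p * (1 + B) * (1 / 2) ^ n)"
        by simp
    qed
  qed simp
  with ext_AE_convergent[OF f] show ?thesis
  proof eventually_elim
    case (elim x)
    have "(\<lambda>n. DH i (OU S i t (approx p f n)) x + (DH i (OU S i t (F n)) x - DH i (OU S i t (approx p f n)) x)) \<longlonglongrightarrow> ext p t f x + 0"
      using elim(1) tendsto_norm_zero_cancel[OF elim(2)] unfolding D by (rule tendsto_add)
    then show ?case by simp
  qed
qed

lemma grad_const_nonneg: "0 \<le> grad_const p t K"
proof -
  have "0 \<le> K" using K[of 0] t norm_ge_zero[of "S\<^sub>H 0"] by linarith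
  then show ?thesis using t gauss_abs_moment_nonneg[of "p / (p - 1)"] by simp
qed

lemma Lp_norm_ext_le:
  assumes f: "f \<in> Lp p (mu_infty S i)"
  shows "Lp_norm p (mu_infty S i) (ext p t f) \<le> 2 * grad_const p t K * Lp_norm p (mu_infty S i) f"
proof -
  have "(2 * grad_const p t K) powr p = 2 powr p * grad_const p t K powr p"
    by (rule powr_mult)
  moreover have "(\<integral>x. norm (ext p t f x) powr p \<partial>mu_infty S i) \<le> (2 powr p * grad_const p t K powr p) * (\<integral>x. norm (f x) powr p \<partial>mu_infty S i)"
    using ext_bound(2)[OF f] by (simp add: mult.assoc mult.left_commute)
  ultimately show ?thesis
    using grad_const_nonneg by (subst Lp_norm_le_iff[OF p_pos]) simp_all
qed

lemma ext_bounded_extension: "bounded_extension_DH_OU S i p t (ext p t)"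
  unfolding bounded_extension_DH_OU_def bounded_linear_Lp_Lp_def
proof (intro conjI ballI allI exI[of _ "2 * grad_const p t K"])
  note a = approx[OF p_pos]
  have small: "(1 / 2 :: real) ^ n * (1 / 2) powr (real n * p) \<le> (1 / 2) ^ n" for n
  proof -
    have "(1 / 2 :: real) powr (real n * p) \<le> 1" using p_pos by (intro powr_le1) auto
    then show ?thesis by (rule mult_left_le) simp
  qed
  have ale: "(\<integral>x. \<bar>f x - approx p f n x\<bar> powr p \<partial>mu_infty S i) \<le> (1 / 2) ^ n" if "f \<in> Lp p (mu_infty S i)" for f n
    using a(2)[OF that, of n] small[of n] by linarith
  have dL: "(\<lambda>x. f x - approx p f n x) \<in> Lp p (mu_infty S i)" if "f \<in> Lp p (mu_infty S i)" for f n
    by (rule Lp_real_diff(1)[OF p_pos that FCb1_Lp[OF p_pos a(1)[OF that]]])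
  show "ext p t f \<in> Lp p (mu_infty S i)" if "f \<in> Lp p (mu_infty S i)" for f
    using strongly_measurable_ext[OF that] ext_bound(1)[OF that] by (simp add: Lp_def)
  show "Lp_norm p (mu_infty S i) (ext p t f) \<le> 2 * grad_const p t K * Lp_norm p (mu_infty S i) f"
    if "f \<in> Lp p (mu_infty S i)" for f
    by (rule Lp_norm_ext_le[OF that])
  show "AE x in mu_infty S i. ext p t f x = DH i (OU S i t f) x" if f: "f \<in> FCb1" for f
  proof -
    \<comment> \<open>A cylindrical function is approximated by itself with error 0.\<close>
    have "AE x in mu_infty S i. (\<lambda>n::nat. DH i (OU S i t f) x) \<longlonglongrightarrow> ext p t f x"
      by (rule ext_limit[OF FCb1_Lp[OF p_pos f], where B = 0]) (use f in simp_all)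
    then show ?thesis by eventually_elim (simp add: LIMSEQ_const_iff)
  qed
  show "AE x in mu_infty S i. ext p t (\<lambda>y. f y + g y) x = ext p t f x + ext p t g x"
    if f: "f \<in> Lp p (mu_infty S i)" and g: "g \<in> Lp p (mu_infty S i)" for f g
  proof -
    have mg: "(\<lambda>x. - g x) \<in> Lp p (mu_infty S i)" using g by (simp add: Lp_realD)
    have fg: "(\<lambda>y. f y + g y) \<in> Lp p (mu_infty S i)" using Lp_real_diff(1)[OF p_pos f mg] by simp
    have md: "(\<lambda>x. - (g x - approx p g n x)) \<in> Lp p (mu_infty S i)" for n 
      using dL[OF g, of n] borel_measurable_uminus[of "\<lambda>x. g x - approx p g n x"]
      unfolding Lp_realD abs_minus_cancel by simp
    have le: "(\<integral>x. \<bar>(f x + g x) - (approx p f n x + approx p g n x)\<bar> powr p \<partial>mu_infty S i) \<le> (2 powr p * 2) * (1 / 2) ^ n" for n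
    proof -
      have "(\<integral>x. \<bar>(f x + g x) - (approx p f n x + approx p g n x)\<bar> powr p \<partial>mu_infty S i)
        = (\<integral>x. \<bar>(f x - approx p f n x) - (- (g x - approx p g n x))\<bar> powr p \<partial>mu_infty S i)"
        by (rule arg_cong[where f = "lebesgue_integral (mu_infty S i)"]) (simp add: fun_eq_iff algebra_simps)
      also have "\<dots> \<le> 2 powr p * ((\<integral>x. \<bar>f x - approx p f n x\<bar> powr p \<partial>mu_infty S i) + (\<integral>x. \<bar>- (g x - approx p g n x)\<bar> powr p \<partial>mu_infty S i))"
        by (rule Lp_real_diff(2)[OF p_pos dL[OF f] md])
      also have "\<dots> \<le> 2 powr p * ((1 / 2) ^ n + (1 / 2) ^ n)"
        unfolding abs_minus_cancel by (intro mult_left_mono add_mono ale f g) simp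
      finally show ?thesis by simp
    qed
    have "AE x in mu_infty S i. (\<lambda>n. DH i (OU S i t (\<lambda>x. approx p f n x + approx p g n x)) x) \<longlonglongrightarrow> ext p t (\<lambda>y. f y + g y) x"
      by (rule ext_limit[OF fg FCb1_add[OF a(1)[OF f] a(1)[OF g]] le])
    with ext_AE_convergent[OF f] ext_AE_convergent[OF g] show ?thesis
    proof eventually_elim
      case (elim x)
      show ?case
        using elim(3) tendsto_add[OF elim(1,2)] unfolding DH_OU_add[OF a(1)[OF f] a(1)[OF g]]
        by (rule LIMSEQ_unique)
    qed
  qed
  show "AE x in mu_infty S i. ext p t (\<lambda>y. c *\<^sub>R f y) x = c *\<^sub>R ext p t f x"
    if f: "f \<in> Lp p (mu_infty S i)" for c f
  proof -
    have cf: "(\<lambda>y. c *\<^sub>R f y) \<in> Lp p (mu_infty S i)" using f by (auto simp: Lp_realD abs_mult powr_mult intro: borel_measurable_times)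
    have le: "(\<integral>x. \<bar>c *\<^sub>R f x - c * approx p f n x\<bar> powr p \<partial>mu_infty S i) \<le> \<bar>c\<bar> powr p * (1 / 2) ^ n" for n
    proof -
      have "(\<integral>x. \<bar>c *\<^sub>R f x - c * approx p f n x\<bar> powr p \<partial>mu_infty S i) = \<bar>c\<bar> powr p * (\<integral>x. \<bar>f x - approx p f n x\<bar> powr p \<partial>mu_infty S i)"
        by (simp add: right_diff_distrib[symmetric] abs_mult powr_mult)
      also have "\<dots> \<le> \<bar>c\<bar> powr p * (1 / 2) ^ n" by (intro mult_left_mono ale f) simp
      finally show ?thesis .
    qed
    have "AE x in mu_infty S i. (\<lambda>n. DH i (OU S i t (\<lambda>x. c * approx p f n x)) x) \<longlonglongrightarrow> ext p t (\<lambda>y. c *\<^sub>R f y) x"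
      by (rule ext_limit[OF cf FCb1_scale[OF a(1)[OF f]] le])
    with ext_AE_convergent[OF f] show ?thesis
    proof eventually_elim
      case (elim x)
      show ?case
        using elim(2) tendsto_scaleR[OF tendsto_const elim(1), of c] unfolding DH_OU_scale[OF a(1)[OF f]]
        by (rule LIMSEQ_unique)
    qed
  qed
qed

text \<open>On cylindrical functions \<open>T\<close> is prescribed, so \<open>T f\<close> differs
  from the n-th gradient by \<open>T\<close> of the approximation error. Boundedness of
  \<open>T\<close> makes the p-th moments of these remainders summable, so they tend to 0 almost
  everywhere.\<close>

lemma extension_eq_ext:
  assumes T: "bounded_extension_DH_OU S i p t T" and f: "f \<in> Lp p (mu_infty S i)"
  shows "AE x in mu_infty S i. T f x = ext p t f x"
proof -
  note a = approx[OF p_pos f]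
  have TL: "\<And>g. g \<in> Lp p (mu_infty S i) \<Longrightarrow> T g \<in> Lp p (mu_infty S i)"
    and Tadd: "\<And>g h. g \<in> Lp p (mu_infty S i) \<Longrightarrow> h \<in> Lp p (mu_infty S i) \<Longrightarrow> AE x in mu_infty S i. T (\<lambda>y. g y + h y) x = T g x + T h x"
    and Tbd: "\<exists>K'. \<forall>g\<in>Lp p (mu_infty S i). Lp_norm p (mu_infty S i) (T g) \<le> K' * Lp_norm p (mu_infty S i) g"
    and TF: "\<And>g. g \<in> FCb1 \<Longrightarrow> AE x in mu_infty S i. T g x = DH i (OU S i t g) x"
    using T unfolding bounded_extension_DH_OU_def bounded_linear_Lp_Lp_def by simp_all
  obtain K' where K': "\<And>g. g \<in> Lp p (mu_infty S i) \<Longrightarrow> Lp_norm p (mu_infty S i) (T g) \<le> K' * Lp_norm p (mu_infty S i) g"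
    using Tbd by auto
  define g where "g n = (\<lambda>x. f x - approx p f n x)" for n
  have aL: "approx p f n \<in> Lp p (mu_infty S i)" for n by (rule FCb1_Lp[OF p_pos a(1)])
  have gL: "g n \<in> Lp p (mu_infty S i)" for n unfolding g_def by (rule Lp_real_diff(1)[OF p_pos f aL])
  have split: "AE x in mu_infty S i. T f x = DH i (OU S i t (approx p f n)) x + T (g n) x" for n
  proof -
    have "(\<lambda>y. approx p f n y + g n y) = f" by (simp add: g_def)
    with Tadd[OF aL[of n] gL[of n]] have "AE x in mu_infty S i. T f x = T (approx p f n) x + T (g n) x" by simp
    with TF[OF a(1)[of n]] show ?thesis by eventually_elim simp
  qed
  have bd: "(\<integral>x. norm (T (g n) x) powr p \<partial>mu_infty S i) \<le> \<bar>K'\<bar> powr p * (1 / 2) ^ n" for n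
  proof -
    \<comment> \<open>The bound provided by \<open>bounded_linear_Lp_Lp\<close> may be a negative
      number; the absolute value makes it admissible in \<open>Lp_norm_le_iff\<close>.\<close>
    have "Lp_norm p (mu_infty S i) (T (g n)) \<le> \<bar>K'\<bar> * Lp_norm p (mu_infty S i) (g n)"
      using K'[OF gL[of n]] mult_right_mono[OF abs_ge_self Lp_norm_nonneg, of K' p "mu_infty S i" "g n"] by linarith
    then have "(\<integral>x. norm (T (g n) x) powr p \<partial>mu_infty S i) \<le> \<bar>K'\<bar> powr p * (\<integral>x. norm (g n x) powr p \<partial>mu_infty S i)"
      by (simp only: Lp_norm_le_iff[OF p_pos abs_ge_zero])
    also have "\<dots> \<le> \<bar>K'\<bar> powr p * (1 / 2) ^ n"
    proof (rule mult_left_mono)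
      have "(1 / 2 :: real) powr (real n * p) \<le> 1" using p_pos by (intro powr_le1) auto
      then have "(1 / 2 :: real) ^ n * (1 / 2) powr (real n * p) \<le> (1 / 2) ^ n" by (rule mult_left_le) simp
      then show "(\<integral>x. norm (g n x) powr p \<partial>mu_infty S i) \<le> (1 / 2) ^ n"
        using a(2)[of n] unfolding g_def real_norm_def by linarith
    qed simp
    finally show ?thesis .
  qed
  have "AE x in mu_infty S i. (\<lambda>n. norm (T (g n) x)) \<longlonglongrightarrow> 0"
  proof (rule AE_tendsto_zero_of_summable_moments[OF p_pos])
    show "(\<lambda>x. norm (T (g n) x)) \<in> borel_measurable (mu_infty S i)" for n
      by (rule strongly_measurable_norm) (use TL[OF gL[of n]] in \<open>simp add: Lp_def\<close>)
    show "integrable (mu_infty S i) (\<lambda>x. norm (T (g n) x) powr p)" for n using TL[OF gL[of n]] by (simp add: Lp_def)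
    show "summable (\<lambda>n. \<integral>x. norm (T (g n) x) powr p \<partial>mu_infty S i)"
    proof (rule summable_comparison_test'[of "\<lambda>n. \<bar>K'\<bar> powr p * (1 / 2) ^ n" 0])
      show "summable (\<lambda>n. \<bar>K'\<bar> powr p * (1 / 2 :: real) ^ n)" by (rule summable_mult, rule summable_geometric) simp
      show "norm (\<integral>x. norm (T (g n) x) powr p \<partial>mu_infty S i) \<le> \<bar>K'\<bar> powr p * (1 / 2) ^ n" for n using bd[of n] by simp
    qed
  qed simp
  moreover have "AE x in mu_infty S i. \<forall>n. T f x = DH i (OU S i t (approx p f n)) x + T (g n) x"
    using split unfolding AE_all_countable by simp
  ultimately show ?thesis using ext_AE_convergent[OF f]
  proof eventually_elim
    case (elim x)
    have "(\<lambda>n. DH i (OU S i t (approx p f n)) x + T (g n) x) \<longlonglongrightarrow> ext p t f x + 0"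
      using elim(3) tendsto_norm_zero_cancel[OF elim(1)] by (rule tendsto_add)
    then have "(\<lambda>n::nat. T f x) \<longlonglongrightarrow> ext p t f x" using elim(2) by simp
    then show ?case by (simp add: LIMSEQ_const_iff)
  qed
qed

text \<open>Norms only see almost everywhere classes, so every extension may be replaced by
  \<open>ext\<close>, for which the bound is explicit.\<close>

lemma Lp_onorm_extension_le:
  assumes T: "bounded_extension_DH_OU S i p t T"
  shows "Lp_onorm p (mu_infty S i) T \<le> 2 * grad_const p t K"
  unfolding Lp_onorm_def
proof (rule cSup_least)
  \<comment> \<open>Bounding a supremum of reals requires a nonempty set; the zero function provides
    an element.\<close>
  have "(\<lambda>x. 0 :: real) \<in> Lp p (mu_infty S i)" "Lp_norm p (mu_infty S i) (\<lambda>x. 0 :: real) \<le> 1"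
    by (simp_all add: Lp_realD Lp_norm_def)
  then show "{Lp_norm p (mu_infty S i) (T f) |f. f \<in> Lp p (mu_infty S i) \<and> Lp_norm p (mu_infty S i) f \<le> 1} \<noteq> {}" by blast
  fix r assume "r \<in> {Lp_norm p (mu_infty S i) (T f) |f. f \<in> Lp p (mu_infty S i) \<and> Lp_norm p (mu_infty S i) f \<le> 1}"
  then obtain f where r: "r = Lp_norm p (mu_infty S i) (T f)" and f: "f \<in> Lp p (mu_infty S i)" "Lp_norm p (mu_infty S i) f \<le> 1" by blast
  have TL: "T f \<in> Lp p (mu_infty S i)"
    using T f(1) unfolding bounded_extension_DH_OU_def bounded_linear_Lp_Lp_def by simp
  have [measurable]: "(\<lambda>x. norm (T f x)) \<in> borel_measurable (mu_infty S i)" "(\<lambda>x. norm (ext p t f x)) \<in> borel_measurable (mu_infty S i)"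
    using strongly_measurable_norm[of "mu_infty S i" "T f"] TL strongly_measurable_norm[OF strongly_measurable_ext[OF f(1)]] by (simp_all add: Lp_def)
  have "(\<integral>x. norm (T f x) powr p \<partial>mu_infty S i) = (\<integral>x. norm (ext p t f x) powr p \<partial>mu_infty S i)"
  proof (rule integral_cong_AE)
    show "AE x in mu_infty S i. norm (T f x) powr p = norm (ext p t f x) powr p"
      using extension_eq_ext[OF T f(1)] by eventually_elim simp
  qed measurable
  then have "r = Lp_norm p (mu_infty S i) (ext p t f)" unfolding r Lp_norm_def by simp
  also have "\<dots> \<le> 2 * grad_const p t K * Lp_norm p (mu_infty S i) f" by (rule Lp_norm_ext_le[OF f(1)])
  also have "\<dots> \<le> 2 * grad_const p t K * 1" using f(2) grad_const_nonneg by (intro mult_left_mono) auto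
  finally show "r \<le> 2 * grad_const p t K" by simp
qed

end

end

theorem corollary2p2:
  fixes S :: "real \<Rightarrow> ('e::banach \<Rightarrow>\<^sub>L 'e)"
    and i :: "'h::{real_inner,complete_space} \<Rightarrow>\<^sub>L 'e"
    and S\<^sub>H :: "real \<Rightarrow> ('h \<Rightarrow>\<^sub>L 'h)"
    and \<kappa> :: "real \<Rightarrow> real"
    and p :: real
  assumes semigroup: "C0_semigroup S"
    and embedding: "inj (blinfun_apply i)"
    and I_infty_defined:
      "\<And>g. g \<in> Lp 2 (restrict_space lborel {0<..}) \<Longrightarrow> (\<lambda>s. S s (i (g s))) integrable_on {0<..}"
    and I_infty_radonifying:
      "gamma_radonifying (restrict_space lborel {0<..}) (conv_op S i {0<..})"
    and semigroup_H: "C0_semigroup S\<^sub>H"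
    and restricts: "\<And>t. 0 \<le> t \<Longrightarrow> S t o\<^sub>L i = i o\<^sub>L S\<^sub>H t"
    and kappa: "\<And>t. \<kappa> t = (SUP s\<in>{0..t}. norm (S\<^sub>H s))"
    and p: "1 < p"
  shows "(\<forall>t>0. \<exists>T. bounded_extension_DH_OU S i p t T \<and>
            (\<forall>T'. bounded_extension_DH_OU S i p t T' \<longrightarrow>
              (\<forall>f\<in>Lp p (mu_infty S i). AE x in mu_infty S i. T' f x = T f x))) \<and>
         (\<exists>C\<ge>0. \<forall>t>0. \<forall>T. bounded_extension_DH_OU S i p t T \<longrightarrow>
            sqrt t * Lp_onorm p (mu_infty S i) T \<le> C * \<kappa> t)"
proof -
  interpret ornstein_uhlenbeck S i S\<^sub>H
  proof
    show "bounded_linear_L2 (restrict_space lborel {0<..}) (conv_op S i {0<..})"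
      using I_infty_radonifying unfolding gamma_radonifying_def by (rule conjunct1)
  qed (fact semigroup I_infty_defined semigroup_H restricts I_infty_radonifying)+
  \<comment> \<open>The supremum \<kappa> t is an upper bound because the norms are bounded on
    [0, t], a consequence of uniform boundedness.\<close>
  have K: "norm (S\<^sub>H s) \<le> \<kappa> t" if "0 \<le> s" "s \<le> t" for s t
    unfolding kappa by (rule cSUP_upper[OF _ C0_semigroup_local_bound[OF semigroup_H]]) (use that in simp)
  show ?thesis
  \<comment> \<open>The constant depends on \<open>p\<close> only, since the factor 1 / sqrt t in
    \<open>grad_const\<close> cancels against sqrt t.\<close>
  proof (intro conjI allI impI exI[of _ "2 * (1 + gauss_abs_moment (p / (p - 1)))"])
    fix t :: real assume t: "0 < t"
    show "\<exists>T. bounded_extension_DH_OU S i p t T \<and>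
            (\<forall>T'. bounded_extension_DH_OU S i p t T' \<longrightarrow>
              (\<forall>f\<in>Lp p (mu_infty S i). AE x in mu_infty S i. T' f x = T f x))"
      using ext_bounded_extension[OF t p K] extension_eq_ext[OF t p K] by (intro exI[of _ "ext p t"]) simp
  next
    show "0 \<le> 2 * (1 + gauss_abs_moment (p / (p - 1)))" using gauss_abs_moment_nonneg[of "p / (p - 1)"] by simp
  next
    fix t :: real and T assume t: "0 < t" and T: "bounded_extension_DH_OU S i p t T"
    have "sqrt t * Lp_onorm p (mu_infty S i) T \<le> sqrt t * (2 * grad_const p t (\<kappa> t))"
      using t by (intro mult_left_mono Lp_onorm_extension_le[OF t p K T]) simp_all
    also have "\<dots> = 2 * (1 + gauss_abs_moment (p / (p - 1))) * \<kappa> t" using t by simp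
    finally show "sqrt t * Lp_onorm p (mu_infty S i) T \<le> 2 * (1 + gauss_abs_moment (p / (p - 1))) * \<kappa> t" .
  qed
qed

end
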